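(* Let $H_0=-\frac12\Delta$ on $L^2(\mathbb{R}^m)$. Let $\theta\in(-1,1)$, $\rho>0$ with $\theta+\rho<1$ and $\theta-\rho>-1$, and let $\sigma>0$. Let $p_+(\xi,x)$ and $p_-(x,\xi)$ be $C^\infty$ functions on $\mathbb{R}^{2m}$ all of whose derivatives are bounded, such that for all multi-indices $\alpha,\beta$ and all $\ell\ge0$ there is $C_{\ell\alpha\beta}$ with $$|\partial_x^\alpha\partial_\xi^\beta p_+(\xi,x)|\le C_{\ell\alpha\beta}\langle x\rangle^{-\ell}\ \text{ whenever } \cos(x,\xi)<\theta+\rho,\qquad |\partial_x^\alpha\partial_\xi^\beta p_-(x,\xi)|\le C_{\ell\alpha\beta}\langle x\rangle^{-\ell}\ \text{ whenever } \cos(x,\xi)>\theta-\rho,$$ and $p_+(\xi,x)=0$, $p_-(x,\xi)=0$ whenever $|x|<\sigma$ or $|\xi|<\sigma$. Define for $f$ in the Schwartz space $$P_+f(x)=\mathrm{Os}\text{-}\!\iint e^{i(x-y)\cdot\xi}p_+(\xi,y)f(y)\,dy\,\hat d\xi,\qquad P_-f(x)=\mathrm{Os}\text{-}\!\iint e^{i(x-y)\cdot\xi}p_-(x,\xi)f(y)\,dy\,\hat d\xi.$$ Then for all $s\ge0$ and $0\le\delta\le s$ there is $C_{s\delta}>0$ such that for all $t\ge0$ $$\|\langle x\rangle^{-s}e^{-itH_0}P_+\langle x\rangle^{\delta}\|\le C_{s\delta}\langle t\rangle^{-s+\delta},\qquad \|\langle x\rangle^{\delta}P_-e^{-itH_0}\langle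 x\rangle^{-s}\|\le C_{s\delta}\langle t\rangle^{-s+\delta},$$ i.e. these operators, defined on the Schwartz space, extend to bounded operators on $L^2(\mathbb{R}^m)$ with these norm bounds.
   Context: $\langle x\rangle=(1+|x|^2)^{1/2}$, $\langle t\rangle=(1+t^2)^{1/2}$, $\cos(x,\xi)=\frac{x\cdot\xi}{|x||\xi|}$, $\hat d\xi=(2\pi)^{-m}d\xi$. The oscillatory integral $\mathrm{Os}\text{-}\iint$ is defined as $\lim_{\epsilon\downarrow0}\iint e^{i(x-y)\cdot\xi}(\cdots)\chi(\epsilon\xi)f(y)\,dy\,\hat d\xi$ for any Schwartz function $\chi$ with $\chi(0)=1$ (the limit is independent of $\chi$). *)

theory Defs
  imports "HOL-Analysis.Analysis"
begin

definition jb :: "'a::real_normed_vector \<Rightarrow> real" where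
  "jb x = sqrt (1 + (norm x)^2)"

definition cosang :: "'a::real_inner \<Rightarrow> 'a \<Rightarrow> real" where
  "cosang x \<xi> = (x \<bullet> \<xi>) / (norm x * norm \<xi>)"

text \<open>Iterated directional derivatives: iter_pd [v1,...,vk] f = D_v1 (... (D_vk f)).
  With v_i ranging over Basis this gives all partial derivatives of all
  multi-indices (a multi-index is written out as a list of coordinate directions).\<close>
fun iter_pd :: "'a::real_normed_vector list \<Rightarrow> ('a \<Rightarrow> 'b::real_normed_vector) \<Rightarrow> 'a \<Rightarrow> 'b" where
  "iter_pd [] f = f"
| "iter_pd (v # vs) f = (\<lambda>x. vector_derivative (\<lambda>t. iter_pd vs f (x + t *\<^sub>R v)) (at 0))"

definition smooth_fn :: "('a::euclidean_space \<Rightarrow> 'b::real_normed_vector) \<Rightarrow> bool" where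
  "smooth_fn f \<longleftrightarrow>
     (\<forall>vs. set vs \<subseteq> Basis \<longrightarrow>
        continuous_on UNIV (iter_pd vs f) \<and>
        (\<forall>v\<in>Basis. \<forall>x. (\<lambda>t. iter_pd vs f (x + t *\<^sub>R v)) differentiable (at 0)))"

definition smooth_bdd_derivs :: "('a::euclidean_space \<Rightarrow> 'b::real_normed_vector) \<Rightarrow> bool" where
  "smooth_bdd_derivs f \<longleftrightarrow> smooth_fn f \<and>
     (\<forall>vs. set vs \<subseteq> Basis \<longrightarrow> bounded (range (iter_pd vs f)))"

definition schwartz :: "('a::euclidean_space \<Rightarrow> complex) \<Rightarrow> bool" where
  "schwartz f \<longleftrightarrow> smooth_fn f \<and>
     (\<forall>vs (N::nat). set vs \<subseteq> Basis \<longrightarrow> (\<exists>C. \<forall>x. (jb x) ^ N * norm (iter_pd vs f x) \<le> C))"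

text \<open>Fixed Schwartz cutoff chi (Gaussian) with chi(0) = 1 (the oscillatory integral is independent of it).\<close>
definition cutoff :: "'a::euclidean_space \<Rightarrow> real" where
  "cutoff \<xi> = exp (- (norm \<xi> ^ 2))"

definition osc_right :: "('a::euclidean_space \<times> 'a \<Rightarrow> complex) \<Rightarrow> ('a \<Rightarrow> complex) \<Rightarrow> 'a \<Rightarrow> complex" where
  "osc_right p f x = Lim (at_right (0::real))
     (\<lambda>\<epsilon>. complex_of_real ((2 * pi) powr (- real DIM('a))) *
        (LINT \<xi>|lborel. (LINT y|lborel.
            cis ((x - y) \<bullet> \<xi>) * p (\<xi>, y) * complex_of_real (cutoff (\<epsilon> *\<^sub>R \<xi>)) * f y)))"

definition osc_left :: "('a::euclidean_space \<times> 'a \<Rightarrow> complex) \<Rightarrow> ('a \<Rightarrow> complex) \<Rightarrow> 'a \<Rightarrow> complex" where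
  "osc_left p f x = Lim (at_right (0::real))
     (\<lambda>\<epsilon>. complex_of_real ((2 * pi) powr (- real DIM('a))) *
        (LINT \<xi>|lborel. (LINT y|lborel.
            cis ((x - y) \<bullet> \<xi>) * p (x, \<xi>) * complex_of_real (cutoff (\<epsilon> *\<^sub>R \<xi>)) * f y)))"

text \<open>Free propagator e^{-itH_0}, H_0 = -Delta/2, via Fourier transform:
  e^{-itH_0} g = F^{-1} (e^{-it|xi|^2/2} F g)  (exact for Schwartz g).\<close>
definition free_prop :: "real \<Rightarrow> ('a::euclidean_space \<Rightarrow> complex) \<Rightarrow> 'a \<Rightarrow> complex" where
  "free_prop t g x = complex_of_real ((2 * pi) powr (- real DIM('a))) *
     (LINT \<xi>|lborel. cis (x \<bullet> \<xi>) * cis (- t * (norm \<xi>)^2 / 2) *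
        (LINT y|lborel. cis (- (y \<bullet> \<xi>)) * g y))"

definition L2sq :: "('a::euclidean_space \<Rightarrow> complex) \<Rightarrow> ennreal" where
  "L2sq g = (\<integral>\<^sup>+ x. ennreal ((cmod (g x))^2) \<partial>lborel)"

definition L2_bounded_by :: "('a::euclidean_space \<Rightarrow> complex) \<Rightarrow> real \<Rightarrow> ('a \<Rightarrow> complex) \<Rightarrow> bool" where
  "L2_bounded_by g K f \<longleftrightarrow> g \<in> borel_measurable lborel \<and> 0 \<le> K \<and> L2sq g \<le> ennreal (K^2) * L2sq f"

end

theory Submission
  imports Defs "HOL-Probability.Probability"
begin

text \<open>
  The phase of \<open>exp(-itH\<^sub>0) P\<^sub>+\<close> is \<open>(x - y) \<bullet> \<xi> - t|\<xi>|\<^sup>2/2\<close>, with \<open>\<xi>\<close>-gradient \<open>x - w\<close>,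
  \<open>w = y + t\<xi>\<close>.  Where \<open>cos(y, \<xi>)\<close> stays away from \<open>-1\<close> there is no cancellation in \<open>w\<close>, so
  \<open>|w|\<^sup>2\<close> is comparable to \<open>|y|\<^sup>2 + t\<^sup>2|\<xi>|\<^sup>2\<close>; on the remaining cone the symbol decays rapidly in \<open>y\<close>.
  Hence integration by parts in \<open>\<xi>\<close> along the field \<open>w/|w|\<^sup>2\<close> trades a power of \<open>\<langle>x\<rangle>\<close> for a
  symbol smaller by the factor \<open>(1 + |y|\<^sup>2 + t\<^sup>2)\<^sup>-\<^sup>1\<^sup>/\<^sup>2\<close>, and the resulting operators are
  \<open>L\<^sup>2\<close>-bounded, uniformly in \<open>t\<close>, by the Calderon--Vaillancourt theorem.  This proves the
  estimate for integer weights \<open>s\<close>; real interpolation in the weight gives all \<open>s \<ge> 0\<close>, and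
  \<open>\<langle>y\<rangle>\<^sup>\<delta> \<langle>t\<rangle>\<^sup>s\<^sup>-\<^sup>\<delta> \<le> (1 + |y|\<^sup>2 + t\<^sup>2)\<^sup>s\<^sup>/\<^sup>2\<close> gives all \<open>\<delta>\<close>.  The integrals are made absolutely
  convergent by a factor \<open>(1 + \<epsilon>\<^sup>2|\<xi>|\<^sup>2)\<^sup>-\<^sup>m\<close>, uniformly in \<open>\<epsilon>\<close>.  The estimate for \<open>P\<^sub>-\<close> is
  the transposed one.
\<close>

subsection \<open>Integration on Euclidean spaces\<close>

text \<open>The symbols are merely bounded together with their derivatives: differentiation in
  \<open>\<xi>\<close> brings no decay, so the gain of an integration by parts must come from the
  factor 1/|w| of the vector field. On the support of the symbol |\<open>\<xi>\<close>| is bounded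
  below, and this is what turns t|\<open>\<xi>\<close>| into t. Where w may vanish, a remainder of
  size |y|^2/(|y|^2 + t^2|\<open>\<xi>\<close>|^2) is split off, and the rapid decay of the symbol
  in y pays for it.

  Uniformity in t and in the regularisation is obtained by making both of them the index of a family
  of symbols, with every constant chosen before the index. Regularised and truncated bounds pass to
  the limit by Fatou's lemma.

  The Calderon-Vaillancourt theorem is proved without almost orthogonality. A bilinear form is
  averaged over unit boxes of phase space; on one box an amplitude is a superposition of tensor
  products, with one integration for each coordinate direction, and a tensor product is handled by
  Plancherel and Cauchy-Schwarz. Hence only mixed derivatives with each direction at most once
  enter.\<close>

lemma measurable_cis [measurable]: "cis \<in> borel_measurable borel"
  by (intro borel_measurable_continuous_onI continuous_intros)

lemma borel_measurable_fst_prod [measurable]: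
  "fst \<in> borel_measurable (borel :: ('a::euclidean_space \<times> 'b::euclidean_space) measure)"
  and borel_measurable_snd_prod [measurable]:
  "snd \<in> borel_measurable (borel :: ('a::euclidean_space \<times> 'b::euclidean_space) measure)"
  by (intro borel_measurable_continuous_onI continuous_intros)+

text \<open>Domination by a tensor product of two integrable functions is the integrability
  criterion behind nearly every use of Fubini below. The measure is \<open>lborel\<close> on the
  pair type, so that both orders of integration are available through
  \<open>lborel_Fubini\<close>.\<close>

lemma lborel_integrable_prod_bound:
  fixes F :: "'a::euclidean_space \<times> 'b::euclidean_space \<Rightarrow> 'c::{banach,second_countable_topology}"
  assumes F: "F \<in> borel_measurable borel" and f: "integrable lborel f" and g: "integrable lborel g"
    and le: "\<And>x y. norm (F (x, y)) \<le> f x * (g y :: real)"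
  shows "integrable lborel F"
proof -
  have "integrable (lborel \<Otimes>\<^sub>M lborel) (\<lambda>z. f (fst z) * g (snd z))"
  proof (rule lborel_pair.Fubini_integrable)
    have [measurable]: "f \<in> borel_measurable borel" "g \<in> borel_measurable borel"
      using f g by (simp_all add: borel_measurable_integrable)
    show "(\<lambda>z. f (fst z) * g (snd z)) \<in> borel_measurable (lborel \<Otimes>\<^sub>M lborel)"
      by measurable
    show "integrable lborel (\<lambda>x. LINT y|lborel. norm (f (fst (x, y)) * g (snd (x, y))))"
      using integrable_norm[OF f] by (simp add: abs_mult)
    show "AE x in lborel. integrable lborel (\<lambda>y. f (fst (x, y)) * g (snd (x, y)))"
      using g by simp
  qed
  then have "integrable lborel (\<lambda>z. f (fst z) * g (snd z))"
    by (simp add: lborel_prod)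
  then show ?thesis
    by (rule Bochner_Integration.integrable_bound)
      (use F in \<open>auto intro!: AE_I2 order_trans[OF le abs_ge_self]\<close>)
qed

lemma lborel_Fubini:
  fixes F :: "'a::euclidean_space \<times> 'b::euclidean_space \<Rightarrow> 'c::{banach,second_countable_topology}"
  assumes "integrable lborel F"
  shows "(LINT x|lborel. LINT y|lborel. F (x, y)) = integral\<^sup>L lborel F"
    and "(LINT y|lborel. LINT x|lborel. F (x, y)) = integral\<^sup>L lborel F"
proof -
  have *: "integrable (lborel \<Otimes>\<^sub>M lborel) (\<lambda>(x, y). F (x, y))"
    using assms by (simp add: lborel_prod)
  show "(LINT x|lborel. LINT y|lborel. F (x, y)) = integral\<^sup>L lborel F"
    using lborel_pair.integral_fst[OF *] by (simp add: lborel_prod)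
  show "(LINT y|lborel. LINT x|lborel. F (x, y)) = integral\<^sup>L lborel F"
    using lborel_pair.integral_snd[OF *] by (simp add: lborel_prod)
qed

lemma lborel_Tonelli:
  fixes F :: "'a::euclidean_space \<times> 'b::euclidean_space \<Rightarrow> ennreal"
  assumes "F \<in> borel_measurable borel"
  shows "(\<integral>\<^sup>+x. \<integral>\<^sup>+y. F (x, y) \<partial>lborel \<partial>lborel) = integral\<^sup>N lborel F"
    and "(\<integral>\<^sup>+y. \<integral>\<^sup>+x. F (x, y) \<partial>lborel \<partial>lborel) = integral\<^sup>N lborel F"
proof -
  have *: "F \<in> borel_measurable (lborel \<Otimes>\<^sub>M lborel)"
    using assms by (simp add: lborel_prod)
  show "(\<integral>\<^sup>+x. \<integral>\<^sup>+y. F (x, y) \<partial>lborel \<partial>lborel) = integral\<^sup>N lborel F"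
    using lborel.nn_integral_fst[OF *] by (simp add: lborel_prod)
  show "(\<integral>\<^sup>+y. \<integral>\<^sup>+x. F (x, y) \<partial>lborel \<partial>lborel) = integral\<^sup>N lborel F"
    using lborel_pair.nn_integral_snd[OF *] by (simp add: lborel_prod)
qed

lemma borel_measurable_integral_snd [measurable (raw)]:
  fixes F :: "'a::euclidean_space \<Rightarrow> 'b::euclidean_space \<Rightarrow> 'c::{banach,second_countable_topology}"
  assumes "(\<lambda>z. F (fst z) (snd z)) \<in> borel_measurable borel"
  shows "(\<lambda>x. LINT y|lborel. F x y) \<in> borel_measurable borel"
proof (rule lborel.borel_measurable_lebesgue_integral)
  show "case_prod F \<in> borel_measurable (borel \<Otimes>\<^sub>M lborel)"
    using assms by (simp add: borel_prod split_beta' measurable_cong_sets[OF sets_pair_measure_cong[OF refl sets_lborel] refl])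
qed

lemma nn_integral_lborel_affine:
  fixes f :: "'a::euclidean_space \<Rightarrow> ennreal"
  assumes [measurable]: "f \<in> borel_measurable borel" and "c \<noteq> 0"
  shows "integral\<^sup>N lborel f = ennreal (\<bar>c\<bar> ^ DIM('a)) * (\<integral>\<^sup>+x. f (t + c *\<^sub>R x) \<partial>lborel)"
  by (subst lborel_affine[OF \<open>c \<noteq> 0\<close>, of t])
    (simp add: nn_integral_density nn_integral_distr nn_integral_cmult)

lemma lborel_integrable_affine:
  fixes f :: "'a::euclidean_space \<Rightarrow> 'c::{banach,second_countable_topology}"
  assumes "integrable lborel f" "c \<noteq> 0"
  shows "integrable lborel (\<lambda>x. f (t + c *\<^sub>R x))"
proof (rule integrableI_bounded)
  have [measurable]: "f \<in> borel_measurable borel"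
    using assms by (simp add: borel_measurable_integrable)
  show "(\<lambda>x. f (t + c *\<^sub>R x)) \<in> borel_measurable lborel" by measurable
  have "ennreal (\<bar>c\<bar> ^ DIM('a)) * (\<integral>\<^sup>+x. norm (f (t + c *\<^sub>R x)) \<partial>lborel) < \<infinity>"
    using assms by (subst nn_integral_lborel_affine[symmetric, of "\<lambda>x. norm (f x)"])
      (auto simp: integrable_iff_bounded)
  then show "(\<integral>\<^sup>+x. norm (f (t + c *\<^sub>R x)) \<partial>lborel) < \<infinity>"
    using \<open>c \<noteq> 0\<close> by (auto simp: ennreal_mult_less_top)
qed

lemma lborel_integral_affine:
  fixes f :: "'a::euclidean_space \<Rightarrow> 'c::{banach,second_countable_topology}"
  assumes "integrable lborel f" "c \<noteq> 0"
  shows "integral\<^sup>L lborel f = (\<bar>c\<bar> ^ DIM('a)) *\<^sub>R (LINT x|lborel. f (t + c *\<^sub>R x))"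
proof -
  have [measurable]: "f \<in> borel_measurable borel"
    using assms by (simp add: borel_measurable_integrable)
  show ?thesis
    by (subst lborel_affine[OF \<open>c \<noteq> 0\<close>, of t]) (simp add: integral_density integral_distr)
qed

lemma nn_integral_lborel_shift:
  fixes f :: "'a::euclidean_space \<Rightarrow> ennreal"
  assumes "f \<in> borel_measurable borel"
  shows "(\<integral>\<^sup>+x. f (t + x) \<partial>lborel) = integral\<^sup>N lborel f"
    "(\<integral>\<^sup>+x. f (x - t) \<partial>lborel) = integral\<^sup>N lborel f"
    "(\<integral>\<^sup>+x. f (t - x) \<partial>lborel) = integral\<^sup>N lborel f"
  using nn_integral_lborel_affine[OF assms, of 1 t] nn_integral_lborel_affine[OF assms, of 1 "-t"]
    nn_integral_lborel_affine[OF assms, of "-1" t] by simp_all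

lemma integral_lborel_shift:
  fixes f :: "'a::euclidean_space \<Rightarrow> 'c::{banach,second_countable_topology}"
  assumes "integrable lborel f"
  shows "(LINT x|lborel. f (t + x)) = integral\<^sup>L lborel f"
    "(LINT x|lborel. f (x - t)) = integral\<^sup>L lborel f"
    "(LINT x|lborel. f (t - x)) = integral\<^sup>L lborel f"
  using lborel_integral_affine[OF assms, of 1 t] lborel_integral_affine[OF assms, of 1 "-t"]
    lborel_integral_affine[OF assms, of "-1" t] by simp_all

lemma integrable_lborel_shift:
  fixes f :: "'a::euclidean_space \<Rightarrow> 'c::{banach,second_countable_topology}"
  assumes "integrable lborel f"
  shows "integrable lborel (\<lambda>x. f (t + x))" "integrable lborel (\<lambda>x. f (x - t))"
    "integrable lborel (\<lambda>x. f (t - x))"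
  using lborel_integrable_affine[OF assms, of 1 t] lborel_integrable_affine[OF assms, of 1 "-t"]
    lborel_integrable_affine[OF assms, of "-1" t] by simp_all

text \<open>Lebesgue measure is the image of a product of one-dimensional ones under the coordinate
  map, so products of functions of single coordinates integrate factor by factor. This brings the
  Gaussian and the inverse powers of \<open>jb\<close> down to dimension one.\<close>

lemma lborel_integral_prod_Basis:
  fixes g :: "'a::euclidean_space \<Rightarrow> real \<Rightarrow> 'c::{real_normed_field,banach,second_countable_topology}"
  assumes "\<And>b. b \<in> Basis \<Longrightarrow> integrable lborel (g b)"
  shows "integrable lborel (\<lambda>x::'a. \<Prod>b\<in>Basis. g b (x \<bullet> b))"
    and "(LINT x|(lborel::'a measure). (\<Prod>b\<in>Basis. g b (x \<bullet> b))) = (\<Prod>b\<in>Basis. (LINT x|lborel. g b x))"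
proof -
  interpret product_sigma_finite "\<lambda>_::'a. lborel :: real measure" ..
  have [measurable]: "\<And>b. b \<in> Basis \<Longrightarrow> g b \<in> borel_measurable borel"
    using assms by (simp add: borel_measurable_integrable)
  have m [measurable]: "(\<lambda>f. \<Sum>b\<in>Basis. f b *\<^sub>R b) \<in> (\<Pi>\<^sub>M b\<in>(Basis::'a set). (lborel :: real measure)) \<rightarrow>\<^sub>M borel"
    by measurable
  have m2: "(\<lambda>x::'a. \<Prod>b\<in>Basis. g b (x \<bullet> b)) \<in> borel_measurable borel"
    by measurable
  have eq: "(\<Prod>b\<in>Basis. g b ((\<Sum>b\<in>Basis. f b *\<^sub>R b) \<bullet> b)) = (\<Prod>b\<in>Basis. g b (f b))" for f :: "'a \<Rightarrow> real"
    by (intro prod.cong refl) simp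
  show "integrable lborel (\<lambda>x::'a. \<Prod>b\<in>Basis. g b (x \<bullet> b))"
    by (subst lborel_eq, subst integrable_distr_eq[OF m m2], unfold eq)
      (intro product_integrable_prod assms finite_Basis)
  show "(LINT x|(lborel::'a measure). (\<Prod>b\<in>Basis. g b (x \<bullet> b))) = (\<Prod>b\<in>Basis. (LINT x|lborel. g b x))"
    by (subst lborel_eq, subst integral_distr[OF m m2], unfold eq)
      (intro product_integral_prod assms finite_Basis)
qed

lemma norm_sq_eq_sum: "(norm x)\<^sup>2 = (\<Sum>b\<in>Basis. (x \<bullet> b)\<^sup>2)" for x :: "'a::euclidean_space"
  unfolding power2_norm_eq_inner by (subst euclidean_inner) (simp add: power2_eq_square)

lemma jb_ge_1: "1 \<le> jb x" and jb_pos: "0 < jb x" and jb_sq: "(jb x)\<^sup>2 = 1 + (norm x)\<^sup>2"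
  and norm_le_jb: "norm x \<le> jb x"
  by (auto simp: jb_def add_pos_nonneg real_le_rsqrt)

lemma jb_measurable [measurable]: "jb \<in> borel_measurable (borel :: 'a::euclidean_space measure)"
  unfolding jb_def by measurable

text \<open>Each coordinate satisfies 1 + (x . b)^2 <= \<open>(jb x)\<^sup>2\<close>, so the product
  over the basis of the integrable functions 1/(1 + u^2) dominates. One such factor per direction
  gives the exponent \<open>2 * DIM('a)\<close>, which recurs in the later integrability
  bounds.\<close>

lemma integrable_inv_jb:
  "integrable lborel (\<lambda>x::'a::euclidean_space. 1 / jb x ^ (2 * DIM('a)))"
proof -
  have "set_integrable lborel UNIV (\<lambda>x::real. inverse (1 + x^2))"
    using integrable_inverse_1_plus_square by simp
  then have "integrable lborel (\<lambda>x::real. inverse (1 + x^2))"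
    by (simp add: set_integrable_def)
  then have "integrable lborel (\<lambda>x::'a. \<Prod>b\<in>Basis. inverse (1 + (x \<bullet> b)^2))"
    by (intro lborel_integral_prod_Basis(1)[where g = "\<lambda>_ x. inverse (1 + x^2)"])
  then show ?thesis
  proof (rule Bochner_Integration.integrable_bound)
    show "AE x in lborel. norm (1 / jb (x::'a) ^ (2 * DIM('a))) \<le> norm (\<Prod>b\<in>Basis. inverse (1 + (x \<bullet> b)^2))"
    proof (intro AE_I2)
      fix x :: 'a
      have "inverse ((jb x)\<^sup>2) \<le> inverse (1 + (x \<bullet> b)\<^sup>2)" if "b \<in> Basis" for b
        using that Basis_le_norm[OF that, of x] unfolding jb_sq
        by (intro le_imp_inverse_le) (auto simp: add_pos_nonneg intro!: power2_le_iff_abs_le[THEN iffD2])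
      then have "(\<Prod>b\<in>(Basis::'a set). inverse ((jb x)\<^sup>2)) \<le> (\<Prod>b\<in>Basis. inverse (1 + (x \<bullet> b)^2))"
        by (intro prod_mono) auto
      then show "norm (1 / jb x ^ (2 * DIM('a))) \<le> norm (\<Prod>b\<in>Basis. inverse (1 + (x \<bullet> b)^2))"
        using jb_pos[of x] by (simp add: power_mult[symmetric] field_simps abs_prod prod_nonneg)
    qed
  qed measurable
qed

text \<open>The form of lower semicontinuity through which bounds for truncated or regularised
  integrands are inherited by their pointwise limits.\<close>

lemma nn_integral_Fatou_le:
  fixes F :: "nat \<Rightarrow> 'a \<Rightarrow> ennreal"
  assumes "\<And>n. F n \<in> borel_measurable M" "\<And>x. (\<lambda>n. F n x) \<longlonglongrightarrow> G x"
    and "\<And>n. integral\<^sup>N M (F n) \<le> B"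
  shows "integral\<^sup>N M G \<le> B"
proof -
  have "integral\<^sup>N M G = (\<integral>\<^sup>+x. liminf (\<lambda>n. F n x) \<partial>M)"
    using lim_imp_Liminf[OF sequentially_bot assms(2)] by (intro nn_integral_cong) simp
  also have "\<dots> \<le> liminf (\<lambda>n. integral\<^sup>N M (F n))"
    by (intro nn_integral_liminf assms)
  also have "\<dots> \<le> B"
    by (rule order_trans[OF Liminf_le_Limsup[OF sequentially_bot] Limsup_bounded]) (simp add: assms(3))
  finally show ?thesis .
qed

subsection \<open>Fourier transform\<close>

definition gauss :: "'a::euclidean_space \<Rightarrow> real" where
  "gauss x = exp (- (norm x)\<^sup>2 / 2)"

lemma gauss_measurable [measurable]: "gauss \<in> borel_measurable borel"
  unfolding gauss_def by measurable

lemma gauss_pos: "0 < gauss x" and gauss_le_1: "gauss x \<le> 1" and gauss_zero: "gauss 0 = 1"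
  by (simp_all add: gauss_def)

lemma gauss_prod: "gauss x = (\<Prod>b\<in>Basis. exp (- (x \<bullet> b)\<^sup>2 / 2))"
  unfolding gauss_def norm_sq_eq_sum exp_sum[symmetric, OF finite_Basis] sum_divide_distrib[symmetric]
    sum_negf ..

text \<open>Read off from the characteristic function of the standard normal distribution.\<close>

lemma gauss_Fourier_real:
  "integrable lborel (\<lambda>x. cis (x * z) * complex_of_real (exp (- x\<^sup>2 / 2)))"
  "(LINT x|lborel. cis (x * z) * complex_of_real (exp (- x\<^sup>2 / 2))) =
     complex_of_real (sqrt (2 * pi) * exp (- z\<^sup>2 / 2))"
proof -
  have d: "exp (- x\<^sup>2 / 2) = sqrt (2 * pi) * std_normal_density x" for x :: real
    by (simp add: std_normal_density_def)
  have "integrable lborel (\<lambda>x::real. sqrt (2 * pi) * std_normal_density x)"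
    using integrable_std_normal_moment[of 0] by simp
  then have "integrable lborel (\<lambda>x::real. exp (- x\<^sup>2 / 2))"
    by (simp only: d)
  then show "integrable lborel (\<lambda>x. cis (x * z) * complex_of_real (exp (- x\<^sup>2 / 2)))"
    by (rule Bochner_Integration.integrable_bound) (auto simp: norm_mult)
  have "complex_of_real (exp (- z\<^sup>2 / 2)) = char std_normal_distribution z"
    by (simp add: char_std_normal_distribution)
  also have "\<dots> = (LINT x|lborel. std_normal_density x *\<^sub>R cis (z * x))"
    unfolding char_def by (subst integral_density) (auto simp: cis_conv_exp)
  finally have c: "(LINT x|lborel. std_normal_density x *\<^sub>R cis (z * x)) = complex_of_real (exp (- z\<^sup>2 / 2))" ..
  have "(LINT x|lborel. cis (x * z) * complex_of_real (exp (- x\<^sup>2 / 2))) =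
      (LINT x|lborel. sqrt (2 * pi) *\<^sub>R (std_normal_density x *\<^sub>R cis (z * x)))"
    by (intro Bochner_Integration.integral_cong refl) (simp only: d scaleR_conv_of_real of_real_mult mult_ac)
  also have "\<dots> = sqrt (2 * pi) *\<^sub>R complex_of_real (exp (- z\<^sup>2 / 2))"
    by (simp only: integral_scaleR_right c)
  finally show "(LINT x|lborel. cis (x * z) * complex_of_real (exp (- x\<^sup>2 / 2))) =
     complex_of_real (sqrt (2 * pi) * exp (- z\<^sup>2 / 2))"
    by (simp only: scaleR_conv_of_real of_real_mult)
qed

lemma cis_sum: "finite S \<Longrightarrow> cis (sum f S) = (\<Prod>b\<in>S. cis (f b))"
  by (induction S rule: finite_induct) (auto simp: cis_mult[symmetric])

lemma gauss_Fourier: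
  fixes z :: "'a::euclidean_space"
  shows "integrable lborel (\<lambda>x. cis (x \<bullet> z) * complex_of_real (gauss x))"
    and "(LINT x|lborel. cis (x \<bullet> z) * complex_of_real (gauss x)) =
      complex_of_real (sqrt (2 * pi) ^ DIM('a) * gauss z)"
proof -
  have eq: "cis (x \<bullet> z) * complex_of_real (gauss x) =
      (\<Prod>b\<in>Basis. cis ((x \<bullet> b) * (z \<bullet> b)) * complex_of_real (exp (- (x \<bullet> b)\<^sup>2 / 2)))" for x
    unfolding gauss_prod by (subst euclidean_inner) (simp add: cis_sum prod.distrib)
  show "integrable lborel (\<lambda>x. cis (x \<bullet> z) * complex_of_real (gauss x))"
    unfolding eq
    by (rule lborel_integral_prod_Basis(1)[where g = "\<lambda>b t. cis (t * (z \<bullet> b)) * complex_of_real (exp (- t\<^sup>2 / 2))"])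
       (rule gauss_Fourier_real)
  show "(LINT x|lborel. cis (x \<bullet> z) * complex_of_real (gauss x)) =
      complex_of_real (sqrt (2 * pi) ^ DIM('a) * gauss z)"
    unfolding eq
    by (subst lborel_integral_prod_Basis(2)[where g = "\<lambda>b t. cis (t * (z \<bullet> b)) * complex_of_real (exp (- t\<^sup>2 / 2))"])
       (auto simp only: gauss_Fourier_real prod.distrib gauss_prod of_real_mult of_real_power of_real_prod prod_constant)
qed

lemma gauss_integrable: "integrable lborel (gauss :: 'a::euclidean_space \<Rightarrow> real)"
  and gauss_integral: "integral\<^sup>L lborel (gauss :: 'a \<Rightarrow> real) = sqrt (2 * pi) ^ DIM('a)"
proof -
  have "integrable lborel (\<lambda>x::'a. complex_of_real (gauss x))"
    using gauss_Fourier(1)[of "0::'a"] by simp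
  then show "integrable lborel (gauss :: 'a \<Rightarrow> real)"
    by (subst (asm) complex_of_real_integrable_eq)
  have "complex_of_real (integral\<^sup>L lborel (gauss :: 'a \<Rightarrow> real)) = complex_of_real (sqrt (2 * pi) ^ DIM('a))"
    using gauss_Fourier(2)[of "0::'a"] by (simp add: gauss_zero)
  then show "integral\<^sup>L lborel (gauss :: 'a \<Rightarrow> real) = sqrt (2 * pi) ^ DIM('a)"
    by (simp only: of_real_eq_iff)
qed

lemma sqrt_2pi_power: "sqrt (2 * pi) ^ m * sqrt (2 * pi) ^ m = (2 * pi) ^ m"
  by (subst power_mult_distrib[symmetric]) simp

text \<open>The Fourier transform of the dilated Gaussian: an approximate identity of mass
  $(2\pi)^m$.\<close>
definition gker :: "real \<Rightarrow> 'a::euclidean_space \<Rightarrow> real" where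
  "gker e z = sqrt (2 * pi) ^ DIM('a) / e ^ DIM('a) * gauss ((1 / e) *\<^sub>R z)"

lemma gker_measurable [measurable]: "gker e \<in> borel_measurable borel"
  unfolding gker_def by measurable

lemma gker_Fourier:
  fixes z :: "'a::euclidean_space"
  assumes "e > 0"
  shows "integrable lborel (\<lambda>x. cis (x \<bullet> z) * complex_of_real (gauss (e *\<^sub>R x)))"
    and "(LINT x|lborel. cis (x \<bullet> z) * complex_of_real (gauss (e *\<^sub>R x))) = complex_of_real (gker e z)"
proof -
  have eq: "(\<lambda>x. cis (x \<bullet> z) * complex_of_real (gauss (e *\<^sub>R x))) =
     (\<lambda>x. (\<lambda>y. cis (y \<bullet> ((1 / e) *\<^sub>R z)) * complex_of_real (gauss y)) (0 + e *\<^sub>R x))"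
    using assms by auto
  show "integrable lborel (\<lambda>x. cis (x \<bullet> z) * complex_of_real (gauss (e *\<^sub>R x)))"
    unfolding eq using assms by (intro lborel_integrable_affine gauss_Fourier) auto
  have "complex_of_real (sqrt (2 * pi) ^ DIM('a) * gauss ((1 / e) *\<^sub>R z)) =
    e ^ DIM('a) *\<^sub>R (LINT x|lborel. cis (x \<bullet> z) * complex_of_real (gauss (e *\<^sub>R x)))"
    unfolding eq gauss_Fourier(2)[symmetric]
    by (subst lborel_integral_affine[OF gauss_Fourier(1), of e _ 0]) (use assms in auto)
  then show "(LINT x|lborel. cis (x \<bullet> z) * complex_of_real (gauss (e *\<^sub>R x))) = complex_of_real (gker e z)"
    using assms unfolding gker_def scaleR_conv_of_real
    by (simp only: of_real_mult of_real_divide of_real_power) (simp add: divide_simps mult_ac)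
qed

lemma gker_nonneg: "e > 0 \<Longrightarrow> 0 \<le> gker e z"
  using gauss_pos[of "(1/e) *\<^sub>R z"] by (simp add: gker_def)

lemma gker_integrable: "e > 0 \<Longrightarrow> integrable lborel (gker e :: 'a::euclidean_space \<Rightarrow> real)"
  unfolding gker_def
  using lborel_integrable_affine[OF gauss_integrable, of "1/e" 0]
  by (intro integrable_mult_right) auto

lemma gker_integral: "e > 0 \<Longrightarrow> integral\<^sup>L lborel (gker e :: 'a::euclidean_space \<Rightarrow> real) = (2 * pi) ^ DIM('a)"
proof -
  assume e: "e > 0"
  have "sqrt (2 * pi) ^ DIM('a) = (1 / e) ^ DIM('a) * (LINT x|(lborel::'a measure). gauss ((1 / e) *\<^sub>R x))"
    using lborel_integral_affine[OF gauss_integrable, where 'a='a, of "1/e" 0] e unfolding gauss_integral by simp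
  then show ?thesis
    unfolding gker_def integral_mult_right_zero sqrt_2pi_power[symmetric]
    using e by (simp add: power_divide field_simps)
qed

lemma gker_nn_integral:
  "e > 0 \<Longrightarrow> (\<integral>\<^sup>+z. ennreal (gker e (z::'a::euclidean_space)) \<partial>lborel) = ennreal ((2 * pi) ^ DIM('a))"
  by (subst nn_integral_eq_integral) (auto simp: gker_integrable gker_nonneg gker_integral)

lemma measurable_cnj [measurable]: "cnj \<in> borel_measurable borel"
  by (intro borel_measurable_continuous_onI continuous_intros)

lemma cis_inner_diff: "cis (x \<bullet> (a - b)) = cis (x \<bullet> a) * cis (- (x \<bullet> b))"
  by (simp add: cis_mult inner_diff_right)

lemma tendsto_gauss_dilation:
  assumes "e \<longlonglongrightarrow> 0"
  shows "(\<lambda>n. gauss (e n *\<^sub>R x)) \<longlonglongrightarrow> 1"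
proof -
  have "isCont (\<lambda>r. gauss (r *\<^sub>R x)) 0"
    unfolding gauss_def by (intro continuous_intros) auto
  from isCont_tendsto_compose[OF this assms] show ?thesis
    by (simp add: gauss_zero)
qed

lemma nn_integral_gker:
  assumes "e > 0"
  shows "(\<integral>\<^sup>+y. ennreal (gker e (x - y :: 'a::euclidean_space)) \<partial>lborel) = ennreal ((2 * pi) ^ DIM('a))"
    and "(\<integral>\<^sup>+y. ennreal (gker e (y - x)) \<partial>lborel) = ennreal ((2 * pi) ^ DIM('a))"
  using nn_integral_lborel_shift[of "\<lambda>z. ennreal (gker e z)" x] gker_nn_integral[OF assms, where 'a='a]
  by simp_all

text \<open>Schur's test: h(x) h(y) is at most the mean of h(x)^2 and h(y)^2, and for each half the
  kernel is integrated in the variable that h does not see, which gives its mass (2 pi)^m.\<close>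

lemma Schur_gker:
  fixes h :: "'a::euclidean_space \<Rightarrow> real"
  assumes [measurable]: "h \<in> borel_measurable borel" and "e > 0" and nn: "\<And>x. 0 \<le> h x"
  shows "(\<integral>\<^sup>+z. ennreal (h (fst z) * h (snd z) * gker e (fst z - snd z)) \<partial>lborel)
     \<le> ennreal ((2 * pi) ^ DIM('a)) * (\<integral>\<^sup>+x. ennreal ((h x)\<^sup>2) \<partial>lborel)"
proof -
  let ?k = "\<lambda>x y. ennreal (gker e (x - y))"
  have "(\<integral>\<^sup>+z. ennreal (h (fst z) * h (snd z) * gker e (fst z - snd z)) \<partial>lborel)
    \<le> (\<integral>\<^sup>+z. ennreal (1/2) * (ennreal ((h (fst z))\<^sup>2) * ?k (fst z) (snd z))
        + ennreal (1/2) * (ennreal ((h (snd z))\<^sup>2) * ?k (fst z) (snd z)) \<partial>lborel)"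
  proof (intro nn_integral_mono)
    fix z :: "'a \<times> 'a"
    have "h (fst z) * h (snd z) \<le> 1/2 * (h (fst z))\<^sup>2 + 1/2 * (h (snd z))\<^sup>2"
      using sum_squares_bound[of "h (fst z)" "h (snd z)"] by simp
    note le = mult_right_mono[OF this gker_nonneg[OF \<open>e > 0\<close>, of "fst z - snd z"]]
    have half: "ennreal (1/2 * (A * B)) = ennreal (1/2) * (ennreal A * ennreal B)" if "0 \<le> A" for A B
      unfolding ennreal_mult'[OF that, symmetric] by (rule ennreal_mult') simp
    have "ennreal (h (fst z) * h (snd z) * gker e (fst z - snd z)) \<le>
      ennreal (1/2 * ((h (fst z))\<^sup>2 * gker e (fst z - snd z)) + 1/2 * ((h (snd z))\<^sup>2 * gker e (fst z - snd z)))"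
      using le by (intro ennreal_leI) (simp add: distrib_right)
    also have "\<dots> = ennreal (1/2) * (ennreal ((h (fst z))\<^sup>2) * ?k (fst z) (snd z))
        + ennreal (1/2) * (ennreal ((h (snd z))\<^sup>2) * ?k (fst z) (snd z))"
      using gker_nonneg[OF \<open>e > 0\<close>, of "fst z - snd z"]
      by (subst ennreal_plus) (auto simp only: half zero_le_power2 intro!: mult_nonneg_nonneg)
    finally show "ennreal (h (fst z) * h (snd z) * gker e (fst z - snd z)) \<le>
      ennreal (1/2) * (ennreal ((h (fst z))\<^sup>2) * ?k (fst z) (snd z))
        + ennreal (1/2) * (ennreal ((h (snd z))\<^sup>2) * ?k (fst z) (snd z))" .
  qed
  also have "\<dots> = ennreal (1/2) * (\<integral>\<^sup>+z. ennreal ((h (fst z))\<^sup>2) * ?k (fst z) (snd z) \<partial>lborel)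
      + ennreal (1/2) * (\<integral>\<^sup>+z. ennreal ((h (snd z))\<^sup>2) * ?k (fst z) (snd z) \<partial>lborel)"
    by (subst nn_integral_add) (simp_all add: nn_integral_cmult)
  also have "(\<integral>\<^sup>+z. ennreal ((h (fst z))\<^sup>2) * ?k (fst z) (snd z) \<partial>lborel) =
      (\<integral>\<^sup>+x. \<integral>\<^sup>+y. ennreal ((h x)\<^sup>2) * ?k x y \<partial>lborel \<partial>lborel)"
    by (subst lborel_Tonelli(1)[symmetric]) simp_all
  also have "\<dots> = ennreal ((2 * pi) ^ DIM('a)) * (\<integral>\<^sup>+x. ennreal ((h x)\<^sup>2) \<partial>lborel)"
    using assms by (simp add: nn_integral_cmult nn_integral_multc nn_integral_gker mult.commute)
  also have "(\<integral>\<^sup>+z. ennreal ((h (snd z))\<^sup>2) * ?k (fst z) (snd z) \<partial>lborel) =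
      (\<integral>\<^sup>+y. \<integral>\<^sup>+x. ennreal ((h y)\<^sup>2) * ?k x y \<partial>lborel \<partial>lborel)"
    by (subst lborel_Tonelli(2)[symmetric]) simp_all
  also have "\<dots> = ennreal ((2 * pi) ^ DIM('a)) * (\<integral>\<^sup>+x. ennreal ((h x)\<^sup>2) \<partial>lborel)"
    using assms by (simp add: nn_integral_cmult nn_integral_multc nn_integral_gker mult.commute)
  also have "ennreal (1/2) * (ennreal ((2 * pi) ^ DIM('a)) * (\<integral>\<^sup>+x. ennreal ((h x)\<^sup>2) \<partial>lborel))
     + ennreal (1/2) * (ennreal ((2 * pi) ^ DIM('a)) * (\<integral>\<^sup>+x. ennreal ((h x)\<^sup>2) \<partial>lborel))
     = ennreal ((2 * pi) ^ DIM('a)) * (\<integral>\<^sup>+x. ennreal ((h x)\<^sup>2) \<partial>lborel)"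
  proof -
    have "ennreal (1/2) + ennreal (1/2) = 1"
      by (subst ennreal_plus[symmetric]) auto
    then show ?thesis
      by (simp only: distrib_right[symmetric] mult_1_left)
  qed
  finally show ?thesis .
qed

lemma integrable_cis_mult:
  fixes h :: "'a::euclidean_space \<Rightarrow> complex"
  assumes "integrable lborel h" "\<phi> \<in> borel_measurable borel"
  shows "integrable lborel (\<lambda>x. cis (\<phi> x) * h x)"
  using assms by (intro Bochner_Integration.integrable_bound[OF assms(1)])
    (auto simp: norm_mult borel_measurable_integrable)

text \<open>Only the inequality in Plancherel's theorem is needed.  Inserting a Gaussian factor makes
  \<open>\<integral>|\<hat>h|\<^sup>2\<close> an absolutely convergent triple integral whose \<open>x\<close>-integral is a positive kernel
  of mass $(2\pi)^m$, so that Schur's test applies.\<close>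
lemma Plancherel_le:
  fixes h :: "'a::euclidean_space \<Rightarrow> complex"
  assumes h: "integrable lborel h"
  shows "L2sq (\<lambda>x. LINT \<xi>|lborel. cis (x \<bullet> \<xi>) * h \<xi>) \<le> ennreal ((2 * pi) ^ DIM('a)) * L2sq h"
proof -
  have hm [measurable]: "h \<in> borel_measurable borel"
    using h by (simp add: borel_measurable_integrable)
  define H where "H x = (LINT \<xi>|lborel. cis (x \<bullet> \<xi>) * h \<xi>)" for x
  have Hm [measurable]: "H \<in> borel_measurable borel"
    unfolding H_def by measurable
  have bound: "(\<integral>\<^sup>+x. ennreal ((cmod (H x))\<^sup>2 * gauss (e *\<^sub>R x)) \<partial>lborel) \<le>
      ennreal ((2 * pi) ^ DIM('a)) * L2sq h" if e: "e > 0" for e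
  proof -
    \<comment> \<open>The square |H x|^2 is expanded into an integral over pairs z of frequencies.
      Integrating first in z gives |H x|^2 times the Gaussian; integrating first in x gives
      \<open>gker e\<close> at the difference of the two frequencies.\<close>
    define G where "G = (\<lambda>(x::'a, z::'a \<times> 'a). cis (x \<bullet> (fst z - snd z)) * complex_of_real (gauss (e *\<^sub>R x))
        * (h (fst z) * cnj (h (snd z))))"
    have ge: "integrable lborel (\<lambda>x::'a. gauss (e *\<^sub>R x))"
      using lborel_integrable_affine[OF gauss_integrable, of e 0] e by simp
    have hh: "integrable lborel (\<lambda>z. h (fst z) * cnj (h (snd z)))"
      by (rule lborel_integrable_prod_bound[OF _ integrable_norm[OF h] integrable_norm[OF h]])
         (auto simp: norm_mult)
    have Gi: "integrable lborel G"
      by (rule lborel_integrable_prod_bound[OF _ ge integrable_norm[OF hh]])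
        (auto simp: G_def norm_mult split_beta' gauss_pos less_imp_le)
    have inner: "(LINT z|lborel. G (x, z)) = complex_of_real ((cmod (H x))\<^sup>2 * gauss (e *\<^sub>R x))" for x
    proof -
      have ih: "integrable lborel (\<lambda>\<xi>. cis (x \<bullet> \<xi>) * h \<xi>)"
        by (intro integrable_cis_mult h) simp
      have "integrable lborel (\<lambda>z. (cis (x \<bullet> fst z) * h (fst z)) * cnj (cis (x \<bullet> snd z) * h (snd z)))"
        by (rule lborel_integrable_prod_bound[OF _ integrable_norm[OF h] integrable_norm[OF h]])
         (auto simp: norm_mult)
      from lborel_Fubini(1)[OF this]
      have "(LINT z|lborel. (cis (x \<bullet> fst z) * h (fst z)) * cnj (cis (x \<bullet> snd z) * h (snd z))) = H x * cnj (H x)"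
        by (simp add: H_def del: complex_cnj_mult)
      moreover have "(\<lambda>z. G (x, z)) = (\<lambda>z. complex_of_real (gauss (e *\<^sub>R x)) *
         ((cis (x \<bullet> fst z) * h (fst z)) * cnj (cis (x \<bullet> snd z) * h (snd z))))"
        by (simp add: G_def cis_inner_diff cis_cnj mult_ac)
      ultimately show ?thesis
        by (simp only: integral_mult_right_zero of_real_mult complex_norm_square mult.commute)
    qed
    have inner2: "(LINT x|lborel. G (x, z)) = h (fst z) * cnj (h (snd z)) * complex_of_real (gker e (fst z - snd z))" for z
      using gker_Fourier(2)[OF e, of "fst z - snd z"] by (simp add: G_def)
    have intx: "integrable lborel (\<lambda>x. (cmod (H x))\<^sup>2 * gauss (e *\<^sub>R x))"
    proof (rule Bochner_Integration.integrable_bound)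
      let ?K = "LINT \<xi>|lborel. norm (h \<xi>)"
      show "integrable lborel (\<lambda>x::'a. ?K\<^sup>2 * gauss (e *\<^sub>R x))"
        using ge by simp
      have "cmod (H x) \<le> ?K" for x
        unfolding H_def by (rule order_trans[OF integral_norm_bound]) (simp add: norm_mult)
      then show "AE x in lborel. norm ((cmod (H x))\<^sup>2 * gauss (e *\<^sub>R x)) \<le> norm (?K\<^sup>2 * gauss (e *\<^sub>R x))"
        by (auto simp: gauss_pos less_imp_le intro!: mult_right_mono power_mono)
    qed measurable
    have "(\<integral>\<^sup>+x. ennreal ((cmod (H x))\<^sup>2 * gauss (e *\<^sub>R x)) \<partial>lborel)
        = ennreal (LINT x|lborel. (cmod (H x))\<^sup>2 * gauss (e *\<^sub>R x))"
      by (intro nn_integral_eq_integral intx) (simp add: gauss_pos less_imp_le)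
    also have "(LINT x|lborel. (cmod (H x))\<^sup>2 * gauss (e *\<^sub>R x)) =
       norm (LINT x|lborel. complex_of_real ((cmod (H x))\<^sup>2 * gauss (e *\<^sub>R x)))"
      by (subst integral_complex_of_real, subst norm_of_real, rule abs_of_nonneg[symmetric])
        (intro Bochner_Integration.integral_nonneg, simp add: gauss_pos less_imp_le)
    also have "(LINT x|lborel. complex_of_real ((cmod (H x))\<^sup>2 * gauss (e *\<^sub>R x))) = integral\<^sup>L lborel G"
      unfolding inner[symmetric] by (rule lborel_Fubini[OF Gi])
    also have "\<dots> = (LINT z|lborel. h (fst z) * cnj (h (snd z)) * complex_of_real (gker e (fst z - snd z)))"
      unfolding inner2[symmetric] by (rule lborel_Fubini[OF Gi, symmetric])
    also have "ennreal (norm \<dots>) \<le> (\<integral>\<^sup>+z. norm (h (fst z) * cnj (h (snd z)) * complex_of_real (gker e (fst z - snd z))) \<partial>lborel)"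
    proof (rule integral_norm_bound_ennreal)
      have "integrable (lborel \<Otimes>\<^sub>M lborel) (\<lambda>(x, z). G (x, z))"
        using Gi by (simp add: lborel_prod)
      from lborel_pair.integrable_snd[OF this]
      show "integrable lborel (\<lambda>z. h (fst z) * cnj (h (snd z)) * complex_of_real (gker e (fst z - snd z)))"
        by (simp only: inner2)
    qed
    also have "\<dots> = (\<integral>\<^sup>+z. ennreal (cmod (h (fst z)) * cmod (h (snd z)) * gker e (fst z - snd z)) \<partial>lborel)"
      by (simp add: norm_mult gker_nonneg[OF e])
    also have "\<dots> \<le> ennreal ((2 * pi) ^ DIM('a)) * L2sq h"
      unfolding L2sq_def by (rule Schur_gker) (use e in auto)
    finally show ?thesis .
  qed
  show ?thesis
    unfolding H_def[symmetric] L2sq_def[of H]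
  proof (rule nn_integral_Fatou_le[where F = "\<lambda>n x. ennreal ((cmod (H x))\<^sup>2 * gauss ((1 / real (Suc n)) *\<^sub>R x))"])
    fix x
    have "(\<lambda>n. (cmod (H x))\<^sup>2 * gauss ((1 / real (Suc n)) *\<^sub>R x)) \<longlonglongrightarrow> (cmod (H x))\<^sup>2 * 1"
      by (intro tendsto_intros tendsto_gauss_dilation LIMSEQ_Suc lim_1_over_n)
    then show "(\<lambda>n. ennreal ((cmod (H x))\<^sup>2 * gauss ((1 / real (Suc n)) *\<^sub>R x))) \<longlonglongrightarrow> ennreal ((cmod (H x))\<^sup>2)"
      by (intro tendsto_ennrealI) simp
    show "(\<integral>\<^sup>+x. ennreal ((cmod (H x))\<^sup>2 * gauss ((1 / real (Suc n)) *\<^sub>R x)) \<partial>lborel)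
      \<le> ennreal ((2 * pi) ^ DIM('a)) * L2sq h" for n
      by (rule bound) simp
  qed measurable
qed

text \<open>A Gaussian factor makes the double integral absolutely convergent and turns its
  x-integral into the approximate identity \<open>gker\<close>. The factor is then removed on both
  sides by dominated convergence: on one side through integrability of the transform, on the other
  through continuity and boundedness of h.\<close>

lemma Fourier_inversion:
  fixes h :: "'a::euclidean_space \<Rightarrow> complex"
  assumes h: "integrable lborel h" and cont: "continuous_on UNIV h" and bdd: "\<And>\<xi>. cmod (h \<xi>) \<le> B"
    and v: "integrable lborel (\<lambda>x. LINT \<xi>|lborel. cis (x \<bullet> \<xi>) * h \<xi>)"
  shows "(LINT x|lborel. cis (- (x \<bullet> \<eta>)) * (LINT \<xi>|lborel. cis (x \<bullet> \<xi>) * h \<xi>)) = (2 * pi) ^ DIM('a) * h \<eta>"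
proof -
  have [measurable]: "h \<in> borel_measurable borel"
    using h by (simp add: borel_measurable_integrable)
  define V where "V x = (LINT \<xi>|lborel. cis (x \<bullet> \<xi>) * h \<xi>)" for x
  have Vm [measurable]: "V \<in> borel_measurable borel"
    unfolding V_def by measurable
  have Vi: "integrable lborel (\<lambda>x. cis (- (x \<bullet> \<eta>)) * V x)"
    unfolding V_def by (intro integrable_cis_mult v) simp
  define c where "c = sqrt (2 * pi) ^ DIM('a)"
  define e where "e n = 1 / real (Suc n)" for n
  have e0: "e n > 0" for n by (simp add: e_def)
  have elim: "e \<longlonglongrightarrow> 0" unfolding e_def by (intro LIMSEQ_Suc lim_1_over_n)
  have gl: "(\<lambda>n. gauss (e n *\<^sub>R x)) \<longlonglongrightarrow> 1" for x :: 'a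
    by (rule tendsto_gauss_dilation[OF elim])
  have eq: "(LINT x|lborel. cis (- (x \<bullet> \<eta>)) * V x * complex_of_real (gauss (e n *\<^sub>R x))) =
      complex_of_real c * (LINT z|lborel. h (\<eta> + e n *\<^sub>R z) * complex_of_real (gauss z))" for n
  proof -
    define G where "G = (\<lambda>(x::'a, \<xi>). cis (x \<bullet> (\<xi> - \<eta>)) * complex_of_real (gauss (e n *\<^sub>R x)) * h \<xi>)"
    have ge: "integrable lborel (\<lambda>x::'a. gauss (e n *\<^sub>R x))"
      using lborel_integrable_affine[OF gauss_integrable, of "e n" 0] e0[of n] by simp
    have Gi: "integrable lborel G"
      by (rule lborel_integrable_prod_bound[OF _ ge integrable_norm[OF h]])
        (auto simp: G_def norm_mult split_beta' gauss_pos less_imp_le)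
    have "(LINT \<xi>|lborel. G (x, \<xi>)) = cis (- (x \<bullet> \<eta>)) * V x * complex_of_real (gauss (e n *\<^sub>R x))" for x
    proof -
      have "(\<lambda>\<xi>. G (x, \<xi>)) = (\<lambda>\<xi>. cis (- (x \<bullet> \<eta>)) * complex_of_real (gauss (e n *\<^sub>R x)) * (cis (x \<bullet> \<xi>) * h \<xi>))"
        by (simp add: G_def cis_inner_diff mult_ac)
      then show ?thesis
        by (simp add: V_def)
    qed
    then have "(LINT x|lborel. cis (- (x \<bullet> \<eta>)) * V x * complex_of_real (gauss (e n *\<^sub>R x))) = integral\<^sup>L lborel G"
      using lborel_Fubini(1)[OF Gi] by simp
    also have "\<dots> = (LINT \<xi>|lborel. complex_of_real (gker (e n) (\<xi> - \<eta>)) * h \<xi>)"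
      by (subst lborel_Fubini(2)[OF Gi, symmetric]) (simp add: G_def gker_Fourier(2)[OF e0])
    \<comment> \<open>The substitution \<open>\<xi>\<close> = \<open>\<eta>\<close> + e z cancels
      the factor 1/e^m of \<open>gker\<close>, so that the limit e -> 0 acts on h alone, against a
      fixed Gaussian.\<close>
    also have "\<dots> = \<bar>e n\<bar> ^ DIM('a) *\<^sub>R (LINT z|lborel. complex_of_real (gker (e n) (\<eta> + e n *\<^sub>R z - \<eta>)) * h (\<eta> + e n *\<^sub>R z))"
    proof (rule lborel_integral_affine)
      have "integrable (lborel \<Otimes>\<^sub>M lborel) (\<lambda>(x, z). G (x, z))"
        using Gi by (simp add: lborel_prod)
      from lborel_pair.integrable_snd[OF this]
      show "integrable lborel (\<lambda>\<xi>. complex_of_real (gker (e n) (\<xi> - \<eta>)) * h \<xi>)"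
        by (simp add: G_def gker_Fourier(2)[OF e0])
    qed (use e0[of n] in simp)
    also have "\<dots> = \<bar>e n\<bar> ^ DIM('a) *\<^sub>R (LINT z|lborel. complex_of_real (c / e n ^ DIM('a)) * (h (\<eta> + e n *\<^sub>R z) * complex_of_real (gauss z)))"
      using e0[of n] by (simp add: gker_def c_def mult_ac)
    also have "\<dots> = complex_of_real c * (LINT z|lborel. h (\<eta> + e n *\<^sub>R z) * complex_of_real (gauss z))"
      using e0[of n] by (simp add: scaleR_conv_of_real)
    finally show ?thesis .
  qed
  have l1: "(\<lambda>n. LINT x|lborel. cis (- (x \<bullet> \<eta>)) * V x * complex_of_real (gauss (e n *\<^sub>R x)))
     \<longlonglongrightarrow> (LINT x|lborel. cis (- (x \<bullet> \<eta>)) * V x)"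
  proof (rule integral_dominated_convergence[OF _ _ integrable_norm[OF Vi]])
    show "AE x in lborel. (\<lambda>n. cis (- (x \<bullet> \<eta>)) * V x * complex_of_real (gauss (e n *\<^sub>R x))) \<longlonglongrightarrow> cis (- (x \<bullet> \<eta>)) * V x"
    proof (rule AE_I2)
      fix x
      have "(\<lambda>n. cis (- (x \<bullet> \<eta>)) * V x * complex_of_real (gauss (e n *\<^sub>R x))) \<longlonglongrightarrow> cis (- (x \<bullet> \<eta>)) * V x * complex_of_real 1"
        by (intro tendsto_intros gl)
      then show "(\<lambda>n. cis (- (x \<bullet> \<eta>)) * V x * complex_of_real (gauss (e n *\<^sub>R x))) \<longlonglongrightarrow> cis (- (x \<bullet> \<eta>)) * V x"
        by simp
    qed
  qed (auto simp: norm_mult gauss_pos less_imp_le gauss_le_1 mult_left_le)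
  have gi: "integrable lborel (\<lambda>z::'a. complex_of_real (gauss z))"
    using gauss_integrable by (rule integrable_of_real)
  have l2: "(\<lambda>n. LINT z|lborel. h (\<eta> + e n *\<^sub>R z) * complex_of_real (gauss z))
     \<longlonglongrightarrow> (LINT z|lborel. h \<eta> * complex_of_real (gauss (z::'a)))"
  proof (rule integral_dominated_convergence[where w = "\<lambda>z::'a. B * gauss z"])
    show "AE z in lborel. (\<lambda>n. h (\<eta> + e n *\<^sub>R z) * complex_of_real (gauss z)) \<longlonglongrightarrow> h \<eta> * complex_of_real (gauss z)"
    proof (rule AE_I2)
      fix z
      have "(\<lambda>n. \<eta> + e n *\<^sub>R z) \<longlonglongrightarrow> \<eta> + 0 *\<^sub>R z"
        by (intro tendsto_intros elim)
      then have "(\<lambda>n. h (\<eta> + e n *\<^sub>R z)) \<longlonglongrightarrow> h \<eta>"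
        using continuous_on_tendsto_compose[OF cont] by auto
      then show "(\<lambda>n. h (\<eta> + e n *\<^sub>R z) * complex_of_real (gauss z)) \<longlonglongrightarrow> h \<eta> * complex_of_real (gauss z)"
        by (intro tendsto_intros)
    qed
  qed (use bdd gauss_integrable in \<open>auto simp: norm_mult gauss_pos less_imp_le intro!: mult_right_mono\<close>)
  have "(LINT x|lborel. cis (- (x \<bullet> \<eta>)) * V x) = complex_of_real c * (LINT z|lborel. h \<eta> * complex_of_real (gauss (z::'a)))"
    using LIMSEQ_unique[OF l1[unfolded eq] tendsto_mult[OF tendsto_const l2, of "complex_of_real c"]] by simp
  also have "\<dots> = complex_of_real (c * c) * h \<eta>"
    by (simp add: gauss_integral c_def)
  also have "c * c = (2 * pi) ^ DIM('a)"
    unfolding c_def by (rule sqrt_2pi_power)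
  finally show ?thesis
    by (simp add: V_def)
qed

section \<open>Derivatives along lines and duality in L2\<close>

lemma directional_derivative_shift:
  fixes h :: "'a::real_normed_vector \<Rightarrow> 'b::real_normed_vector"
  assumes "\<And>x. ((\<lambda>s. h (x + s *\<^sub>R v)) has_vector_derivative h' x) (at 0)"
  shows "((\<lambda>s. h (x + s *\<^sub>R v)) has_vector_derivative h' (x + r *\<^sub>R v)) (at r)"
proof -
  have "((\<lambda>s. h (x + r *\<^sub>R v + s *\<^sub>R v)) \<circ> (\<lambda>s. s - r) has_vector_derivative 1 *\<^sub>R h' (x + r *\<^sub>R v)) (at r)"
    by (rule vector_diff_chain_at) (auto intro!: derivative_eq_intros assms)
  moreover have "x + r *\<^sub>R v + (s - r) *\<^sub>R v = x + s *\<^sub>R v" for s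
    by (simp add: algebra_simps)
  ultimately show ?thesis
    by (simp add: comp_def)
qed

text \<open>Translation invariance gives \<open>\<integral>(h(x + v) - h(x)) dx = 0\<close>; the difference is
  \<open>\<integral>\<^sub>0\<^sup>1 h'(x + sv) ds\<close>, and Fubini finishes.\<close>
lemma integral_directional_derivative:
  fixes h h' :: "'a::euclidean_space \<Rightarrow> complex"
  assumes h: "integrable lborel h" and h': "integrable lborel h'" and cont: "continuous_on UNIV h'"
    and deriv: "\<And>x. ((\<lambda>s. h (x + s *\<^sub>R v)) has_vector_derivative h' x) (at 0)"
  shows "integral\<^sup>L lborel h' = 0"
proof -
  have hm [measurable]: "h' \<in> borel_measurable borel"
    using h' by (simp add: borel_measurable_integrable)
  define F where "F = (\<lambda>(s::real, x). indicator {0..1} s *\<^sub>R h' (x + s *\<^sub>R v))"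
  note d = directional_derivative_shift[of h v h', OF deriv]
  have ftc: "(LINT s|lborel. F (s, x)) = h (x + v) - h x" for x
  proof -
    have "continuous_on {0..1} (\<lambda>s. h' (x + s *\<^sub>R v))"
      by (intro continuous_on_compose2[OF cont] continuous_intros) auto
    then have "(LINT s|lborel. indicator {0..1} s *\<^sub>R h' (x + s *\<^sub>R v)) = h (x + 1 *\<^sub>R v) - h (x + 0 *\<^sub>R v)"
      by (intro integral_FTC_Icc has_vector_derivative_at_within[OF d]) auto
    then show ?thesis by (simp add: F_def)
  qed
  have Fi: "integrable lborel F"
  proof -
    have "integrable (lborel \<Otimes>\<^sub>M lborel) F"
    proof (rule lborel_pair.Fubini_integrable)
      show "F \<in> borel_measurable (lborel \<Otimes>\<^sub>M lborel)"
        unfolding F_def by measurable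
      have i: "integrable lborel (\<lambda>x. h' (x + s *\<^sub>R v))" for s
        using integrable_lborel_shift(1)[OF h', of "s *\<^sub>R v"] by (simp add: add.commute)
      have "(LINT x|lborel. norm (F (s, x))) = (LINT x|lborel. norm (h' x)) * indicator {0..1} s" for s
        using integral_lborel_shift(1)[OF integrable_norm[OF h'], of "s *\<^sub>R v"]
        by (simp add: F_def add.commute)
      then show "integrable lborel (\<lambda>s. LINT x|lborel. norm (F (s, x)))"
        by simp
      show "AE s in lborel. integrable lborel (\<lambda>x. F (s, x))"
        using i by (simp add: F_def)
    qed
    then show ?thesis by (simp add: lborel_prod)
  qed
  have "integral\<^sup>L lborel F = (LINT x|lborel. h (v + x) - h x)"
    by (subst lborel_Fubini(2)[OF Fi, symmetric]) (simp add: ftc add.commute)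
  also have "\<dots> = 0"
    using integral_lborel_shift(1)[OF h, of v] integrable_lborel_shift(1)[OF h, of v] h by simp
  also have "integral\<^sup>L lborel F = (LINT s|lborel. indicator {0..1::real} s *\<^sub>R integral\<^sup>L lborel h')"
    using integral_lborel_shift(1)[OF h', of "s *\<^sub>R v" for s]
    by (subst lborel_Fubini(1)[OF Fi, symmetric]) (simp add: F_def add.commute)
  also have "\<dots> = integral\<^sup>L lborel h'"
    by simp
  finally show ?thesis .
qed

text \<open>Testing against the truncation of \<open>cnj v\<close> to a ball avoids any density argument.\<close>
lemma L2sq_le_by_duality:
  fixes v :: "'a::euclidean_space \<Rightarrow> complex"
  assumes vm [measurable]: "v \<in> borel_measurable borel" and K: "0 \<le> K"
    and loc: "\<And>R. \<exists>B. \<forall>x. norm x \<le> R \<longrightarrow> cmod (v x) \<le> B"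
    and dual: "\<And>g R B. g \<in> borel_measurable borel \<Longrightarrow> (\<And>x. norm x > R \<Longrightarrow> g x = 0) \<Longrightarrow> (\<And>x. cmod (g x) \<le> B) \<Longrightarrow>
      (cmod (LINT x|lborel. v x * g x))\<^sup>2 \<le> K * (LINT x|lborel. (cmod (g x))\<^sup>2)"
  shows "L2sq v \<le> ennreal K"
proof -
  define S where "S n = cball (0::'a) (real n)" for n
  have Sm [measurable]: "S n \<in> sets borel" for n
    by (simp add: S_def)
  have fin: "(\<integral>\<^sup>+x. ennreal (indicator (S n) x * (cmod (v x))\<^sup>2) \<partial>lborel) \<le> ennreal K" for n
  proof -
    obtain B where B: "\<And>x. norm x \<le> real n \<Longrightarrow> cmod (v x) \<le> B"
      using loc by blast
    have B0: "0 \<le> B" using B[of 0] norm_ge_zero[of "v 0"] by (auto intro: order_trans[OF norm_ge_zero])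
    define g where "g x = indicator (S n) x * cnj (v x)" for x
    have gm: "g \<in> borel_measurable borel" unfolding g_def by measurable
    have sq: "(cmod (g x))\<^sup>2 = indicator (S n) x * (cmod (v x))\<^sup>2" for x
      by (auto simp: g_def norm_mult indicator_def)
    have vg: "v x * g x = complex_of_real (indicator (S n) x * (cmod (v x))\<^sup>2)" for x
      by (auto simp: g_def indicator_def complex_norm_square[symmetric] simp del: of_real_power)
    define I where "I = (LINT x|lborel. indicator (S n) x * (cmod (v x))\<^sup>2)"
    have I0: "0 \<le> I" unfolding I_def by (intro Bochner_Integration.integral_nonneg) auto
    have "integrable lborel (\<lambda>x. B\<^sup>2 * indicator (S n) x)"
      using emeasure_lborel_cball_finite[of "0::'a" "real n"]
      by (intro integrable_mult_right integrable_real_indicator) (auto simp: S_def)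
    then have int: "integrable lborel (\<lambda>x. indicator (S n) x * (cmod (v x))\<^sup>2)"
      by (rule Bochner_Integration.integrable_bound)
        (auto simp: indicator_def S_def B0 intro!: power_mono B)
    have "(cmod (LINT x|lborel. v x * g x))\<^sup>2 \<le> K * (LINT x|lborel. (cmod (g x))\<^sup>2)"
      by (rule dual[OF gm, of "real n" B]) (use B B0 in \<open>auto simp: g_def S_def norm_mult indicator_def\<close>)
    then have "(cmod (complex_of_real I))\<^sup>2 \<le> K * I"
      unfolding vg sq I_def integral_complex_of_real by simp
    \<comment> \<open>Testing with \<open>g\<close> puts the truncated square integral I on both
      sides; being finite, it can be divided out.\<close>
    then have "I * I \<le> K * I"
      using I0 by (simp add: power2_eq_square)
    then have "I \<le> K"
      using I0 K by (cases "I = 0") (auto simp: mult_le_cancel_right)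
    then show ?thesis
      using nn_integral_eq_integral[OF int] by (simp add: I_def ennreal_leI)
  qed
  show ?thesis
    unfolding L2sq_def
  proof (rule nn_integral_Fatou_le[where F = "\<lambda>n x. ennreal (indicator (S n) x * (cmod (v x))\<^sup>2)", OF _ _ fin])
    fix x :: 'a
    obtain N :: nat where N: "norm x \<le> real N"
      using real_arch_simple by blast
    show "(\<lambda>n. ennreal (indicator (S n) x * (cmod (v x))\<^sup>2)) \<longlonglongrightarrow> ennreal ((cmod (v x))\<^sup>2)"
      by (rule tendsto_eventually, rule eventually_sequentiallyI[of N])
        (use N in \<open>auto simp: S_def indicator_def\<close>)
  qed measurable
qed

subsection \<open>The Calderon--Vaillancourt theorem\<close>

definition ubox :: "'a::euclidean_space set" where
  "ubox = cbox 0 One"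

lemma ubox_sets [measurable]: "ubox \<in> sets borel"
  by (simp add: ubox_def)

lemma emeasure_ubox: "emeasure lborel (ubox :: 'a::euclidean_space set) = 1"
  by (simp add: ubox_def emeasure_lborel_cbox_eq inner_Basis)

lemma mem_ubox: "x \<in> ubox \<longleftrightarrow> (\<forall>b\<in>Basis. 0 \<le> x \<bullet> b \<and> x \<bullet> b \<le> 1)"
  by (simp add: ubox_def mem_box)

lemma mem_ubox_prod: "x \<in> ubox \<longleftrightarrow> fst x \<in> ubox \<and> snd x \<in> ubox"
  by (cases x) (simp add: mem_ubox Basis_prod_def ball_Un)

lemma ennreal_power2_le_imp_le:
  fixes x y :: ennreal
  assumes "x\<^sup>2 \<le> y\<^sup>2"
  shows "x \<le> y"
proof (cases x rule: ennreal_cases)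
  case (real r)
  show ?thesis
  proof (cases y rule: ennreal_cases)
    case (real r')
    with assms \<open>x = ennreal r\<close> \<open>0 \<le> r\<close> show ?thesis
      by (auto simp: ennreal_power intro!: ennreal_leI dest!: power2_le_imp_le)
  qed simp
next
  case top
  then have "y\<^sup>2 = \<top>"
    using assms by (simp add: top_unique)
  then show ?thesis
    by (simp add: power_eq_top_ennreal)
qed

lemma Plancherel_le_neg:
  fixes h :: "'a::euclidean_space \<Rightarrow> complex"
  assumes h: "integrable lborel h"
  shows "L2sq (\<lambda>x. LINT \<xi>|lborel. cis (- (x \<bullet> \<xi>)) * h \<xi>) \<le> ennreal ((2 * pi) ^ DIM('a)) * L2sq h"
proof -
  have [measurable]: "h \<in> borel_measurable borel"
    using h by (simp add: borel_measurable_integrable)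
  let ?H = "\<lambda>x. ennreal ((cmod (LINT \<xi>|lborel. cis (x \<bullet> \<xi>) * h \<xi>))\<^sup>2)"
  have "(\<integral>\<^sup>+x. ?H (0 - x) \<partial>lborel) = integral\<^sup>N lborel ?H"
    by (rule nn_integral_lborel_shift) measurable
  then show ?thesis
    using Plancherel_le[OF h] by (simp add: L2sq_def)
qed

text \<open>A window cut down to the unit box. It is an arbitrary measurable function rather than a
  smooth bump, so that any factor bounded by 1 on the box, even a sharp cutoff, can be absorbed into
  it.\<close>

definition unit_mult :: "('a::euclidean_space \<Rightarrow> complex) \<Rightarrow> bool" where
  "unit_mult a \<longleftrightarrow> a \<in> borel_measurable borel \<and> (\<forall>x. cmod (a x) \<le> indicator ubox x)"

lemma unit_mult_measurable [measurable_dest]: "unit_mult a \<Longrightarrow> a \<in> borel_measurable borel"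
  and unit_mult_le: "unit_mult a \<Longrightarrow> cmod (a x) \<le> indicator ubox x"
  by (auto simp: unit_mult_def)

lemma unit_mult_le_1: "unit_mult a \<Longrightarrow> cmod (a x) \<le> 1"
  by (rule order_trans[OF unit_mult_le]) (auto simp: indicator_def)

text \<open>For each window position \<open>\<eta>\<close>, Plancherel in s bounds the inner
  integral by the mass of |h|^2 on the box at \<open>\<eta>\<close>. Over all positions each point
  lies in boxes of total measure 1, so the only constant is that of Plancherel.\<close>

lemma windowed_Fourier_bound:
  fixes h :: "'a::euclidean_space \<Rightarrow> complex"
  assumes h: "integrable lborel h" and a: "unit_mult a"
  shows "(\<integral>\<^sup>+\<eta>. \<integral>\<^sup>+s. ennreal ((cmod (LINT \<xi>|lborel. cis (- (s \<bullet> \<xi>)) * (a (\<xi> - \<eta>) * h \<xi>)))\<^sup>2) \<partial>lborel \<partial>lborel)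
     \<le> ennreal ((2 * pi) ^ DIM('a)) * L2sq h"
proof -
  have [measurable]: "h \<in> borel_measurable borel" "a \<in> borel_measurable borel"
    using h a by (simp_all add: borel_measurable_integrable unit_mult_measurable)
  have int: "integrable lborel (\<lambda>\<xi>. a (\<xi> - \<eta>) * h \<xi>)" for \<eta>
    by (rule Bochner_Integration.integrable_bound[OF h])
      (auto simp: norm_mult unit_mult_le_1[OF a] intro!: mult_left_le_one_le)
  have "(\<integral>\<^sup>+\<eta>. \<integral>\<^sup>+s. ennreal ((cmod (LINT \<xi>|lborel. cis (- (s \<bullet> \<xi>)) * (a (\<xi> - \<eta>) * h \<xi>)))\<^sup>2) \<partial>lborel \<partial>lborel)
     \<le> (\<integral>\<^sup>+\<eta>. ennreal ((2 * pi) ^ DIM('a)) * (\<integral>\<^sup>+\<xi>. ennreal (indicator ubox (\<xi> - \<eta>) * (cmod (h \<xi>))\<^sup>2) \<partial>lborel) \<partial>lborel)"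
  proof (intro nn_integral_mono)
    fix \<eta> :: 'a
    have "(\<integral>\<^sup>+\<xi>. ennreal ((cmod (a (\<xi> - \<eta>) * h \<xi>))\<^sup>2) \<partial>lborel) \<le>
       (\<integral>\<^sup>+\<xi>. ennreal (indicator ubox (\<xi> - \<eta>) * (cmod (h \<xi>))\<^sup>2) \<partial>lborel)"
    proof (intro nn_integral_mono ennreal_leI)
      fix \<xi>
      have "(cmod (a (\<xi> - \<eta>)))\<^sup>2 \<le> indicator ubox (\<xi> - \<eta>)"
        using unit_mult_le[OF a, of "\<xi> - \<eta>"]
        by (auto simp: indicator_def power_le_one split: if_splits)
      then show "(cmod (a (\<xi> - \<eta>) * h \<xi>))\<^sup>2 \<le> indicator ubox (\<xi> - \<eta>) * (cmod (h \<xi>))\<^sup>2"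
        by (simp add: norm_mult power_mult_distrib mult_right_mono)
    qed
    then show "(\<integral>\<^sup>+s. ennreal ((cmod (LINT \<xi>|lborel. cis (- (s \<bullet> \<xi>)) * (a (\<xi> - \<eta>) * h \<xi>)))\<^sup>2) \<partial>lborel)
      \<le> ennreal ((2 * pi) ^ DIM('a)) * (\<integral>\<^sup>+\<xi>. ennreal (indicator ubox (\<xi> - \<eta>) * (cmod (h \<xi>))\<^sup>2) \<partial>lborel)"
      using Plancherel_le_neg[OF int[of \<eta>]] unfolding L2sq_def
      by (elim order_trans) (intro mult_left_mono, auto)
  qed
  also have "\<dots> = ennreal ((2 * pi) ^ DIM('a)) *
      (\<integral>\<^sup>+\<xi>. \<integral>\<^sup>+\<eta>. ennreal (indicator ubox (\<xi> - \<eta>) * (cmod (h \<xi>))\<^sup>2) \<partial>lborel \<partial>lborel)"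
    by (subst nn_integral_cmult, simp, subst lborel_pair.Fubini') (simp_all add: split_beta')
  also have "(\<integral>\<^sup>+\<xi>. \<integral>\<^sup>+\<eta>. ennreal (indicator ubox (\<xi> - \<eta>) * (cmod (h \<xi>))\<^sup>2) \<partial>lborel \<partial>lborel) = L2sq h"
    unfolding L2sq_def
  proof (intro nn_integral_cong)
    fix \<xi> :: 'a
    have "(\<integral>\<^sup>+\<eta>. ennreal (indicator ubox (\<xi> - \<eta>) * (cmod (h \<xi>))\<^sup>2) \<partial>lborel) =
      (\<integral>\<^sup>+\<eta>. indicator ubox (\<xi> - \<eta>) \<partial>lborel) * ennreal ((cmod (h \<xi>))\<^sup>2)"
      by (subst nn_integral_multc[symmetric], simp) (auto intro!: nn_integral_cong simp: indicator_def)
    also have "(\<integral>\<^sup>+\<eta>. indicator ubox (\<xi> - \<eta>) \<partial>lborel) = 1"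
      by (subst nn_integral_lborel_shift(3)) (simp_all add: emeasure_ubox)
    finally show "(\<integral>\<^sup>+\<eta>. ennreal (indicator ubox (\<xi> - \<eta>) * (cmod (h \<xi>))\<^sup>2) \<partial>lborel) = ennreal ((cmod (h \<xi>))\<^sup>2)"
      by simp
  qed
  finally show ?thesis .
qed

text \<open>A fixed pair of test functions; \<open>N\<close> stands for (2 pi)^m times the product
  of their L2 norms. The hypothesis is stated for squares because Cauchy-Schwarz for nonnegative
  integrals delivers it in that form.\<close>

locale L2_pair =
  fixes h f :: "'a::euclidean_space \<Rightarrow> complex" and N :: real
  assumes h: "integrable lborel h" and f: "integrable lborel f" and N: "0 \<le> N"
    and hfN: "(ennreal ((2 * pi) ^ DIM('a)) * L2sq h) * (ennreal ((2 * pi) ^ DIM('a)) * L2sq f) \<le> ennreal (N\<^sup>2)"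
begin

lemma h_measurable [measurable]: "h \<in> borel_measurable borel"
  and f_measurable [measurable]: "f \<in> borel_measurable borel"
  using h f by (simp_all add: borel_measurable_integrable)

text \<open>The bilinear form localised to the unit box based at \<open>w = (\<eta>, s)\<close> in phase space;
  the amplitude \<open>Q w\<close> is a function of the position relative to \<open>w\<close>.\<close>
definition loc_form where
  "loc_form Q a b w = (LINT z|lborel. cis (- (snd w \<bullet> fst z)) * cis (- (fst w \<bullet> snd z)) * Q w (z - w) *
     (a (fst z - fst w) * b (snd z - snd w)) * (h (fst z) * f (snd z)))"

text \<open>The bound is demanded on the unit box only, since the windows vanish elsewhere;
  measurability is joint in both arguments because w is integrated as well.\<close>

definition amplitude :: "('a \<times> 'a \<Rightarrow> 'a \<times> 'a \<Rightarrow> complex) \<Rightarrow> real \<Rightarrow> bool" where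
  "amplitude Q B \<longleftrightarrow> (\<lambda>p. Q (fst p) (snd p)) \<in> borel_measurable borel \<and>
      0 \<le> B \<and> (\<forall>w. \<forall>x\<in>ubox. cmod (Q w x) \<le> B)"

text \<open>Amplitudes whose localised forms are summable over \<open>w\<close>, uniformly over tensor multipliers;
  \<open>K\<close> plays the role of a projective tensor norm.\<close>
definition tensor_bdd :: "real \<Rightarrow> ('a \<times> 'a \<Rightarrow> 'a \<times> 'a \<Rightarrow> complex) \<Rightarrow> bool" where
  "tensor_bdd K Q \<longleftrightarrow> 0 \<le> K \<and> (\<exists>B. amplitude Q B) \<and>
     (\<forall>a b. unit_mult a \<longrightarrow> unit_mult b \<longrightarrow>
        (\<integral>\<^sup>+w. ennreal (cmod (loc_form Q a b w)) \<partial>lborel) \<le> ennreal (K * N))"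

lemma amplitude_measurable: "amplitude Q B \<Longrightarrow> (\<lambda>p. Q (fst p) (snd p)) \<in> borel_measurable borel"
  by (simp add: amplitude_def)

lemma amplitude_le: "amplitude Q B \<Longrightarrow> x \<in> ubox \<Longrightarrow> cmod (Q w x) \<le> B"
  by (auto simp: amplitude_def simp del: split_paired_All)

lemma amplitude_measurable_comp:
  assumes "amplitude Q B" "u \<in> borel_measurable M" "v \<in> borel_measurable M"
  shows "(\<lambda>p. Q (u p) (v p)) \<in> borel_measurable M"
  using measurable_compose[of "\<lambda>p. (u p, v p)" M borel "\<lambda>p. Q (fst p) (snd p)" borel]
    amplitude_measurable[OF assms(1)] assms(2,3) by simp

lemma loc_integrand_bound:
  assumes Q: "amplitude Q B" and a: "unit_mult a" and b: "unit_mult b"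
  shows "cmod (Q w (z - w) * (a (fst z - fst w) * b (snd z - snd w))) \<le> B"
proof (cases "z - w \<in> ubox")
  case True
  then have "cmod (Q w (z - w)) * (cmod (a (fst z - fst w)) * cmod (b (snd z - snd w))) \<le> B * (1 * 1)"
    using Q by (intro mult_mono amplitude_le[OF Q] unit_mult_le_1[OF a] unit_mult_le_1[OF b]) (auto simp: amplitude_def)
  then show ?thesis by (simp add: norm_mult)
next
  case False
  then have z: "a (fst z - fst w) * b (snd z - snd w) = 0"
    using unit_mult_le[OF a, of "fst z - fst w"] unit_mult_le[OF b, of "snd z - snd w"]
    by (auto simp: mem_ubox_prod indicator_def split: if_splits)
  show ?thesis
    unfolding z using Q by (simp add: amplitude_def)
qed

lemma hf_integrable: "integrable lborel (\<lambda>z. h (fst z) * f (snd z))"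
  by (rule lborel_integrable_prod_bound[OF _ integrable_norm[OF h] integrable_norm[OF f]])
     (auto simp: norm_mult)

lemma loc_integrand_integrable:
  assumes Q: "amplitude Q B" and a: "unit_mult a" and b: "unit_mult b"
  shows "integrable lborel (\<lambda>z. cis (- (snd w \<bullet> fst z)) * cis (- (fst w \<bullet> snd z)) * Q w (z - w) *
     (a (fst z - fst w) * b (snd z - snd w)) * (h (fst z) * f (snd z)))"
proof (rule Bochner_Integration.integrable_bound)
  show "integrable lborel (\<lambda>z. B * cmod (h (fst z) * f (snd z)))"
    by (intro integrable_mult_right integrable_norm hf_integrable)
  note [measurable] = unit_mult_measurable[OF a] unit_mult_measurable[OF b] amplitude_measurable_comp[OF Q]
  show "(\<lambda>z. cis (- (snd w \<bullet> fst z)) * cis (- (fst w \<bullet> snd z)) * Q w (z - w) *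
     (a (fst z - fst w) * b (snd z - snd w)) * (h (fst z) * f (snd z))) \<in> borel_measurable lborel"
    by measurable
  have B: "0 \<le> B" using Q by (simp add: amplitude_def)
  show "AE z in lborel. norm (cis (- (snd w \<bullet> fst z)) * cis (- (fst w \<bullet> snd z)) * Q w (z - w) *
     (a (fst z - fst w) * b (snd z - snd w)) * (h (fst z) * f (snd z))) \<le> norm (B * cmod (h (fst z) * f (snd z)))"
  proof (rule AE_I2)
    fix z :: "'a \<times> 'a"
    show "norm (cis (- (snd w \<bullet> fst z)) * cis (- (fst w \<bullet> snd z)) * Q w (z - w) *
     (a (fst z - fst w) * b (snd z - snd w)) * (h (fst z) * f (snd z))) \<le> norm (B * cmod (h (fst z) * f (snd z)))"
      using mult_right_mono[OF loc_integrand_bound[OF Q a b, of w z], of "cmod (h (fst z) * f (snd z))"] B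
      by (simp add: norm_mult mult_ac)
  qed
qed

lemma loc_form_measurable:
  assumes Q: "amplitude Q B" and a: "unit_mult a" and b: "unit_mult b"
  shows "loc_form Q a b \<in> borel_measurable borel"
proof -
  note [measurable] = unit_mult_measurable[OF a] unit_mult_measurable[OF b] amplitude_measurable_comp[OF Q]
  show ?thesis
    unfolding loc_form_def by measurable
qed

lemma tensor_bdd_mono: "tensor_bdd K Q \<Longrightarrow> K \<le> K' \<Longrightarrow> tensor_bdd K' Q"
proof -
  assume Q: "tensor_bdd K Q" and K: "K \<le> K'"
  have "ennreal (K * N) \<le> ennreal (K' * N)"
    by (intro ennreal_leI mult_right_mono K N)
  then show ?thesis
    using Q K unfolding tensor_bdd_def by (meson order_trans)
qed

lemma tensor_bdd_cong:
  assumes Q: "tensor_bdd K Q" and m: "(\<lambda>p. Q' (fst p) (snd p)) \<in> borel_measurable borel"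
    and eq: "\<And>w x. x \<in> ubox \<Longrightarrow> Q' w x = Q w x"
  shows "tensor_bdd K Q'"
proof -
  have "loc_form Q' a b w = loc_form Q a b w" if a: "unit_mult a" and b: "unit_mult b" for a b w
    unfolding loc_form_def
  proof (intro Bochner_Integration.integral_cong refl)
    fix z :: "'a \<times> 'a"
    have "Q' w (z - w) * (a (fst z - fst w) * b (snd z - snd w)) = Q w (z - w) * (a (fst z - fst w) * b (snd z - snd w))"
      using unit_mult_le[OF a, of "fst z - fst w"] unit_mult_le[OF b, of "snd z - snd w"] eq[of "z - w" w]
      by (cases "z - w \<in> ubox") (auto simp: mem_ubox_prod indicator_def split: if_splits)
    then show "cis (- (snd w \<bullet> fst z)) * cis (- (fst w \<bullet> snd z)) * Q' w (z - w) *
     (a (fst z - fst w) * b (snd z - snd w)) * (h (fst z) * f (snd z)) =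
     cis (- (snd w \<bullet> fst z)) * cis (- (fst w \<bullet> snd z)) * Q w (z - w) *
     (a (fst z - fst w) * b (snd z - snd w)) * (h (fst z) * f (snd z))"
      by auto
  qed
  moreover have "\<exists>B. amplitude Q' B"
    using Q m eq by (auto simp: tensor_bdd_def amplitude_def)
  ultimately show ?thesis
    using Q by (auto simp: tensor_bdd_def)
qed

text \<open>The base case. With w = (\<open>\<eta>\<close>, s), an amplitude constant on the box
  makes the localised form factor into a windowed Fourier transform of h (window at
  \<open>\<eta>\<close>, frequency s) and one of f (window at s, frequency \<open>\<eta>\<close>).
  Cauchy-Schwarz in w and \<open>windowed_Fourier_bound\<close> for each factor finish.\<close>

lemma tensor_bdd_const:
  assumes c [measurable]: "c \<in> borel_measurable borel" and M: "\<And>w. cmod (c w) \<le> M"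
  shows "tensor_bdd M (\<lambda>w x. c w)"
  unfolding tensor_bdd_def
proof (intro conjI allI impI exI)
  have M0: "0 \<le> M" using order_trans[OF norm_ge_zero M] .
  then show "0 \<le> M" .
  show "amplitude (\<lambda>w x. c w) M"
    using M M0 by (auto simp: amplitude_def)
  fix a b :: "'a \<Rightarrow> complex" assume a: "unit_mult a" and b: "unit_mult b"
  note [measurable] = unit_mult_measurable[OF a] unit_mult_measurable[OF b]
  define Z1 where "Z1 w = (LINT \<xi>|lborel. cis (- (snd w \<bullet> \<xi>)) * (a (\<xi> - fst w) * h \<xi>))" for w :: "'a \<times> 'a"
  define Z2 where "Z2 w = (LINT y|lborel. cis (- (fst w \<bullet> y)) * (b (y - snd w) * f y))" for w :: "'a \<times> 'a"
  have [measurable]: "Z1 \<in> borel_measurable borel" "Z2 \<in> borel_measurable borel"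
    unfolding Z1_def Z2_def by measurable
  have eq: "loc_form (\<lambda>w x. c w) a b w = c w * (Z1 w * Z2 w)" for w
  proof -
    define F where "F z = (cis (- (snd w \<bullet> fst z)) * (a (fst z - fst w) * h (fst z))) *
       (cis (- (fst w \<bullet> snd z)) * (b (snd z - snd w) * f (snd z)))" for z :: "'a \<times> 'a"
    have Fi: "integrable lborel F"
    proof (rule Bochner_Integration.integrable_bound[OF hf_integrable])
      show "AE z in lborel. cmod (F z) \<le> cmod (h (fst z) * f (snd z))"
      proof (rule AE_I2)
        fix z :: "'a \<times> 'a"
        have "(cmod (a (fst z - fst w)) * cmod (h (fst z))) * (cmod (b (snd z - snd w)) * cmod (f (snd z)))
            \<le> (1 * cmod (h (fst z))) * (1 * cmod (f (snd z)))"
          by (intro mult_mono unit_mult_le_1[OF a] unit_mult_le_1[OF b]) auto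
        then show "cmod (F z) \<le> cmod (h (fst z) * f (snd z))"
          by (simp add: F_def norm_mult)
      qed
    qed (simp add: F_def[abs_def])
    have "integral\<^sup>L lborel F = Z1 w * Z2 w"
      by (subst lborel_Fubini(1)[OF Fi, symmetric]) (simp add: F_def Z1_def Z2_def)
    moreover have "loc_form (\<lambda>w x. c w) a b w = (LINT z|lborel. c w * F z)"
      unfolding loc_form_def F_def by (intro Bochner_Integration.integral_cong) (auto simp: mult_ac)
    ultimately show ?thesis by simp
  qed
  have z1: "(\<integral>\<^sup>+w. (ennreal (cmod (Z1 w)))\<^sup>2 \<partial>lborel) \<le> ennreal ((2 * pi) ^ DIM('a)) * L2sq h"
    using windowed_Fourier_bound[OF h a]
    by (subst lborel_Tonelli(1)[symmetric]) (simp_all add: Z1_def ennreal_power)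
  have z2: "(\<integral>\<^sup>+w. (ennreal (cmod (Z2 w)))\<^sup>2 \<partial>lborel) \<le> ennreal ((2 * pi) ^ DIM('a)) * L2sq f"
    using windowed_Fourier_bound[OF f b]
    by (subst lborel_Tonelli(2)[symmetric]) (simp_all add: Z2_def ennreal_power)
  have "(\<integral>\<^sup>+w. ennreal (cmod (Z1 w)) * ennreal (cmod (Z2 w)) \<partial>lborel)\<^sup>2 \<le> (ennreal N)\<^sup>2"
  proof -
    have "(\<integral>\<^sup>+w. ennreal (cmod (Z1 w)) * ennreal (cmod (Z2 w)) \<partial>lborel)\<^sup>2 \<le>
       (\<integral>\<^sup>+w. (ennreal (cmod (Z1 w)))\<^sup>2 \<partial>lborel) * (\<integral>\<^sup>+w. (ennreal (cmod (Z2 w)))\<^sup>2 \<partial>lborel)"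
      by (rule Cauchy_Schwarz_nn_integral) measurable
    also have "\<dots> \<le> (ennreal ((2 * pi) ^ DIM('a)) * L2sq h) * (ennreal ((2 * pi) ^ DIM('a)) * L2sq f)"
      by (intro mult_mono z1 z2) auto
    also have "\<dots> \<le> (ennreal N)\<^sup>2"
      using hfN N by (simp add: ennreal_power)
    finally show ?thesis .
  qed
  then have le: "(\<integral>\<^sup>+w. ennreal (cmod (Z1 w)) * ennreal (cmod (Z2 w)) \<partial>lborel) \<le> ennreal N"
    by (rule ennreal_power2_le_imp_le)
  have "(\<integral>\<^sup>+w. ennreal (cmod (loc_form (\<lambda>w x. c w) a b w)) \<partial>lborel) \<le>
     (\<integral>\<^sup>+w. ennreal M * (ennreal (cmod (Z1 w)) * ennreal (cmod (Z2 w))) \<partial>lborel)"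
    unfolding eq using M M0
    by (intro nn_integral_mono) (auto simp: norm_mult ennreal_mult[symmetric] intro!: ennreal_leI mult_right_mono)
  also have "\<dots> \<le> ennreal M * ennreal N"
    by (subst nn_integral_cmult) (auto intro!: mult_left_mono le)
  also have "\<dots> = ennreal (M * N)"
    using M0 N by (simp add: ennreal_mult)
  finally show "(\<integral>\<^sup>+w. ennreal (cmod (loc_form (\<lambda>w x. c w) a b w)) \<partial>lborel) \<le> ennreal (M * N)" .
qed

lemma tensor_bdd_add:
  assumes Q1: "tensor_bdd K1 Q1" and Q2: "tensor_bdd K2 Q2"
  shows "tensor_bdd (K1 + K2) (\<lambda>w x. Q1 w x + Q2 w x)"
  unfolding tensor_bdd_def
proof (intro conjI allI impI)
  obtain B1 B2 where B: "amplitude Q1 B1" "amplitude Q2 B2"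
    using Q1 Q2 by (auto simp: tensor_bdd_def)
  show "0 \<le> K1 + K2"
    using Q1 Q2 by (auto simp: tensor_bdd_def)
  have "amplitude (\<lambda>w x. Q1 w x + Q2 w x) (B1 + B2)"
    using B by (auto simp: amplitude_def intro!: norm_triangle_le add_mono borel_measurable_add)
  then show "\<exists>B. amplitude (\<lambda>w x. Q1 w x + Q2 w x) B" ..
  fix a b :: "'a \<Rightarrow> complex" assume a: "unit_mult a" and b: "unit_mult b"
  have eq: "loc_form (\<lambda>w x. Q1 w x + Q2 w x) a b w = loc_form Q1 a b w + loc_form Q2 a b w" for w
    unfolding loc_form_def
    by (subst Bochner_Integration.integral_add[symmetric, OF loc_integrand_integrable[OF B(1) a b] loc_integrand_integrable[OF B(2) a b]])
      (simp add: distrib_left distrib_right)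
  have "(\<integral>\<^sup>+w. ennreal (cmod (loc_form (\<lambda>w x. Q1 w x + Q2 w x) a b w)) \<partial>lborel) \<le>
    (\<integral>\<^sup>+w. ennreal (cmod (loc_form Q1 a b w)) + ennreal (cmod (loc_form Q2 a b w)) \<partial>lborel)"
    unfolding eq by (intro nn_integral_mono) (simp flip: ennreal_plus add: norm_triangle_ineq ennreal_leI)
  also have "\<dots> = (\<integral>\<^sup>+w. ennreal (cmod (loc_form Q1 a b w)) \<partial>lborel) + (\<integral>\<^sup>+w. ennreal (cmod (loc_form Q2 a b w)) \<partial>lborel)"
    using loc_form_measurable[OF B(1) a b] loc_form_measurable[OF B(2) a b] by (intro nn_integral_add) auto
  also have "\<dots> \<le> ennreal (K1 * N) + ennreal (K2 * N)"
    using Q1 Q2 a b by (intro add_mono) (auto simp: tensor_bdd_def)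
  also have "\<dots> = ennreal ((K1 + K2) * N)"
    using Q1 Q2 N by (subst ennreal_plus[symmetric]) (auto simp: tensor_bdd_def distrib_right)
  finally show "(\<integral>\<^sup>+w. ennreal (cmod (loc_form (\<lambda>w x. Q1 w x + Q2 w x) a b w)) \<partial>lborel) \<le> ennreal ((K1 + K2) * N)" .
qed

text \<open>The factors \<open>\<alpha>\<close> and \<open>\<beta>\<close> are absorbed into the
  windows a and b at no cost. This is the reason why \<open>tensor_bdd\<close> quantifies over all
  windows.\<close>

lemma tensor_bdd_tensor_mult:
  assumes Q: "tensor_bdd K Q"
    and [measurable]: "\<alpha> \<in> borel_measurable borel" "\<beta> \<in> borel_measurable borel"
    and le: "\<And>x. x \<in> ubox \<Longrightarrow> cmod (\<alpha> x) \<le> 1" "\<And>x. x \<in> ubox \<Longrightarrow> cmod (\<beta> x) \<le> 1"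
  shows "tensor_bdd K (\<lambda>w x. Q w x * (\<alpha> (fst x) * \<beta> (snd x)))"
  unfolding tensor_bdd_def
proof (intro conjI allI impI)
  obtain B where B: "amplitude Q B"
    using Q by (auto simp: tensor_bdd_def)
  show "0 \<le> K" using Q by (auto simp: tensor_bdd_def)
  note [measurable] = amplitude_measurable_comp[OF B]
  have "cmod (Q w x * (\<alpha> (fst x) * \<beta> (snd x))) \<le> B" if "x \<in> ubox" for w x
  proof -
    have "cmod (Q w x) * (cmod (\<alpha> (fst x)) * cmod (\<beta> (snd x))) \<le> B * (1 * 1)"
      using B that by (intro mult_mono le amplitude_le[OF B]) (auto simp: amplitude_def mem_ubox_prod)
    then show ?thesis by (simp add: norm_mult)
  qed
  then have "amplitude (\<lambda>w x. Q w x * (\<alpha> (fst x) * \<beta> (snd x))) B"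
    using B unfolding amplitude_def by (auto intro!: borel_measurable_times)
  then show "\<exists>B. amplitude (\<lambda>w x. Q w x * (\<alpha> (fst x) * \<beta> (snd x))) B" ..
  fix a b :: "'a \<Rightarrow> complex" assume a: "unit_mult a" and b: "unit_mult b"
  note [measurable] = unit_mult_measurable[OF a] unit_mult_measurable[OF b]
  have ind: "c * d \<le> indicator ubox x" if "c \<le> indicator ubox x" "0 \<le> c" "x \<in> ubox \<Longrightarrow> d \<le> 1" "0 \<le> d" for c d :: real and x :: 'a
    using that by (cases "x \<in> ubox") (auto intro!: mult_le_one)
  have "unit_mult (\<lambda>x. a x * \<alpha> x)" "unit_mult (\<lambda>x. b x * \<beta> x)"
    unfolding unit_mult_def using unit_mult_le[OF a] unit_mult_le[OF b] le
    by (auto simp: norm_mult intro!: ind)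
  moreover have "loc_form (\<lambda>w x. Q w x * (\<alpha> (fst x) * \<beta> (snd x))) a b w =
      loc_form Q (\<lambda>x. a x * \<alpha> x) (\<lambda>x. b x * \<beta> x) w" for w
    unfolding loc_form_def by (intro Bochner_Integration.integral_cong) (auto simp: mult_ac)
  ultimately show "(\<integral>\<^sup>+w. ennreal (cmod (loc_form (\<lambda>w x. Q w x * (\<alpha> (fst x) * \<beta> (snd x))) a b w)) \<partial>lborel) \<le> ennreal (K * N)"
    using Q by (auto simp: tensor_bdd_def)
qed

lemma tensor_bdd_cmult:
  assumes Q: "tensor_bdd K Q"
  shows "tensor_bdd (cmod c * K) (\<lambda>w x. c * Q w x)"
  unfolding tensor_bdd_def
proof (intro conjI allI impI)
  obtain B where B: "amplitude Q B"
    using Q by (auto simp: tensor_bdd_def)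
  show "0 \<le> cmod c * K" using Q by (auto simp: tensor_bdd_def)
  have "amplitude (\<lambda>w x. c * Q w x) (cmod c * B)"
    using B by (auto simp: amplitude_def norm_mult intro!: mult_left_mono)
  then show "\<exists>B. amplitude (\<lambda>w x. c * Q w x) B" ..
  fix a b :: "'a \<Rightarrow> complex" assume a: "unit_mult a" and b: "unit_mult b"
  have "loc_form (\<lambda>w x. c * Q w x) a b w = c * loc_form Q a b w" for w
    unfolding loc_form_def
    by (subst integral_mult_right_zero[symmetric], intro Bochner_Integration.integral_cong) (auto simp: mult_ac)
  then have "(\<integral>\<^sup>+w. ennreal (cmod (loc_form (\<lambda>w x. c * Q w x) a b w)) \<partial>lborel) =
     ennreal (cmod c) * (\<integral>\<^sup>+w. ennreal (cmod (loc_form Q a b w)) \<partial>lborel)"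
    using loc_form_measurable[OF B a b] by (simp add: norm_mult ennreal_mult nn_integral_cmult)
  also have "\<dots> \<le> ennreal (cmod c) * ennreal (K * N)"
    using Q a b by (intro mult_left_mono) (auto simp: tensor_bdd_def)
  finally show "(\<integral>\<^sup>+w. ennreal (cmod (loc_form (\<lambda>w x. c * Q w x) a b w)) \<partial>lborel) \<le> ennreal (cmod c * K * N)"
    using Q N by (simp add: ennreal_mult tensor_bdd_def mult.assoc)
qed

text \<open>Dominated convergence moves the limit through each localised form, and Fatou moves it
  through the integral over w.\<close>

lemma tensor_bdd_limit:
  assumes Q: "\<And>n. tensor_bdd K (Q n)" and B: "\<And>n. amplitude (Q n) B" and Q': "amplitude Q' B"
    and lim: "\<And>w x. (\<lambda>n. Q n w x) \<longlonglongrightarrow> Q' w x"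
  shows "tensor_bdd K Q'"
  unfolding tensor_bdd_def
proof (intro conjI allI impI)
  show "0 \<le> K" using Q by (auto simp: tensor_bdd_def)
  show "\<exists>B. amplitude Q' B" using Q' ..
  fix a b :: "'a \<Rightarrow> complex" assume a: "unit_mult a" and b: "unit_mult b"
  show "(\<integral>\<^sup>+w. ennreal (cmod (loc_form Q' a b w)) \<partial>lborel) \<le> ennreal (K * N)"
  proof (rule nn_integral_Fatou_le[where F = "\<lambda>n w. ennreal (cmod (loc_form (Q n) a b w))"])
    show "(\<lambda>w. ennreal (cmod (loc_form (Q n) a b w))) \<in> borel_measurable lborel" for n
      using loc_form_measurable[OF B a b] by auto
    show "(\<integral>\<^sup>+w. ennreal (cmod (loc_form (Q n) a b w)) \<partial>lborel) \<le> ennreal (K * N)" for n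
      using Q a b by (auto simp: tensor_bdd_def)
    fix w
    have "(\<lambda>n. loc_form (Q n) a b w) \<longlonglongrightarrow> loc_form Q' a b w"
      unfolding loc_form_def
    proof (rule integral_dominated_convergence[where w = "\<lambda>z. B * cmod (h (fst z) * f (snd z))"])
      show "integrable lborel (\<lambda>z. B * cmod (h (fst z) * f (snd z)))"
        by (intro integrable_mult_right integrable_norm hf_integrable)
      show "AE z in lborel. norm (cis (- (snd w \<bullet> fst z)) * cis (- (fst w \<bullet> snd z)) * Q n w (z - w) *
         (a (fst z - fst w) * b (snd z - snd w)) * (h (fst z) * f (snd z))) \<le> B * cmod (h (fst z) * f (snd z))" for n
      proof (rule AE_I2)
        fix z :: "'a \<times> 'a"
        show "norm (cis (- (snd w \<bullet> fst z)) * cis (- (fst w \<bullet> snd z)) * Q n w (z - w) *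
         (a (fst z - fst w) * b (snd z - snd w)) * (h (fst z) * f (snd z))) \<le> B * cmod (h (fst z) * f (snd z))"
          using mult_right_mono[OF loc_integrand_bound[OF B[of n] a b, of w z], of "cmod (h (fst z) * f (snd z))"]
          by (simp add: norm_mult mult_ac)
      qed
      show "AE z in lborel. (\<lambda>n. cis (- (snd w \<bullet> fst z)) * cis (- (fst w \<bullet> snd z)) * Q n w (z - w) *
         (a (fst z - fst w) * b (snd z - snd w)) * (h (fst z) * f (snd z))) \<longlonglongrightarrow>
         cis (- (snd w \<bullet> fst z)) * cis (- (fst w \<bullet> snd z)) * Q' w (z - w) *
         (a (fst z - fst w) * b (snd z - snd w)) * (h (fst z) * f (snd z))"
        by (intro AE_I2 tendsto_mult tendsto_const lim)
    qed (use borel_measurable_integrable[OF loc_integrand_integrable[OF B a b]]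
       borel_measurable_integrable[OF loc_integrand_integrable[OF Q' a b]] in auto)
    then show "(\<lambda>n. ennreal (cmod (loc_form (Q n) a b w))) \<longlonglongrightarrow> ennreal (cmod (loc_form Q' a b w))"
      by (intro tendsto_ennrealI tendsto_norm)
  qed
qed

text \<open>Minkowski's inequality: the modulus of an average of localised forms is at most the
  average of the moduli, and Tonelli exchanges this average with the integral over w.\<close>

lemma tensor_bdd_average:
  assumes m: "(\<lambda>p. Q (fst p) (fst (snd p)) (snd (snd p))) \<in> borel_measurable (borel :: (real \<times> ('a \<times> 'a) \<times> 'a \<times> 'a) measure)"
    and bdd: "\<And>r. amplitude (Q r) B" and Q: "\<And>r. tensor_bdd K (Q r)"
  shows "tensor_bdd K (\<lambda>w x. LINT r|lborel. indicator {0..1} r *\<^sub>R Q r w x)"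
  unfolding tensor_bdd_def
proof (intro conjI allI impI)
  show "0 \<le> K" using Q by (auto simp: tensor_bdd_def)
  have B0: "0 \<le> B" using bdd by (simp add: amplitude_def)
  have Qm [measurable]: "(\<lambda>p. Q (u p) (v p) (w p)) \<in> borel_measurable M"
    if "u \<in> borel_measurable M" "v \<in> borel_measurable M" "w \<in> borel_measurable M" for u v w M
    using measurable_compose[of "\<lambda>p. (u p, v p, w p)" M borel _ borel, OF _ m] that by simp
  have amp: "amplitude (\<lambda>w x. LINT r|lborel. indicator {0..1} r *\<^sub>R Q r w x) B"
    unfolding amplitude_def
  proof (intro conjI allI ballI B0)
    show "(\<lambda>p. LINT r|lborel. indicator {0..1} r *\<^sub>R Q r (fst p) (snd p)) \<in> borel_measurable borel"
      by measurable
    fix w x :: "'a \<times> 'a" assume x: "x \<in> ubox"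
    have "cmod (LINT r|lborel. indicator {0..1} r *\<^sub>R Q r w x) \<le> (LINT r|lborel. norm (indicator {0..1} r *\<^sub>R Q r w x))"
      by (rule integral_norm_bound)
    also have "\<dots> \<le> (LINT r|lborel. B * indicator {0..1::real} r)"
    proof (rule integral_mono')
      show "integrable lborel (\<lambda>r. B * indicator {0..1::real} r)" by simp
      show "norm (indicator {0..1} r *\<^sub>R Q r w x) \<le> B * indicator {0..1} r" for r
        using amplitude_le[OF bdd[of r] x, of w] by (auto simp: indicator_def)
      show "0 \<le> B * indicator {0..1} r" for r :: real
        using B0 by simp
    qed
    finally show "cmod (LINT r|lborel. indicator {0..1} r *\<^sub>R Q r w x) \<le> B"
      by simp
  qed
  then show "\<exists>B. amplitude (\<lambda>w x. LINT r|lborel. indicator {0..1} r *\<^sub>R Q r w x) B" ..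
  fix a b :: "'a \<Rightarrow> complex" assume a: "unit_mult a" and b: "unit_mult b"
  note [measurable] = unit_mult_measurable[OF a] unit_mult_measurable[OF b]
  have eq: "loc_form (\<lambda>w x. LINT r|lborel. indicator {0..1} r *\<^sub>R Q r w x) a b w =
     (LINT r|lborel. indicator {0..1} r *\<^sub>R loc_form (Q r) a b w)" for w
  proof -
    define F where "F = (\<lambda>(r::real, z). indicator {0..1} r *\<^sub>R (cis (- (snd w \<bullet> fst z)) * cis (- (fst w \<bullet> snd z)) * Q r w (z - w) *
         (a (fst z - fst w) * b (snd z - snd w)) * (h (fst z) * f (snd z))))"
    have Fi: "integrable lborel F"
    proof (rule lborel_integrable_prod_bound)
      show "integrable lborel (indicator {0..1} :: real \<Rightarrow> real)" by simp
      show "integrable lborel (\<lambda>z. B * cmod (h (fst z) * f (snd z)))"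
        by (intro integrable_mult_right integrable_norm hf_integrable)
      show "F \<in> borel_measurable borel"
        unfolding F_def split_beta' by measurable
      show "norm (F (r, z)) \<le> indicator {0..1} r * (B * cmod (h (fst z) * f (snd z)))" for r z
        using mult_right_mono[OF loc_integrand_bound[OF bdd[of r] a b, of w z], of "cmod (h (fst z) * f (snd z))"]
        by (auto simp: F_def norm_mult mult_ac indicator_def)
    qed
    have "(LINT r|lborel. F (r, z)) = cis (- (snd w \<bullet> fst z)) * cis (- (fst w \<bullet> snd z)) *
        (LINT r|lborel. indicator {0..1} r *\<^sub>R Q r w (z - w)) *
         (a (fst z - fst w) * b (snd z - snd w)) * (h (fst z) * f (snd z))" for z
      by (simp add: F_def flip: integral_mult_right_zero integral_mult_left_zero)
    moreover have "(LINT z|lborel. F (r, z)) = indicator {0..1} r *\<^sub>R loc_form (Q r) a b w" for r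
      by (simp add: F_def loc_form_def)
    ultimately show ?thesis
      using lborel_Fubini[OF Fi] by (simp add: loc_form_def)
  qed
  have lm [measurable]: "(\<lambda>p. loc_form (Q (fst p)) a b (snd p)) \<in> borel_measurable borel"
    unfolding loc_form_def by measurable
  have "(\<integral>\<^sup>+w. ennreal (cmod (loc_form (\<lambda>w x. LINT r|lborel. indicator {0..1} r *\<^sub>R Q r w x) a b w)) \<partial>lborel)
    \<le> (\<integral>\<^sup>+w. \<integral>\<^sup>+r. ennreal (indicator {0..1::real} r * cmod (loc_form (Q r) a b w)) \<partial>lborel \<partial>lborel)"
  proof (intro nn_integral_mono)
    fix w
    let ?g = "\<lambda>r::real. indicator {0..1} r *\<^sub>R loc_form (Q r) a b w"
    show "ennreal (cmod (loc_form (\<lambda>w x. LINT r|lborel. indicator {0..1} r *\<^sub>R Q r w x) a b w))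
      \<le> (\<integral>\<^sup>+r. ennreal (indicator {0..1::real} r * cmod (loc_form (Q r) a b w)) \<partial>lborel)"
    \<comment> \<open>Integrability in r has not been established for each single w; if it fails,
      the Bochner integral is zero and the bound is trivial.\<close>
    proof (cases "integrable lborel ?g")
      case True
      show ?thesis
        unfolding eq by (rule order_trans[OF integral_norm_bound_ennreal[OF True]]) (auto intro!: nn_integral_mono)
    next
      case False
      then show ?thesis
        unfolding eq by (simp add: not_integrable_integral_eq)
    qed
  qed
  also have "\<dots> = (\<integral>\<^sup>+r. \<integral>\<^sup>+w. ennreal (indicator {0..1::real} r * cmod (loc_form (Q r) a b w)) \<partial>lborel \<partial>lborel)"
  proof -
    let ?G = "\<lambda>p. ennreal (indicator {0..1::real} (fst p) * cmod (loc_form (Q (fst p)) a b (snd p)))"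
    have "?G \<in> borel_measurable borel" by measurable
    from lborel_Tonelli[OF this] show ?thesis by simp
  qed
  also have "\<dots> \<le> (\<integral>\<^sup>+r. indicator {0..1::real} r * ennreal (K * N) \<partial>lborel)"
  proof (intro nn_integral_mono)
    fix r :: real
    show "(\<integral>\<^sup>+w. ennreal (indicator {0..1::real} r * cmod (loc_form (Q r) a b w)) \<partial>lborel) \<le> indicator {0..1} r * ennreal (K * N)"
      using Q[of r] a b by (auto simp: tensor_bdd_def indicator_def)
  qed
  also have "\<dots> = ennreal (K * N)"
    by (simp add: nn_integral_multc)
  finally show "(\<integral>\<^sup>+w. ennreal (cmod (loc_form (\<lambda>w x. LINT r|lborel. indicator {0..1} r *\<^sub>R Q r w x) a b w)) \<partial>lborel)
    \<le> ennreal (K * N)" .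
qed

lemma tensor_bdd_sum:
  assumes "finite S" "S \<noteq> {}" "\<And>b. b \<in> S \<Longrightarrow> tensor_bdd K (Q b)"
  shows "tensor_bdd (real (card S) * K) (\<lambda>w x. \<Sum>b\<in>S. Q b w x)"
  using assms
proof (induction S rule: finite_ne_induct)
  case (singleton b)
  then show ?case by simp
next
  case (insert b S)
  then have "tensor_bdd (K + real (card S) * K) (\<lambda>w x. Q b w x + (\<Sum>b\<in>S. Q b w x))"
    by (intro tensor_bdd_add) auto
  then show ?case
    using insert by (simp add: algebra_simps)
qed

text \<open>The inner product is a sum over the basis of tensor products of coordinates, each of
  modulus at most 1 on the unit box; hence the factor \<open>DIM('a)\<close>.\<close>

lemma tensor_bdd_inner:
  assumes "tensor_bdd K Q"
  shows "tensor_bdd (real DIM('a) * K) (\<lambda>w x. Q w x * complex_of_real (fst x \<bullet> snd x))"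
proof -
  have "tensor_bdd K (\<lambda>w x. Q w x * (complex_of_real (fst x \<bullet> b) * complex_of_real (snd x \<bullet> b)))"
    if "b \<in> Basis" for b :: 'a
    using that by (intro tensor_bdd_tensor_mult assms) (auto simp: mem_ubox)
  then have "tensor_bdd (real DIM('a) * K) (\<lambda>w x. \<Sum>b\<in>Basis. Q w x * (complex_of_real (fst x \<bullet> b) * complex_of_real (snd x \<bullet> b)))"
    by (intro tensor_bdd_sum) auto
  moreover have "(\<Sum>b\<in>Basis. Q w x * (complex_of_real (fst x \<bullet> b) * complex_of_real (snd x \<bullet> b))) =
      Q w x * complex_of_real (fst x \<bullet> snd x)" for w x
    by (subst euclidean_inner) (simp add: sum_distrib_left)
  ultimately show ?thesis by simp
qed

lemma tensor_bdd_inner_power: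
  assumes "tensor_bdd K Q"
  shows "tensor_bdd (real DIM('a) ^ n * K) (\<lambda>w x. Q w x * complex_of_real (fst x \<bullet> snd x) ^ n)"
proof (induction n)
  case 0
  then show ?case using assms by simp
next
  case (Suc n)
  from tensor_bdd_inner[OF this] show ?case
    by (simp add: mult_ac)
qed

lemma ubox_inner_bound: "x \<in> ubox \<Longrightarrow> \<bar>fst x \<bullet> snd x\<bar> \<le> real DIM('a)" for x :: "'a \<times> 'a"
proof -
  assume "x \<in> ubox"
  then have "\<bar>fst x \<bullet> b\<bar> * \<bar>snd x \<bullet> b\<bar> \<le> 1" if "b \<in> Basis" for b
    using that by (intro mult_le_one) (auto simp: mem_ubox_prod mem_ubox)
  then have "\<bar>\<Sum>b\<in>Basis. (fst x \<bullet> b) * (snd x \<bullet> b)\<bar> \<le> (\<Sum>b\<in>(Basis::'a set). 1)"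
    by (intro order_trans[OF sum_abs sum_mono]) (auto simp: abs_mult)
  then show ?thesis
    by (subst euclidean_inner) simp
qed

text \<open>The phase \<open>exp(- i a \<cdot> b)\<close> on the unit box is expanded in its power series.\<close>
lemma tensor_bdd_phase:
  assumes Q: "tensor_bdd K Q"
  shows "tensor_bdd (exp (real DIM('a)) * K) (\<lambda>w x. Q w x * cis (- (fst x \<bullet> snd x)))"
proof -
  define m where "m = real DIM('a)"
  have K: "0 \<le> K" using Q by (simp add: tensor_bdd_def)
  obtain B where B: "amplitude Q B" using Q by (auto simp: tensor_bdd_def)
  have B0: "0 \<le> B" using B by (simp add: amplitude_def)
  note [measurable] = amplitude_measurable_comp[OF B]
  define P where "P n x = (\<Sum>k<n. (- \<i>) ^ k / fact k * complex_of_real (fst x \<bullet> snd x) ^ k)" for n and x :: "'a \<times> 'a"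
  have Ppow: "P n x = (\<Sum>k<n. (- \<i> * complex_of_real (fst x \<bullet> snd x)) ^ k /\<^sub>R fact k)" for n x
    unfolding P_def by (intro sum.cong refl) (simp only: power_mult_distrib scaleR_conv_of_real of_real_inverse of_real_fact divide_inverse mult_ac)
  \<comment> \<open>The k-th term of the exponential series costs m^k / k!, so all partial sums
    share the constant exp m.\<close>
  have part: "tensor_bdd (exp m * K) (\<lambda>w x. Q w x * P n x)" for n
  proof -
    have "tensor_bdd ((\<Sum>k<n. m ^ k / fact k) * K) (\<lambda>w x. Q w x * P n x)"
    proof (induction n)
      case 0
      show ?case
        using tensor_bdd_const[of "\<lambda>_. 0" 0] by (simp add: P_def)
    next
      case (Suc n)
      have "tensor_bdd (cmod ((- \<i>) ^ n / fact n) * (m ^ n * K)) (\<lambda>w x. (- \<i>) ^ n / fact n * (Q w x * complex_of_real (fst x \<bullet> snd x) ^ n))"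
        unfolding m_def by (intro tensor_bdd_cmult tensor_bdd_inner_power Q)
      from tensor_bdd_add[OF Suc this] show ?case
        by (simp add: P_def norm_divide norm_power algebra_simps)
    qed
    moreover have "(\<Sum>k<n. m ^ k / fact k) \<le> exp m"
      using sum_le_suminf[OF summable_exp_generic[of m], of "{..<n}"]
      by (simp add: exp_def m_def divide_inverse mult.commute)
    ultimately show ?thesis
      using K by (auto intro: tensor_bdd_mono mult_right_mono)
  qed
  have Pb: "cmod (P n x) \<le> exp m" if "x \<in> ubox" for n x
  proof -
    have "cmod (P n x) \<le> (\<Sum>k<n. m ^ k / fact k)"
      unfolding P_def using ubox_inner_bound[OF that]
      by (intro sum_norm_le) (auto simp: norm_mult norm_divide norm_power m_def intro!: divide_right_mono power_mono)
    also have "\<dots> \<le> exp m"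
      using sum_le_suminf[OF summable_exp_generic[of m], of "{..<n}"]
      by (simp add: exp_def m_def divide_inverse mult.commute)
    finally show ?thesis .
  qed
  have cis_exp: "cis (- (fst x \<bullet> snd x)) = exp (- \<i> * complex_of_real (fst x \<bullet> snd x))" for x :: "'a \<times> 'a"
    by (simp add: cis_conv_exp)
  have Plim: "(\<lambda>n. P n x) \<longlonglongrightarrow> cis (- (fst x \<bullet> snd x))" for x :: "'a \<times> 'a"
    unfolding cis_exp Ppow using exp_converges[of "- \<i> * complex_of_real (fst x \<bullet> snd x)"] by (simp add: sums_def)
  have Pm [measurable]: "P n \<in> borel_measurable borel" for n
    unfolding P_def by (intro borel_measurable_continuous_onI continuous_intros)
  have "tensor_bdd (exp m * K) (\<lambda>w x. Q w x * cis (- (fst x \<bullet> snd x)))"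
  proof (rule tensor_bdd_limit[OF part, where B = "B * exp m"])
    show "amplitude (\<lambda>w x. Q w x * P n x) (B * exp m)" for n
      unfolding amplitude_def
    proof (intro conjI allI ballI)
      fix w x :: "'a \<times> 'a" assume x: "x \<in> ubox"
      show "cmod (Q w x * P n x) \<le> B * exp m"
        unfolding norm_mult using x B0 by (intro mult_mono amplitude_le[OF B] Pb) auto
    qed (use B0 in auto)
    show "amplitude (\<lambda>w x. Q w x * cis (- (fst x \<bullet> snd x))) (B * exp m)"
      unfolding amplitude_def
    proof (intro conjI allI ballI)
      fix w x :: "'a \<times> 'a" assume x: "x \<in> ubox"
      have "cmod (Q w x) * 1 \<le> B * exp m"
        using x B0 by (intro mult_mono amplitude_le[OF B]) (auto simp: m_def)
      then show "cmod (Q w x * cis (- (fst x \<bullet> snd x))) \<le> B * exp m"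
        by (simp add: norm_mult)
    qed (use B0 in auto)
    show "(\<lambda>n. Q w x * P n x) \<longlonglongrightarrow> Q w x * cis (- (fst x \<bullet> snd x))" for w x
      by (intro tendsto_intros Plim)
  qed
  then show ?thesis by (simp add: m_def)
qed

end

text \<open>Bounds on the mixed derivatives in which each direction of the list occurs at most once.\<close>
primrec bdd_mixed :: "real \<Rightarrow> 'e::euclidean_space list \<Rightarrow> ('e \<Rightarrow> complex) \<Rightarrow> bool" where
  "bdd_mixed M [] D \<longleftrightarrow> continuous_on UNIV D \<and> (\<forall>x. cmod (D x) \<le> M)"
| "bdd_mixed M (v # vs) D \<longleftrightarrow> bdd_mixed M vs D \<and>
     (\<exists>D'. (\<forall>x. ((\<lambda>s. D (x + s *\<^sub>R v)) has_vector_derivative D' x) (at 0)) \<and> bdd_mixed M vs D')"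

lemma bdd_mixed_continuous: "bdd_mixed M vs D \<Longrightarrow> continuous_on UNIV D"
  by (induction vs arbitrary: D) auto

lemma bdd_mixed_bound: "bdd_mixed M vs D \<Longrightarrow> cmod (D x) \<le> M"
  by (induction vs arbitrary: D) auto

lemma bdd_mixed_shift: "bdd_mixed M vs D \<Longrightarrow> bdd_mixed M vs (\<lambda>x. D (c + x))"
proof (induction vs arbitrary: D)
  case Nil
  then show ?case
    by (auto intro!: continuous_on_compose2[of UNIV D] continuous_intros)
next
  case (Cons v vs)
  then obtain D' where D': "\<And>x. ((\<lambda>s. D (x + s *\<^sub>R v)) has_vector_derivative D' x) (at 0)" "bdd_mixed M vs D'"
    by auto
  have "((\<lambda>s. D (c + (x + s *\<^sub>R v))) has_vector_derivative D' (c + x)) (at 0)" for x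
    using D'(1)[of "c + x"] by (simp add: add.assoc)
  then show ?case
    using Cons.prems Cons.IH[of D] Cons.IH[OF D'(2)] by (auto intro!: exI[of _ "\<lambda>x. D' (c + x)"])
qed

lemma directional_FTC:
  fixes D D' :: "'e::euclidean_space \<Rightarrow> complex"
  assumes "\<And>x. ((\<lambda>s. D (x + s *\<^sub>R v)) has_vector_derivative D' x) (at 0)"
    and cont: "continuous_on UNIV D'" and "0 \<le> t"
  shows "(LINT r|lborel. indicator {0..t} r *\<^sub>R D' (y + r *\<^sub>R v)) = D (y + t *\<^sub>R v) - D y"
proof -
  have c: "continuous_on {0..t} (\<lambda>r. D' (y + r *\<^sub>R v))"
    by (intro continuous_on_compose2[OF cont] continuous_intros) auto
  have d: "((\<lambda>s. D (y + s *\<^sub>R v)) has_vector_derivative D' (y + r *\<^sub>R v)) (at r within {0..t})" for r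
    by (rule has_vector_derivative_at_within[OF directional_derivative_shift[of D v D', OF assms(1)]])
  show ?thesis
    using integral_FTC_Icc[OF \<open>0 \<le> t\<close> d c] by simp
qed

text \<open>Projection onto the span of the listed directions. The expansion of an amplitude on the
  box lets the coordinates vary one after the other; when the list exhausts the basis, the
  projection is the identity.\<close>

definition coord_proj :: "'e::euclidean_space list \<Rightarrow> 'e \<Rightarrow> 'e" where
  "coord_proj vs x = (\<Sum>v\<leftarrow>vs. (x \<bullet> v) *\<^sub>R v)"

lemma coord_proj_simps [simp]:
  "coord_proj [] x = 0" "coord_proj (v # vs) x = (x \<bullet> v) *\<^sub>R v + coord_proj vs x"
  by (simp_all add: coord_proj_def)

lemma coord_proj_continuous: "continuous_on UNIV (coord_proj vs)"
proof (induction vs)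
  case (Cons v vs)
  have "continuous_on UNIV (\<lambda>x. (x \<bullet> v) *\<^sub>R v + coord_proj vs x)"
    by (intro continuous_intros Cons)
  then show ?case by (simp cong: continuous_on_cong)
qed (simp cong: continuous_on_cong)

lemma coord_proj_measurable [measurable]: "coord_proj vs \<in> borel_measurable borel"
  by (rule borel_measurable_continuous_onI[OF coord_proj_continuous])

lemma coord_proj_Basis: "distinct vs \<Longrightarrow> set vs = Basis \<Longrightarrow> coord_proj vs x = x"
  by (simp add: coord_proj_def sum_list_distinct_conv_sum_set euclidean_representation)

context L2_pair
begin

text \<open>By the fundamental theorem, switching on the coordinate along v adds the integral of D'
  over r from 0 to x . v. Written as an average over [0, 1], it carries the sharp cutoff r <= x . v,
  which depends on a single coordinate and is therefore a tensor factor. Value and derivative each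
  contribute the earlier bound, so every direction doubles the constant.\<close>

lemma tensor_bdd_mixed:
  assumes "bdd_mixed M vs D" "set vs \<subseteq> Basis"
  shows "tensor_bdd (2 ^ length vs * M) (\<lambda>w x. D (w + coord_proj vs x))"
  using assms
proof (induction vs arbitrary: D)
  case Nil
  then have [measurable]: "D \<in> borel_measurable borel"
    by (intro borel_measurable_continuous_onI) auto
  show ?case
    using Nil by (auto intro!: tensor_bdd_const)
next
  case (Cons v vs)
  then obtain D' where D': "\<And>x. ((\<lambda>s. D (x + s *\<^sub>R v)) has_vector_derivative D' x) (at 0)" "bdd_mixed M vs D'"
    and D: "bdd_mixed M vs D" and v: "v \<in> Basis" "set vs \<subseteq> Basis"
    by auto
  have cont: "continuous_on UNIV D" "continuous_on UNIV D'"
    using D D' by (auto intro: bdd_mixed_continuous)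
  then have [measurable]: "D \<in> borel_measurable borel" "D' \<in> borel_measurable borel"
    by (auto intro: borel_measurable_continuous_onI)
  have M0: "0 \<le> M" by (rule order_trans[OF norm_ge_zero bdd_mixed_bound[OF D, of 0]])
  \<comment> \<open>A basis vector of the product lies in one of the two factors. The cutoff is put
    on that factor, and the other one receives the constant 1.\<close>
  define \<alpha> where "\<alpha> r x = (if r \<le> x \<bullet> fst v \<or> fst v = 0 then 1 else 0 :: complex)" for r and x :: 'a
  define \<beta> where "\<beta> r x = (if r \<le> x \<bullet> snd v \<or> snd v = 0 then 1 else 0 :: complex)" for r and x :: 'a
  have ind: "\<alpha> r (fst x) * \<beta> r (snd x) = (if r \<le> x \<bullet> v then 1 else 0)" for r x
  proof -
    have "fst v = 0 \<and> snd v \<noteq> 0 \<or> fst v \<noteq> 0 \<and> snd v = 0"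
      using v by (auto simp: Basis_prod_def)
    then show ?thesis
      by (auto simp: \<alpha>_def \<beta>_def inner_prod_def)
  qed
  define Q where "Q r w x = D' (r *\<^sub>R v + (w + coord_proj vs x)) * (\<alpha> r (fst x) * \<beta> r (snd x))"
    for r :: real and w x :: "'a \<times> 'a"
  have Qm: "(\<lambda>p. Q (fst p) (fst (snd p)) (snd (snd p))) \<in> borel_measurable (borel :: (real \<times> ('a \<times> 'a) \<times> 'a \<times> 'a) measure)"
    unfolding Q_def ind by measurable
  have Qt: "tensor_bdd (2 ^ length vs * M) (Q r)" for r
  proof -
    have "tensor_bdd (2 ^ length vs * M) (\<lambda>w x. D' (r *\<^sub>R v + (w + coord_proj vs x)))"
      using Cons.IH[OF bdd_mixed_shift[OF D'(2)] v(2)] .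
    then show ?thesis
      unfolding Q_def by (rule tensor_bdd_tensor_mult) (auto simp: \<alpha>_def \<beta>_def)
  qed
  have Qb: "amplitude (Q r) M" for r
    unfolding amplitude_def
  proof (intro conjI allI ballI M0)
    show "(\<lambda>p. Q r (fst p) (snd p)) \<in> borel_measurable borel"
      unfolding Q_def ind by measurable
    show "cmod (Q r w x) \<le> M" for w x
      using bdd_mixed_bound[OF D'(2)] M0 by (auto simp: Q_def ind)
  qed
  have "tensor_bdd (2 ^ length vs * M + 2 ^ length vs * M)
      (\<lambda>w x. D (w + coord_proj vs x) + (LINT r|lborel. indicator {0..1} r *\<^sub>R Q r w x))"
    by (intro tensor_bdd_add Cons.IH D v tensor_bdd_average[OF Qm Qb Qt])
  then show ?case
  proof (rule tensor_bdd_cong[OF tensor_bdd_mono])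
    show "2 ^ length vs * M + 2 ^ length vs * M \<le> 2 ^ length (v # vs) * M" by simp
    show "(\<lambda>p. D (fst p + coord_proj (v # vs) (snd p))) \<in> borel_measurable borel" by measurable
    fix w x :: "'a \<times> 'a" assume x: "x \<in> ubox"
    then have t: "0 \<le> x \<bullet> v" "x \<bullet> v \<le> 1" using v by (auto simp: mem_ubox)
    have "(LINT r|lborel. indicator {0..1} r *\<^sub>R Q r w x) =
        (LINT r|lborel. indicator {0..x \<bullet> v} r *\<^sub>R D' (w + coord_proj vs x + r *\<^sub>R v))"
      using t by (intro Bochner_Integration.integral_cong) (auto simp: Q_def ind indicator_def add_ac)
    also have "\<dots> = D (w + coord_proj vs x + (x \<bullet> v) *\<^sub>R v) - D (w + coord_proj vs x)"
      by (rule directional_FTC[OF D'(1) cont(2) t(1)])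
    finally show "D (w + coord_proj (v # vs) x) =
       D (w + coord_proj vs x) + (LINT r|lborel. indicator {0..1} r *\<^sub>R Q r w x)"
      by (simp add: add_ac)
  qed
qed

text \<open>The form is averaged over all boxes, each z being covered with total weight 1. For z =
  (\<open>\<xi>\<close>, y) and w = (\<open>\<eta>\<close>, s) one has \<open>\<xi>\<close> . y = s
  . \<open>\<xi>\<close> + \<open>\<eta>\<close> . y - \<open>\<eta>\<close> . s +
  (\<open>\<xi>\<close> - \<open>\<eta>\<close>) . (y - s): two linear phases, which the windowed
  transforms accept, a unimodular constant, and a phase relative to the box, which
  \<open>tensor_bdd_phase\<close> absorbs into the amplitude.\<close>

lemma bilinear_bound:
  assumes q: "bdd_mixed M vs q" and vs: "distinct vs" "set vs = Basis"
  shows "cmod (LINT z|lborel. cis (- (fst z \<bullet> snd z)) * q z * (h (fst z) * f (snd z)))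
    \<le> exp (real DIM('a)) * (2 ^ (2 * DIM('a)) * M) * N"
proof -
  define K where "K = exp (real DIM('a)) * (2 ^ (2 * DIM('a)) * M)"
  have [measurable]: "q \<in> borel_measurable borel"
    using bdd_mixed_continuous[OF q] by (rule borel_measurable_continuous_onI)
  have M: "cmod (q x) \<le> M" for x by (rule bdd_mixed_bound[OF q])
  have len: "length vs = 2 * DIM('a)"
    using distinct_card[OF vs(1)] vs(2) by simp
  define Q where "Q w x = q (w + x) * cis (- (fst x \<bullet> snd x))" for w x
  have "tensor_bdd (2 ^ length vs * M) (\<lambda>w x. q (w + coord_proj vs x))"
    by (rule tensor_bdd_mixed[OF q]) (simp add: vs)
  from tensor_bdd_phase[OF this] have Q: "tensor_bdd K Q"
    by (simp add: K_def Q_def[abs_def] coord_proj_Basis[OF vs] len)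
  have K0: "0 \<le> K" using Q by (simp add: tensor_bdd_def)
  define a where "a = (indicator ubox :: 'a \<Rightarrow> complex)"
  have a: "unit_mult a"
    by (auto simp: unit_mult_def a_def indicator_def)
  define G where "G z = cis (- (fst z \<bullet> snd z)) * q z * (h (fst z) * f (snd z))" for z
  have Gm [measurable]: "G \<in> borel_measurable borel" unfolding G_def[abs_def] by measurable
  have Gi: "integrable lborel G"
  proof (rule Bochner_Integration.integrable_bound)
    show "integrable lborel (\<lambda>z. M * cmod (h (fst z) * f (snd z)))"
      by (intro integrable_mult_right integrable_norm hf_integrable)
    have "0 \<le> M" by (rule order_trans[OF norm_ge_zero M])
    then show "AE z in lborel. norm (G z) \<le> norm (M * cmod (h (fst z) * f (snd z)))"
      using M by (auto simp: G_def norm_mult intro!: mult_right_mono)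
  qed measurable
  define F where "F = (\<lambda>(z, w). indicator ubox (z - w) * G z)"
  have sh: "cis (fst w \<bullet> snd w) * loc_form Q a a w = (LINT z|lborel. F (z, w))" for w
  proof -
    have "cis (fst w \<bullet> snd w) * (cis (- (snd w \<bullet> fst z)) * cis (- (fst w \<bullet> snd z)) * Q w (z - w) *
     (a (fst z - fst w) * a (snd z - snd w)) * (h (fst z) * f (snd z))) = F (z, w)" for z
    proof -
      have A: "a (fst z - fst w) * a (snd z - snd w) = indicator ubox (z - w)"
        by (auto simp: a_def indicator_def mem_ubox_prod)
      have P: "cis (fst w \<bullet> snd w) * (cis (- (snd w \<bullet> fst z)) * cis (- (fst w \<bullet> snd z)) * cis (- (fst (z - w) \<bullet> snd (z - w))))
         = cis (- (fst z \<bullet> snd z))"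
        unfolding cis_mult by (rule arg_cong[of _ _ cis]) (simp add: inner_diff_left inner_diff_right inner_commute)
      have regroup: "c * (c1 * c2 * (q' * c3) * A * H) = (c * (c1 * c2 * c3)) * q' * A * H" for c c1 c2 q' c3 A H :: complex
        by (simp only: mult_ac)
      show ?thesis
        unfolding F_def G_def Q_def regroup A P by simp
    qed
    then show ?thesis
      unfolding loc_form_def by (subst integral_mult_right_zero[symmetric]) (intro Bochner_Integration.integral_cong refl)
  qed
  have Fi: "integrable lborel F"
  proof -
    have u: "(\<integral>\<^sup>+w. indicator ubox (z - w) \<partial>lborel) = (1 :: ennreal)" for z :: "'a \<times> 'a"
      by (subst nn_integral_lborel_shift(3)) (simp_all add: emeasure_ubox)
    have "(\<integral>\<^sup>+p. ennreal (norm (F p)) \<partial>lborel) = (\<integral>\<^sup>+z. \<integral>\<^sup>+w. ennreal (norm (F (z, w))) \<partial>lborel \<partial>lborel)"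
      by (subst lborel_Tonelli(1)) (simp_all add: F_def split_beta')
    also have "\<dots> = (\<integral>\<^sup>+z. \<integral>\<^sup>+w. indicator ubox (z - w) * ennreal (norm (G z)) \<partial>lborel \<partial>lborel)"
      by (intro nn_integral_cong) (auto simp: F_def indicator_def)
    also have "\<dots> = (\<integral>\<^sup>+z. ennreal (norm (G z)) \<partial>lborel)"
      by (simp add: nn_integral_multc u)
    also have "\<dots> < \<infinity>"
      using Gi by (simp add: integrable_iff_bounded)
    finally show ?thesis
      by (intro integrableI_bounded) (simp_all add: F_def split_beta')
  qed
  have "(LINT w|lborel. F (z, w)) = G z" for z
  proof -
    have "integrable lborel (indicator ubox :: 'a \<times> 'a \<Rightarrow> real)"
      by (intro integrable_real_indicator) (simp_all add: emeasure_ubox)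
    from integral_lborel_shift(3)[OF this, of z]
    have "(LINT w|lborel. indicator ubox (z - w)) = (1 :: real)"
      by (simp add: measure_def emeasure_ubox)
    then have "complex_of_real (LINT w|lborel. indicator ubox (z - w)) = 1" by simp
    then have "(LINT w|lborel. complex_of_real (indicator ubox (z - w))) = 1"
      by (simp only: integral_complex_of_real)
    moreover have "complex_of_real (indicator ubox (z - w)) = indicator ubox (z - w)" for w
      by (auto simp: indicator_def)
    ultimately show ?thesis by (simp add: F_def)
  qed
  then have "integral\<^sup>L lborel G = (LINT w|lborel. LINT z|lborel. F (z, w))"
    using lborel_Fubini[OF Fi] by simp
  also have "\<dots> = (LINT w|lborel. cis (fst w \<bullet> snd w) * loc_form Q a a w)"
    by (simp only: sh)
  finally have eq: "integral\<^sup>L lborel G = (LINT w|lborel. cis (fst w \<bullet> snd w) * loc_form Q a a w)" .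
  have "ennreal (cmod (integral\<^sup>L lborel G)) \<le> (\<integral>\<^sup>+w. ennreal (cmod (cis (fst w \<bullet> snd w) * loc_form Q a a w)) \<partial>lborel)"
    unfolding eq
  proof (cases "integrable lborel (\<lambda>w. cis (fst w \<bullet> snd w) * loc_form Q a a w)")
    case True
    then show "ennreal (cmod (LINT w|lborel. cis (fst w \<bullet> snd w) * loc_form Q a a w)) \<le>
      (\<integral>\<^sup>+w. ennreal (cmod (cis (fst w \<bullet> snd w) * loc_form Q a a w)) \<partial>lborel)"
      by (rule integral_norm_bound_ennreal)
  qed (simp add: not_integrable_integral_eq)
  also have "\<dots> \<le> ennreal (K * N)"
    using Q a by (simp add: tensor_bdd_def norm_mult)
  finally show ?thesis
    using K0 N by (simp add: G_def[abs_def] K_def)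
qed

end

section \<open>Calderon-Vaillancourt in bilinear and in operator form\<close>

definition L2norm :: "('a::euclidean_space \<Rightarrow> complex) \<Rightarrow> real" where
  "L2norm f = sqrt (LINT x|lborel. (cmod (f x))\<^sup>2)"

lemma L2sq_eq_L2norm:
  assumes "integrable lborel (\<lambda>x. (cmod (f x))\<^sup>2)"
  shows "L2sq f = ennreal ((L2norm f)\<^sup>2)"
  unfolding L2sq_def L2norm_def using nn_integral_eq_integral[OF assms] by simp

text \<open>Here exp m is the cost of expanding the phase, 2^(2m) that of one integration in each of
  the 2m directions, and (2 pi)^m collects the two Plancherel constants after
  Cauchy-Schwarz.\<close>

definition CV_const :: "nat \<Rightarrow> real" where
  "CV_const m = exp (real m) * 2 ^ (2 * m) * (2 * pi) ^ m"

theorem Calderon_Vaillancourt_bilinear: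
  fixes q :: "'a::euclidean_space \<times> 'a \<Rightarrow> complex"
  assumes q: "bdd_mixed M vs q" and vs: "distinct vs" "set vs = Basis"
    and h: "integrable lborel h" "integrable lborel (\<lambda>x. (cmod (h x))\<^sup>2)"
    and f: "integrable lborel f" "integrable lborel (\<lambda>x. (cmod (f x))\<^sup>2)"
  shows "cmod (LINT z|lborel. cis (- (fst z \<bullet> snd z)) * q z * (h (fst z) * f (snd z)))
    \<le> CV_const DIM('a) * M * L2norm h * L2norm f"
proof -
  interpret L2_pair h f "(2 * pi) ^ DIM('a) * L2norm h * L2norm f"
  proof
    show "ennreal ((2 * pi) ^ DIM('a)) * L2sq h * (ennreal ((2 * pi) ^ DIM('a)) * L2sq f)
      \<le> ennreal (((2 * pi) ^ DIM('a) * L2norm h * L2norm f)\<^sup>2)"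
      unfolding L2sq_eq_L2norm[OF h(2)] L2sq_eq_L2norm[OF f(2)]
      by (subst ennreal_mult[symmetric], simp, simp)+ (simp add: power_mult_distrib power2_eq_square mult_ac)
  qed (use h f in \<open>auto simp: L2norm_def\<close>)
  show ?thesis
    using bilinear_bound[OF q vs] by (simp add: CV_const_def mult_ac)
qed

text \<open>Integrability of f bounds the transform uniformly, which supplies the local boundedness
  for \<open>L2sq_le_by_duality\<close>. The bilinear bound is then applied to bounded test
  functions of bounded support, which are integrable and square integrable.\<close>

theorem Calderon_Vaillancourt:
  fixes q :: "'a::euclidean_space \<times> 'a \<Rightarrow> complex"
  assumes q: "bdd_mixed M vs q" and vs: "distinct vs" "set vs = Basis"
    and f: "integrable lborel f" "integrable lborel (\<lambda>x. (cmod (f x))\<^sup>2)"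
  shows "L2sq (\<lambda>\<xi>. LINT y|lborel. cis (- (\<xi> \<bullet> y)) * q (\<xi>, y) * f y) \<le> ennreal ((CV_const DIM('a) * M)\<^sup>2) * L2sq f"
proof -
  define v where "v \<xi> = (LINT y|lborel. cis (- (\<xi> \<bullet> y)) * q (\<xi>, y) * f y)" for \<xi>
  have [measurable]: "q \<in> borel_measurable borel" "f \<in> borel_measurable borel"
    using bdd_mixed_continuous[OF q] f by (auto intro: borel_measurable_continuous_onI borel_measurable_integrable)
  have vm [measurable]: "v \<in> borel_measurable borel"
    unfolding v_def[abs_def] by measurable
  have M: "cmod (q x) \<le> M" for x by (rule bdd_mixed_bound[OF q])
  have M0: "0 \<le> M" by (rule order_trans[OF norm_ge_zero M])
  have bd: "cmod (v \<xi>) \<le> (LINT y|lborel. M * cmod (f y))" for \<xi>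
    unfolding v_def
  proof (rule Bochner_Integration.integral_norm_bound_integral)
    show i: "integrable lborel (\<lambda>y. M * cmod (f y))"
      by (intro integrable_mult_right integrable_norm f)
    show "integrable lborel (\<lambda>y. cis (- (\<xi> \<bullet> y)) * q (\<xi>, y) * f y)"
      by (rule Bochner_Integration.integrable_bound[OF i])
        (use M M0 in \<open>auto simp: norm_mult intro!: mult_right_mono\<close>)
    show "norm (cis (- (\<xi> \<bullet> y)) * q (\<xi>, y) * f y) \<le> M * cmod (f y)" for y
      using M by (auto simp: norm_mult intro!: mult_right_mono)
  qed
  have "L2sq v \<le> ennreal ((CV_const DIM('a) * M)\<^sup>2 * (L2norm f)\<^sup>2)"
  proof (rule L2sq_le_by_duality[OF vm])
    show "\<exists>B. \<forall>x. norm x \<le> R \<longrightarrow> cmod (v x) \<le> B" for R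
      using bd by blast
    fix g :: "'a \<Rightarrow> complex" and R B :: real
    assume gm [measurable]: "g \<in> borel_measurable borel" and g0: "\<And>x. R < norm x \<Longrightarrow> g x = 0"
      and gB: "\<And>x. cmod (g x) \<le> B"
    have B0: "0 \<le> B" by (rule order_trans[OF norm_ge_zero gB])
    have ci: "integrable lborel (\<lambda>x. c * indicator (cball (0::'a) R) x)" for c :: real
      using emeasure_lborel_cball_finite[of "0::'a" R] by (intro integrable_mult_right integrable_real_indicator) auto
    have gi: "integrable lborel g"
      by (rule Bochner_Integration.integrable_bound[OF ci[of B]]) (use gB g0 B0 in \<open>auto simp: indicator_def\<close>)
    have gi2: "integrable lborel (\<lambda>x. (cmod (g x))\<^sup>2)"
      by (rule Bochner_Integration.integrable_bound[OF ci[of "B\<^sup>2"]])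
        (use gB g0 B0 in \<open>auto simp: indicator_def intro!: power_mono\<close>)
    define F where "F z = cis (- (fst z \<bullet> snd z)) * q z * (g (fst z) * f (snd z))" for z
    have Fi: "integrable lborel F"
    proof (rule lborel_integrable_prod_bound)
      show "integrable lborel (\<lambda>x. M * cmod (g x))" "integrable lborel (\<lambda>x. cmod (f x))"
        using gi f by auto
      show "cmod (F (x, y)) \<le> M * cmod (g x) * cmod (f y)" for x y
        using mult_right_mono[OF M, of "cmod (g x) * cmod (f y)" "(x, y)"] by (simp add: F_def norm_mult mult_ac)
    qed (simp add: F_def[abs_def])
    have "(LINT x|lborel. v x * g x) = integral\<^sup>L lborel F"
      by (subst lborel_Fubini(1)[OF Fi, symmetric])
        (simp add: F_def v_def mult_ac flip: integral_mult_left_zero integral_mult_right_zero)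
    also have "cmod \<dots> \<le> CV_const DIM('a) * M * L2norm g * L2norm f"
      unfolding F_def[abs_def] by (rule Calderon_Vaillancourt_bilinear[OF q vs gi gi2 f])
    finally have "(cmod (LINT x|lborel. v x * g x))\<^sup>2 \<le> (CV_const DIM('a) * M * L2norm g * L2norm f)\<^sup>2"
      by (intro power_mono) auto
    also have "\<dots> = (CV_const DIM('a) * M)\<^sup>2 * (L2norm f)\<^sup>2 * (LINT x|lborel. (cmod (g x))\<^sup>2)"
      by (simp add: power_mult_distrib L2norm_def mult_ac)
    finally show "(cmod (LINT x|lborel. v x * g x))\<^sup>2 \<le> (CV_const DIM('a) * M)\<^sup>2 * (L2norm f)\<^sup>2 * (LINT x|lborel. (cmod (g x))\<^sup>2)" .
  qed simp
  then show ?thesis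
    unfolding L2sq_eq_L2norm[OF f(2)] by (simp add: v_def[abs_def] ennreal_mult)
qed

subsection \<open>Symbol classes\<close>

text \<open>The constant is chosen before the index, so all estimates are uniform over the family.
  Continuity is included for the fundamental theorem and for measurability.\<close>

definition sym0 :: "'e::euclidean_space set \<Rightarrow> ('i \<Rightarrow> 'e \<Rightarrow> real) \<Rightarrow> ('i \<Rightarrow> 'e \<Rightarrow> 'b::real_normed_vector) \<Rightarrow> bool" where
  "sym0 \<Omega> \<mu> a \<longleftrightarrow> (\<forall>i. continuous_on \<Omega> (a i)) \<and> (\<exists>C\<ge>0. \<forall>i. \<forall>z\<in>\<Omega>. norm (a i z) \<le> C * \<mu> i z)"

text \<open>Families indexed by a parameter \<open>i\<close> whose derivatives up to order \<open>n\<close> on \<open>\<Omega>\<close> are all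
  bounded by the weight \<open>\<mu>\<close>, uniformly in \<open>i\<close>; differentiation gains nothing.\<close>
primrec symn :: "nat \<Rightarrow> 'e::euclidean_space set \<Rightarrow> ('i \<Rightarrow> 'e \<Rightarrow> real) \<Rightarrow> ('i \<Rightarrow> 'e \<Rightarrow> 'b::real_normed_vector) \<Rightarrow> bool" where
  "symn 0 \<Omega> \<mu> a \<longleftrightarrow> sym0 \<Omega> \<mu> a"
| "symn (Suc n) \<Omega> \<mu> a \<longleftrightarrow> sym0 \<Omega> \<mu> a \<and>
     (\<forall>v\<in>Basis. \<exists>a'. (\<forall>i. \<forall>z\<in>\<Omega>. ((\<lambda>s. a i (z + s *\<^sub>R v)) has_vector_derivative a' i z) (at 0)) \<and> symn n \<Omega> \<mu> a')"

lemma sym_imp_sym0: "symn n \<Omega> \<mu> a \<Longrightarrow> sym0 \<Omega> \<mu> a"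
  by (cases n) auto

lemma sym_SucE:
  assumes "symn (Suc n) \<Omega> \<mu> a" and "v \<in> Basis"
  obtains a' where "\<And>i z. z \<in> \<Omega> \<Longrightarrow> ((\<lambda>s. a i (z + s *\<^sub>R v)) has_vector_derivative a' i z) (at 0)" "symn n \<Omega> \<mu> a'"
proof -
  obtain a' where "(\<forall>i. \<forall>z\<in>\<Omega>. ((\<lambda>s. a i (z + s *\<^sub>R v)) has_vector_derivative a' i z) (at 0)) \<and> symn n \<Omega> \<mu> a'"
    using assms(1)[THEN iffD1[OF symn.simps(2)], THEN conjunct2, THEN bspec, OF assms(2)] ..
  then show thesis by (intro that[of a']) auto
qed

lemma sym_SucI:
  assumes "sym0 \<Omega> \<mu> a"
    and "\<And>v. v \<in> Basis \<Longrightarrow> \<exists>a'. (\<forall>i. \<forall>z\<in>\<Omega>. ((\<lambda>s. a i (z + s *\<^sub>R v)) has_vector_derivative a' i z) (at 0)) \<and> symn n \<Omega> \<mu> a'"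
  shows "symn (Suc n) \<Omega> \<mu> a"
  by (rule iffD2[OF symn.simps(2)]) (use assms in \<open>intro conjI ballI\<close>)

lemma sym_SucD: "symn (Suc n) \<Omega> \<mu> a \<Longrightarrow> symn n \<Omega> \<mu> a"
proof (induction n arbitrary: a)
  case 0
  from sym_imp_sym0[OF this] show ?case by (simp only: symn.simps(1))
next
  case (Suc n)
  show ?case
  proof (rule sym_SucI[OF sym_imp_sym0[OF Suc.prems]])
    fix v :: 'a assume "v \<in> Basis"
    from sym_SucE[OF Suc.prems this] obtain a' where
      a': "\<And>i z. z \<in> \<Omega> \<Longrightarrow> ((\<lambda>s. a i (z + s *\<^sub>R v)) has_vector_derivative a' i z) (at 0)" "symn (Suc n) \<Omega> \<mu> a'"
      by metis
    show "\<exists>a'. (\<forall>i. \<forall>z\<in>\<Omega>. ((\<lambda>s. a i (z + s *\<^sub>R v)) has_vector_derivative a' i z) (at 0)) \<and> symn n \<Omega> \<mu> a'"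
      by (intro exI[of _ a'] conjI allI ballI a'(1) Suc.IH a'(2))
  qed
qed

lemma directional_derivative_cong:
  fixes f g :: "'e::euclidean_space \<Rightarrow> 'b::real_normed_vector"
  assumes "open U" "z \<in> U" "\<And>z. z \<in> U \<Longrightarrow> f z = g z"
    and "((\<lambda>s. f (z + s *\<^sub>R v)) has_vector_derivative d) (at 0)"
  shows "((\<lambda>s. g (z + s *\<^sub>R v)) has_vector_derivative d) (at 0)"
proof (rule has_vector_derivative_transform_within_open[OF assms(4)])
  show "open ((\<lambda>s. z + s *\<^sub>R v) -` U)"
    by (intro open_vimage assms continuous_intros)
qed (use assms in auto)

lemma sym0_cong:
  assumes "sym0 \<Omega> \<mu> a" "\<And>i z. z \<in> \<Omega> \<Longrightarrow> a i z = b i z"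
  shows "sym0 \<Omega> \<mu> b"
  using assms unfolding sym0_def by (metis continuous_on_cong)

lemma sym_cong:
  assumes "symn n \<Omega> \<mu> a" "open \<Omega>" "\<And>i z. z \<in> \<Omega> \<Longrightarrow> a i z = b i z"
  shows "symn n \<Omega> \<mu> b"
proof (cases n)
  case 0
  then show ?thesis using sym0_cong[OF _ assms(3)] assms(1) by simp
next
  case (Suc m)
  show ?thesis
    unfolding Suc
  proof (rule sym_SucI)
    show "sym0 \<Omega> \<mu> b"
      by (rule sym0_cong[OF sym_imp_sym0[OF assms(1)] assms(3)])
    fix v :: 'a assume v: "v \<in> Basis"
    obtain a' where a': "\<And>i z. z \<in> \<Omega> \<Longrightarrow> ((\<lambda>s. a i (z + s *\<^sub>R v)) has_vector_derivative a' i z) (at 0)" "symn m \<Omega> \<mu> a'"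
      by (rule sym_SucE[OF assms(1)[unfolded Suc] v], rule that)
    have "((\<lambda>s. b i (z + s *\<^sub>R v)) has_vector_derivative a' i z) (at 0)" if "z \<in> \<Omega>" for i z
      by (rule directional_derivative_cong[OF assms(2) that assms(3) a'(1)[OF that]])
    then show "\<exists>b'. (\<forall>i. \<forall>z\<in>\<Omega>. ((\<lambda>s. b i (z + s *\<^sub>R v)) has_vector_derivative b' i z) (at 0)) \<and> symn m \<Omega> \<mu> b'"
      using a' by blast
  qed
qed

lemma sym_weaken:
  fixes a :: "'i \<Rightarrow> 'e::euclidean_space \<Rightarrow> 'b::real_normed_vector"
  assumes "symn n \<Omega> \<mu> a" "\<And>i z. z \<in> \<Omega>' \<Longrightarrow> \<mu> i z \<le> c * \<nu> i z" "0 \<le> c" "\<Omega>' \<subseteq> \<Omega>"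
  shows "symn n \<Omega>' \<nu> a"
  using assms(1)
proof (induction n arbitrary: a)
  have s0: "sym0 \<Omega>' \<nu> a" if a: "sym0 \<Omega> \<mu> a" for a :: "'i \<Rightarrow> 'e \<Rightarrow> 'b"
  proof -
    obtain C where C: "C \<ge> 0" "\<And>i z. z \<in> \<Omega> \<Longrightarrow> norm (a i z) \<le> C * \<mu> i z"
      using a by (auto simp: sym0_def)
    have "norm (a i z) \<le> (C * c) * \<nu> i z" if "z \<in> \<Omega>'" for i z
      using C(2)[of z i] mult_left_mono[OF assms(2)[OF that, of i] C(1)] that assms(4) by (auto simp: mult.assoc)
    moreover have "0 \<le> C * c" using C assms by simp
    ultimately show ?thesis
      using a assms(4) unfolding sym0_def by (meson continuous_on_subset)
  qed
  {
    case 0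
    then show ?case using s0 by simp
  next
    case (Suc n)
    show ?case
    proof (rule sym_SucI)
      show "sym0 \<Omega>' \<nu> a" by (rule s0[OF sym_imp_sym0[OF Suc.prems(1)]])
      fix v :: 'e assume v: "v \<in> Basis"
      obtain a' where "\<And>i z. z \<in> \<Omega> \<Longrightarrow> ((\<lambda>s. a i (z + s *\<^sub>R v)) has_vector_derivative a' i z) (at 0)" "symn n \<Omega> \<mu> a'"
        by (rule sym_SucE[OF Suc.prems(1) v], rule that)
      then show "\<exists>a'. (\<forall>i. \<forall>z\<in>\<Omega>'. ((\<lambda>s. a i (z + s *\<^sub>R v)) has_vector_derivative a' i z) (at 0)) \<and> symn n \<Omega>' \<nu> a'"
        using Suc.IH assms(4) by blast
    qed
  }
qed

lemma sym_subset: "symn n \<Omega> \<mu> a \<Longrightarrow> \<Omega>' \<subseteq> \<Omega> \<Longrightarrow> symn n \<Omega>' \<mu> a"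
  by (rule sym_weaken[where c = 1]) auto

lemma sym_bounded_linear:
  fixes a :: "'i \<Rightarrow> 'e::euclidean_space \<Rightarrow> 'b::real_normed_vector"
  assumes L: "bounded_linear L" and a: "symn n \<Omega> \<mu> a"
  shows "symn n \<Omega> \<mu> (\<lambda>i z. L (a i z))"
  using a
proof (induction n arbitrary: a)
  have s0: "sym0 \<Omega> \<mu> (\<lambda>i z. L (a i z))" if a: "sym0 \<Omega> \<mu> a" for a :: "'i \<Rightarrow> 'e \<Rightarrow> 'b"
  proof -
    obtain C where C: "C \<ge> 0" "\<And>i z. z \<in> \<Omega> \<Longrightarrow> norm (a i z) \<le> C * \<mu> i z"
      using a by (auto simp: sym0_def)
    obtain K where K: "K > 0" "\<And>x. norm (L x) \<le> norm x * K"
      using bounded_linear.pos_bounded[OF L] by blast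
    have "norm (L (a i z)) \<le> (C * K) * \<mu> i z" if "z \<in> \<Omega>" for i z
      using order_trans[OF K(2)[of "a i z"] mult_right_mono[OF C(2)[OF that, of i], of K]] K(1) by (simp add: mult_ac)
    moreover have "0 \<le> C * K" using C K by simp
    ultimately show ?thesis
      using a bounded_linear.continuous_on[OF L] unfolding sym0_def by blast
  qed
  {
    case 0
    then show ?case using s0 by simp
  next
    case (Suc n)
    show ?case
    proof (rule sym_SucI)
      show "sym0 \<Omega> \<mu> (\<lambda>i z. L (a i z))" by (rule s0[OF sym_imp_sym0[OF Suc.prems(1)]])
      fix v :: 'e assume v: "v \<in> Basis"
      obtain a' where a': "\<And>i z. z \<in> \<Omega> \<Longrightarrow> ((\<lambda>s. a i (z + s *\<^sub>R v)) has_vector_derivative a' i z) (at 0)" "symn n \<Omega> \<mu> a'"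
        by (rule sym_SucE[OF Suc.prems(1) v], rule that)
      then show "\<exists>a'. (\<forall>i. \<forall>z\<in>\<Omega>. ((\<lambda>s. L (a i (z + s *\<^sub>R v))) has_vector_derivative a' i z) (at 0)) \<and> symn n \<Omega> \<mu> a'"
        by (intro exI[of _ "\<lambda>i z. L (a' i z)"] conjI allI ballI Suc.IH[OF a'(2)] bounded_linear.has_vector_derivative[OF L a'(1)])
    qed
  }
qed

lemma sym_add:
  fixes a b :: "'i \<Rightarrow> 'e::euclidean_space \<Rightarrow> 'b::real_normed_vector"
  assumes "symn n \<Omega> \<mu> a" "symn n \<Omega> \<mu> b"
  shows "symn n \<Omega> \<mu> (\<lambda>i z. a i z + b i z)"
  using assms
proof (induction n arbitrary: a b)
  have s0: "sym0 \<Omega> \<mu> (\<lambda>i z. a i z + b i z)" if a: "sym0 \<Omega> \<mu> a" and b: "sym0 \<Omega> \<mu> b" for a b :: "'i \<Rightarrow> 'e \<Rightarrow> 'b"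
  proof -
    obtain C where C: "C \<ge> 0" "\<And>i z. z \<in> \<Omega> \<Longrightarrow> norm (a i z) \<le> C * \<mu> i z"
      using a by (auto simp: sym0_def)
    obtain D where D: "D \<ge> 0" "\<And>i z. z \<in> \<Omega> \<Longrightarrow> norm (b i z) \<le> D * \<mu> i z"
      using b by (auto simp: sym0_def)
    have "norm (a i z + b i z) \<le> (C + D) * \<mu> i z" if "z \<in> \<Omega>" for i z
      using C(2)[OF that, of i] D(2)[OF that, of i] by (intro norm_triangle_le) (simp add: distrib_right)
    moreover have "0 \<le> C + D" using C D by simp
    ultimately show ?thesis
      using a b continuous_on_add unfolding sym0_def by blast
  qed
  {
    case 0
    then show ?case using s0 by simp
  next
    case (Suc n)
    show ?case
    proof (rule sym_SucI)
      show "sym0 \<Omega> \<mu> (\<lambda>i z. a i z + b i z)" by (rule s0[OF sym_imp_sym0[OF Suc.prems(1)] sym_imp_sym0[OF Suc.prems(2)]])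
      fix v :: 'e assume v: "v \<in> Basis"
      obtain a' where a': "\<And>i z. z \<in> \<Omega> \<Longrightarrow> ((\<lambda>s. a i (z + s *\<^sub>R v)) has_vector_derivative a' i z) (at 0)" "symn n \<Omega> \<mu> a'"
        by (rule sym_SucE[OF Suc.prems(1) v], rule that)
      obtain b' where b': "\<And>i z. z \<in> \<Omega> \<Longrightarrow> ((\<lambda>s. b i (z + s *\<^sub>R v)) has_vector_derivative b' i z) (at 0)" "symn n \<Omega> \<mu> b'"
        by (rule sym_SucE[OF Suc.prems(2) v], rule that)
      show "\<exists>a'. (\<forall>i. \<forall>z\<in>\<Omega>. ((\<lambda>s. a i (z + s *\<^sub>R v) + b i (z + s *\<^sub>R v)) has_vector_derivative a' i z) (at 0)) \<and> symn n \<Omega> \<mu> a'"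
        by (intro exI[of _ "\<lambda>i z. a' i z + b' i z"] conjI allI ballI Suc.IH[OF a'(2) b'(2)] has_vector_derivative_add a'(1) b'(1))
    qed
  }
qed

text \<open>The product rule closes up because a derivative has the same weight as the function
  itself: both of its terms are again products of weight \<open>\<mu>\<close> times
  \<open>\<nu>\<close>.\<close>

lemma sym_mult:
  fixes a b :: "'i \<Rightarrow> 'e::euclidean_space \<Rightarrow> 'b::real_normed_algebra"
  assumes "symn n \<Omega> \<mu> a" "symn n \<Omega> \<nu> b"
  shows "symn n \<Omega> (\<lambda>i z. \<mu> i z * \<nu> i z) (\<lambda>i z. a i z * b i z)"
  using assms
proof (induction n arbitrary: a b)
  have s0: "sym0 \<Omega> (\<lambda>i z. \<mu> i z * \<nu> i z) (\<lambda>i z. a i z * b i z)"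
    if a: "sym0 \<Omega> \<mu> a" and b: "sym0 \<Omega> \<nu> b" for a b :: "'i \<Rightarrow> 'e \<Rightarrow> 'b"
  proof -
    obtain C where C: "C \<ge> 0" "\<And>i z. z \<in> \<Omega> \<Longrightarrow> norm (a i z) \<le> C * \<mu> i z"
      using a by (auto simp: sym0_def)
    obtain D where D: "D \<ge> 0" "\<And>i z. z \<in> \<Omega> \<Longrightarrow> norm (b i z) \<le> D * \<nu> i z"
      using b by (auto simp: sym0_def)
    have "norm (a i z * b i z) \<le> (C * D) * (\<mu> i z * \<nu> i z)" if "z \<in> \<Omega>" for i z
      using order_trans[OF norm_mult_ineq mult_mono'[OF C(2)[OF that, of i] D(2)[OF that, of i]]] by (simp add: mult_ac)
    moreover have "0 \<le> C * D" using C D by simp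
    ultimately show ?thesis
      using a b continuous_on_mult unfolding sym0_def by blast
  qed
  {
    case 0
    then show ?case using s0 by simp
  next
    case (Suc n)
    show ?case
    proof (rule sym_SucI)
      show "sym0 \<Omega> (\<lambda>i z. \<mu> i z * \<nu> i z) (\<lambda>i z. a i z * b i z)" by (rule s0[OF sym_imp_sym0[OF Suc.prems(1)] sym_imp_sym0[OF Suc.prems(2)]])
      fix v :: 'e assume v: "v \<in> Basis"
      obtain a' where a': "\<And>i z. z \<in> \<Omega> \<Longrightarrow> ((\<lambda>s. a i (z + s *\<^sub>R v)) has_vector_derivative a' i z) (at 0)" "symn n \<Omega> \<mu> a'"
        by (rule sym_SucE[OF Suc.prems(1) v], rule that)
      obtain b' where b': "\<And>i z. z \<in> \<Omega> \<Longrightarrow> ((\<lambda>s. b i (z + s *\<^sub>R v)) has_vector_derivative b' i z) (at 0)" "symn n \<Omega> \<nu> b'"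
        by (rule sym_SucE[OF Suc.prems(2) v], rule that)
      have "symn n \<Omega> (\<lambda>i z. \<mu> i z * \<nu> i z) (\<lambda>i z. a i z * b' i z + a' i z * b i z)"
        using Suc.prems a' b' by (intro sym_add Suc.IH) (auto intro: sym_SucD)
      moreover have "((\<lambda>s. a i (z + s *\<^sub>R v) * b i (z + s *\<^sub>R v)) has_vector_derivative a i z * b' i z + a' i z * b i z) (at 0)"
        if "z \<in> \<Omega>" for i z
        using has_vector_derivative_mult[OF a'(1)[OF that] b'(1)[OF that], of i i] by simp
      ultimately show "\<exists>a'. (\<forall>i. \<forall>z\<in>\<Omega>. ((\<lambda>s. a i (z + s *\<^sub>R v) * b i (z + s *\<^sub>R v)) has_vector_derivative a' i z) (at 0))
           \<and> symn n \<Omega> (\<lambda>i z. \<mu> i z * \<nu> i z) a'"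
        by (intro exI[of _ "\<lambda>i z. a i z * b' i z + a' i z * b i z"] conjI allI ballI)
    qed
  }
qed

lemma sym_const:
  fixes c :: "'i \<Rightarrow> 'b::real_normed_vector" and \<mu> :: "'i \<Rightarrow> 'e::euclidean_space \<Rightarrow> real"
  assumes "\<And>i z. z \<in> \<Omega> \<Longrightarrow> norm (c i) \<le> C * \<mu> i z" "0 \<le> C"
  shows "symn n \<Omega> \<mu> (\<lambda>i z. c i)"
  using assms
proof (induction n arbitrary: c C)
  case 0
  then show ?case by (auto simp: sym0_def)
next
  case (Suc n)
  show ?case
  proof (rule sym_SucI)
    show "sym0 \<Omega> \<mu> (\<lambda>i z. c i)" using Suc.prems by (auto simp: sym0_def)
    have "symn n \<Omega> \<mu> (\<lambda>i z. 0 :: 'b)"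
      using Suc.prems by (intro Suc.IH[of "\<lambda>_. 0" C]) (auto intro: order_trans[OF norm_ge_zero])
    then show "\<exists>a'. (\<forall>i. \<forall>z\<in>\<Omega>. ((\<lambda>s. c i) has_vector_derivative a' i z) (at 0)) \<and> symn n \<Omega> \<mu> a'" for v :: 'e
      by (intro exI[of _ "\<lambda>i z. 0"]) auto
  qed
qed

lemma sym_sum:
  assumes "finite S" "S \<noteq> {}" "\<And>b. b \<in> S \<Longrightarrow> symn n \<Omega> \<mu> (a b)"
  shows "symn n \<Omega> \<mu> (\<lambda>i z. \<Sum>b\<in>S. a b i z)"
  using assms
  by (induction S rule: finite_ne_induct) (auto intro: sym_add)

lemma sym_linear:
  fixes L :: "'e::euclidean_space \<Rightarrow> 'b::real_normed_vector"
  assumes L: "bounded_linear L" and "0 \<le> C"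
    and 1: "\<And>i z. z \<in> \<Omega> \<Longrightarrow> \<bar>c i\<bar> * norm (L z) \<le> C * \<mu> i z"
    and 2: "\<And>i z v. z \<in> \<Omega> \<Longrightarrow> v \<in> Basis \<Longrightarrow> \<bar>c i\<bar> * norm (L v) \<le> C * \<mu> i z"
  shows "symn n \<Omega> \<mu> (\<lambda>i z. c i *\<^sub>R L z)"
proof (cases n)
  have s0: "sym0 \<Omega> \<mu> (\<lambda>i z. c i *\<^sub>R L z)"
    using assms by (auto simp: sym0_def intro!: continuous_intros bounded_linear.continuous_on[OF L])
  case 0
  then show ?thesis using s0 by simp
next
  case (Suc m)
  have s0: "sym0 \<Omega> \<mu> (\<lambda>i z. c i *\<^sub>R L z)"
    using assms by (auto simp: sym0_def intro!: continuous_intros bounded_linear.continuous_on[OF L])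
  show ?thesis
    unfolding Suc
  proof (rule sym_SucI[OF s0])
    fix v :: 'e assume v: "v \<in> Basis"
    have "((\<lambda>s. c i *\<^sub>R L (z + s *\<^sub>R v)) has_vector_derivative c i *\<^sub>R L v) (at 0)" for i z
    proof -
      interpret bounded_linear L by fact
      have "((\<lambda>s. c i *\<^sub>R (L z + s *\<^sub>R L v)) has_vector_derivative c i *\<^sub>R L v) (at 0)"
        by (auto intro!: derivative_eq_intros)
      then show ?thesis by (simp add: add scaleR)
    qed
    moreover have "symn m \<Omega> \<mu> (\<lambda>i z. c i *\<^sub>R L v)"
      by (rule sym_const[where C = C]) (use 2 v assms in auto)
    ultimately show "\<exists>a'. (\<forall>i. \<forall>z\<in>\<Omega>. ((\<lambda>s. c i *\<^sub>R L (z + s *\<^sub>R v)) has_vector_derivative a' i z) (at 0)) \<and> symn m \<Omega> \<mu> a'"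
      by (intro exI[of _ "\<lambda>i z. c i *\<^sub>R L v"]) auto
  qed
qed

text \<open>The three bounds control the value, the gradient and the Hessian; all further
  derivatives vanish. In the applications \<open>P\<close> is one of the two projections of phase
  space.\<close>

lemma sym_quadratic:
  fixes P :: "'e::euclidean_space \<Rightarrow> 'a::euclidean_space"
  assumes P: "bounded_linear P" and PB: "\<And>v. v \<in> Basis \<Longrightarrow> norm (P v) \<le> 1" and C: "0 \<le> C"
    and 1: "\<And>i z. z \<in> \<Omega> \<Longrightarrow> \<bar>k i + c i * (norm (P z))\<^sup>2\<bar> \<le> C * \<mu> i z"
    and 2: "\<And>i z. z \<in> \<Omega> \<Longrightarrow> \<bar>c i\<bar> * norm (P z) \<le> C * \<mu> i z"
    and 3: "\<And>i z. z \<in> \<Omega> \<Longrightarrow> \<bar>c i\<bar> \<le> C * \<mu> i z"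
  shows "symn n \<Omega> \<mu> (\<lambda>i z. k i + c i * (norm (P z))\<^sup>2)"
proof (cases n)
  have s0: "sym0 \<Omega> \<mu> (\<lambda>i z. k i + c i * (norm (P z))\<^sup>2)"
    using 1 C by (auto simp: sym0_def intro!: continuous_intros bounded_linear.continuous_on[OF P])
  case 0
  then show ?thesis using s0 by simp
next
  case (Suc m)
  have s0: "sym0 \<Omega> \<mu> (\<lambda>i z. k i + c i * (norm (P z))\<^sup>2)"
    using 1 C by (auto simp: sym0_def intro!: continuous_intros bounded_linear.continuous_on[OF P])
  show ?thesis
    unfolding Suc
  proof (rule sym_SucI[OF s0])
    fix v :: 'e assume v: "v \<in> Basis"
    have d: "((\<lambda>s. k i + c i * (norm (P (z + s *\<^sub>R v)))\<^sup>2) has_vector_derivative (2 * c i) *\<^sub>R (P z \<bullet> P v)) (at 0)" for i z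
    proof -
      interpret bounded_linear P by fact
      have "(norm (P (z + s *\<^sub>R v)))\<^sup>2 = (norm (P z))\<^sup>2 + 2 * s * (P z \<bullet> P v) + s\<^sup>2 * (norm (P v))\<^sup>2" for s
        unfolding power2_norm_eq_inner add scaleR
        by (simp add: inner_add_left inner_add_right inner_commute power2_eq_square algebra_simps)
      moreover have "((\<lambda>s. k i + c i * ((norm (P z))\<^sup>2 + 2 * s * (P z \<bullet> P v) + s\<^sup>2 * (norm (P v))\<^sup>2))
           has_real_derivative (2 * c i) * (P z \<bullet> P v)) (at 0)"
        by (auto intro!: derivative_eq_intros)
      ultimately show ?thesis
        by (simp add: has_real_derivative_iff_has_vector_derivative)
    qed
    have "symn m \<Omega> \<mu> (\<lambda>i z. (2 * c i) *\<^sub>R (P z \<bullet> P v))"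
    proof (rule sym_linear[where C = "2 * C"])
      show "bounded_linear (\<lambda>z. P z \<bullet> P v)"
        by (intro bounded_linear_compose[OF bounded_linear_inner_left P])
      have le: "norm (x \<bullet> P v) \<le> norm x" for x
        using order_trans[OF Cauchy_Schwarz_ineq2[of x "P v"]] mult_left_mono[OF PB[OF v] norm_ge_zero[of x]] by simp
      show "\<bar>2 * c i\<bar> * norm (P z \<bullet> P v) \<le> 2 * C * \<mu> i z" if "z \<in> \<Omega>" for i z
        using mult_left_mono[OF le[of "P z"], of "\<bar>c i\<bar>"] 2[OF that, of i] by (simp add: abs_mult)
      show "\<bar>2 * c i\<bar> * norm (P u \<bullet> P v) \<le> 2 * C * \<mu> i z" if "z \<in> \<Omega>" "u \<in> Basis" for i z u
        using mult_left_mono[OF order_trans[OF le[of "P u"] PB[OF that(2)]], of "\<bar>c i\<bar>"] 3[OF that(1), of i] by (simp add: abs_mult)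
    qed (use C in auto)
    then show "\<exists>a'. (\<forall>i. \<forall>z\<in>\<Omega>. ((\<lambda>s. k i + c i * (norm (P (z + s *\<^sub>R v)))\<^sup>2) has_vector_derivative a' i z) (at 0)) \<and> symn m \<Omega> \<mu> a'"
      by (intro exI[of _ "\<lambda>i z. (2 * c i) *\<^sub>R (P z \<bullet> P v)"] conjI allI ballI d)
  qed
qed

text \<open>The lower bound is ellipticity: it makes g comparable to its weight, so powers of either
  sign are admissible. The chain rule yields g^(a-1) g', whose weight \<open>\<mu>\<close>^(a-1)
  times \<open>\<mu>\<close> is again \<open>\<mu>\<close>^a.\<close>

lemma sym_powr:
  fixes g :: "'i \<Rightarrow> 'e::euclidean_space \<Rightarrow> real"
  assumes g: "symn n \<Omega> \<mu> g" and c: "0 < c" and lo: "\<And>i z. z \<in> \<Omega> \<Longrightarrow> c * \<mu> i z \<le> g i z"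
    and pos: "\<And>i z. z \<in> \<Omega> \<Longrightarrow> 0 < \<mu> i z"
  shows "symn n \<Omega> (\<lambda>i z. \<mu> i z powr a) (\<lambda>i z. g i z powr a)"
  using g
proof (induction n arbitrary: a)
  have gpos: "0 < g i z" if "z \<in> \<Omega>" for i z
    using lo[OF that, of i] pos[OF that, of i] c mult_pos_pos[of c "\<mu> i z"] by linarith
  have s0: "sym0 \<Omega> (\<lambda>i z. \<mu> i z powr a) (\<lambda>i z. g i z powr a)" if g: "sym0 \<Omega> \<mu> g" for a
  proof -
    obtain C where C: "C \<ge> 0" "\<And>i z. z \<in> \<Omega> \<Longrightarrow> norm (g i z) \<le> C * \<mu> i z"
      using g by (auto simp: sym0_def)
    have "norm (g i z powr a) \<le> (C powr a + c powr a) * \<mu> i z powr a" if z: "z \<in> \<Omega>" for i z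
    proof (cases "a \<ge> 0")
      case True
      have "g i z powr a \<le> (C * \<mu> i z) powr a"
        using C(2)[OF z, of i] gpos[OF z, of i] True by (intro powr_mono2) auto
      also have "\<dots> = C powr a * \<mu> i z powr a"
        using C pos[OF z, of i] by (simp add: powr_mult)
      also have "\<dots> \<le> (C powr a + c powr a) * \<mu> i z powr a"
        by (intro mult_right_mono) auto
      finally show ?thesis by simp
    next
      case False
      have "g i z powr a \<le> (c * \<mu> i z) powr a"
        using lo[OF z, of i] mult_pos_pos[OF c pos[OF z, of i]] False by (intro powr_mono2') auto
      also have "\<dots> = c powr a * \<mu> i z powr a"
        using c pos[OF z, of i] by (simp add: powr_mult)
      also have "\<dots> \<le> (C powr a + c powr a) * \<mu> i z powr a"
        by (intro mult_right_mono) auto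
      finally show ?thesis by simp
    qed
    moreover have "continuous_on \<Omega> (\<lambda>z. g i z powr a)" for i
      using g gpos by (intro continuous_on_powr continuous_on_const) (auto simp: sym0_def, metis less_irrefl)
    moreover have "0 \<le> C powr a + c powr a" by simp
    ultimately show ?thesis
      unfolding sym0_def by blast
  qed
  {
    case 0
    then show ?case using s0 by simp
  next
    case (Suc n)
    show ?case
    proof (rule sym_SucI)
      show "sym0 \<Omega> (\<lambda>i z. \<mu> i z powr a) (\<lambda>i z. g i z powr a)" by (rule s0[OF sym_imp_sym0[OF Suc.prems(1)]])
      fix v :: 'e assume v: "v \<in> Basis"
      obtain g' where g': "\<And>i z. z \<in> \<Omega> \<Longrightarrow> ((\<lambda>s. g i (z + s *\<^sub>R v)) has_vector_derivative g' i z) (at 0)" "symn n \<Omega> \<mu> g'"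
        by (rule sym_SucE[OF Suc.prems(1) v], rule that)
      have "symn n \<Omega> (\<lambda>i z. \<mu> i z powr (a - 1) * \<mu> i z) (\<lambda>i z. g i z powr (a - 1) * g' i z)"
        by (intro sym_mult Suc.IH sym_SucD[OF Suc.prems(1)] g'(2))
      then have "symn n \<Omega> (\<lambda>i z. \<mu> i z powr (a - 1) * \<mu> i z) (\<lambda>i z. a *\<^sub>R (g i z powr (a - 1) * g' i z))"
        by (rule sym_bounded_linear[OF bounded_linear_scaleR_right])
      then have "symn n \<Omega> (\<lambda>i z. \<mu> i z powr a) (\<lambda>i z. a *\<^sub>R (g i z powr (a - 1) * g' i z))"
      proof (rule sym_weaken[where c = 1])
        show "\<mu> i z powr (a - 1) * \<mu> i z \<le> 1 * \<mu> i z powr a" if "z \<in> \<Omega>" for i z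
          using powr_add[of "\<mu> i z" "a - 1" 1] pos[OF that, of i] by simp
      qed auto
      moreover have "((\<lambda>s. g i (z + s *\<^sub>R v) powr a) has_vector_derivative a *\<^sub>R (g i z powr (a - 1) * g' i z)) (at 0)"
        if "z \<in> \<Omega>" for i z
        using DERIV_fun_powr[OF g'(1)[OF that, of i, folded has_real_derivative_iff_has_vector_derivative], of a] gpos[OF that, of i]
        by (simp add: has_real_derivative_iff_has_vector_derivative[symmetric] mult.assoc)
      ultimately show "\<exists>a'. (\<forall>i. \<forall>z\<in>\<Omega>. ((\<lambda>s. g i (z + s *\<^sub>R v) powr a) has_vector_derivative a' i z) (at 0))
           \<and> symn n \<Omega> (\<lambda>i z. \<mu> i z powr a) a'"
        by (intro exI[of _ "\<lambda>i z. a *\<^sub>R (g i z powr (a - 1) * g' i z)"] conjI allI ballI)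
    qed
  }
qed

section \<open>Flat cutoffs and extension by zero\<close>

definition bump :: "nat \<Rightarrow> real \<Rightarrow> real" where
  "bump j x = (if x > 0 then exp (- 1 / x) / x ^ j else 0)"

lemma bump_nonneg: "0 \<le> bump j x"
  by (simp add: bump_def)

lemma bump_le: "bump j x \<le> fact j"
proof (cases "x > 0")
  case True
  \<comment> \<open>A single term of the exponential series at 1/x.\<close>
  have "(1 / x) ^ j / fact j \<le> exp (1 / x)"
    using sum_le_suminf[OF summable_exp_generic[of "1 / x"], of "{j}"] True
    by (simp add: exp_def divide_inverse mult.commute)
  then have "(1 / x) ^ j * exp (- 1 / x) \<le> fact j"
    using True by (simp add: exp_minus field_simps)
  then show ?thesis
    using True by (simp add: bump_def divide_inverse power_inverse mult.commute)
qed (simp add: bump_def)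

lemma bump_Suc: "x \<noteq> 0 \<Longrightarrow> bump j x = x * bump (Suc j) x"
  by (simp add: bump_def)

text \<open>The functions exp(-1/x)/x^j, set to zero for x <= 0, are closed under differentiation up
  to linear combinations, which makes \<open>bump 0\<close> smooth with bounded derivatives. At the
  origin two applications of \<open>bump_Suc\<close> write the difference quotient as y times the
  bounded function \<open>bump (j + 2)\<close>.\<close>

lemma bump_deriv: "(bump j has_real_derivative bump (j + 2) x - real j * bump (j + 1) x) (at x)"
proof -
  consider "x > 0" | "x < 0" | "x = 0" by linarith
  then show ?thesis
  proof cases
    case 1
    have "((\<lambda>x. exp (- 1 / x) / x ^ j) has_real_derivative bump (j + 2) x - real j * bump (j + 1) x) (at x)"
      using 1 by (auto intro!: derivative_eq_intros simp: bump_def field_simps power2_eq_square)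
        (cases j; simp add: field_simps)
    then show ?thesis
      by (rule has_field_derivative_transform_within_open[where S = "{0<..}"]) (use 1 in \<open>auto simp: bump_def\<close>)
  next
    case 2
    have "((\<lambda>x. 0) has_real_derivative bump (j + 2) x - real j * bump (j + 1) x) (at x)"
      using 2 by (auto simp: bump_def)
    then show ?thesis
      by (rule has_field_derivative_transform_within_open[where S = "{..<0}"]) (use 2 in \<open>auto simp: bump_def\<close>)
  next
    case 3
    have "((\<lambda>y. bump j y / y) \<longlongrightarrow> 0) (at 0)"
    proof (rule Lim_null_comparison[where g = "\<lambda>y. \<bar>y\<bar> * fact (j + 2)"])
      have "norm (bump j y / y) \<le> \<bar>y\<bar> * fact (j + 2)" if "y \<noteq> 0" for y :: real
      proof -
        have "bump j y / y = y * bump (j + 2) y"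
          using that bump_Suc[OF that, of j] bump_Suc[OF that, of "Suc j"] by simp
        then show ?thesis
          using bump_le[of "j + 2" y] bump_nonneg[of "j + 2" y] by (simp add: abs_mult mult_left_mono)
      qed
      then show "\<forall>\<^sub>F y in at 0. norm (bump j y / y) \<le> \<bar>y\<bar> * fact (j + 2)"
        by (simp add: eventually_at_filter)
      show "((\<lambda>y::real. \<bar>y\<bar> * fact (j + 2)) \<longlongrightarrow> 0) (at 0)"
        by (auto intro!: tendsto_eq_intros)
    qed
    then show ?thesis
      using 3 by (simp add: DERIV_def bump_def)
  qed
qed

lemma sym_bump:
  fixes g :: "'i \<Rightarrow> 'e::euclidean_space \<Rightarrow> real"
  assumes "symn n \<Omega> (\<lambda>_ _. 1) g"
  shows "symn n \<Omega> (\<lambda>_ _. 1) (\<lambda>i z. bump j (g i z))"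
  using assms
proof (induction n arbitrary: j)
  have cb: "continuous_on UNIV (bump j)" for j
    using bump_deriv by (intro continuous_at_imp_continuous_on) (auto intro: DERIV_isCont)
  have s0: "sym0 \<Omega> (\<lambda>_ _. 1) (\<lambda>i z. bump j (g i z))" if "sym0 \<Omega> (\<lambda>_ _. 1) g" for j
    using that bump_le[of j] bump_nonneg[of j]
    by (auto simp: sym0_def intro!: continuous_on_compose2[OF cb] exI[of _ "fact j"])
  {
    case 0
    then show ?case using s0 by simp
  next
    case (Suc n)
    show ?case
    proof (rule sym_SucI)
      show "sym0 \<Omega> (\<lambda>_ _. 1) (\<lambda>i z. bump j (g i z))" by (rule s0[OF sym_imp_sym0[OF Suc.prems(1)]])
      fix v :: 'e assume v: "v \<in> Basis"
      obtain g' where g': "\<And>i z. z \<in> \<Omega> \<Longrightarrow> ((\<lambda>s. g i (z + s *\<^sub>R v)) has_vector_derivative g' i z) (at 0)" "symn n \<Omega> (\<lambda>_ _. 1) g'"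
        by (rule sym_SucE[OF Suc.prems(1) v], rule that)
      have "symn n \<Omega> (\<lambda>_ _. 1) (\<lambda>i z. bump (j + 2) (g i z) + (- real j) *\<^sub>R bump (j + 1) (g i z))"
        by (intro sym_add sym_bounded_linear[OF bounded_linear_scaleR_right] Suc.IH sym_SucD[OF Suc.prems(1)])
      from sym_mult[OF this g'(2)]
      have "symn n \<Omega> (\<lambda>_ _. 1) (\<lambda>i z. (bump (j + 2) (g i z) - real j * bump (j + 1) (g i z)) * g' i z)"
        by simp
      moreover have "((\<lambda>s. bump j (g i (z + s *\<^sub>R v))) has_vector_derivative (bump (j + 2) (g i z) - real j * bump (j + 1) (g i z)) * g' i z) (at 0)"
        if "z \<in> \<Omega>" for i z
        using DERIV_chain2[of "bump j" _ "\<lambda>s. g i (z + s *\<^sub>R v)" 0, OF bump_deriv g'(1)[OF that, of i, folded has_real_derivative_iff_has_vector_derivative]]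
        by (simp add: has_real_derivative_iff_has_vector_derivative[symmetric])
      ultimately show "\<exists>a'. (\<forall>i. \<forall>z\<in>\<Omega>. ((\<lambda>s. bump j (g i (z + s *\<^sub>R v))) has_vector_derivative a' i z) (at 0))
           \<and> symn n \<Omega> (\<lambda>_ _. 1) a'"
        by (intro exI[of _ "\<lambda>i z. (bump (j + 2) (g i z) - real j * bump (j + 1) (g i z)) * g' i z"] conjI allI ballI)
    qed
  }
qed

text \<open>The open set \<open>\<Omega>\<close> and the complement of K cover the space; on their
  overlap the function vanishes together with its derivatives, so the two pieces glue.\<close>

lemma sym_extend_by_zero:
  fixes a :: "'i \<Rightarrow> 'e::euclidean_space \<Rightarrow> 'b::real_normed_vector"
  assumes "symn n \<Omega> \<mu> a" "open \<Omega>" "closed K" "K \<subseteq> \<Omega>"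
    and "\<And>i z. z \<notin> K \<Longrightarrow> a i z = 0" and "\<And>i z. 0 \<le> \<mu> i z"
  shows "symn n UNIV \<mu> a"
  using assms(1,5)
proof (induction n arbitrary: a)
  have s0: "sym0 UNIV \<mu> a" if a: "sym0 \<Omega> \<mu> a" and z: "\<And>i z. z \<notin> K \<Longrightarrow> a i z = 0" for a :: "'i \<Rightarrow> 'e \<Rightarrow> 'b"
  proof -
    obtain C where C: "C \<ge> 0" "\<And>i z. z \<in> \<Omega> \<Longrightarrow> norm (a i z) \<le> C * \<mu> i z"
      using a by (auto simp: sym0_def)
    have "norm (a i z) \<le> C * \<mu> i z" for i z
      using C z[of z i] assms(4) mult_nonneg_nonneg[OF C(1) assms(6)[of i z]] by (cases "z \<in> K") auto
    moreover have "continuous_on UNIV (a i)" for i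
    proof -
      have "continuous_on (- K) (a i)"
        by (rule continuous_on_eq[OF continuous_on_const[of _ 0]]) (use z in auto)
      then have "continuous_on (\<Omega> \<union> - K) (a i)"
        using a assms(2,3) by (intro continuous_on_open_Un) (auto simp: sym0_def)
      moreover have "\<Omega> \<union> - K = UNIV" using assms(4) by auto
      ultimately show ?thesis by simp
    qed
    ultimately show ?thesis
      using C unfolding sym0_def by blast
  qed
  {
    case 0
    then show ?case using s0 by simp
  next
    case (Suc n)
    show ?case
    proof (rule sym_SucI)
      show "sym0 UNIV \<mu> a" by (rule s0[OF sym_imp_sym0[OF Suc.prems(1)] Suc.prems(2)])
      fix v :: 'e assume v: "v \<in> Basis"
      obtain a' where a': "\<And>i z. z \<in> \<Omega> \<Longrightarrow> ((\<lambda>s. a i (z + s *\<^sub>R v)) has_vector_derivative a' i z) (at 0)" "symn n \<Omega> \<mu> a'"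
        by (rule sym_SucE[OF Suc.prems(1) v], rule that)
      \<comment> \<open>Nothing is known about \<open>a'\<close> outside \<open>\<Omega>\<close>, so
        it is replaced by zero off K; on \<open>\<Omega>\<close> this changes nothing, by uniqueness
        of derivatives.\<close>
      define b where "b i z = (if z \<in> K then a' i z else 0)" for i z
      have zero: "((\<lambda>s. a i (z + s *\<^sub>R v)) has_vector_derivative 0) (at 0)" if "z \<notin> K" for i z
        by (rule directional_derivative_cong[of "- K" z "\<lambda>_. 0"]) (use that assms(3) Suc.prems(2) in auto)
      have eq: "a' i z = b i z" if "z \<in> \<Omega>" for i z
        using vector_derivative_unique_at[OF a'(1)[OF that, of i] zero[of z i]] by (auto simp: b_def)
      have "((\<lambda>s. a i (z + s *\<^sub>R v)) has_vector_derivative b i z) (at 0)" for i z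
        using zero[of z i] a'(1)[of z i] assms(4) by (auto simp: b_def)
      moreover have "symn n UNIV \<mu> b"
        by (rule Suc.IH[OF sym_cong[OF a'(2) assms(2) eq]]) (auto simp: b_def)
      ultimately show "\<exists>a'. (\<forall>i. \<forall>z\<in>UNIV. ((\<lambda>s. a i (z + s *\<^sub>R v)) has_vector_derivative a' i z) (at 0)) \<and> symn n UNIV \<mu> a'"
        by (intro exI[of _ b] conjI allI ballI)
    qed
  }
qed

definition symb where "symb \<Omega> \<mu> a \<longleftrightarrow> (\<forall>n. symn n \<Omega> \<mu> a)"

text \<open>Each order n provides its own derivative family. On an open set these agree by
  uniqueness of derivatives, so a single family serves all orders.\<close>

lemma symb_deriv:
  assumes "symb \<Omega> \<mu> a" "open \<Omega>" "v \<in> Basis"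
  obtains a' where "\<And>i z. z \<in> \<Omega> \<Longrightarrow> ((\<lambda>s. a i (z + s *\<^sub>R v)) has_vector_derivative a' i z) (at 0)" "symb \<Omega> \<mu> a'"
proof -
  obtain a' where a': "\<And>i z. z \<in> \<Omega> \<Longrightarrow> ((\<lambda>s. a i (z + s *\<^sub>R v)) has_vector_derivative a' i z) (at 0)"
    using sym_SucE[of 0 \<Omega> \<mu> a v] assms unfolding symb_def by metis
  have "symn n \<Omega> \<mu> a'" for n
  proof -
    obtain b where b: "\<And>i z. z \<in> \<Omega> \<Longrightarrow> ((\<lambda>s. a i (z + s *\<^sub>R v)) has_vector_derivative b i z) (at 0)" "symn n \<Omega> \<mu> b"
      using sym_SucE[of n \<Omega> \<mu> a v] assms unfolding symb_def by metis
    show ?thesis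
      by (rule sym_cong[OF b(2) assms(2)]) (rule vector_derivative_unique_at[OF b(1) a'])
  qed
  then show thesis using that a' by (auto simp: symb_def)
qed

lemma bdd_mixed_mono: "bdd_mixed M vs D \<Longrightarrow> M \<le> M' \<Longrightarrow> bdd_mixed M' vs D"
proof (induction vs arbitrary: D)
  case Nil
  then show ?case by (auto intro: order_trans)
next
  case (Cons v vs)
  then obtain D' where D': "\<And>x. ((\<lambda>s. D (x + s *\<^sub>R v)) has_vector_derivative D' x) (at 0)" "bdd_mixed M vs D'"
    by auto
  have "bdd_mixed M' vs D" "bdd_mixed M' vs D'"
    using Cons D' by auto
  then show ?case using D'(1) by auto
qed

lemma sym_imp_bdd_mixed:
  fixes a :: "'i \<Rightarrow> 'e::euclidean_space \<Rightarrow> complex"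
  assumes "symn (length vs) UNIV (\<lambda>_ _. 1) a" "set vs \<subseteq> Basis"
  shows "\<exists>M. \<forall>i. bdd_mixed M vs (a i)"
  using assms
proof (induction vs arbitrary: a)
  case Nil
  then show ?case by (auto simp: sym0_def)
next
  case (Cons v vs)
  obtain a' where a': "\<And>i z. ((\<lambda>s. a i (z + s *\<^sub>R v)) has_vector_derivative a' i z) (at 0)" "symn (length vs) UNIV (\<lambda>_ _. 1) a'"
    using Cons.prems sym_SucE[of "length vs" UNIV "\<lambda>_ _. 1" a v] by auto
  obtain M1 M2 where "\<And>i. bdd_mixed M1 vs (a i)" "\<And>i. bdd_mixed M2 vs (a' i)"
    using Cons.IH[OF a'(2)] Cons.IH[of a] Cons.prems sym_SucD[of "length vs" UNIV "\<lambda>_ _. 1" a] by auto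
  then have "bdd_mixed (max M1 M2) vs (a i)" "bdd_mixed (max M1 M2) vs (a' i)" for i
    by (meson bdd_mixed_mono max.cobounded1 max.cobounded2)+
  then have "\<forall>i. bdd_mixed (max M1 M2) (v # vs) (a i)"
    unfolding bdd_mixed.simps using a'(1) by (intro allI conjI exI[of _ "a' _"]) auto
  then show ?case by blast
qed

subsection \<open>The phase function and its symbols\<close>

text \<open>A parameter \<open>i = (\<tau>, n)\<close> encodes the time \<open>t = |\<tau>|\<close> and the regularisation
  \<open>\<epsilon> = 1/(n + 1)\<close>, so that every parameter is admissible.  Phase space points are
  \<open>z = (\<xi>, y)\<close>.\<close>
type_synonym par = "real \<times> nat"

definition tm :: "par \<Rightarrow> real" where "tm i = \<bar>fst i\<bar>"
definition ep :: "par \<Rightarrow> real" where "ep i = 1 / (1 + real (snd i))"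
definition lamsq :: "par \<Rightarrow> 'a::euclidean_space \<times> 'a \<Rightarrow> real" where
  "lamsq i z = 1 + (norm (snd z))\<^sup>2 + (tm i)\<^sup>2"
definition regsq :: "par \<Rightarrow> 'a::euclidean_space \<times> 'a \<Rightarrow> real" where
  "regsq i z = 1 + (ep i)\<^sup>2 * (norm (fst z))\<^sup>2"
definition jsq :: "par \<Rightarrow> 'a::euclidean_space \<times> 'a \<Rightarrow> real" where
  "jsq i z = 1 + (norm (snd z))\<^sup>2"
definition bsq :: "par \<Rightarrow> 'a::euclidean_space \<times> 'a \<Rightarrow> real" where
  "bsq i z = (norm (snd z))\<^sup>2 + (tm i)\<^sup>2 * (norm (fst z))\<^sup>2"

lemma tm_nonneg: "0 \<le> tm i" by (simp add: tm_def)
lemma ep_pos: "0 < ep i" by (simp add: ep_def)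
lemma ep_le_1: "ep i \<le> 1" by (simp add: ep_def)
lemma lamsq_ge_1: "1 \<le> lamsq i z" by (simp add: lamsq_def)
lemma regsq_ge_1: "1 \<le> regsq i z" by (simp add: regsq_def)
lemma jsq_ge_1: "1 \<le> jsq i z" by (simp add: jsq_def)

lemma norm_Basis_prod: "v \<in> Basis \<Longrightarrow> norm (fst v) \<le> 1" "v \<in> Basis \<Longrightarrow> norm (snd v) \<le> 1"
  for v :: "'a::euclidean_space \<times> 'b::euclidean_space"
  by (auto simp: Basis_prod_def)

lemma le_one_plus_sq: "x \<le> 1 + x\<^sup>2" for x :: real
proof -
  have "0 \<le> (x - 1/2)\<^sup>2" by simp
  then show ?thesis by (simp add: power2_eq_square algebra_simps)
qed

lemma sym_lamsq: "symn n UNIV lamsq (lamsq :: par \<Rightarrow> 'a::euclidean_space \<times> 'a \<Rightarrow> real)"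
proof -
  have "symn n UNIV lamsq (\<lambda>i (z :: 'a \<times> 'a). (1 + (tm i)\<^sup>2) + 1 * (norm (snd z))\<^sup>2)"
    by (rule sym_quadratic[where C = 1])
      (auto simp: lamsq_def bounded_linear_snd norm_Basis_prod add_increasing2 le_one_plus_sq intro: order_trans[OF le_one_plus_sq])
  then show ?thesis by (simp add: lamsq_def[abs_def] add_ac)
qed

lemma sym_jsq: "symn n UNIV jsq (jsq :: par \<Rightarrow> 'a::euclidean_space \<times> 'a \<Rightarrow> real)"
proof -
  have "symn n UNIV jsq (\<lambda>(i::par) (z :: 'a \<times> 'a). 1 + 1 * (norm (snd z))\<^sup>2)"
    by (rule sym_quadratic[where C = 1])
      (auto simp: jsq_def bounded_linear_snd norm_Basis_prod le_one_plus_sq)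
  then show ?thesis by (simp add: jsq_def[abs_def])
qed

text \<open>Each \<open>\<xi>\<close>-derivative falls on the term with
  \<open>(ep i)\<^sup>2\<close>, which is at most 1; the symbol bounds therefore do not deteriorate
  as the regularisation is removed.\<close>

lemma sym_regsq: "symn n UNIV regsq (regsq :: par \<Rightarrow> 'a::euclidean_space \<times> 'a \<Rightarrow> real)"
proof -
  have e: "(ep i)\<^sup>2 \<le> 1" for i
    using ep_pos[of i] ep_le_1[of i] by (simp add: power_le_one)
  have e2: "(ep i)\<^sup>2 * x \<le> 1 + (ep i)\<^sup>2 * x\<^sup>2" if "0 \<le> x" for i and x :: real
  proof -
    have "(ep i)\<^sup>2 * x \<le> (ep i)\<^sup>2 * (1 + x\<^sup>2)"
      by (intro mult_left_mono le_one_plus_sq) simp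
    then show ?thesis using e[of i] by (simp add: distrib_left)
  qed
  have "symn n UNIV regsq (\<lambda>i (z :: 'a \<times> 'a). 1 + (ep i)\<^sup>2 * (norm (fst z))\<^sup>2)"
    by (rule sym_quadratic[where C = 1])
      (auto simp: regsq_def bounded_linear_fst norm_Basis_prod e2 intro: add_increasing2 e)
  then show ?thesis by (simp add: regsq_def[abs_def])
qed

lemma sym_lamsq_powr: "symn n UNIV (\<lambda>i z. lamsq i z powr a) (\<lambda>i (z :: 'a::euclidean_space \<times> 'a). lamsq i z powr a)"
  by (rule sym_powr[OF sym_lamsq, of 1]) (auto intro: less_le_trans[OF zero_less_one lamsq_ge_1])
lemma sym_jsq_powr: "symn n UNIV (\<lambda>i z. jsq i z powr a) (\<lambda>i (z :: 'a::euclidean_space \<times> 'a). jsq i z powr a)"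
  by (rule sym_powr[OF sym_jsq, of 1]) (auto intro: less_le_trans[OF zero_less_one jsq_ge_1])
lemma sym_regsq_powr: "symn n UNIV (\<lambda>i z. regsq i z powr a) (\<lambda>i (z :: 'a::euclidean_space \<times> 'a). regsq i z powr a)"
  by (rule sym_powr[OF sym_regsq, of 1]) (auto intro: less_le_trans[OF zero_less_one regsq_ge_1])

section \<open>Geometry of phase space and the vector field\<close>

locale outgoing =
  fixes \<sigma> \<kappa> M :: real
  assumes sigma: "0 < \<sigma>" and kappa: "-1 < \<kappa>" "\<kappa> < 1" and M: "0 \<le> M"
begin

text \<open>The symbols are supported in \<open>Kset\<close>; \<open>Omega\<close> is an open
  neighbourhood with half the radius, on which norms and cosine are smooth and both norms stay
  bounded below. The number \<open>\<kappa>\<close> bounds the cone of rapid decay: it is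
  \<open>\<theta> + \<rho>\<close> for P_+ and \<open>\<rho> - \<theta>\<close> for the reflected
  P_-.\<close>

definition Omega :: "('a::euclidean_space \<times> 'a) set" where
  "Omega = {z. \<sigma> / 2 < norm (fst z) \<and> \<sigma> / 2 < norm (snd z)}"
definition Kset :: "('a::euclidean_space \<times> 'a) set" where
  "Kset = {z. \<sigma> \<le> norm (fst z) \<and> \<sigma> \<le> norm (snd z)}"
definition cosf :: "'a::euclidean_space \<times> 'a \<Rightarrow> real" where
  "cosf z = cosang (snd z) (fst z)"
definition Gamma :: "('a::euclidean_space \<times> 'a) set" where
  "Gamma = {z \<in> Omega. cosf z < \<kappa>}"

lemma open_Omega: "open Omega"
  unfolding Omega_def by (intro open_Collect_conj open_Collect_less continuous_intros)

lemma closed_Kset: "closed Kset"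
  unfolding Kset_def by (intro closed_Collect_conj closed_Collect_le continuous_intros)

lemma Kset_subset_Omega: "Kset \<subseteq> Omega"
  using sigma by (auto simp: Kset_def Omega_def)

lemma continuous_cosf: "continuous_on Omega cosf"
  unfolding cosf_def cosang_def
  by (intro continuous_intros) (use sigma in \<open>auto simp: Omega_def\<close>)

lemma open_Gamma: "open Gamma"
proof -
  have "open (Omega \<inter> cosf -` {..<\<kappa>})"
    by (rule continuous_open_preimage[OF continuous_cosf open_Omega]) simp
  then show ?thesis by (simp add: Gamma_def Int_def vimage_def)
qed

text \<open>The midpoint between -1 and \<open>\<kappa>\<close>. As \<open>phi\<close> is positive
  exactly where the cosine is below \<open>kap2\<close>, the correction lives, within
  \<open>Kset\<close>, in the closed set \<open>K2set\<close>, which still lies inside the open cone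
  \<open>Gamma\<close>.\<close>

definition kap2 :: real where "kap2 = (\<kappa> - 1) / 2"

lemma kap2: "-1 < kap2" "kap2 < \<kappa>"
  using kappa by (auto simp: kap2_def)

definition K2set :: "('a::euclidean_space \<times> 'a) set" where
  "K2set = {z \<in> Kset. cosf z \<le> kap2}"

lemma closed_K2set: "closed K2set"
proof -
  have "closed (Kset \<inter> cosf -` {..kap2})"
    by (rule continuous_closed_preimage[OF continuous_on_subset[OF continuous_cosf Kset_subset_Omega] closed_Kset]) simp
  then show ?thesis by (simp add: K2set_def Int_def vimage_def)
qed

lemma K2set_subset_Gamma: "K2set \<subseteq> Gamma"
  using Kset_subset_Omega kap2 by (auto simp: K2set_def Gamma_def)

text \<open>With \<open>w = y + t\<xi>\<close>, the denominator \<open>Dn\<close> is \<open>|w|\<^sup>2\<close>, corrected by \<open>\<phi>|y|\<^sup>2\<close> inside the cone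
  \<open>Gamma\<close>, where \<open>w\<close> may vanish; \<open>av b\<close> are the components of the field \<open>w/Dn\<close>, and
  \<open>cv = 1 - w \<bullet> w/Dn\<close> is harmless because it lives in \<open>Gamma\<close>.\<close>
definition wv :: "'a::euclidean_space \<Rightarrow> par \<Rightarrow> 'a \<times> 'a \<Rightarrow> real" where
  "wv b i z = snd z \<bullet> b + tm i * (fst z \<bullet> b)"
definition phi :: "'a::euclidean_space \<times> 'a \<Rightarrow> real" where
  "phi z = bump 0 (kap2 - cosf z)"
definition Dn :: "par \<Rightarrow> 'a::euclidean_space \<times> 'a \<Rightarrow> real" where
  "Dn i z = (norm (snd z + tm i *\<^sub>R fst z))\<^sup>2 + phi z * (norm (snd z))\<^sup>2"
definition av :: "'a::euclidean_space \<Rightarrow> par \<Rightarrow> 'a \<times> 'a \<Rightarrow> real" where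
  "av b i z = wv b i z * Dn i z powr (-1)"
definition cv :: "par \<Rightarrow> 'a::euclidean_space \<times> 'a \<Rightarrow> real" where
  "cv i z = (phi z * (norm (snd z))\<^sup>2) * Dn i z powr (-1)"

lemma phi_nonneg: "0 \<le> phi z"
  by (simp add: phi_def bump_nonneg)

lemma norm_outgoing: "(norm (snd z + tm i *\<^sub>R fst z))\<^sup>2 =
    (norm (snd z))\<^sup>2 + 2 * tm i * (snd z \<bullet> fst z) + (tm i * norm (fst z))\<^sup>2"
  unfolding power2_norm_eq_inner power_mult_distrib
  by (simp add: inner_add_left inner_add_right inner_commute power2_eq_square algebra_simps)

text \<open>Put P = |y| and R = t|\<open>\<xi>\<close>|. If the cosine is at least k1 > -1, the
  inequality 2PR <= P^2 + R^2 keeps |w|^2 above (1 + k1)(P^2 + R^2). Otherwise \<open>phi\<close> is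
  bounded below, so P^2 is available even where w = 0, and R is recovered from P and |P - R| <=
  |w|.\<close>

lemma Dn_lower:
  obtains c where "0 < c" "\<And>i z. z \<in> Omega \<Longrightarrow> c * bsq i z \<le> Dn i z"
proof -
  \<comment> \<open>The midpoint between -1 and \<open>kap2\<close>. It is below
    \<open>kap2\<close>, so \<open>phi\<close> has a positive lower bound f0 for smaller cosines,
    and it is negative, so multiplying 2PR <= P^2 + R^2 by it reverses the inequality as
    required.\<close>
  define k1 where "k1 = (kap2 - 1) / 2"
  have k1: "-1 < k1" "k1 < kap2" "k1 < 0" using kap2 kappa by (auto simp: k1_def)
  define f0 where "f0 = bump 0 (kap2 - k1)"
  have f0: "0 < f0" using k1 by (simp add: f0_def bump_def)
  define c where "c = min (1 + k1) (1 / (2 + 3 / f0))"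
  have c: "0 < c" "c \<le> 1 + k1" "c \<le> 1 / (2 + 3 / f0)"
    using k1 f0 by (auto simp: c_def add_pos_pos)
  have "c * bsq i z \<le> Dn i z" if z: "z \<in> Omega" for i and z :: "'a \<times> 'a"
  proof -
    define P where "P = norm (snd z)"
    define R where "R = tm i * norm (fst z)"
    have pos: "0 < P" "0 < norm (fst z)" and R0: "0 \<le> R"
      using z sigma by (auto simp: Omega_def P_def R_def tm_nonneg)
    have bsq: "bsq i z = P\<^sup>2 + R\<^sup>2" by (simp add: bsq_def P_def R_def power_mult_distrib)
    have b0: "0 \<le> bsq i z" by (simp add: bsq)
    have inner: "tm i * (snd z \<bullet> fst z) = cosf z * (P * R)"
      using pos by (simp add: cosf_def cosang_def P_def R_def)
    have W: "(norm (snd z + tm i *\<^sub>R fst z))\<^sup>2 = P\<^sup>2 + 2 * (cosf z * (P * R)) + R\<^sup>2"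
      unfolding norm_outgoing inner[symmetric] by (simp add: P_def R_def)
    have PR: "2 * (P * R) \<le> P\<^sup>2 + R\<^sup>2" using sum_squares_bound[of P R] by simp
    show ?thesis
    proof (cases "k1 \<le> cosf z")
      case True
      have "k1 * (P * R) \<le> cosf z * (P * R)" using True pos R0 by (intro mult_right_mono) auto
      moreover have "k1 * (P\<^sup>2 + R\<^sup>2) \<le> k1 * (2 * (P * R))" using PR k1 by (intro mult_left_mono_neg) auto
      ultimately have "(1 + k1) * (P\<^sup>2 + R\<^sup>2) \<le> (norm (snd z + tm i *\<^sub>R fst z))\<^sup>2"
        unfolding W by (simp add: distrib_right)
      moreover have "c * bsq i z \<le> (1 + k1) * bsq i z" using c b0 by (intro mult_right_mono)
      moreover have "0 \<le> phi z * (norm (snd z))\<^sup>2" by (simp add: phi_nonneg)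
      ultimately show ?thesis unfolding Dn_def bsq by linarith
    next
      case False
      have "-1 \<le> cosf z"
        using Cauchy_Schwarz_ineq2[of "snd z" "fst z"] pos unfolding cosf_def cosang_def P_def
        by (simp add: divide_simps abs_le_iff)
      then have "- 1 * (P * R) \<le> cosf z * (P * R)" using pos R0 by (intro mult_right_mono) auto
      then have w: "(P - R)\<^sup>2 \<le> (norm (snd z + tm i *\<^sub>R fst z))\<^sup>2"
        unfolding W by (simp add: power2_eq_square algebra_simps)
      have "f0 \<le> phi z"
      proof -
        have "kap2 - k1 \<le> kap2 - cosf z" "0 < kap2 - k1" using False k1 by auto
        then have "- 1 / (kap2 - k1) \<le> - 1 / (kap2 - cosf z)"
          by (simp add: frac_le)
        then show ?thesis
          using False k1 by (simp add: f0_def phi_def bump_def)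
      qed
      then have ph: "f0 * P\<^sup>2 \<le> phi z * (norm (snd z))\<^sup>2" by (simp add: P_def mult_right_mono)
      \<comment> \<open>The difference of the two sides is (2P - R)^2.\<close>
      have "R\<^sup>2 \<le> 2 * (P - R)\<^sup>2 + 2 * P\<^sup>2"
        using sum_squares_ge_zero[of "2 * P - R" 0] by (simp add: power2_eq_square algebra_simps)
      then have "bsq i z \<le> 2 * (P - R)\<^sup>2 + 3 * P\<^sup>2" unfolding bsq by simp
      also have "\<dots> \<le> (2 + 3 / f0) * ((P - R)\<^sup>2 + f0 * P\<^sup>2)"
        using f0 by (simp add: algebra_simps)
      also have "\<dots> \<le> (2 + 3 / f0) * Dn i z"
        unfolding Dn_def using w ph f0 by (intro mult_left_mono) (auto intro: add_nonneg_nonneg)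
      finally have le: "bsq i z \<le> (2 + 3 / f0) * Dn i z" .
      have "c * bsq i z \<le> 1 / (2 + 3 / f0) * bsq i z" using c b0 by (intro mult_right_mono)
      also have "\<dots> \<le> Dn i z" using le f0 by (simp add: divide_simps add_pos_pos) (simp add: algebra_simps)
      finally show ?thesis .
    qed
  qed
  then show thesis using that c(1) by blast
qed

lemma bsq_pos: "z \<in> Omega \<Longrightarrow> 0 < bsq i z"
  unfolding bsq_def by (rule add_pos_nonneg) (use sigma in \<open>auto simp: Omega_def\<close>)

lemma Dn_pos:
  assumes "z \<in> Omega"
  shows "0 < Dn i z"
proof -
  obtain c where "0 < c" "c * bsq i z \<le> Dn i z"
    using Dn_lower assms by metis
  then show ?thesis
    using mult_pos_pos[OF \<open>0 < c\<close> bsq_pos[OF assms, of i]] by linarith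
qed

lemma partition_identity:
  assumes "z \<in> Omega"
  shows "(\<Sum>b\<in>Basis. av b i z * wv b i z) + cv i z = 1"
proof -
  have "(\<Sum>b\<in>Basis. wv b i z * wv b i z) = (norm (snd z + tm i *\<^sub>R fst z))\<^sup>2"
    unfolding norm_sq_eq_sum by (simp add: wv_def inner_add_left power2_eq_square)
  then have "(\<Sum>b\<in>Basis. wv b i z * wv b i z) + phi z * (norm (snd z))\<^sup>2 = Dn i z"
    by (simp add: Dn_def)
  moreover have "(\<Sum>b\<in>Basis. av b i z * wv b i z) + cv i z =
      ((\<Sum>b\<in>Basis. wv b i z * wv b i z) + phi z * (norm (snd z))\<^sup>2) * Dn i z powr (-1)"
    unfolding av_def cv_def distrib_right sum_distrib_right by (simp only: mult_ac)
  ultimately show ?thesis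
    using Dn_pos[OF assms, of i] by (simp add: powr_minus)
qed

lemma Omega_norm_bounds:
  assumes "z \<in> Omega"
  shows "1 \<le> 2 / \<sigma> * norm (fst z)" "1 \<le> 2 / \<sigma> * norm (snd z)"
  using assms sigma by (auto simp: Omega_def field_simps)

text \<open>Derivatives of a squared norm have lower degree and would be dominated by lower powers
  of the norm. Since the norms are at least \<open>\<sigma> / 2\<close> on \<open>Omega\<close>,
  those powers are bounded by multiples of the square, which fixes the constant C.\<close>

lemma sym_normsq_fst: "symn n Omega (\<lambda>i z. (norm (fst z))\<^sup>2) (\<lambda>(i::par) z. (norm (fst (z :: 'a::euclidean_space \<times> 'a)))\<^sup>2)"
  and sym_normsq_snd: "symn n Omega (\<lambda>i z. (norm (snd z))\<^sup>2) (\<lambda>(i::par) z. (norm (snd (z :: 'a::euclidean_space \<times> 'a)))\<^sup>2)"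
proof -
  define C where "C = 1 + 2 / \<sigma> + (2 / \<sigma>)\<^sup>2"
  have C: "0 \<le> C" using sigma by (simp add: C_def)
  have le: "x\<^sup>2 \<le> C * x\<^sup>2" "x \<le> C * x\<^sup>2" "1 \<le> C * x\<^sup>2" if "1 \<le> 2 / \<sigma> * x" "0 \<le> x" for x :: real
  proof -
    have "0 \<le> 2 / \<sigma>" using sigma by simp
    have "x * 1 \<le> x * (2 / \<sigma> * x)" using that by (intro mult_left_mono) auto
    then have 1: "x \<le> 2 / \<sigma> * x\<^sup>2" by (simp add: power2_eq_square mult_ac)
    have "1 * 1 \<le> (2 / \<sigma> * x) * (2 / \<sigma> * x)" using that by (intro mult_mono) auto
    then have 2: "1 \<le> (2 / \<sigma>)\<^sup>2 * x\<^sup>2" by (simp add: power2_eq_square mult_ac)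
    have 3: "0 \<le> 2 / \<sigma> * x\<^sup>2" using sigma by auto
    show "x\<^sup>2 \<le> C * x\<^sup>2" "x \<le> C * x\<^sup>2" "1 \<le> C * x\<^sup>2"
      using 1 2 3 zero_le_power2[of x] unfolding C_def distrib_right by linarith+
  qed
  note lef = le[OF Omega_norm_bounds(1) norm_ge_zero] and les = le[OF Omega_norm_bounds(2) norm_ge_zero]
  have "symn n Omega (\<lambda>i z. (norm (fst z))\<^sup>2) (\<lambda>(i::par) z. 0 + 1 * (norm (fst (z :: 'a \<times> 'a)))\<^sup>2)"
    by (rule sym_quadratic[OF bounded_linear_fst norm_Basis_prod(1) C]) (simp_all add: lef)
  then show "symn n Omega (\<lambda>i z. (norm (fst z))\<^sup>2) (\<lambda>(i::par) z. (norm (fst (z :: 'a \<times> 'a)))\<^sup>2)" by simp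
  have "symn n Omega (\<lambda>i z. (norm (snd z))\<^sup>2) (\<lambda>(i::par) z. 0 + 1 * (norm (snd (z :: 'a \<times> 'a)))\<^sup>2)"
    by (rule sym_quadratic[OF bounded_linear_snd norm_Basis_prod(2) C]) (simp_all add: les)
  then show "symn n Omega (\<lambda>i z. (norm (snd z))\<^sup>2) (\<lambda>(i::par) z. (norm (snd (z :: 'a \<times> 'a)))\<^sup>2)" by simp
qed

lemma sym_coord_fst: "b \<in> Basis \<Longrightarrow> symn n Omega (\<lambda>i z. norm (fst z)) (\<lambda>(i::par) z. fst (z :: 'a::euclidean_space \<times> 'a) \<bullet> b)"
  and sym_coord_snd: "b \<in> Basis \<Longrightarrow> symn n Omega (\<lambda>i z. norm (snd z)) (\<lambda>(i::par) z. snd (z :: 'a::euclidean_space \<times> 'a) \<bullet> b)"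
  and sym_tcoord_fst: "b \<in> Basis \<Longrightarrow> symn n Omega (\<lambda>i z. tm i * norm (fst z)) (\<lambda>(i::par) z. tm i * (fst (z :: 'a::euclidean_space \<times> 'a) \<bullet> b))"
proof -
  assume b: "b \<in> (Basis :: 'a set)"
  define C where "C = 1 + 2 / \<sigma>"
  have C: "0 \<le> C" using sigma by (simp add: C_def)
  have ib: "\<bar>x \<bullet> b\<bar> \<le> norm x" for x using Basis_le_norm[OF b] .
  have le: "y \<le> C * x" if "1 \<le> 2 / \<sigma> * x" "0 \<le> x" "y \<le> x \<or> y \<le> 1" for x y :: real
    using that unfolding C_def distrib_right by (elim disjE) linarith+
  have bl: "bounded_linear (\<lambda>z::'a \<times> 'a. fst z \<bullet> b)" "bounded_linear (\<lambda>z::'a \<times> 'a. snd z \<bullet> b)"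
    by (intro bounded_linear_compose[OF bounded_linear_inner_left] bounded_linear_fst bounded_linear_snd)+
  have z1: "norm (fst z \<bullet> b) \<le> C * norm (fst z)" and z2: "norm (snd z \<bullet> b) \<le> C * norm (snd z)"
    if z: "z \<in> Omega" for z :: "'a \<times> 'a"
    using le[OF Omega_norm_bounds(1)[OF z] norm_ge_zero disjI1[OF ib[of "fst z"]]]
      le[OF Omega_norm_bounds(2)[OF z] norm_ge_zero disjI1[OF ib[of "snd z"]]] by simp_all
  have v1: "norm (fst v \<bullet> b) \<le> C * norm (fst z)" and v2: "norm (snd v \<bullet> b) \<le> C * norm (snd z)"
    if z: "z \<in> Omega" and v: "v \<in> Basis" for z v :: "'a \<times> 'a"
    using le[OF Omega_norm_bounds(1)[OF z] norm_ge_zero disjI2[OF order_trans[OF ib[of "fst v"] norm_Basis_prod(1)[OF v]]]]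
      le[OF Omega_norm_bounds(2)[OF z] norm_ge_zero disjI2[OF order_trans[OF ib[of "snd v"] norm_Basis_prod(2)[OF v]]]] by simp_all
  have "symn n Omega (\<lambda>i z. norm (fst z)) (\<lambda>(i::par) z. 1 *\<^sub>R (fst (z :: 'a \<times> 'a) \<bullet> b))"
    by (rule sym_linear[OF bl(1) C]) (use z1 v1 in simp_all)
  then show "symn n Omega (\<lambda>i z. norm (fst z)) (\<lambda>(i::par) z. fst (z :: 'a \<times> 'a) \<bullet> b)" by simp
  have "symn n Omega (\<lambda>i z. norm (snd z)) (\<lambda>(i::par) z. 1 *\<^sub>R (snd (z :: 'a \<times> 'a) \<bullet> b))"
    by (rule sym_linear[OF bl(2) C]) (use z2 v2 in simp_all)
  then show "symn n Omega (\<lambda>i z. norm (snd z)) (\<lambda>(i::par) z. snd (z :: 'a \<times> 'a) \<bullet> b)" by simp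
  have "symn n Omega (\<lambda>i z. tm i * norm (fst z)) (\<lambda>(i::par) z. tm i *\<^sub>R (fst (z :: 'a \<times> 'a) \<bullet> b))"
  proof (rule sym_linear[OF bl(1) C])
    fix i :: par and z v :: "'a \<times> 'a" assume z: "z \<in> Omega"
    from mult_left_mono[OF z1[OF z] tm_nonneg[of i]]
    show "\<bar>tm i\<bar> * norm (fst z \<bullet> b) \<le> C * (tm i * norm (fst z))"
      using tm_nonneg[of i] by (simp add: mult_ac)
    assume v: "v \<in> Basis"
    from mult_left_mono[OF v1[OF z v] tm_nonneg[of i]]
    show "\<bar>tm i\<bar> * norm (fst v \<bullet> b) \<le> C * (tm i * norm (fst z))"
      using tm_nonneg[of i] by (simp add: mult_ac)
  qed
  then show "symn n Omega (\<lambda>i z. tm i * norm (fst z)) (\<lambda>(i::par) z. tm i * (fst (z :: 'a \<times> 'a) \<bullet> b))" by simp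
qed

lemma sym_wv:
  assumes b: "b \<in> Basis"
  shows "symn n Omega (\<lambda>i z. bsq i z powr (1/2)) (wv (b::'a::euclidean_space))"
proof -
  have le: "norm (snd z) \<le> bsq i z powr (1/2)" "tm i * norm (fst z) \<le> bsq i z powr (1/2)" for i and z :: "'a \<times> 'a"
    by (simp_all add: powr_half_sqrt bsq_def real_le_rsqrt power_mult_distrib)
  have "symn n Omega (\<lambda>i z. bsq i z powr (1/2)) (\<lambda>i z. snd (z :: 'a \<times> 'a) \<bullet> b + tm i * (fst z \<bullet> b))"
    by (intro sym_add sym_weaken[OF sym_coord_snd[OF b], where c = 1] sym_weaken[OF sym_tcoord_fst[OF b], where c = 1])
      (use le in auto)
  then show ?thesis by (simp add: wv_def[abs_def])
qed

text \<open>The cosine is a sum of products of coordinates times negative powers of the squared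
  norms. All factors are symbols of the weight of their own size, and the weights multiply to
  1.\<close>

lemma sym_cosf: "symn n Omega (\<lambda>_ _. 1) (\<lambda>(i::par) z. cosf (z :: 'a::euclidean_space \<times> 'a))"
proof -
  let ?X = "\<lambda>z::'a \<times> 'a. (norm (fst z))\<^sup>2" and ?Y = "\<lambda>z::'a \<times> 'a. (norm (snd z))\<^sup>2"
  have pos: "0 < ?X z" "0 < ?Y z" if "z \<in> Omega" for z
    using that sigma by (auto simp: Omega_def)
  have "symn n Omega (\<lambda>i z. norm (snd z) * norm (fst z)) (\<lambda>(i::par) z. \<Sum>b\<in>Basis. (snd z \<bullet> b) * (fst (z :: 'a \<times> 'a) \<bullet> b))"
    by (intro sym_sum sym_mult sym_coord_fst sym_coord_snd) auto
  note sum = this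
  have p1: "symn n Omega (\<lambda>i z. ?Y z powr (-1/2)) (\<lambda>(i::par) z. ?Y z powr (-1/2))"
    by (rule sym_powr[OF sym_normsq_snd, of 1]) (simp_all only: pos mult_1_left order_refl zero_less_one)
  have p2: "symn n Omega (\<lambda>i z. ?X z powr (-1/2)) (\<lambda>(i::par) z. ?X z powr (-1/2))"
    by (rule sym_powr[OF sym_normsq_fst, of 1]) (simp_all only: pos mult_1_left order_refl zero_less_one)
  have half: "(r\<^sup>2) powr (-1/2) = 1 / r" if "0 \<le> r" for r :: real
  proof -
    have "(r\<^sup>2) powr (-1/2) = (r\<^sup>2) powr (- (1/2))" by (simp only: minus_divide_left)
    also have "\<dots> = 1 / r"
      unfolding powr_minus powr_half_sqrt[OF zero_le_power2] real_sqrt_abs abs_of_nonneg[OF that]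
      by (simp only: divide_inverse mult_1_left)
    finally show ?thesis .
  qed
  have c: "cosf z = (\<Sum>b\<in>Basis. (snd z \<bullet> b) * (fst z \<bullet> b)) * (?Y z powr (-1/2) * ?X z powr (-1/2))" for z
    unfolding half[OF norm_ge_zero] cosf_def cosang_def
    by (subst euclidean_inner) (simp only: divide_inverse mult_1_left inverse_mult_distrib)
  note prod = sym_mult[OF sum sym_mult[OF p1 p2], folded c]
  have le: "norm (snd z) * norm (fst z) * (?Y z powr (-1/2) * ?X z powr (-1/2)) \<le> 1 * 1" if "z \<in> Omega" for z
    unfolding half[OF norm_ge_zero] using pos[OF that] by simp
  show ?thesis
    by (rule sym_weaken[OF prod le zero_le_one order_refl])
qed

lemma sym_phi: "symn n Omega (\<lambda>_ _. 1) (\<lambda>(i::par) z. phi (z :: 'a::euclidean_space \<times> 'a))"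
proof -
  have "symn n Omega (\<lambda>_ _. 1) (\<lambda>(i::par) z. kap2 + (- 1) *\<^sub>R cosf (z :: 'a \<times> 'a))"
    by (intro sym_add sym_bounded_linear[OF bounded_linear_scaleR_right] sym_cosf sym_const[where C = "\<bar>kap2\<bar>"]) auto
  from sym_bump[OF this, of 0] show ?thesis by (simp add: phi_def)
qed

lemma sym_phi_normsq: "symn n Omega (\<lambda>i z. (norm (snd z))\<^sup>2) (\<lambda>(i::par) z. phi z * (norm (snd (z :: 'a::euclidean_space \<times> 'a)))\<^sup>2)"
  using sym_mult[OF sym_phi sym_normsq_snd] by simp

lemma sym_Dn: "symn n Omega bsq (Dn :: par \<Rightarrow> 'a::euclidean_space \<times> 'a \<Rightarrow> real)"
proof -
  have sq: "bsq i z powr (1/2) * bsq i z powr (1/2) = bsq i z" for i and z :: "'a \<times> 'a"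
    by (simp add: powr_half_sqrt bsq_def add_nonneg_nonneg)
  have "symn n Omega (\<lambda>i z. bsq i z powr (1/2) * bsq i z powr (1/2)) (\<lambda>i (z :: 'a \<times> 'a). \<Sum>b\<in>Basis. wv b i z * wv b i z)"
    by (intro sym_sum sym_mult sym_wv) auto
  then have "symn n Omega bsq (\<lambda>i (z :: 'a \<times> 'a). \<Sum>b\<in>Basis. wv b i z * wv b i z)"
    unfolding sq by simp
  moreover have "symn n Omega bsq (\<lambda>i z. phi z * (norm (snd (z :: 'a \<times> 'a)))\<^sup>2)"
    by (rule sym_weaken[OF sym_phi_normsq, where c = 1]) (auto simp: bsq_def)
  ultimately have "symn n Omega bsq (\<lambda>i (z :: 'a \<times> 'a). (\<Sum>b\<in>Basis. wv b i z * wv b i z) + phi z * (norm (snd z))\<^sup>2)"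
    by (rule sym_add)
  moreover have "(\<Sum>b\<in>Basis. wv b i z * wv b i z) = (norm (snd z + tm i *\<^sub>R fst z))\<^sup>2" for i and z :: "'a \<times> 'a"
    unfolding norm_sq_eq_sum by (simp add: wv_def inner_add_left power2_eq_square)
  ultimately show ?thesis by (simp add: Dn_def[abs_def])
qed

text \<open>\<open>Dn_lower\<close> is the ellipticity that \<open>sym_powr\<close> demands, with
  one constant for all times. Hence the field w/\<open>Dn\<close> has size
  \<open>bsq i z powr (-1/2)\<close> even near zeros of w.\<close>

lemma sym_Dn_inv: "symn n Omega (\<lambda>i z. bsq i z powr (-1)) (\<lambda>i (z :: 'a::euclidean_space \<times> 'a). Dn i z powr (-1))"
proof -
  obtain c where "0 < c" "\<And>i (z :: 'a \<times> 'a). z \<in> Omega \<Longrightarrow> c * bsq i z \<le> Dn i z"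
    using Dn_lower by metis
  then show ?thesis
    by (intro sym_powr[OF sym_Dn, of c] bsq_pos)
qed

lemma sym_av:
  assumes b: "b \<in> Basis"
  shows "symn n Omega (\<lambda>i z. bsq i z powr (-1/2)) (av (b::'a::euclidean_space))"
proof -
  have "symn n Omega (\<lambda>i z. bsq i z powr (1/2) * bsq i z powr (-1)) (\<lambda>i (z :: 'a \<times> 'a). wv b i z * Dn i z powr (-1))"
    by (intro sym_mult sym_wv sym_Dn_inv b)
  moreover have "bsq i z powr (1/2) * bsq i z powr (-1) = bsq i z powr (-1/2)" for i and z :: "'a \<times> 'a"
    by (simp only: powr_add[symmetric]) simp
  ultimately show ?thesis
    by (simp only: av_def[abs_def])
qed

lemma sym_cv: "symn n Omega (\<lambda>i z. (norm (snd z))\<^sup>2 * bsq i z powr (-1)) (cv :: par \<Rightarrow> 'a::euclidean_space \<times> 'a \<Rightarrow> real)"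
  using sym_mult[OF sym_phi_normsq sym_Dn_inv] by (simp only: cv_def[abs_def])

text \<open>The lower bound on |\<open>\<xi>\<close>| turns t|\<open>\<xi>\<close>| into t, that is,
  vanishing velocities are excluded; the lower bound on |y| takes care of the constant 1.\<close>

lemma lamsq_le_bsq:
  obtains c where "1 \<le> c" "\<And>i z. z \<in> Omega \<Longrightarrow> lamsq i z \<le> c * bsq i z"
proof -
  define c where "c = 1 + (2 / \<sigma>)\<^sup>2"
  have "lamsq i z \<le> c * bsq i z" if z: "z \<in> Omega" for i and z :: "'a \<times> 'a"
  proof -
    have 1: "1 \<le> (2 / \<sigma> * norm (fst z))\<^sup>2" "1 \<le> (2 / \<sigma> * norm (snd z))\<^sup>2"
      using Omega_norm_bounds[OF z] by (auto simp: one_le_power)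
    have "(tm i)\<^sup>2 * 1 \<le> (tm i)\<^sup>2 * (2 / \<sigma> * norm (fst z))\<^sup>2"
      using 1 by (intro mult_left_mono) auto
    moreover have "0 \<le> (tm i)\<^sup>2 * (norm (fst z))\<^sup>2" by simp
    moreover have "c * bsq i z = (norm (snd z))\<^sup>2 + (tm i)\<^sup>2 * (norm (fst z))\<^sup>2 + (2 / \<sigma> * norm (snd z))\<^sup>2
        + (tm i)\<^sup>2 * (2 / \<sigma> * norm (fst z))\<^sup>2"
      unfolding bsq_def c_def power_mult_distrib by (simp only: algebra_simps mult_1_left mult_1_right)
    ultimately show ?thesis
      using 1(2) unfolding lamsq_def by linarith
  qed
  then show thesis using that[of c] by (simp add: c_def)
qed

end

section \<open>Symbol classes with rapid decay in the incoming cone\<close>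

lemma powr_minus_le_one: "1 \<le> x \<Longrightarrow> 0 \<le> a \<Longrightarrow> x powr (- a) \<le> 1" for x a :: real
  using powr_mono2'[of "- a" 1 x] by simp

context outgoing
begin

text \<open>The power of \<open>regsq\<close> is carried along unchanged and serves for absolute
  convergence in \<open>\<xi>\<close>; k is the order gained by integrations by parts, and l is the
  decay in y used in the cone.\<close>

definition wt :: "real \<Rightarrow> real \<Rightarrow> par \<Rightarrow> 'a::euclidean_space \<times> 'a \<Rightarrow> real" where
  "wt k l i z = regsq i z powr (- M) * lamsq i z powr (- k / 2) * jsq i z powr (- l / 2)"

lemma wt_nonneg: "0 \<le> wt k l i z"
  by (simp add: wt_def)

text \<open>The order \<open>k\<close> counts powers of \<open>1/(1 + |y|\<^sup>2 + t\<^sup>2)\<^sup>1\<^sup>/\<^sup>2\<close>; in the incoming cone \<open>Gamma\<close>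
  the symbols decay rapidly in \<open>y\<close>.\<close>
definition cls :: "real \<Rightarrow> (par \<Rightarrow> 'a::euclidean_space \<times> 'a \<Rightarrow> complex) \<Rightarrow> bool" where
  "cls k q \<longleftrightarrow> symb UNIV (wt k 0) q \<and> (\<forall>l\<ge>0. symb Gamma (wt k l) q) \<and> (\<forall>i z. z \<notin> Kset \<longrightarrow> q i z = 0)"

lemma cls_zero: "cls k q \<Longrightarrow> z \<notin> Kset \<Longrightarrow> q i z = 0"
  unfolding cls_def by blast

lemma cls_sym0: "cls k q \<Longrightarrow> sym0 UNIV (wt k 0) q"
  unfolding cls_def symb_def by (metis sym_imp_sym0)

text \<open>The derivative families obtained for the various weights coincide by uniqueness, and the
  support condition survives because the complement of \<open>Kset\<close> is open.\<close>

lemma cls_deriv: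
  assumes q: "cls k q" and v: "v \<in> Basis"
  obtains q' where "\<And>i z. ((\<lambda>s. q i (z + s *\<^sub>R v)) has_vector_derivative q' i z) (at 0)" "cls k q'"
proof -
  obtain q' where q': "\<And>i z. ((\<lambda>s. q i (z + s *\<^sub>R v)) has_vector_derivative q' i z) (at 0)" "symb UNIV (wt k 0) q'"
    using symb_deriv[of UNIV "wt k 0" q v] q v unfolding cls_def by auto
  have "symb Gamma (wt k l) q'" if l: "0 \<le> l" for l
  proof -
    obtain b where b: "\<And>i z. z \<in> Gamma \<Longrightarrow> ((\<lambda>s. q i (z + s *\<^sub>R v)) has_vector_derivative b i z) (at 0)" "symb Gamma (wt k l) b"
      using symb_deriv[of Gamma "wt k l" q v] q v l open_Gamma unfolding cls_def by auto
    have "b i z = q' i z" if "z \<in> Gamma" for i z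
      by (rule vector_derivative_unique_at[OF b(1)[OF that] q'(1)])
    then show ?thesis
      using b(2) sym_cong[OF _ open_Gamma] unfolding symb_def by blast
  qed
  moreover have "q' i z = 0" if "z \<notin> Kset" for i z
  proof -
    have "((\<lambda>s. q i (z + s *\<^sub>R v)) has_vector_derivative 0) (at 0)"
      by (rule directional_derivative_cong[of "- Kset" z "\<lambda>_. 0"]) (use that closed_Kset cls_zero[OF q] in \<open>auto\<close>)
    then show ?thesis
      using vector_derivative_unique_at[OF q'(1)[of i z]] by auto
  qed
  ultimately have "cls k q'"
    using q'(2) by (auto simp: cls_def)
  with q'(1) that show thesis by blast
qed

lemma bsq_powr_le:
  fixes a :: real
  assumes "0 \<le> a"
  obtains c where "0 \<le> c" "\<And>i (z :: 'a::euclidean_space \<times> 'a). z \<in> Omega \<Longrightarrow> bsq i z powr (- a) \<le> c * lamsq i z powr (- a)"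
proof -
  obtain c where c: "1 \<le> c" "\<And>i (z :: 'a \<times> 'a). z \<in> Omega \<Longrightarrow> lamsq i z \<le> c * bsq i z"
    using lamsq_le_bsq by metis
  have "bsq i z powr (- a) \<le> c powr a * lamsq i z powr (- a)" if z: "z \<in> Omega" for i and z :: "'a \<times> 'a"
  proof -
    have "(c * bsq i z) powr (- a) \<le> lamsq i z powr (- a)"
      using c(2)[OF z, of i] lamsq_ge_1[of i z] assms by (intro powr_mono2') auto
    then have "c powr a * (c powr (- a) * bsq i z powr (- a)) \<le> c powr a * lamsq i z powr (- a)"
      using c(1) bsq_pos[OF z, of i] by (intro mult_left_mono) (auto simp: powr_mult)
    moreover have "c powr a * (c powr (- a) * bsq i z powr (- a)) = bsq i z powr (- a)"
      using c(1) by (simp add: mult.assoc[symmetric] powr_add[symmetric])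
    ultimately show ?thesis by simp
  qed
  then show thesis by (intro that[of "c powr a"]) auto
qed

lemma sym_of_real:
  "symn n \<Omega> \<mu> a \<Longrightarrow> symn n \<Omega> \<mu> (\<lambda>i z. complex_of_real (a i z))"
  by (rule sym_bounded_linear[OF bounded_linear_of_real])

text \<open>On \<open>Omega\<close> the field has size \<open>bsq i z powr (-1/2)\<close>, which
  \<open>lamsq_le_bsq\<close> converts into one order. The field is a symbol only there, so the
  product is first estimated on \<open>Omega\<close> and then extended by zero from
  \<open>Kset\<close>.\<close>

lemma cls_mult_av:
  assumes q: "cls k q" and b: "b \<in> Basis"
  shows "cls (k + 1) (\<lambda>i z. complex_of_real (av (b::'a::euclidean_space) i z) * q i z)"
proof -
  obtain c where c: "0 \<le> c" "\<And>i (z :: 'a \<times> 'a). z \<in> Omega \<Longrightarrow> bsq i z powr (- (1/2)) \<le> c * lamsq i z powr (- (1/2))"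
    using bsq_powr_le[of "1/2"] by auto
  have w: "bsq i z powr (-1/2) * wt k l i z \<le> c * wt (k + 1) l i z" if "z \<in> Omega" for l i and z :: "'a \<times> 'a"
  proof -
    have "bsq i z powr (- (1/2)) * wt k l i z \<le> (c * lamsq i z powr (- (1/2))) * wt k l i z"
      by (intro mult_right_mono c(2) that wt_nonneg)
    also have "\<dots> = c * wt (k + 1) l i z"
    proof -
      have "lamsq i z powr (- (1/2)) * lamsq i z powr (- k / 2) = lamsq i z powr (- (k + 1) / 2)"
        by (simp only: powr_add[symmetric]) (simp add: field_simps)
      moreover have "(c * L) * (R * L' * J) = c * (R * (L * L') * J)" for L R L' J :: real
        by (simp only: mult_ac)
      ultimately show ?thesis unfolding wt_def by (simp only:)
    qed
    finally show ?thesis by simp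
  qed
  have G: "Gamma \<subseteq> Omega" by (auto simp: Gamma_def)
  have p: "symn n U (wt (k + 1) l) (\<lambda>i z. complex_of_real (av b i z) * q i z)"
    if "symn n U (wt k l) q" "U \<subseteq> Omega" for n U l
    by (rule sym_weaken[OF sym_mult[OF sym_of_real[OF sym_subset[OF sym_av[OF b] that(2)]] that(1)], where c = c])
      (use w that c in auto)
  have 1: "symn n Omega (wt (k + 1) 0) (\<lambda>i z. complex_of_real (av b i z) * q i z)" for n
    by (rule p) (use q in \<open>auto simp: cls_def symb_def intro: sym_subset\<close>)
  have "symn n UNIV (wt (k + 1) 0) (\<lambda>i z. complex_of_real (av b i z) * q i z)" for n
    by (rule sym_extend_by_zero[OF 1 open_Omega closed_Kset Kset_subset_Omega])
      (use q in \<open>auto simp: cls_def wt_nonneg\<close>)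
  moreover have "symn n Gamma (wt (k + 1) l) (\<lambda>i z. complex_of_real (av b i z) * q i z)" if "0 \<le> l" for n l
    by (rule p[OF _ G]) (use q that in \<open>auto simp: cls_def symb_def\<close>)
  ultimately show ?thesis
    using q by (auto simp: cls_def symb_def)
qed

text \<open>The size of \<open>cv\<close> is |y|^2/\<open>bsq\<close>, and the factor |y|^2 would
  destroy the gain. But \<open>cv\<close> lives in the cone, where q decays at any rate: decay of
  index l + 2 in place of l pays for |y|^2. The remaining inverse power of \<open>bsq\<close> yields
  the order.\<close>

lemma cls_mult_cv:
  assumes q: "cls k q"
  shows "cls (k + 1) (\<lambda>i z. complex_of_real (cv i (z :: 'a::euclidean_space \<times> 'a)) * q i z)"
proof -
  obtain c where c: "0 \<le> c" "\<And>i (z :: 'a \<times> 'a). z \<in> Omega \<Longrightarrow> bsq i z powr (- 1) \<le> c * lamsq i z powr (- 1)"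
    using bsq_powr_le[of 1] by auto
  have w: "(norm (snd z))\<^sup>2 * bsq i z powr (-1) * wt k (l + 2) i z \<le> c * wt (k + 1) l i z" if "z \<in> Omega" for l i and z :: "'a \<times> 'a"
  proof -
    have 1: "lamsq i z powr (-1) \<le> lamsq i z powr (- (1/2))"
      using lamsq_ge_1[of i z] by (intro powr_mono) auto
    have "bsq i z powr (-1) \<le> c * lamsq i z powr (- (1/2))"
      by (rule order_trans[OF c(2)[OF that] mult_left_mono[OF 1 c(1)]])
    then have "(norm (snd z))\<^sup>2 * bsq i z powr (-1) \<le> jsq i z * (c * lamsq i z powr (- (1/2)))"
      by (intro mult_mono) (auto simp: jsq_def)
    then have "(norm (snd z))\<^sup>2 * bsq i z powr (-1) * wt k (l + 2) i z \<le> jsq i z * (c * lamsq i z powr (- (1/2))) * wt k (l + 2) i z"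
      by (intro mult_right_mono wt_nonneg)
    also have "\<dots> = c * wt (k + 1) l i z"
    proof -
      have "lamsq i z powr (- (1/2)) * lamsq i z powr (- k / 2) = lamsq i z powr (- (k + 1) / 2)"
        by (simp only: powr_add[symmetric]) (simp add: field_simps)
      moreover have "jsq i z * jsq i z powr (- (l + 2) / 2) = jsq i z powr (- l / 2)"
      proof -
        have "jsq i z * jsq i z powr (- (l + 2) / 2) = jsq i z powr 1 * jsq i z powr (- (l + 2) / 2)"
          using jsq_ge_1[of i z] by simp
        also have "\<dots> = jsq i z powr (- l / 2)"
          by (simp only: powr_add[symmetric]) (simp add: field_simps)
        finally show ?thesis .
      qed
      moreover have "J * (c * L) * (R * L' * J') = c * (R * (L * L') * (J * J'))" for J L R L' J' :: real
        by (simp only: mult_ac)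
      ultimately show ?thesis unfolding wt_def by (simp only:)
    qed
    finally show ?thesis .
  qed
  have G: "Gamma \<subseteq> Omega" by (auto simp: Gamma_def)
  have p: "symn n Gamma (wt (k + 1) l) (\<lambda>i z. complex_of_real (cv i z) * q i z)" if "0 \<le> l" for n l
  proof (rule sym_weaken[OF sym_mult[OF sym_of_real[OF sym_subset[OF sym_cv G]]], where c = c])
    show "symn n Gamma (wt k (l + 2)) q" using q that by (auto simp: cls_def symb_def)
    show "(norm (snd z))\<^sup>2 * bsq i z powr (-1) * wt k (l + 2) i z \<le> c * wt (k + 1) l i z" if "z \<in> Gamma" for i and z :: "'a \<times> 'a"
      by (rule w[OF subsetD[OF G that]])
  qed (use c in auto)
  have z0: "complex_of_real (cv i z) * q i z = 0" if "z \<notin> K2set" for i z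
  proof (cases "z \<in> Kset")
    case True
    then have "kap2 < cosf z" using that by (auto simp: K2set_def)
    then show ?thesis by (simp add: cv_def phi_def bump_def)
  next
    case False
    then show ?thesis using cls_zero[OF q] by simp
  qed
  have "symn n UNIV (wt (k + 1) 0) (\<lambda>i z. complex_of_real (cv i z) * q i z)" for n
    by (rule sym_extend_by_zero[OF p open_Gamma closed_K2set K2set_subset_Gamma z0 wt_nonneg]) simp
  with p show ?thesis
    using q by (auto simp: cls_def symb_def)
qed

text \<open>Multiplication by the power k/2 of \<open>lamsq\<close> normalises the symbol to order
  zero, which gives the hypothesis of Calderon-Vaillancourt with one bound for all times and
  regularisations.\<close>

lemma cls_bdd_mixed:
  assumes q: "cls k q" and vs: "set vs \<subseteq> Basis"
  shows "\<exists>B. \<forall>i. bdd_mixed B vs (\<lambda>z. complex_of_real (lamsq i z powr (k / 2)) * q i (z :: 'a::euclidean_space \<times> 'a))"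
proof (rule sym_imp_bdd_mixed[OF _ vs])
  have "symn (length vs) UNIV (\<lambda>i z. lamsq i z powr (k / 2) * wt k 0 i z) (\<lambda>i z. complex_of_real (lamsq i z powr (k / 2)) * q i z)"
    by (intro sym_mult sym_of_real sym_lamsq_powr) (use q in \<open>auto simp: cls_def symb_def\<close>)
  then show "symn (length vs) UNIV (\<lambda>_ _. 1) (\<lambda>i z. complex_of_real (lamsq i z powr (k / 2)) * q i z)"
  proof (rule sym_weaken[where c = 1])
    show "lamsq i z powr (k / 2) * wt k 0 i z \<le> 1 * 1" for i and z :: "'a \<times> 'a"
    proof -
      have "lamsq i z powr (k / 2) * wt k 0 i z = regsq i z powr (- M) * (lamsq i z powr (k / 2) * lamsq i z powr (- k / 2))"
        using jsq_ge_1[of i z] by (simp add: wt_def)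
      also have "lamsq i z powr (k / 2) * lamsq i z powr (- k / 2) = 1"
        using lamsq_ge_1[of i z] by (simp add: powr_add[symmetric])
      also have "regsq i z powr (- M) \<le> 1"
        using regsq_ge_1[of i z] M by (rule powr_minus_le_one)
      finally show ?thesis by simp
    qed
  qed auto
qed

lemma cls_measurable:
  assumes "cls k q"
  shows "q i \<in> borel_measurable borel"
  using cls_sym0[OF assms] unfolding sym0_def by (intro borel_measurable_continuous_onI) blast

lemma cls_continuous:
  assumes "cls k q"
  shows "continuous_on UNIV (q i)"
  using cls_sym0[OF assms] unfolding sym0_def by blast

lemma cls_bound:
  assumes "cls k q" "0 \<le> k"
  shows "\<exists>C\<ge>0. \<forall>i z. cmod (q i z) \<le> C * regsq i z powr (- M)"
proof -
  obtain C where C: "C \<ge> 0" "\<And>i z. cmod (q i z) \<le> C * wt k 0 i z"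
    using cls_sym0[OF assms(1)] unfolding sym0_def by auto
  have "wt k 0 i z \<le> regsq i z powr (- M)" for i and z :: "'a \<times> 'a"
  proof -
    have "lamsq i z powr (- k / 2) \<le> 1"
      using powr_minus_le_one[OF lamsq_ge_1[of i z], of "k / 2"] assms(2) by simp
    then show ?thesis
      using jsq_ge_1[of i z] by (simp add: wt_def mult_left_le)
  qed
  then show ?thesis
    using C by (meson mult_left_mono order_trans)
qed

end

subsection \<open>Rapidly decaying functions\<close>

text \<open>No smoothness is required, so the class is stable under truncation and under
  polynomially bounded multipliers.\<close>
definition rapid :: "('a::euclidean_space \<Rightarrow> complex) \<Rightarrow> bool" where
  "rapid f \<longleftrightarrow> f \<in> borel_measurable borel \<and> (\<forall>k::nat. \<exists>C. \<forall>y. jb y ^ k * cmod (f y) \<le> C)"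

lemma rapid_measurable: "rapid f \<Longrightarrow> f \<in> borel_measurable borel"
  by (simp add: rapid_def)

lemma rapid_integrable:
  fixes f :: "'a::euclidean_space \<Rightarrow> complex"
  assumes f: "rapid f"
  shows "integrable lborel f" "integrable lborel (\<lambda>y. (cmod (f y))\<^sup>2)"
proof -
  have [measurable]: "f \<in> borel_measurable borel" by (rule rapid_measurable[OF f])
  obtain C where C: "\<And>y. jb y ^ (2 * DIM('a)) * cmod (f y) \<le> C"
    using f unfolding rapid_def by blast
  have C0: "0 \<le> C" by (rule order_trans[OF _ C[of 0]]) (simp add: jb_pos less_imp_le)
  have le: "cmod (f y) \<le> C * (1 / jb y ^ (2 * DIM('a)))" for y
    using C[of y] jb_pos[of y] by (simp add: field_simps)
  show "integrable lborel f"
    by (rule Bochner_Integration.integrable_bound[OF integrable_mult_right[OF integrable_inv_jb, of C]])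
      (use le C0 jb_pos in \<open>auto simp: less_imp_le\<close>)
  have le1: "cmod (f y) \<le> C" for y
  proof -
    have "1 / jb y ^ (2 * DIM('a)) \<le> 1" using jb_ge_1[of y] by (simp add: one_le_power)
    then show ?thesis using order_trans[OF le[of y]] mult_left_mono[of _ 1 C] C0 by fastforce
  qed
  show "integrable lborel (\<lambda>y. (cmod (f y))\<^sup>2)"
  proof (rule Bochner_Integration.integrable_bound[OF integrable_mult_right[OF integrable_inv_jb, of "C * C"]])
    show "AE y in lborel. norm ((cmod (f y))\<^sup>2) \<le> norm (C * C * (1 / jb y ^ (2 * DIM('a))))"
    proof (rule AE_I2)
      fix y :: 'a
      have "cmod (f y) * cmod (f y) \<le> C * (C * (1 / jb y ^ (2 * DIM('a))))"
        by (intro mult_mono le le1 C0) auto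
      then show "norm ((cmod (f y))\<^sup>2) \<le> norm (C * C * (1 / jb y ^ (2 * DIM('a))))"
        using jb_pos[of y] C0 by (simp add: power2_eq_square)
    qed
  qed measurable
qed

lemma rapid_mult:
  assumes f: "rapid f" and g: "g \<in> borel_measurable borel" and le: "\<And>y. cmod (g y) \<le> B * jb y ^ n"
  shows "rapid (\<lambda>y. g y * f y)"
  unfolding rapid_def
proof (intro conjI allI)
  show "(\<lambda>y. g y * f y) \<in> borel_measurable borel"
    using g rapid_measurable[OF f] by measurable
  fix k
  obtain C where C: "\<And>y. jb y ^ (n + k) * cmod (f y) \<le> C"
    using f unfolding rapid_def by blast
  have B0: "0 \<le> B"
    using order_trans[OF norm_ge_zero le[of 0]] zero_less_power[OF jb_pos[of "0::'a"], of n]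
    by (simp add: zero_le_mult_iff)
  have "jb y ^ k * cmod (g y * f y) \<le> B * C" for y
  proof -
    have "jb y ^ k * cmod (g y * f y) = cmod (g y) * (jb y ^ k * cmod (f y))"
      by (simp add: norm_mult)
    also have "\<dots> \<le> (B * jb y ^ n) * (jb y ^ k * cmod (f y))"
      using jb_pos[of y] by (intro mult_right_mono le) (simp add: less_imp_le)
    also have "\<dots> = B * (jb y ^ (n + k) * cmod (f y))" by (simp add: power_add mult_ac)
    also have "\<dots> \<le> B * C" by (intro mult_left_mono C B0)
    finally show ?thesis .
  qed
  then show "\<exists>C. \<forall>y. jb y ^ k * cmod (g y * f y) \<le> C" by blast
qed

lemma rapid_mult_bounded:
  assumes "rapid f" "g \<in> borel_measurable borel" "\<And>y. cmod (g y) \<le> B"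
  shows "rapid (\<lambda>y. g y * f y)"
  by (rule rapid_mult[of f g B 0]) (use assms in auto)

lemma L2sq_cmult_unit: "(\<And>x. cmod (c x) = 1) \<Longrightarrow> L2sq (\<lambda>x. c x * g x) = L2sq g"
  by (simp add: L2sq_def norm_mult)

lemma L2sq_mono: "(\<And>x. cmod (u x) \<le> cmod (v x)) \<Longrightarrow> L2sq u \<le> L2sq v"
  unfolding L2sq_def by (intro nn_integral_mono ennreal_leI power_mono) auto

lemma L2sq_add_le:
  assumes [measurable]: "u \<in> borel_measurable borel" "v \<in> borel_measurable borel"
  shows "L2sq (\<lambda>x. u x + v x) \<le> 2 * L2sq u + 2 * L2sq v"
proof -
  have "L2sq (\<lambda>x. u x + v x) \<le> (\<integral>\<^sup>+x. 2 * ennreal ((cmod (u x))\<^sup>2) + 2 * ennreal ((cmod (v x))\<^sup>2) \<partial>lborel)"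
    unfolding L2sq_def
  proof (intro nn_integral_mono)
    fix x
    have "(cmod (u x + v x))\<^sup>2 \<le> (cmod (u x) + cmod (v x))\<^sup>2"
      by (intro power_mono norm_triangle_ineq) auto
    also have "\<dots> \<le> 2 * (cmod (u x))\<^sup>2 + 2 * (cmod (v x))\<^sup>2"
      using sum_squares_bound[of "cmod (u x)" "cmod (v x)"] by (simp add: power2_sum)
    finally have "ennreal ((cmod (u x + v x))\<^sup>2) \<le> ennreal (2 * (cmod (u x))\<^sup>2 + 2 * (cmod (v x))\<^sup>2)"
      by (rule ennreal_leI)
    also have "\<dots> = 2 * ennreal ((cmod (u x))\<^sup>2) + 2 * ennreal ((cmod (v x))\<^sup>2)"
      by (simp add: ennreal_mult)
    finally show "ennreal ((cmod (u x + v x))\<^sup>2) \<le> 2 * ennreal ((cmod (u x))\<^sup>2) + 2 * ennreal ((cmod (v x))\<^sup>2)" .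
  qed
  also have "\<dots> = 2 * L2sq u + 2 * L2sq v"
    unfolding L2sq_def by (simp add: nn_integral_add nn_integral_cmult)
  finally show ?thesis .
qed

subsection \<open>Oscillatory integral operators\<close>

definition lamy :: "par \<Rightarrow> 'a::euclidean_space \<Rightarrow> real" where
  "lamy i y = 1 + (norm y)\<^sup>2 + (tm i)\<^sup>2"

lemma lamsq_eq_lamy: "lamsq i z = lamy i (snd z)"
  by (simp add: lamsq_def lamy_def)

lemma lamy_ge_1: "1 \<le> lamy i y"
  by (simp add: lamy_def)

lemma lamy_measurable [measurable]: "lamy i \<in> borel_measurable borel"
  unfolding lamy_def[abs_def] by measurable

text \<open>\<open>op_bdd \<kappa> U\<close>: the operators \<open>U i\<close>, composed on the right with multiplication by
  \<open>(1 + |y|\<^sup>2 + t\<^sup>2)\<close> to the power \<open>\<kappa>/2\<close>, are bounded on \<open>L\<^sup>2\<close> uniformly in \<open>i\<close>.\<close>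
definition op_bdd :: "real \<Rightarrow> (par \<Rightarrow> ('a::euclidean_space \<Rightarrow> complex) \<Rightarrow> 'a \<Rightarrow> complex) \<Rightarrow> bool" where
  "op_bdd \<kappa> U \<longleftrightarrow> (\<exists>C\<ge>0. \<forall>i f. rapid f \<longrightarrow> U i f \<in> borel_measurable borel \<and>
      L2sq (U i f) \<le> ennreal C * L2sq (\<lambda>y. complex_of_real (lamy i y powr (- \<kappa> / 2)) * f y))"

lemma op_bdd_measurable: "op_bdd \<kappa> U \<Longrightarrow> rapid f \<Longrightarrow> U i f \<in> borel_measurable borel"
  by (auto simp: op_bdd_def simp del: split_paired_All)

lemma op_bddE:
  assumes "op_bdd \<kappa> U"
  obtains C where "0 \<le> C" "\<And>i f. rapid f \<Longrightarrow> L2sq (U i f) \<le> ennreal C * L2sq (\<lambda>y. complex_of_real (lamy i y powr (- \<kappa> / 2)) * f y)"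
  using assms unfolding op_bdd_def by blast

lemma op_bdd_add:
  assumes U: "op_bdd \<kappa> U" and V: "op_bdd \<kappa> V"
  shows "op_bdd \<kappa> (\<lambda>i f x. U i f x + V i f x)"
proof -
  obtain C where C: "0 \<le> C" "\<And>i f. rapid f \<Longrightarrow> L2sq (U i f) \<le> ennreal C * L2sq (\<lambda>y. complex_of_real (lamy i y powr (- \<kappa> / 2)) * f y)"
    using op_bddE[OF U] by blast
  obtain D where D: "0 \<le> D" "\<And>i f. rapid f \<Longrightarrow> L2sq (V i f) \<le> ennreal D * L2sq (\<lambda>y. complex_of_real (lamy i y powr (- \<kappa> / 2)) * f y)"
    using op_bddE[OF V] by blast
  show ?thesis
    unfolding op_bdd_def
  proof (intro exI[of _ "2 * C + 2 * D"] conjI allI impI)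
    fix i :: par and f :: "'a \<Rightarrow> complex" assume f: "rapid f"
    note [measurable] = op_bdd_measurable[OF U f] op_bdd_measurable[OF V f]
    show "(\<lambda>x. U i f x + V i f x) \<in> borel_measurable borel" by measurable
    let ?L = "L2sq (\<lambda>y. complex_of_real (lamy i y powr (- \<kappa> / 2)) * f y)"
    have "L2sq (\<lambda>x. U i f x + V i f x) \<le> 2 * L2sq (U i f) + 2 * L2sq (V i f)"
      by (rule L2sq_add_le) measurable
    also have "\<dots> \<le> 2 * (ennreal C * ?L) + 2 * (ennreal D * ?L)"
      by (intro add_mono mult_left_mono C D f) auto
    also have "\<dots> = ennreal (2 * C + 2 * D) * ?L"
      using C(1) D(1) by (simp add: ennreal_mult distrib_right mult.assoc)
    finally show "L2sq (\<lambda>x. U i f x + V i f x) \<le> ennreal (2 * C + 2 * D) * ?L" .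
  qed (use C D in auto)
qed

lemma op_bdd_sum:
  assumes "finite S" "S \<noteq> {}" "\<And>b. b \<in> S \<Longrightarrow> op_bdd \<kappa> (U b)"
  shows "op_bdd \<kappa> (\<lambda>i f x. \<Sum>b\<in>S. U b i f x)"
  using assms by (induction S rule: finite_ne_induct) (auto intro: op_bdd_add)

lemma op_bdd_mult:
  assumes U: "op_bdd \<kappa> U" and g: "g \<in> borel_measurable borel" and le: "\<And>x. cmod (g x) \<le> 1"
  shows "op_bdd \<kappa> (\<lambda>i f x. g x * U i f x)"
proof -
  obtain C where C: "0 \<le> C" "\<And>i f. rapid f \<Longrightarrow> L2sq (U i f) \<le> ennreal C * L2sq (\<lambda>y. complex_of_real (lamy i y powr (- \<kappa> / 2)) * f y)"
    using op_bddE[OF U] by blast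
  show ?thesis
    unfolding op_bdd_def
  proof (intro exI[of _ C] conjI allI impI)
    fix i :: par and f :: "'a \<Rightarrow> complex" assume f: "rapid f"
    show "(\<lambda>x. g x * U i f x) \<in> borel_measurable borel"
      using op_bdd_measurable[OF U f] g by measurable
    have "L2sq (\<lambda>x. g x * U i f x) \<le> L2sq (U i f)"
      by (rule L2sq_mono) (auto simp: norm_mult intro!: mult_left_le_one_le le)
    also note C(2)[OF f]
    finally show "L2sq (\<lambda>x. g x * U i f x) \<le> ennreal C * L2sq (\<lambda>y. complex_of_real (lamy i y powr (- \<kappa> / 2)) * f y)" .
  qed (rule C)
qed

definition osc :: "par \<Rightarrow> 'a::euclidean_space \<Rightarrow> 'a \<times> 'a \<Rightarrow> complex" where
  "osc i x z = cis ((x - snd z) \<bullet> fst z - tm i * (norm (fst z))\<^sup>2 / 2)"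

lemma norm_osc [simp]: "cmod (osc i x z) = 1"
  by (simp add: osc_def)

lemma osc_measurable [measurable]: "osc i x \<in> borel_measurable borel"
  unfolding osc_def[abs_def] by measurable

lemma osc_measurable2 [measurable]: "(\<lambda>p. osc i (fst p) (snd p)) \<in> borel_measurable borel"
  unfolding osc_def[abs_def] by measurable

definition Top :: "(par \<Rightarrow> 'a::euclidean_space \<times> 'a \<Rightarrow> complex) \<Rightarrow> par \<Rightarrow> ('a \<Rightarrow> complex) \<Rightarrow> 'a \<Rightarrow> complex" where
  "Top q i f x = (LINT z|lborel. osc i x z * q i z * f (snd z))"

text \<open>The regularising factor \<open>regsq i z powr (- M)\<close> as a function of
  \<open>\<xi>\<close> alone, with M equal to the dimension. Its decay of order 2m makes it
  comparable, for fixed index, to the integrable function of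
  \<open>integrable_inv_jb\<close>.\<close>

definition rg :: "par \<Rightarrow> 'a::euclidean_space \<Rightarrow> real" where
  "rg i \<xi> = (1 + (ep i)\<^sup>2 * (norm \<xi>)\<^sup>2) powr (- real DIM('a))"

lemma rg_nonneg: "0 \<le> rg i \<xi>" by (simp add: rg_def)

lemma rg_le_1: "rg i \<xi> \<le> 1"
  unfolding rg_def by (intro powr_minus_le_one) auto

lemma rg_measurable [measurable]: "rg i \<in> borel_measurable borel"
  unfolding rg_def[abs_def] by measurable

lemma rg_integrable: "integrable lborel (rg i :: 'a::euclidean_space \<Rightarrow> real)"
proof (rule Bochner_Integration.integrable_bound[OF integrable_mult_right[OF integrable_inv_jb, of "(1 / ep i) ^ (2 * DIM('a))"]])
  show "AE (\<xi> :: 'a) in lborel. norm (rg i \<xi>) \<le> norm ((1 / ep i) ^ (2 * DIM('a)) * (1 / jb \<xi> ^ (2 * DIM('a))))"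
  proof (rule AE_I2)
    fix \<xi> :: 'a
    have e: "(ep i)\<^sup>2 \<le> 1" using ep_pos[of i] ep_le_1[of i] by (simp add: power_le_one)
    have "(ep i)\<^sup>2 * (jb \<xi>)\<^sup>2 \<le> 1 + (ep i)\<^sup>2 * (norm \<xi>)\<^sup>2"
      using e by (simp add: jb_sq distrib_left)
    then have "((ep i)\<^sup>2 * (jb \<xi>)\<^sup>2) ^ DIM('a) \<le> (1 + (ep i)\<^sup>2 * (norm \<xi>)\<^sup>2) ^ DIM('a)"
      by (intro power_mono) auto
    then have "inverse ((1 + (ep i)\<^sup>2 * (norm \<xi>)\<^sup>2) ^ DIM('a)) \<le> inverse (((ep i)\<^sup>2 * (jb \<xi>)\<^sup>2) ^ DIM('a))"
      using ep_pos[of i] jb_pos[of \<xi>] by (intro le_imp_inverse_le) auto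
    moreover have "rg i \<xi> = inverse ((1 + (ep i)\<^sup>2 * (norm \<xi>)\<^sup>2) ^ DIM('a))"
      unfolding rg_def powr_minus by (subst powr_realpow) (auto simp: add_pos_nonneg)
    moreover have "inverse (((ep i)\<^sup>2 * (jb \<xi>)\<^sup>2) ^ DIM('a)) = (1 / ep i) ^ (2 * DIM('a)) * (1 / jb \<xi> ^ (2 * DIM('a)))"
      by (simp add: power_mult_distrib power_mult[symmetric] power_one_over divide_inverse power_inverse)
    ultimately show "norm (rg i \<xi>) \<le> norm ((1 / ep i) ^ (2 * DIM('a)) * (1 / jb \<xi> ^ (2 * DIM('a))))"
      using rg_nonneg[of i \<xi>] by simp
  qed
qed simp

lemma integrable_bound_rg:
  fixes Q :: "'a::euclidean_space \<times> 'a \<Rightarrow> complex"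
  assumes [measurable]: "Q \<in> borel_measurable borel" and le: "\<And>z. cmod (Q z) \<le> C * rg i (fst z)" and f: "rapid f"
  shows "integrable lborel (\<lambda>z. osc i x z * Q z * f (snd z))"
proof (rule lborel_integrable_prod_bound)
  note [measurable] = rapid_measurable[OF f]
  show "(\<lambda>z. osc i x z * Q z * f (snd z)) \<in> borel_measurable borel" by measurable
  show "integrable lborel (\<lambda>\<xi>. C * rg i \<xi>)" by (intro integrable_mult_right rg_integrable)
  show "integrable lborel (\<lambda>y. cmod (f y))" using rapid_integrable[OF f] by simp
  show "norm (osc i x (\<xi>, y) * Q (\<xi>, y) * f (snd (\<xi>, y))) \<le> C * rg i \<xi> * cmod (f y)" for \<xi> y
    using le[of "(\<xi>, y)"] by (simp add: norm_mult mult_right_mono)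
qed

text \<open>The extra parameter fixes the type of the space, so that the exponent M can be tied to
  its dimension.\<close>

locale outgoing_dim = outgoing +
  fixes dummy :: "'a::euclidean_space itself"
  assumes MD: "M = real DIM('a)"
begin

lemma rg_eq: "regsq i z powr (- M) = rg i (fst (z :: 'a \<times> 'a))"
  by (simp add: rg_def regsq_def MD)

lemma cls_bound_rg:
  assumes "cls k q" "0 \<le> k"
  obtains C where "0 \<le> C" "\<And>i z. cmod (q i (z :: 'a \<times> 'a)) \<le> C * rg i (fst z)"
  using cls_bound[OF assms] unfolding rg_eq by blast

lemma Top_integrable:
  assumes q: "cls k q" "0 \<le> k" and f: "rapid f"
  shows "integrable lborel (\<lambda>z. osc i x z * q i (z :: 'a \<times> 'a) * f (snd z))"
proof -
  obtain C where "0 \<le> C" "\<And>i z. cmod (q i (z :: 'a \<times> 'a)) \<le> C * rg i (fst z)"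
    using cls_bound_rg[OF q] by blast
  then show ?thesis
    by (intro integrable_bound_rg[OF cls_measurable[OF q(1)] _ f])
qed

lemma Top_measurable:
  fixes f :: "'a \<Rightarrow> complex"
  assumes q: "cls k q" and f: "rapid f"
  shows "Top q i f \<in> borel_measurable borel"
proof -
  note [measurable] = rapid_measurable[OF f] cls_measurable[OF q, of i]
  show ?thesis
    unfolding Top_def[abs_def] by measurable
qed

lemma Top_add:
  fixes f g :: "'a \<Rightarrow> complex"
  assumes q: "cls k q" "0 \<le> k" and f: "rapid f" and g: "rapid g"
  shows "Top q i (\<lambda>y. f y + g y) x = Top q i f x + Top q i g x"
  unfolding Top_def
  by (subst Bochner_Integration.integral_add[symmetric, OF Top_integrable[OF q f] Top_integrable[OF q g]])
    (simp add: distrib_left)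

text \<open>Integration by parts in \<open>\<xi>\<close>, based on
  \<open>\<partial>\<^sub>\<xi> exp(i\<Phi>) = i (x - y - t\<xi>) exp(i\<Phi>)\<close>.\<close>
lemma Top_ibp:
  fixes f :: "'a \<Rightarrow> complex"
  assumes b: "b \<in> Basis" and q: "cls k q" "0 \<le> k"
    and q': "\<And>i z. ((\<lambda>s. q i (z + s *\<^sub>R (b, 0))) has_vector_derivative q' i z) (at 0)" "cls k q'"
    and wq: "\<And>z. cmod (complex_of_real (wv b i z) * q i z) \<le> B * rg i (fst z)"
    and f: "rapid f"
  shows "(LINT z|lborel. osc i x z * (complex_of_real (wv b i z) * q i z) * f (snd z)) =
      complex_of_real (x \<bullet> b) * Top q i f x - \<i> * Top q' i f x"
proof -
  note [measurable] = cls_measurable[OF q(1)] cls_measurable[OF q'(2)] rapid_measurable[OF f]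
  have [measurable]: "(\<lambda>z. wv b i z) \<in> borel_measurable borel"
    unfolding wv_def by measurable
  have wm: "(\<lambda>z. complex_of_real (wv b i z) * q i z) \<in> borel_measurable borel" by measurable
  obtain C where C: "0 \<le> C" "\<And>i z. cmod (q i (z :: 'a \<times> 'a)) \<le> C * rg i (fst z)"
    using cls_bound_rg[OF q] by blast
  obtain C' where C': "0 \<le> C'" "\<And>i z. cmod (q' i (z :: 'a \<times> 'a)) \<le> C' * rg i (fst z)"
    using cls_bound_rg[OF q'(2) q(2)] by blast
  have int1: "integrable lborel (\<lambda>\<xi>. osc i x (\<xi>, y) * Q (\<xi>, y))"
    if [measurable]: "Q \<in> borel_measurable borel" and "\<And>z. cmod (Q z) \<le> K * rg i (fst z)" for Q K y
  proof (rule Bochner_Integration.integrable_bound[OF integrable_mult_right[OF rg_integrable, of K]])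
    show "AE \<xi> in lborel. norm (osc i x (\<xi>, y) * Q (\<xi>, y)) \<le> norm (K * rg i \<xi>)"
      using that(2)[of "(\<xi>, y)" for \<xi>] by (intro AE_I2) (auto simp: norm_mult intro: order_trans[OF _ abs_ge_self])
  qed measurable
  \<comment> \<open>At fixed y, the derivative of the integrand in direction b has integral zero. It
    consists of three terms, coming from x . b, from w . b and from the symbol.\<close>
  have fib: "(LINT \<xi>|lborel. osc i x (\<xi>, y) * (complex_of_real (wv b i (\<xi>, y)) * q i (\<xi>, y))) =
     complex_of_real (x \<bullet> b) * (LINT \<xi>|lborel. osc i x (\<xi>, y) * q i (\<xi>, y))
       - \<i> * (LINT \<xi>|lborel. osc i x (\<xi>, y) * q' i (\<xi>, y))" for y
  proof -
    let ?h = "\<lambda>\<xi>. osc i x (\<xi>, y) * q i (\<xi>, y)"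
    let ?h' = "\<lambda>\<xi>. \<i> * complex_of_real (x \<bullet> b) * (osc i x (\<xi>, y) * q i (\<xi>, y))
        - \<i> * (osc i x (\<xi>, y) * (complex_of_real (wv b i (\<xi>, y)) * q i (\<xi>, y))) + osc i x (\<xi>, y) * q' i (\<xi>, y)"
    note I1 = int1[OF cls_measurable[OF q(1)] C(2), of y] and I2 = int1[OF wm wq, of y]
      and I3 = int1[OF cls_measurable[OF q'(2)] C'(2), of y]
    have "integral\<^sup>L lborel ?h' = 0"
    proof (rule integral_directional_derivative[where v = b])
      show "integrable lborel ?h" by (rule I1)
      show "integrable lborel ?h'"
        by (intro Bochner_Integration.integrable_add Bochner_Integration.integrable_diff integrable_mult_right I1 I2 I3)
      have co: "continuous_on UNIV (\<lambda>\<xi>. osc i x (\<xi>, y))"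
        unfolding osc_def by (intro continuous_intros) auto
      have cp: "continuous_on UNIV (\<lambda>\<xi>::'a. (\<xi>, y))" by (intro continuous_intros)
      have cq: "continuous_on UNIV (\<lambda>\<xi>. q i (\<xi>, y))" "continuous_on UNIV (\<lambda>\<xi>. q' i (\<xi>, y))"
        using continuous_on_compose2[OF cls_continuous[OF q(1)] cp] continuous_on_compose2[OF cls_continuous[OF q'(2)] cp] by auto
      have cw: "continuous_on UNIV (\<lambda>\<xi>. wv b i (\<xi>, y))"
        unfolding wv_def by (intro continuous_intros)
      show "continuous_on UNIV ?h'"
        by (intro continuous_intros co cq cw)
      fix \<xi> :: 'a
      have dq: "((\<lambda>s. q i (\<xi> + s *\<^sub>R b, y)) has_vector_derivative q' i (\<xi>, y)) (at 0)"
        using q'(1)[of i "(\<xi>, y)"] by simp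
      \<comment> \<open>Along a line the phase is a quadratic polynomial in s, whose linear
        coefficient is (x - w) . b.\<close>
      define ph where "ph s = (x - y) \<bullet> \<xi> - tm i * (norm \<xi>)\<^sup>2 / 2
          + s * ((x - y) \<bullet> b - tm i * (\<xi> \<bullet> b)) - s\<^sup>2 * (tm i * (norm b)\<^sup>2 / 2)" for s
      have phase: "(x - y) \<bullet> (\<xi> + s *\<^sub>R b) - tm i * (norm (\<xi> + s *\<^sub>R b))\<^sup>2 / 2 = ph s" for s
        unfolding ph_def power2_norm_eq_inner
        by (simp add: inner_add_left inner_add_right inner_commute power2_eq_square field_simps)
      have "(ph has_real_derivative ((x - y) \<bullet> b - tm i * (\<xi> \<bullet> b))) (at 0)"
        unfolding ph_def[abs_def] by (auto intro!: derivative_eq_intros)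
      then have "((\<lambda>s. cis (ph s)) has_vector_derivative ((x - y) \<bullet> b - tm i * (\<xi> \<bullet> b)) *\<^sub>R (\<i> * cis (ph 0))) (at 0)"
      proof -
        assume dph: "(ph has_real_derivative ((x - y) \<bullet> b - tm i * (\<xi> \<bullet> b))) (at 0)"
        have "((\<lambda>s. complex_of_real (ph s)) has_vector_derivative complex_of_real ((x - y) \<bullet> b - tm i * (\<xi> \<bullet> b))) (at 0)"
          using dph by (intro has_vector_derivative_of_real) (simp add: has_real_derivative_iff_has_vector_derivative)
        then have "((\<lambda>s. \<i> * complex_of_real (ph s)) has_vector_derivative \<i> * complex_of_real ((x - y) \<bullet> b - tm i * (\<xi> \<bullet> b))) (at 0)"
          by (rule has_vector_derivative_mult_right)
        from field_vector_diff_chain_at[OF this DERIV_exp]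
        show ?thesis
          by (simp add: comp_def cis_conv_exp scaleR_conv_of_real mult_ac)
      qed
      moreover have "(x - y) \<bullet> b - tm i * (\<xi> \<bullet> b) = x \<bullet> b - wv b i (\<xi>, y)"
        by (simp add: wv_def inner_diff_left)
      ultimately have do: "((\<lambda>s. osc i x (\<xi> + s *\<^sub>R b, y)) has_vector_derivative (x \<bullet> b - wv b i (\<xi>, y)) *\<^sub>R (\<i> * osc i x (\<xi>, y))) (at 0)"
        using phase[of 0] by (simp add: osc_def phase)
      show "((\<lambda>s. ?h (\<xi> + s *\<^sub>R b)) has_vector_derivative ?h' \<xi>) (at 0)"
        by (rule has_vector_derivative_eq_rhs[OF has_vector_derivative_mult[OF do dq]])
          (simp add: scaleR_conv_of_real algebra_simps)
    qed
    moreover have "integral\<^sup>L lborel ?h' = \<i> * complex_of_real (x \<bullet> b) * (LINT \<xi>|lborel. osc i x (\<xi>, y) * q i (\<xi>, y))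
       - \<i> * (LINT \<xi>|lborel. osc i x (\<xi>, y) * (complex_of_real (wv b i (\<xi>, y)) * q i (\<xi>, y)))
       + (LINT \<xi>|lborel. osc i x (\<xi>, y) * q' i (\<xi>, y))"
      using I1 I2 I3 by simp
    ultimately have "\<i> * (LINT \<xi>|lborel. osc i x (\<xi>, y) * (complex_of_real (wv b i (\<xi>, y)) * q i (\<xi>, y))) =
       \<i> * (complex_of_real (x \<bullet> b) * (LINT \<xi>|lborel. osc i x (\<xi>, y) * q i (\<xi>, y))
       - \<i> * (LINT \<xi>|lborel. osc i x (\<xi>, y) * q' i (\<xi>, y)))"
      by (simp add: algebra_simps)
    then show ?thesis
      by (subst (asm) mult_cancel_left) simp
  qed
  \<comment> \<open>The identities at fixed y are assembled: each integrand is dominated by a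
    multiple of \<open>rg\<close> in \<open>\<xi>\<close> times |f| in y, so Fubini applies.\<close>
  have F: "(LINT z|lborel. osc i x z * Q z * f (snd z)) = (LINT y|lborel. (LINT \<xi>|lborel. osc i x (\<xi>, y) * Q (\<xi>, y)) * f y)"
    and FI: "integrable lborel (\<lambda>y. (LINT \<xi>|lborel. osc i x (\<xi>, y) * Q (\<xi>, y)) * f y)"
    if "Q \<in> borel_measurable borel" "\<And>z. cmod (Q z) \<le> K * rg i (fst z)" for Q K
  proof -
    have I: "integrable lborel (\<lambda>z. osc i x z * Q z * f (snd z))"
      by (rule integrable_bound_rg[OF that f])
    show "(LINT z|lborel. osc i x z * Q z * f (snd z)) = (LINT y|lborel. (LINT \<xi>|lborel. osc i x (\<xi>, y) * Q (\<xi>, y)) * f y)"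
      by (subst lborel_Fubini(2)[OF I, symmetric]) simp
    have "integrable (lborel \<Otimes>\<^sub>M lborel) (\<lambda>(\<xi>, y). osc i x (\<xi>, y) * Q (\<xi>, y) * f y)"
      using I by (simp add: lborel_prod split_beta')
    from lborel_pair.integrable_snd[OF this]
    show "integrable lborel (\<lambda>y. (LINT \<xi>|lborel. osc i x (\<xi>, y) * Q (\<xi>, y)) * f y)" by simp
  qed
  show ?thesis
    unfolding Top_def F[OF wm wq] F[OF cls_measurable[OF q(1)] C(2)] F[OF cls_measurable[OF q'(2)] C'(2)] fib
    using FI[OF cls_measurable[OF q(1)] C(2)] FI[OF cls_measurable[OF q'(2)] C'(2)]
    by (simp add: left_diff_distrib mult.assoc)
qed

text \<open>The operator is an inverse Fourier transform, after the unimodular multiplier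
  exp(-it|\<open>\<xi>\<close>|^2/2), after an operator with phase -\<open>\<xi>\<close> . y and
  amplitude q. Plancherel and Calderon-Vaillancourt bound the outer two, and the middle one
  preserves norms, whence uniformity in t. Since \<open>lamsq\<close> depends on y only, its power
  can be moved from f onto the amplitude.\<close>

lemma Top_op_bdd_zero:
  fixes q :: "par \<Rightarrow> 'a \<times> 'a \<Rightarrow> complex"
  assumes q: "cls k q" "0 \<le> k"
  shows "op_bdd k (Top q)"
proof -
  obtain vs :: "('a \<times> 'a) list" where vs: "set vs = Basis" "distinct vs"
    using finite_distinct_list[OF finite_Basis] by blast
  obtain B where B: "\<And>i. bdd_mixed B vs (\<lambda>z. complex_of_real (lamsq i z powr (k / 2)) * q i z)"
    using cls_bdd_mixed[OF q(1), of vs] vs by auto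
  define C where "C = (2 * pi) ^ DIM('a) * (CV_const DIM('a) * B)\<^sup>2"
  show ?thesis
    unfolding op_bdd_def
  proof (intro exI[of _ C] conjI allI impI)
    show "0 \<le> C" by (simp add: C_def)
    fix i :: par and f :: "'a \<Rightarrow> complex" assume f: "rapid f"
    show "Top q i f \<in> borel_measurable borel" by (rule Top_measurable[OF q(1) f])
    define g where "g y = complex_of_real (lamy i y powr (- k / 2)) * f y" for y
    have g: "rapid g"
      unfolding g_def
    proof (rule rapid_mult_bounded[OF f, of _ 1])
      show "cmod (complex_of_real (lamy i y powr (- k / 2))) \<le> 1" for y :: 'a
        using powr_minus_le_one[OF lamy_ge_1[of i y], of "k / 2"] q(2) by simp
    qed measurable
    define A where "A \<xi> = (LINT y|lborel. cis (- (\<xi> \<bullet> y)) * (complex_of_real (lamsq i (\<xi>, y) powr (k / 2)) * q i (\<xi>, y)) * g y)" for \<xi>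
    have A: "A \<xi> = (LINT y|lborel. cis (- (\<xi> \<bullet> y)) * q i (\<xi>, y) * f y)" for \<xi>
      unfolding A_def
    proof (intro Bochner_Integration.integral_cong refl)
      fix y
      have "complex_of_real (lamsq i (\<xi>, y) powr (k / 2)) * complex_of_real (lamy i y powr (- k / 2)) = 1"
        using lamy_ge_1[of i y] by (simp add: lamsq_eq_lamy powr_minus flip: of_real_mult)
      then show "cis (- (\<xi> \<bullet> y)) * (complex_of_real (lamsq i (\<xi>, y) powr (k / 2)) * q i (\<xi>, y)) * g y = cis (- (\<xi> \<bullet> y)) * q i (\<xi>, y) * f y"
        unfolding g_def by (simp add: mult_ac)
    qed
    define h where "h \<xi> = cis (- (tm i * (norm \<xi>)\<^sup>2 / 2)) * A \<xi>" for \<xi>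
    have osc: "osc i x (\<xi>, y) = cis (x \<bullet> \<xi>) * (cis (- (tm i * (norm \<xi>)\<^sup>2 / 2)) * cis (- (\<xi> \<bullet> y)))" for x \<xi> y
      by (simp add: osc_def cis_mult inner_diff_left inner_commute algebra_simps)
    have inner: "(LINT y|lborel. osc i x (\<xi>, y) * q i (\<xi>, y) * f y) = cis (x \<bullet> \<xi>) * h \<xi>" for x \<xi>
      unfolding osc h_def A by (simp add: mult.assoc)
    have T: "Top q i f x = (LINT \<xi>|lborel. cis (x \<bullet> \<xi>) * h \<xi>)" for x
      unfolding Top_def lborel_Fubini(1)[OF Top_integrable[OF q f], symmetric] by (simp add: inner)
    have hi: "integrable lborel h"
    proof -
      have "integrable (lborel \<Otimes>\<^sub>M lborel) (\<lambda>(\<xi>, y). osc i 0 (\<xi>, y) * q i (\<xi>, y) * f y)"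
        using Top_integrable[OF q f, of i 0] by (simp add: lborel_prod split_beta')
      from lborel_pair.integrable_fst[OF this] show ?thesis by (simp add: inner)
    qed
    have "L2sq (Top q i f) \<le> ennreal ((2 * pi) ^ DIM('a)) * L2sq h"
      using Plancherel_le[OF hi] by (simp only: T[abs_def])
    also have "L2sq h = L2sq A"
      unfolding h_def[abs_def] by (rule L2sq_cmult_unit) simp
    also have "L2sq A \<le> ennreal ((CV_const DIM('a) * B)\<^sup>2) * L2sq g"
      unfolding A_def[abs_def]
      by (rule Calderon_Vaillancourt[OF B vs(2,1) rapid_integrable[OF g]])
    finally show "L2sq (Top q i f) \<le> ennreal C * L2sq (\<lambda>y. complex_of_real (lamy i y powr (- k / 2)) * f y)"
      by (simp add: C_def g_def[abs_def] ennreal_mult mult.assoc mult_left_mono)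
  qed
qed

text \<open>The components of w grow with y and t, but multiplied by those of w/\<open>Dn\<close>
  they have weight 1. This keeps the integrands of the integration by parts below a multiple of
  \<open>rg\<close>.\<close>

lemma wv_av_bound:
  assumes b: "b \<in> Basis"
  obtains C where "0 \<le> C" "\<And>i (z :: 'a \<times> 'a). z \<in> Omega \<Longrightarrow> \<bar>wv b i z * av b i z\<bar> \<le> C"
proof -
  have "sym0 Omega (\<lambda>i z. bsq i z powr (1/2) * bsq i z powr (-1/2)) (\<lambda>i z. wv b i z * av b i z)"
    by (rule sym_imp_sym0[OF sym_mult[OF sym_wv[OF b, of 0] sym_av[OF b]]])
  then obtain C where C: "0 \<le> C" "\<And>i z. z \<in> Omega \<Longrightarrow> norm (wv b i z * av b i z) \<le> C * (bsq i z powr (1/2) * bsq i z powr (-1/2))"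
    unfolding sym0_def by blast
  have "bsq i z powr (1/2) * bsq i z powr (-1/2) = 1" if "z \<in> Omega" for i and z :: "'a \<times> 'a"
    using bsq_pos[OF that, of i] by (simp only: powr_add[symmetric]) simp
  then show thesis using that[of C] C by auto
qed

text \<open>The symbol is multiplied by \<open>partition_identity\<close>, and each term with a
  component of w is integrated by parts. \<open>d b\<close> is the derivative of the product of
  \<open>av b\<close> and q in the direction (b, 0); it and the other new symbols all have order k +
  1.\<close>

lemma Top_decomposition:
  fixes q :: "par \<Rightarrow> 'a \<times> 'a \<Rightarrow> complex"
  assumes q: "cls k q" "0 \<le> k"
  obtains d where "\<And>b. b \<in> Basis \<Longrightarrow> cls (k + 1) (d b)"
    and "\<And>i f x. rapid f \<Longrightarrow> Top q i f x = (\<Sum>b\<in>Basis. complex_of_real (x \<bullet> b) * Top (\<lambda>i z. complex_of_real (av b i z) * q i z) i f x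
           - \<i> * Top (d b) i f x) + Top (\<lambda>i z. complex_of_real (cv i z) * q i z) i f x"
proof -
  let ?a = "\<lambda>b i z. complex_of_real (av b i z) * q i z"
  let ?c = "\<lambda>i z. complex_of_real (cv i z) * q i z"
  have ex: "\<exists>d. (\<forall>i z. ((\<lambda>s. ?a b i (z + s *\<^sub>R (b, 0))) has_vector_derivative d i z) (at 0)) \<and> cls (k + 1) d" if b: "b \<in> Basis" for b
  proof -
    have bb: "(b, 0) \<in> Basis" using b by (simp add: Basis_prod_def)
    obtain d where "\<And>i z. ((\<lambda>s. ?a b i (z + s *\<^sub>R (b, 0))) has_vector_derivative d i z) (at 0)" "cls (k + 1) d"
      by (rule cls_deriv[OF cls_mult_av[OF q(1) b] bb], rule that)
    then show ?thesis by (intro exI[of _ d] conjI allI)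
  qed
  have "\<forall>b\<in>Basis. \<exists>d. (\<forall>i z. ((\<lambda>s. ?a b i (z + s *\<^sub>R (b, 0))) has_vector_derivative d i z) (at 0)) \<and> cls (k + 1) d"
    by (intro ballI ex)
  from bchoice[OF this] obtain d where
    dd: "\<forall>b\<in>Basis. (\<forall>i z. ((\<lambda>s. ?a b i (z + s *\<^sub>R (b, 0))) has_vector_derivative d b i z) (at 0)) \<and> cls (k + 1) (d b)" ..
  have d: "((\<lambda>s. ?a b i (z + s *\<^sub>R (b, 0))) has_vector_derivative d b i z) (at 0)" if "b \<in> Basis" for b i z
    using bspec[OF dd that] by (elim conjE allE)
  have d2: "cls (k + 1) (d b)" if "b \<in> Basis" for b
    using bspec[OF dd that] by (elim conjE)
  obtain C where C: "0 \<le> C" "\<And>i z. cmod (q i (z :: 'a \<times> 'a)) \<le> C * rg i (fst z)"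
    using cls_bound_rg[OF q] by blast
  have "Top q i f x = (\<Sum>b\<in>Basis. complex_of_real (x \<bullet> b) * Top (?a b) i f x - \<i> * Top (d b) i f x) + Top ?c i f x"
    if f: "rapid f" for i f x
  proof -
    have wq: "\<exists>B. \<forall>z. cmod (complex_of_real (wv b i z) * ?a b i z) \<le> B * rg i (fst z)" if b: "b \<in> Basis" for b
    proof -
      obtain D where D: "0 \<le> D" "\<And>i (z :: 'a \<times> 'a). z \<in> Omega \<Longrightarrow> \<bar>wv b i z * av b i z\<bar> \<le> D"
        using wv_av_bound[OF b] by blast
      have "cmod (complex_of_real (wv b i z) * ?a b i z) \<le> (D * C) * rg i (fst z)" for z
      proof (cases "z \<in> Kset")
        case True
        then have "\<bar>wv b i z * av b i z\<bar> * cmod (q i z) \<le> D * (C * rg i (fst z))"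
          by (intro mult_mono D(2) C(2) subsetD[OF Kset_subset_Omega] D(1) norm_ge_zero)
        then show ?thesis by (simp add: norm_mult abs_mult mult.assoc)
      next
        case False
        then show ?thesis
          using cls_zero[OF q(1) False] mult_nonneg_nonneg[OF mult_nonneg_nonneg[OF D(1) C(1)] rg_nonneg[of i "fst z"]] by simp
      qed
      then show ?thesis by blast
    qed
    have ibp: "(LINT z|lborel. osc i x z * (complex_of_real (wv b i z) * ?a b i z) * f (snd z)) =
       complex_of_real (x \<bullet> b) * Top (?a b) i f x - \<i> * Top (d b) i f x" if b: "b \<in> Basis" for b
    proof -
      obtain B where B: "\<And>z. cmod (complex_of_real (wv b i z) * ?a b i z) \<le> B * rg i (fst z)"
        using wq[OF b] by blast
      show ?thesis
        by (rule Top_ibp[OF b cls_mult_av[OF q(1) b] _ d[OF b] d2[OF b] B f]) (use q in simp)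
    qed
    have int: "integrable lborel (\<lambda>z. osc i x z * (complex_of_real (wv b i z) * ?a b i z) * f (snd z))" if b: "b \<in> Basis" for b
    proof -
      obtain B where B: "\<And>z. cmod (complex_of_real (wv b i z) * ?a b i z) \<le> B * rg i (fst z)"
        using wq[OF b] by blast
      have [measurable]: "?a b i \<in> borel_measurable borel"
        by (rule cls_measurable[OF cls_mult_av[OF q(1) b]])
      have [measurable]: "wv b i \<in> borel_measurable borel"
        unfolding wv_def[abs_def] by measurable
      show ?thesis
        by (rule integrable_bound_rg[OF _ B f]) measurable
    qed
    have intc: "integrable lborel (\<lambda>z. osc i x z * ?c i z * f (snd z))"
      by (rule Top_integrable[OF cls_mult_cv[OF q(1)] _ f]) (use q in simp)
    have split: "q i z = (\<Sum>b\<in>Basis. complex_of_real (wv b i z) * ?a b i z) + ?c i z" for z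
    proof (cases "z \<in> Kset")
      case True
      then have "(\<Sum>b\<in>Basis. av b i z * wv b i z) + cv i z = 1"
        by (intro partition_identity subsetD[OF Kset_subset_Omega])
      then have "q i z = complex_of_real ((\<Sum>b\<in>Basis. av b i z * wv b i z) + cv i z) * q i z" by (simp only: of_real_1 mult_1_left)
      also have "\<dots> = (\<Sum>b\<in>Basis. complex_of_real (wv b i z) * ?a b i z) + ?c i z"
        unfolding of_real_add of_real_sum of_real_mult distrib_right sum_distrib_right by (simp only: mult_ac)
      finally show ?thesis .
    next
      case False
      then show ?thesis using cls_zero[OF q(1) False] by simp
    qed
    have "Top q i f x = (LINT z|lborel. (\<Sum>b\<in>Basis. osc i x z * (complex_of_real (wv b i z) * ?a b i z) * f (snd z)) + osc i x z * ?c i z * f (snd z))"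
      unfolding Top_def by (subst split) (simp add: sum_distrib_left sum_distrib_right distrib_left distrib_right)
    also have "\<dots> = (\<Sum>b\<in>Basis. (LINT z|lborel. osc i x z * (complex_of_real (wv b i z) * ?a b i z) * f (snd z))) + Top ?c i f x"
      using int intc by (simp add: Top_def)
    also have "\<dots> = (\<Sum>b\<in>Basis. complex_of_real (x \<bullet> b) * Top (?a b) i f x - \<i> * Top (d b) i f x) + Top ?c i f x"
      by (simp only: ibp cong: sum.cong)
    finally show ?thesis .
  qed
  with d2 show thesis by (rule that)
qed

text \<open>Each step trades one power of \<open>\<langle>x\<rangle>\<close> for one order of the symbol.\<close>
lemma Top_op_bdd:
  fixes q :: "par \<Rightarrow> 'a \<times> 'a \<Rightarrow> complex"
  assumes "cls k q" "0 \<le> k"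
  shows "op_bdd (k + real N) (\<lambda>i f x. complex_of_real (1 / jb x ^ N) * Top q i f x)"
  using assms
proof (induction N arbitrary: k q)
  case 0
  from Top_op_bdd_zero[OF this] show ?case by simp
next
  case (Suc N)
  note q = Suc.prems
  obtain d where d: "\<And>b. b \<in> Basis \<Longrightarrow> cls (k + 1) (d b)"
    and dec: "\<And>i f x. rapid f \<Longrightarrow> Top q i f x = (\<Sum>b\<in>Basis. complex_of_real (x \<bullet> b) * Top (\<lambda>i z. complex_of_real (av b i z) * q i z) i f x
           - \<i> * Top (d b) i f x) + Top (\<lambda>i z. complex_of_real (cv i z) * q i z) i f x"
    by (rule Top_decomposition[OF q], rule that)
  let ?a = "\<lambda>b i z. complex_of_real (av b i z) * q i z"
  let ?c = "\<lambda>i z. complex_of_real (cv i z) * q i z"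
  let ?W = "\<lambda>q i f x. complex_of_real (1 / jb x ^ N) * Top q i f x"
  \<comment> \<open>Order k + 1 with N powers of the bracket has the same total as order k with N +
    1, so all new terms fall under the induction hypothesis. The one bracket left over makes x . b
    bounded.\<close>
  have IH: "op_bdd (k + real (Suc N)) (?W q)" if "cls (k + 1) q" for q :: "par \<Rightarrow> 'a \<times> 'a \<Rightarrow> complex"
    using Suc.IH[OF that] \<open>0 \<le> k\<close> by (simp add: add_ac)
  have xb: "cmod (complex_of_real ((x \<bullet> b) / jb x)) \<le> 1" if "b \<in> Basis" for x b :: 'a
    unfolding norm_of_real abs_divide
    using order_trans[OF Basis_le_norm[OF that] norm_le_jb[of x]] jb_pos[of x] by simp
  have x1: "cmod (- \<i> * complex_of_real (1 / jb x)) \<le> 1" "cmod (complex_of_real (1 / jb x)) \<le> 1" for x :: 'a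
    unfolding norm_mult norm_of_real using jb_ge_1[of x] by simp_all
  have X: "op_bdd (k + real (Suc N)) (\<lambda>i f x. (\<Sum>b\<in>Basis. complex_of_real ((x \<bullet> b) / jb x) * ?W (?a b) i f x
       + (- \<i> * complex_of_real (1 / jb x)) * ?W (d b) i f x) + complex_of_real (1 / jb x) * ?W ?c i f x)"
    by (intro op_bdd_add op_bdd_sum op_bdd_mult IH cls_mult_av cls_mult_cv q d xb x1) auto
  obtain C where C: "0 \<le> C" "\<And>i f. rapid f \<Longrightarrow> L2sq (\<lambda>x. (\<Sum>b\<in>Basis. complex_of_real ((x \<bullet> b) / jb x) * ?W (?a b) i f x
       + (- \<i> * complex_of_real (1 / jb x)) * ?W (d b) i f x) + complex_of_real (1 / jb x) * ?W ?c i f x)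
      \<le> ennreal C * L2sq (\<lambda>y. complex_of_real (lamy i y powr (- (k + real (Suc N)) / 2)) * f y)"
    by (rule op_bddE[OF X], rule that)
  have eq: "complex_of_real (1 / jb x ^ Suc N) * Top q i f x = (\<Sum>b\<in>Basis. complex_of_real ((x \<bullet> b) / jb x) * ?W (?a b) i f x
       + (- \<i> * complex_of_real (1 / jb x)) * ?W (d b) i f x) + complex_of_real (1 / jb x) * ?W ?c i f x"
    if "rapid f" for i f x
  proof -
    have 1: "complex_of_real (1 / jb x ^ Suc N) * (complex_of_real u * S - \<i> * S') =
        complex_of_real (u / jb x) * (complex_of_real (1 / jb x ^ N) * S) + (- \<i> * complex_of_real (1 / jb x)) * (complex_of_real (1 / jb x ^ N) * S')"
      for u S S'
      by (simp add: right_diff_distrib divide_inverse mult_ac)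
    have 2: "complex_of_real (1 / jb x ^ Suc N) * S = complex_of_real (1 / jb x) * (complex_of_real (1 / jb x ^ N) * S)" for S
      by (simp add: divide_inverse mult_ac)
    show ?thesis
      unfolding dec[OF that] distrib_left sum_distrib_left 1 by (simp only: 2)
  qed
  show ?case
    unfolding op_bdd_def
  proof (intro exI[of _ C] conjI allI impI, rule C(1))
    fix i :: par and f :: "'a \<Rightarrow> complex" assume f: "rapid f"
    show "(\<lambda>x. complex_of_real (1 / jb x ^ Suc N) * Top q i f x) \<in> borel_measurable borel"
      using Top_measurable[OF q(1) f, of i] by measurable
    show "L2sq (\<lambda>x. complex_of_real (1 / jb x ^ Suc N) * Top q i f x) \<le>
      ennreal C * L2sq (\<lambda>y. complex_of_real (lamy i y powr (- (k + real (Suc N)) / 2)) * f y)"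
      unfolding eq[OF f] by (rule C(2)[OF f])
  qed
qed

end

subsection \<open>Interpolation\<close>

text \<open>Comparable to min(1, (\<open>\<tau>\<close>/A)^N). The rational form is chosen for the
  exact relation 1 - G = (A/\<open>\<tau>\<close>)^N G.\<close>

definition Gk :: "nat \<Rightarrow> real \<Rightarrow> real \<Rightarrow> real" where
  "Gk N \<tau> A = \<tau> ^ N / (\<tau> ^ N + A ^ N)"

lemma Gk_measurable [measurable]: "(\<lambda>p. Gk N (u p) (v p)) \<in> borel_measurable M"
  if [measurable]: "u \<in> borel_measurable M" "v \<in> borel_measurable M"
  unfolding Gk_def by measurable

lemma Gk_bounds:
  assumes "0 < \<tau>" "0 < A"
  shows "0 \<le> Gk N \<tau> A" "Gk N \<tau> A \<le> 1" "Gk N \<tau> A \<le> \<tau> ^ N / A ^ N"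
    and "1 - Gk N \<tau> A = A ^ N / (\<tau> ^ N + A ^ N)"
proof -
  have pos: "0 < \<tau> ^ N" "0 < A ^ N" using assms by auto
  then show "0 \<le> Gk N \<tau> A" "Gk N \<tau> A \<le> 1" by (auto simp: Gk_def)
  show "Gk N \<tau> A \<le> \<tau> ^ N / A ^ N"
    unfolding Gk_def using pos by (intro frac_le) auto
  have "\<tau> ^ N + A ^ N \<noteq> 0" using pos by linarith
  then show "1 - Gk N \<tau> A = A ^ N / (\<tau> ^ N + A ^ N)"
    by (simp add: Gk_def field_simps)
qed

definition Kint :: "nat \<Rightarrow> real \<Rightarrow> real \<Rightarrow> ennreal" where
  "Kint N s A = (\<integral>\<^sup>+\<tau>. indicator {0<..} \<tau> * ennreal (\<tau> powr (-2 * s - 1) * (Gk N \<tau> A)\<^sup>2) \<partial>lborel)"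

text \<open>\<open>Gk\<close> depends only on the ratio of \<open>\<tau>\<close> and A, so the
  substitution of A \<open>\<tau>\<close> for \<open>\<tau>\<close> extracts the power -2s of
  A.\<close>

lemma Kint_scale:
  assumes A: "0 < A"
  shows "Kint N s A = ennreal (A powr (-2 * s)) * Kint N s 1"
proof -
  have "Kint N s A = ennreal \<bar>A\<bar> * (\<integral>\<^sup>+\<tau>. indicator {0<..} (0 + A * \<tau>) *
      ennreal ((0 + A * \<tau>) powr (-2 * s - 1) * (Gk N (0 + A * \<tau>) A)\<^sup>2) \<partial>lborel)"
    unfolding Kint_def by (rule nn_integral_real_affine) (use A in auto)
  also have "\<dots> = ennreal \<bar>A\<bar> * (\<integral>\<^sup>+\<tau>. ennreal (A powr (-2 * s - 1)) *
      (indicator {0<..} \<tau> * ennreal (\<tau> powr (-2 * s - 1) * (Gk N \<tau> 1)\<^sup>2)) \<partial>lborel)"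
  proof (rule arg_cong2[of _ _ _ _ "(*)"], rule refl, rule nn_integral_cong)
    fix \<tau> :: real
    show "indicator {0<..} (0 + A * \<tau>) * ennreal ((0 + A * \<tau>) powr (-2 * s - 1) * (Gk N (0 + A * \<tau>) A)\<^sup>2) =
      ennreal (A powr (-2 * s - 1)) * (indicator {0<..} \<tau> * ennreal (\<tau> powr (-2 * s - 1) * (Gk N \<tau> 1)\<^sup>2))"
    proof (cases "\<tau> > 0")
      case True
      have "Gk N (A * \<tau>) A = Gk N \<tau> 1"
      proof -
        have "(A * \<tau>) ^ N + A ^ N = A ^ N * (\<tau> ^ N + 1 ^ N)"
          by (simp add: power_mult_distrib distrib_left)
        then show ?thesis
          using A unfolding Gk_def by (simp add: power_mult_distrib)
      qed
      then show ?thesis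
        using A True by (simp add: powr_mult ennreal_mult[symmetric] mult.assoc)
    next
      case False
      then show ?thesis using A by (simp add: zero_less_mult_iff)
    qed
  qed
  also have "\<dots> = ennreal \<bar>A\<bar> * (ennreal (A powr (-2 * s - 1)) * Kint N s 1)"
    unfolding Kint_def by (subst nn_integral_cmult) auto
  also have "\<dots> = ennreal (\<bar>A\<bar> * A powr (-2 * s - 1)) * Kint N s 1"
    by (simp add: ennreal_mult mult.assoc)
  also have "\<bar>A\<bar> * A powr (-2 * s - 1) = A powr (-2 * s)"
    using A powr_add[of A 1 "-2 * s - 1"] by simp
  finally show ?thesis .
qed

text \<open>On (0, 1] the integrand is at most \<open>\<tau>\<close> to the power 2N - 2s - 1, which
  is at least 1; beyond 1 it is at most \<open>\<tau>\<close> to the power -2s - 1, integrable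
  because s > 0.\<close>

lemma Kint_finite:
  assumes s: "0 < s" and N: "s + 1 \<le> real N"
  shows "Kint N s 1 < \<infinity>"
proof -
  have "Kint N s 1 \<le> (\<integral>\<^sup>+\<tau>. indicator {0..1} \<tau> + ennreal (\<tau> powr (-2 * s - 1)) * indicator {1..} \<tau> \<partial>lborel)"
    unfolding Kint_def
  proof (intro nn_integral_mono)
    fix \<tau> :: real
    show "indicator {0<..} \<tau> * ennreal (\<tau> powr (-2 * s - 1) * (Gk N \<tau> 1)\<^sup>2) \<le>
      indicator {0..1} \<tau> + ennreal (\<tau> powr (-2 * s - 1)) * indicator {1..} \<tau>"
    proof (cases "\<tau> > 0")
      case True
      note G = Gk_bounds[OF True zero_less_one, of N]
      show ?thesis
      proof (cases "\<tau> \<le> 1")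
        case le: True
        have "(Gk N \<tau> 1)\<^sup>2 \<le> (\<tau> ^ N)\<^sup>2"
          using G(1,3) by (intro power_mono) simp_all
        also have "\<dots> = \<tau> powr (2 * real N)"
          using powr_realpow[OF True, of "N * 2"] unfolding power_mult[symmetric] by (simp add: mult.commute)
        finally have "\<tau> powr (-2 * s - 1) * (Gk N \<tau> 1)\<^sup>2 \<le> \<tau> powr (-2 * s - 1) * \<tau> powr (2 * real N)"
          by (intro mult_left_mono) auto
        also have "\<dots> = \<tau> powr (-2 * s - 1 + 2 * real N)"
          by (simp add: powr_add)
        also have "\<dots> \<le> 1"
          using True le N by (intro powr_le1) auto
        finally have "ennreal (\<tau> powr (-2 * s - 1) * (Gk N \<tau> 1)\<^sup>2) \<le> 1"
          by (simp add: ennreal_le_1)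
        then show ?thesis
          using True le by (simp add: add_increasing2)
      next
        case False
        have "\<tau> powr (-2 * s - 1) * (Gk N \<tau> 1)\<^sup>2 \<le> \<tau> powr (-2 * s - 1) * 1"
          using G by (intro mult_left_mono power_le_one) auto
        then show ?thesis
          using True False by (auto simp: indicator_def intro: ennreal_leI)
      qed
    qed simp
  qed
  also have "\<dots> = (\<integral>\<^sup>+\<tau>. indicator {0..1} \<tau> \<partial>(lborel :: real measure)) + (\<integral>\<^sup>+\<tau>. ennreal (\<tau> powr (-2 * s - 1)) * indicator {1..} \<tau> \<partial>lborel)"
    by (intro nn_integral_add) auto
  also have "(\<integral>\<^sup>+\<tau>. ennreal (\<tau> powr (-2 * s - 1)) * indicator {1..} \<tau> \<partial>lborel) =
     ennreal (0 - (- (1 / (2 * s)) * 1 powr (-2 * s)))"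
  proof (rule nn_integral_FTC_atLeast[where F = "\<lambda>\<tau>. - (1 / (2 * s)) * \<tau> powr (-2 * s)" and T = 0 and a = 1])
    show "((\<lambda>\<tau>. - (1 / (2 * s)) * \<tau> powr (-2 * s)) has_real_derivative x powr (-2 * s - 1)) (at x)" if "1 \<le> x" for x
      using that s by (auto intro!: derivative_eq_intros)
    have "((\<lambda>\<tau>. - (1 / (2 * s)) * \<tau> powr (-2 * s)) \<longlongrightarrow> - (1 / (2 * s)) * 0) at_top"
      using s by (intro tendsto_mult tendsto_const tendsto_neg_powr filterlim_ident) auto
    then show "((\<lambda>\<tau>. - (1 / (2 * s)) * \<tau> powr (-2 * s)) \<longlongrightarrow> 0) at_top" by simp
  qed auto
  finally show ?thesis
    by (rule le_less_trans) (auto simp: less_top[symmetric] ennreal_add_eq_top)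
qed

text \<open>Together with finiteness, this lets the common factor \<open>Kint N s 1\<close> be
  cancelled at the end of the interpolation.\<close>

lemma Kint_pos: "0 < Kint N s 1"
proof (rule ccontr)
  assume "\<not> 0 < Kint N s 1"
  then have "AE \<tau> in lborel. indicator {0<..} \<tau> * ennreal (\<tau> powr (-2 * s - 1) * (Gk N \<tau> 1)\<^sup>2) = 0"
    unfolding Kint_def by (subst (asm) not_gr_zero, subst (asm) nn_integral_0_iff_AE) auto
  then have "AE \<tau> in (lborel :: real measure). \<tau> \<notin> {0<..1}"
  proof eventually_elim
    case (elim \<tau>)
    have "0 < Gk N \<tau> 1" if "0 < \<tau>" using that by (simp add: Gk_def add_pos_pos)
    then have "0 < \<tau> powr (-2 * s - 1) * (Gk N \<tau> 1)\<^sup>2" if "0 < \<tau>" using that by simp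
    then show ?case using elim by (auto simp: indicator_def split: if_splits)
  qed
  then have "emeasure lborel {0<..1::real} = 0"
    by (subst (asm) AE_iff_measurable[of "{0<..1}"]) auto
  then show False by simp
qed

lemma ennreal_cancel_left:
  fixes c x y :: ennreal
  assumes "0 < c" "c < \<infinity>" "c * x \<le> c * y"
  shows "x \<le> y"
  using assms by (simp add: ennreal_mult_le_mult_iff less_top)

context outgoing_dim
begin

text \<open>Real interpolation: \<open>\<tau>\<^sup>-\<^sup>2\<^sup>s\<^sup>-\<^sup>1 d\<tau>\<close>-averages of the squared weight \<open>Gk N \<tau> A\<close> reproduce
  \<open>A\<^sup>-\<^sup>2\<^sup>s\<close>, while for fixed \<open>\<tau>\<close> splitting \<open>f\<close> at \<open>lamy = \<tau>\<^sup>2\<close> only needs the exponents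
  \<open>0\<close> and \<open>N\<close>.\<close>
lemma Top_op_bdd_real:
  fixes q :: "par \<Rightarrow> 'a \<times> 'a \<Rightarrow> complex"
  assumes q: "cls 0 q" and s: "0 \<le> s"
  shows "op_bdd s (\<lambda>i f x. complex_of_real (jb x powr (- s)) * Top q i f x)"
proof (cases "s = 0")
  case True
  have "jb x powr (- 0) = 1" for x :: 'a using jb_pos[of x] by simp
  with Top_op_bdd_zero[OF q] True show ?thesis by simp
next
  case False
  with s have s: "0 < s" by simp
  \<comment> \<open>An integer with s + 1 <= N, as \<open>Kint_finite\<close> demands.\<close>
  define N where "N = nat \<lceil>s\<rceil> + 1"
  have N: "s + 1 \<le> real N" unfolding N_def by linarith
  obtain C0 where C0: "0 \<le> C0" "\<And>i f. rapid f \<Longrightarrow> L2sq (Top q i f) \<le> ennreal C0 * L2sq (\<lambda>y. complex_of_real (lamy i y powr (- 0 / 2)) * f y)"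
    by (rule op_bddE[OF Top_op_bdd_zero[OF q order_refl]], rule that)
  obtain C1 where C1: "0 \<le> C1" "\<And>i f. rapid f \<Longrightarrow> L2sq (\<lambda>x. complex_of_real (1 / jb x ^ N) * Top q i f x) \<le>
      ennreal C1 * L2sq (\<lambda>y. complex_of_real (lamy i y powr (- (0 + real N) / 2)) * f y)"
    by (rule op_bddE[OF Top_op_bdd[OF q order_refl, of N]], rule that)
  define C where "C = 2 * (C0 + C1)"
  have main: "L2sq (\<lambda>x. complex_of_real (jb x powr (- s)) * Top q i f x) \<le>
      ennreal C * L2sq (\<lambda>y. complex_of_real (lamy i y powr (- s / 2)) * f y)"
    if f: "rapid f" for i and f :: "'a \<Rightarrow> complex"
  proof -
    note [measurable] = rapid_measurable[OF f]
    define u where "u = Top q i f"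
    have um [measurable]: "u \<in> borel_measurable borel"
      unfolding u_def by (rule Top_measurable[OF q f])
    define l where "l y = sqrt (lamy i y)" for y :: 'a
    have lm [measurable]: "l \<in> borel_measurable borel" unfolding l_def[abs_def] by measurable
    have l1: "1 \<le> l y" for y using lamy_ge_1[of i y] by (simp add: l_def)
    have lpow: "lamy i y powr (- (0 + real N) / 2) = 1 / l y ^ N" for y
    proof -
      have "lamy i y powr (- (0 + real N) / 2) = (lamy i y powr (1/2)) powr (- real N)"
        by (simp only: powr_powr) simp
      also have "lamy i y powr (1/2) = l y"
        using lamy_ge_1[of i y] by (simp add: powr_half_sqrt l_def)
      also have "l y powr (- real N) = 1 / l y ^ N"
      proof -
        have "0 < l y" using l1[of y] by linarith
        then show ?thesis
          by (simp only: powr_minus powr_realpow divide_inverse mult_1_left)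
      qed
      finally show ?thesis .
    qed
    have fixed: "(\<integral>\<^sup>+x. ennreal ((Gk N \<tau> (jb x))\<^sup>2 * (cmod (u x))\<^sup>2) \<partial>lborel) \<le>
        ennreal C * (\<integral>\<^sup>+y. ennreal ((Gk N \<tau> (l y))\<^sup>2 * (cmod (f y))\<^sup>2) \<partial>lborel)" if \<tau>: "0 < \<tau>" for \<tau> :: real
    proof -
      have Gl: "0 \<le> Gk N \<tau> (l y)" "Gk N \<tau> (l y) \<le> 1" "1 - Gk N \<tau> (l y) = l y ^ N / (\<tau> ^ N + l y ^ N)" for y
        using Gk_bounds[OF \<tau>, of "l y" N] l1[of y] by auto
      have Gj: "0 \<le> Gk N \<tau> (jb x)" "Gk N \<tau> (jb x) \<le> 1" "Gk N \<tau> (jb x) \<le> \<tau> ^ N / jb x ^ N" for x :: 'a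
        using Gk_bounds[OF \<tau> jb_pos[of x], of N] by auto
      \<comment> \<open>\<open>f0\<close> carries the part of f where l is below
        \<open>\<tau>\<close> and is estimated without weight. \<open>f1\<close> is the rest and is
        estimated with N powers of the weight, at the price of \<open>\<tau>\<close>^N by
        \<open>Gk N \<tau> (jb x) \<le> \<tau> ^ N / jb x ^ N\<close>.\<close>
      define f0 where "f0 y = complex_of_real (Gk N \<tau> (l y)) * f y" for y
      define f1 where "f1 y = complex_of_real (1 - Gk N \<tau> (l y)) * f y" for y
      have f0: "rapid f0"
        unfolding f0_def by (rule rapid_mult_bounded[OF f, of _ 1]) (use Gl in auto)
      have f1: "rapid f1"
        unfolding f1_def
      proof (rule rapid_mult_bounded[OF f, of _ 1])
        show "cmod (complex_of_real (1 - Gk N \<tau> (l y))) \<le> 1" for y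
          unfolding norm_of_real using Gl(1,2)[of y] by linarith
      qed measurable
      note [measurable] = Top_measurable[OF q f0, of i] Top_measurable[OF q f1, of i]
      have split: "u x = Top q i f0 x + Top q i f1 x" for x
        unfolding u_def Top_add[OF q order_refl f0 f1, symmetric] f0_def f1_def by (simp flip: distrib_right)
      \<comment> \<open>This relation makes the weighted norm of \<open>f1\<close>, including the
        price \<open>\<tau>\<close>^N, equal to the norm of \<open>f0\<close>, so both pieces lead
        to the same right-hand side.\<close>
      have f1eq: "\<tau> ^ N * (1 / l y ^ N * (1 - Gk N \<tau> (l y))) = Gk N \<tau> (l y)" for y
        using l1[of y] \<tau> unfolding Gl(3) by (simp add: Gk_def)
      have "(\<integral>\<^sup>+x. ennreal ((Gk N \<tau> (jb x))\<^sup>2 * (cmod (u x))\<^sup>2) \<partial>lborel) =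
         L2sq (\<lambda>x. complex_of_real (Gk N \<tau> (jb x)) * Top q i f0 x + complex_of_real (Gk N \<tau> (jb x)) * Top q i f1 x)"
        unfolding L2sq_def split distrib_left[symmetric] by (simp add: norm_mult power_mult_distrib)
      also have "\<dots> \<le> 2 * L2sq (\<lambda>x. complex_of_real (Gk N \<tau> (jb x)) * Top q i f0 x) + 2 * L2sq (\<lambda>x. complex_of_real (Gk N \<tau> (jb x)) * Top q i f1 x)"
        by (rule L2sq_add_le) measurable
      also have "\<dots> \<le> 2 * L2sq (Top q i f0) + 2 * L2sq (\<lambda>x. complex_of_real (\<tau> ^ N) * (complex_of_real (1 / jb x ^ N) * Top q i f1 x))"
      proof (intro add_mono mult_left_mono L2sq_mono)
        show "cmod (complex_of_real (Gk N \<tau> (jb x)) * Top q i f0 x) \<le> cmod (Top q i f0 x)" for x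
          using Gj[of x] by (simp add: norm_mult mult_left_le_one_le)
        show "cmod (complex_of_real (Gk N \<tau> (jb x)) * Top q i f1 x) \<le> cmod (complex_of_real (\<tau> ^ N) * (complex_of_real (1 / jb x ^ N) * Top q i f1 x))" for x
          unfolding mult.assoc[symmetric] of_real_mult[symmetric] norm_mult norm_of_real
          using Gj[of x] \<tau> jb_pos[of x] by (intro mult_right_mono) auto
      qed auto
      also have "L2sq (\<lambda>x. complex_of_real (\<tau> ^ N) * (complex_of_real (1 / jb x ^ N) * Top q i f1 x)) =
         ennreal ((\<tau> ^ N)\<^sup>2) * L2sq (\<lambda>x. complex_of_real (1 / jb x ^ N) * Top q i f1 x)"
        unfolding L2sq_def norm_mult[of "complex_of_real (\<tau> ^ N)"] power_mult_distrib[of "cmod (complex_of_real (\<tau> ^ N))"]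
        using \<tau> by (subst nn_integral_cmult[symmetric]) (auto simp: ennreal_mult simp del: of_real_power)
      also have "2 * L2sq (Top q i f0) + 2 * (ennreal ((\<tau> ^ N)\<^sup>2) * L2sq (\<lambda>x. complex_of_real (1 / jb x ^ N) * Top q i f1 x)) \<le>
         2 * (ennreal C0 * L2sq f0) + 2 * (ennreal ((\<tau> ^ N)\<^sup>2) * (ennreal C1 * L2sq (\<lambda>y. complex_of_real (1 / l y ^ N) * f1 y)))"
      proof (intro add_mono mult_left_mono)
        have "lamy i y powr (- 0 / 2) = 1" for y :: 'a using lamy_ge_1[of i y] by simp
        then show "L2sq (Top q i f0) \<le> ennreal C0 * L2sq f0"
          using C0(2)[OF f0, of i] by simp
        show "L2sq (\<lambda>x. complex_of_real (1 / jb x ^ N) * Top q i f1 x) \<le> ennreal C1 * L2sq (\<lambda>y. complex_of_real (1 / l y ^ N) * f1 y)"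
          using C1(2)[OF f1, of i] unfolding lpow .
      qed auto
      also have "ennreal ((\<tau> ^ N)\<^sup>2) * (ennreal C1 * L2sq (\<lambda>y. complex_of_real (1 / l y ^ N) * f1 y)) = ennreal C1 * L2sq f0"
      proof -
        have "ennreal ((\<tau> ^ N)\<^sup>2) * L2sq (\<lambda>y. complex_of_real (1 / l y ^ N) * f1 y) =
          (\<integral>\<^sup>+y. ennreal ((\<tau> ^ N)\<^sup>2) * ennreal ((cmod (complex_of_real (1 / l y ^ N) * f1 y))\<^sup>2) \<partial>lborel)"
          unfolding L2sq_def f1_def by (subst nn_integral_cmult) auto
        also have "\<dots> = L2sq f0"
          unfolding L2sq_def
        proof (intro nn_integral_cong)
          fix y
          have "\<tau> ^ N * cmod (complex_of_real (1 / l y ^ N) * f1 y) = cmod (f0 y)"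
          proof -
            have c: "cmod (complex_of_real (1 / l y ^ N) * f1 y) = (1 / l y ^ N * (1 - Gk N \<tau> (l y))) * cmod (f y)"
              unfolding f1_def norm_mult norm_of_real using Gl(2)[of y] l1[of y] by simp
            have "cmod (f0 y) = Gk N \<tau> (l y) * cmod (f y)"
              unfolding f0_def norm_mult norm_of_real using Gl(1)[of y] by simp
            then show ?thesis
              unfolding c using arg_cong[OF f1eq[of y], of "\<lambda>r. r * cmod (f y)"] by (simp only: mult.assoc)
          qed
          then have "(\<tau> ^ N)\<^sup>2 * (cmod (complex_of_real (1 / l y ^ N) * f1 y))\<^sup>2 = (cmod (f0 y))\<^sup>2"
            by (simp add: power_mult_distrib[symmetric])
          then show "ennreal ((\<tau> ^ N)\<^sup>2) * ennreal ((cmod (complex_of_real (1 / l y ^ N) * f1 y))\<^sup>2) = ennreal ((cmod (f0 y))\<^sup>2)"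
            by (simp only: ennreal_mult[symmetric] zero_le_power2)
        qed
        finally show ?thesis by (simp add: mult_ac)
      qed
      also have "2 * (ennreal C0 * L2sq f0) + 2 * (ennreal C1 * L2sq f0) = ennreal C * L2sq f0"
        using C0(1) C1(1) by (simp add: C_def ennreal_mult distrib_left distrib_right mult.assoc)
      also have "L2sq f0 = (\<integral>\<^sup>+y. ennreal ((Gk N \<tau> (l y))\<^sup>2 * (cmod (f y))\<^sup>2) \<partial>lborel)"
        unfolding L2sq_def f0_def by (simp add: norm_mult power_mult_distrib)
      finally show ?thesis .
    qed
    \<comment> \<open>Tonelli and \<open>Kint_scale\<close> turn the average over
      \<open>\<tau>\<close> into the power -s of A. It is applied with A = \<open>jb\<close> to the
      output and with A = \<open>l\<close> to the input.\<close>
    have swap: "(\<integral>\<^sup>+\<tau>. indicator {0<..} \<tau> * ennreal (\<tau> powr (-2 * s - 1)) * (\<integral>\<^sup>+x. ennreal ((Gk N \<tau> (A x))\<^sup>2 * (cmod (v x))\<^sup>2) \<partial>lborel) \<partial>lborel)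
        = Kint N s 1 * L2sq (\<lambda>x. complex_of_real (A x powr (- s)) * v x)"
      if [measurable]: "A \<in> borel_measurable borel" "v \<in> borel_measurable borel" and A: "\<And>x. 0 < A x" for A :: "'a \<Rightarrow> real" and v
    proof -
      let ?F = "\<lambda>p. indicator {0<..} (fst p) * ennreal (fst p powr (-2 * s - 1)) * ennreal ((Gk N (fst p) (A (snd p)))\<^sup>2 * (cmod (v (snd p)))\<^sup>2)"
      have Fm: "?F \<in> borel_measurable borel" by measurable
      have "(\<integral>\<^sup>+\<tau>. indicator {0<..} \<tau> * ennreal (\<tau> powr (-2 * s - 1)) * (\<integral>\<^sup>+x. ennreal ((Gk N \<tau> (A x))\<^sup>2 * (cmod (v x))\<^sup>2) \<partial>lborel) \<partial>lborel)
        = (\<integral>\<^sup>+\<tau>. \<integral>\<^sup>+x. ?F (\<tau>, x) \<partial>lborel \<partial>lborel)"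
        by (intro nn_integral_cong) (subst nn_integral_cmult[symmetric], auto)
      also have "\<dots> = (\<integral>\<^sup>+x. \<integral>\<^sup>+\<tau>. ?F (\<tau>, x) \<partial>lborel \<partial>lborel)"
        using lborel_Tonelli[OF Fm] by simp
      also have "\<dots> = (\<integral>\<^sup>+x. Kint N s 1 * ennreal ((cmod (complex_of_real (A x powr (- s)) * v x))\<^sup>2) \<partial>lborel)"
      proof (intro nn_integral_cong)
        fix x
        have "(\<integral>\<^sup>+\<tau>. ?F (\<tau>, x) \<partial>lborel) = (\<integral>\<^sup>+\<tau>. (indicator {0<..} \<tau> * ennreal (\<tau> powr (-2 * s - 1) * (Gk N \<tau> (A x))\<^sup>2)) * ennreal ((cmod (v x))\<^sup>2) \<partial>lborel)"
          by (intro nn_integral_cong) (simp add: ennreal_mult mult_ac)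
        also have "\<dots> = Kint N s (A x) * ennreal ((cmod (v x))\<^sup>2)"
          unfolding Kint_def by (subst nn_integral_multc) auto
        also have "\<dots> = Kint N s 1 * (ennreal (A x powr (-2 * s)) * ennreal ((cmod (v x))\<^sup>2))"
          unfolding Kint_scale[OF A] by (simp only: mult_ac)
        also have "ennreal (A x powr (-2 * s)) * ennreal ((cmod (v x))\<^sup>2) = ennreal ((cmod (complex_of_real (A x powr (- s)) * v x))\<^sup>2)"
        proof -
          have "(A x powr (- s))\<^sup>2 = A x powr (-2 * s)"
            using powr_add[of "A x" "- s" "- s"] by (simp add: power2_eq_square)
          then show ?thesis
            by (simp add: norm_mult power_mult_distrib ennreal_mult)
        qed
        finally show "(\<integral>\<^sup>+\<tau>. ?F (\<tau>, x) \<partial>lborel) = Kint N s 1 * ennreal ((cmod (complex_of_real (A x powr (- s)) * v x))\<^sup>2)" .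
      qed
      also have "\<dots> = Kint N s 1 * L2sq (\<lambda>x. complex_of_real (A x powr (- s)) * v x)"
        unfolding L2sq_def by (rule nn_integral_cmult) measurable
      finally show ?thesis .
    qed
    have "Kint N s 1 * L2sq (\<lambda>x. complex_of_real (jb x powr (- s)) * u x) \<le>
        Kint N s 1 * (ennreal C * L2sq (\<lambda>y. complex_of_real (l y powr (- s)) * f y))"
    proof -
      let ?R = "\<lambda>\<tau>. \<integral>\<^sup>+y. ennreal ((Gk N \<tau> (l y))\<^sup>2 * (cmod (f y))\<^sup>2) \<partial>lborel"
      have l0: "0 < l y" for y using l1[of y] by linarith
      have "Kint N s 1 * L2sq (\<lambda>x. complex_of_real (jb x powr (- s)) * u x) \<le>
         (\<integral>\<^sup>+\<tau>. ennreal C * (indicator {0<..} \<tau> * ennreal (\<tau> powr (-2 * s - 1)) * ?R \<tau>) \<partial>lborel)"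
        unfolding swap[OF jb_measurable um jb_pos, symmetric]
      proof (intro nn_integral_mono)
        fix \<tau> :: real
        show "indicator {0<..} \<tau> * ennreal (\<tau> powr (-2 * s - 1)) * (\<integral>\<^sup>+x. ennreal ((Gk N \<tau> (jb x))\<^sup>2 * (cmod (u x))\<^sup>2) \<partial>lborel) \<le>
          ennreal C * (indicator {0<..} \<tau> * ennreal (\<tau> powr (-2 * s - 1)) * ?R \<tau>)"
        proof (cases "0 < \<tau>")
          case True
          have "ennreal (\<tau> powr (-2 * s - 1)) * (\<integral>\<^sup>+x. ennreal ((Gk N \<tau> (jb x))\<^sup>2 * (cmod (u x))\<^sup>2) \<partial>lborel)
              \<le> ennreal (\<tau> powr (-2 * s - 1)) * (ennreal C * ?R \<tau>)"
            by (intro mult_left_mono fixed True) auto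
          then show ?thesis using True by (simp add: mult_ac)
        qed simp
      qed
      also have "\<dots> = ennreal C * (\<integral>\<^sup>+\<tau>. indicator {0<..} \<tau> * ennreal (\<tau> powr (-2 * s - 1)) * ?R \<tau> \<partial>lborel)"
      proof (rule nn_integral_cmult)
        have "(\<lambda>p. ennreal ((Gk N (fst p) (l (snd p)))\<^sup>2 * (cmod (f (snd p)))\<^sup>2)) \<in> borel_measurable (lborel \<Otimes>\<^sub>M lborel)"
          by measurable
        from lborel.borel_measurable_nn_integral_fst[OF this]
        have [measurable]: "?R \<in> borel_measurable borel" by simp
        show "(\<lambda>\<tau>. indicator {0<..} \<tau> * ennreal (\<tau> powr (-2 * s - 1)) * ?R \<tau>) \<in> borel_measurable lborel"
          by measurable
      qed
      also have "\<dots> = ennreal C * (Kint N s 1 * L2sq (\<lambda>y. complex_of_real (l y powr (- s)) * f y))"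
        unfolding swap[OF lm rapid_measurable[OF f] l0] ..
      finally show ?thesis by (simp only: mult_ac)
    qed
    then have "L2sq (\<lambda>x. complex_of_real (jb x powr (- s)) * u x) \<le> ennreal C * L2sq (\<lambda>y. complex_of_real (l y powr (- s)) * f y)"
      by (rule ennreal_cancel_left[OF Kint_pos Kint_finite[OF s N]])
    moreover have "l y powr (- s) = lamy i y powr (- s / 2)" for y
    proof -
      have "l y = lamy i y powr (1/2)" using lamy_ge_1[of i y] by (simp add: l_def powr_half_sqrt)
      then have "l y powr (- s) = lamy i y powr (1/2 * (- s))" by (simp only: powr_powr)
      then show ?thesis by simp
    qed
    ultimately show ?thesis by (simp add: u_def)
  qed
  show ?thesis
    unfolding op_bdd_def
  proof (intro exI[of _ C] conjI allI impI)
    show "0 \<le> C" using C0(1) C1(1) by (simp add: C_def)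
    fix i :: par and f :: "'a \<Rightarrow> complex" assume f: "rapid f"
    show "(\<lambda>x. complex_of_real (jb x powr (- s)) * Top q i f x) \<in> borel_measurable borel"
      using Top_measurable[OF q f, of i] by measurable
    show "L2sq (\<lambda>x. complex_of_real (jb x powr (- s)) * Top q i f x) \<le>
      ennreal C * L2sq (\<lambda>y. complex_of_real (lamy i y powr (- s / 2)) * f y)"
      by (rule main[OF f])
  qed
qed

end

subsection \<open>Symbols from smooth functions\<close>

lemma smooth_fn_continuous: "smooth_fn p \<Longrightarrow> set vs \<subseteq> Basis \<Longrightarrow> continuous_on UNIV (iter_pd vs p)"
  unfolding smooth_fn_def by blast

lemma smooth_fn_deriv:
  assumes "smooth_fn p" "set vs \<subseteq> Basis" "w \<in> Basis"
  shows "((\<lambda>s. iter_pd vs p (x + s *\<^sub>R w)) has_vector_derivative iter_pd (w # vs) p x) (at 0)"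
proof -
  have "(\<lambda>s. iter_pd vs p (x + s *\<^sub>R w)) differentiable (at 0)"
    using assms unfolding smooth_fn_def by blast
  then show ?thesis
    unfolding iter_pd.simps by (simp only: vector_derivative_works)
qed

text \<open>If L sends basis vectors to zero or to basis vectors up to sign, derivatives of the
  composition with L are again iterated partial derivatives of p, up to sign. This covers the
  identity, the projection \<open>snd\<close> and the reflection (\<open>\<xi>\<close>, y) -> (y,
  -\<open>\<xi>\<close>).\<close>

lemma sym_iter_pd:
  fixes p :: "'c::euclidean_space \<Rightarrow> complex" and L :: "'e::euclidean_space \<Rightarrow> 'c"
    and \<mu> :: "'i \<Rightarrow> 'e \<Rightarrow> real"
  assumes p: "smooth_fn p" and L: "bounded_linear L"
    and LB: "\<And>v. v \<in> Basis \<Longrightarrow> L v = 0 \<or> L v \<in> Basis \<or> - L v \<in> Basis"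
    and bound: "\<And>vs. set vs \<subseteq> Basis \<Longrightarrow> \<exists>C. \<forall>i. \<forall>z\<in>\<Omega>. cmod (iter_pd vs p (L z)) \<le> C * \<mu> i z"
    and mu: "\<And>i z. 0 \<le> \<mu> i z"
  shows "set vs \<subseteq> Basis \<Longrightarrow> symn n \<Omega> \<mu> (\<lambda>i z. iter_pd vs p (L z))"
proof (induction n arbitrary: vs)
  have s0: "sym0 \<Omega> \<mu> (\<lambda>i z. iter_pd vs p (L z))" if vs: "set vs \<subseteq> Basis" for vs
  proof -
    obtain C where C: "\<And>i z. z \<in> \<Omega> \<Longrightarrow> cmod (iter_pd vs p (L z)) \<le> C * \<mu> i z"
      using bound[OF vs] by blast
    have "cmod (iter_pd vs p (L z)) \<le> \<bar>C\<bar> * \<mu> i z" if "z \<in> \<Omega>" for i z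
      using C[OF that, of i] mult_right_mono[OF abs_ge_self[of C] mu[of i z]] by linarith
    moreover have "continuous_on \<Omega> (\<lambda>z. iter_pd vs p (L z))"
      by (rule continuous_on_compose2[OF smooth_fn_continuous[OF p vs] bounded_linear.continuous_on[OF L continuous_on_id]]) simp
    ultimately show ?thesis
      unfolding sym0_def by (intro conjI allI exI[of _ "\<bar>C\<bar>"]) auto
  qed
  {
    case 0
    from s0[OF this] show ?case by simp
  next
    case (Suc n)
    show ?case
    proof (rule sym_SucI[OF s0[OF Suc.prems]])
      fix v :: 'e assume v: "v \<in> Basis"
      interpret L: bounded_linear L by fact
      note d = smooth_fn_deriv[OF p Suc.prems]
      have Lz: "L (z + s *\<^sub>R v) = L z + s *\<^sub>R L v" for z s
        by (simp add: L.add L.scaleR)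
      consider "L v = 0" | "L v \<in> Basis" | "- L v \<in> Basis" using LB[OF v] by blast
      then show "\<exists>a'. (\<forall>i. \<forall>z\<in>\<Omega>. ((\<lambda>s. iter_pd vs p (L (z + s *\<^sub>R v))) has_vector_derivative a' i z) (at 0)) \<and> symn n \<Omega> \<mu> a'"
      proof cases
        case 1
        have "symn n \<Omega> \<mu> (\<lambda>i z. 0 :: complex)"
          by (rule sym_const[where C = 0]) auto
        then show ?thesis
          unfolding Lz 1 by (intro exI[of _ "\<lambda>i z. 0"] conjI allI ballI) auto
      next
        case 2
        show ?thesis
          unfolding Lz by (intro exI[of _ "\<lambda>i z. iter_pd (L v # vs) p (L z)"] conjI allI ballI d[OF 2] Suc.IH) (use 2 Suc.prems in auto)
      next
        case 3
        have "((\<lambda>s. iter_pd vs p (L z + s *\<^sub>R L v)) has_vector_derivative - iter_pd (- L v # vs) p (L z)) (at 0)" for z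
        proof -
          have "((\<lambda>s. iter_pd vs p (L z + s *\<^sub>R (- L v))) \<circ> uminus has_vector_derivative (-1) *\<^sub>R iter_pd (- L v # vs) p (L z)) (at 0)"
          proof (rule vector_diff_chain_at)
            show "(uminus has_vector_derivative - 1) (at (0::real))"
              by (auto intro!: derivative_eq_intros)
            show "((\<lambda>s. iter_pd vs p (L z + s *\<^sub>R (- L v))) has_vector_derivative iter_pd (- L v # vs) p (L z)) (at (- 0))"
              using d[OF 3, of "L z"] by (simp only: minus_zero)
          qed
          then show ?thesis by (simp add: comp_def del: iter_pd.simps)
        qed
        moreover have "symn n \<Omega> \<mu> (\<lambda>i z. - iter_pd (- L v # vs) p (L z))"
          by (rule sym_bounded_linear[OF bounded_linear_minus[OF bounded_linear_ident]], rule Suc.IH) (use 3 Suc.prems in auto)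
        ultimately show ?thesis
          unfolding Lz by (intro exI[of _ "\<lambda>i z. - iter_pd (- L v # vs) p (L z)"] conjI allI ballI)
      qed
    qed
  }
qed

lemma jsq_powr: "jsq i z powr (l / 2) = jb (snd z) powr l"
proof -
  have "jsq i z = jb (snd z) powr 2" using jb_pos[of "snd z"] jb_sq[of "snd z"] by (simp add: jsq_def)
  then show ?thesis by (simp add: powr_powr)
qed

lemma jb_powr_le_power:
  obtains n :: nat where "\<And>y :: 'a::real_normed_vector. jb y powr \<delta> \<le> jb y ^ n"
proof -
  have "jb y powr \<delta> \<le> jb y ^ nat \<lceil>\<delta>\<rceil>" for y :: 'a
    using jb_ge_1[of y] jb_pos[of y] powr_mono[of \<delta> "real (nat \<lceil>\<delta>\<rceil>)" "jb y"] real_nat_ceiling_ge[of \<delta>]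
    by (simp add: powr_realpow)
  then show thesis using that by blast
qed

lemma rapid_jb_powr:
  fixes f :: "'a::euclidean_space \<Rightarrow> complex"
  assumes "rapid f"
  shows "rapid (\<lambda>y. complex_of_real (jb y powr \<delta>) * f y)"
proof -
  obtain n where n: "\<And>y :: 'a. jb y powr \<delta> \<le> jb y ^ n" using jb_powr_le_power by blast
  show ?thesis
    by (rule rapid_mult[OF assms, of _ 1 n]) (use n in auto)
qed

definition Reg :: "('a::euclidean_space \<times> 'a \<Rightarrow> complex) \<Rightarrow> real \<Rightarrow> nat \<Rightarrow> ('a \<Rightarrow> complex) \<Rightarrow> 'a \<Rightarrow> complex" where
  "Reg q t n f x = (LINT z|lborel. osc (t, n) x z * (q z * complex_of_real (rg (t, n) (fst z))) * f (snd z))"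

text \<open>The map L lets one estimate serve both operators: it is the identity for P_+ and the
  reflection for the transposed P_-. Regularising p o L gives a symbol of order 0, to which the
  interpolated bound applies.\<close>

lemma outgoing_estimate:
  fixes p :: "'a::euclidean_space \<times> 'a \<Rightarrow> complex" and L :: "'a \<times> 'a \<Rightarrow> 'a \<times> 'a"
  assumes "0 < \<sigma>" "-1 < \<kappa>" "\<kappa> < 1"
    and p: "smooth_bdd_derivs p" and L: "bounded_linear L"
    and LB: "\<And>v. v \<in> Basis \<Longrightarrow> L v = 0 \<or> L v \<in> Basis \<or> - L v \<in> Basis"
    and dec: "\<And>vs l. set vs \<subseteq> Basis \<Longrightarrow> 0 \<le> l \<Longrightarrow> \<exists>C. \<forall>z. fst z \<noteq> 0 \<longrightarrow> snd z \<noteq> 0 \<longrightarrow> cosang (snd z) (fst z) < \<kappa> \<longrightarrow>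
        cmod (iter_pd vs p (L z)) \<le> C * jb (snd z) powr (- l)"
    and zero: "\<And>z. norm (fst z) < \<sigma> \<or> norm (snd z) < \<sigma> \<Longrightarrow> p (L z) = 0"
    and s: "0 \<le> \<delta>" "\<delta> \<le> s"
  shows "\<exists>C\<ge>0. \<forall>t n f. 0 \<le> t \<longrightarrow> rapid f \<longrightarrow>
    L2sq (\<lambda>x. complex_of_real (jb x powr (- s)) * Reg (\<lambda>z. p (L z)) t n (\<lambda>y. complex_of_real (jb y powr \<delta>) * f y) x)
      \<le> ennreal (C * (jb t powr (\<delta> - s))\<^sup>2) * L2sq f"
proof -
  interpret outgoing_dim \<sigma> \<kappa> "real DIM('a)" "TYPE('a)"
    by unfold_locales (use assms in auto)
  define q where "q i z = p (L z) * complex_of_real (regsq i z powr (- real DIM('a)))" for i and z :: "'a \<times> 'a"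
  have sm: "smooth_fn p" using p by (simp add: smooth_bdd_derivs_def)
  have b1: "symn n UNIV (\<lambda>_ _. 1) (\<lambda>(i::par) z. iter_pd [] p (L z))" for n
  proof (rule sym_iter_pd[OF sm L LB])
    fix vs :: "('a \<times> 'a) list" assume "set vs \<subseteq> Basis"
    then have "bounded (range (iter_pd vs p))" using p by (auto simp: smooth_bdd_derivs_def)
    then obtain C where "\<forall>u\<in>range (iter_pd vs p). norm u \<le> C"
      unfolding bounded_iff ..
    then have "cmod (iter_pd vs p (L z)) \<le> C * 1" for z
      by (simp del: split_paired_All)
    then show "\<exists>C. \<forall>i::par. \<forall>z\<in>UNIV. cmod (iter_pd vs p (L z)) \<le> C * 1"
      by blast
  qed auto
  have b2: "symn n Gamma (\<lambda>i z. jsq i z powr (- l / 2)) (\<lambda>(i::par) z. iter_pd [] p (L z))" if l: "0 \<le> l" for n l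
  proof (rule sym_iter_pd[OF sm L LB])
    fix vs :: "('a \<times> 'a) list" assume vs: "set vs \<subseteq> Basis"
    obtain C where C: "\<And>z. fst z \<noteq> 0 \<Longrightarrow> snd z \<noteq> 0 \<Longrightarrow> cosang (snd z) (fst z) < \<kappa> \<Longrightarrow>
        cmod (iter_pd vs p (L z)) \<le> C * jb (snd z) powr (- l)"
      using dec[OF vs l] by blast
    show "\<exists>C. \<forall>i. \<forall>z\<in>Gamma. cmod (iter_pd vs p (L z)) \<le> C * jsq i z powr (- l / 2)"
      unfolding jsq_powr
      by (intro exI[of _ C] allI ballI C) (use sigma in \<open>auto simp: Gamma_def Omega_def cosf_def\<close>)
  qed auto
  have r: "symn n U (\<lambda>i z. regsq i z powr (- real DIM('a))) (\<lambda>i (z::'a \<times> 'a). complex_of_real (regsq i z powr (- real DIM('a))))" for n U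
    by (rule sym_subset[OF sym_of_real[OF sym_regsq_powr]]) auto
  have q: "cls 0 q"
    unfolding cls_def symb_def
  proof (intro conjI allI impI)
    fix n
    show "symn n UNIV (wt 0 0) q"
      unfolding q_def[abs_def]
    proof (rule sym_weaken[OF sym_mult[OF b1[unfolded iter_pd.simps] r], where c = 1])
      show "1 * regsq i z powr (- real DIM('a)) \<le> 1 * wt 0 0 i z" for i and z :: "'a \<times> 'a"
        using lamsq_ge_1[of i z] jsq_ge_1[of i z] by (simp add: wt_def)
    qed auto
  next
    fix n and l :: real assume l: "0 \<le> l"
    show "symn n Gamma (wt 0 l) q"
      unfolding q_def[abs_def]
    proof (rule sym_weaken[OF sym_mult[OF b2[OF l, unfolded iter_pd.simps] r], where c = 1])
      show "jsq i z powr (- l / 2) * regsq i z powr (- real DIM('a)) \<le> 1 * wt 0 l i z" for i and z :: "'a \<times> 'a"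
        using lamsq_ge_1[of i z] by (simp add: wt_def)
    qed auto
  next
    fix i and z :: "'a \<times> 'a" assume "z \<notin> Kset"
    then show "q i z = 0" using zero[of z] by (auto simp: q_def Kset_def not_le)
  qed
  obtain C where C: "0 \<le> C" "\<And>i f. rapid f \<Longrightarrow> L2sq (\<lambda>x. complex_of_real (jb x powr (- s)) * Top q i f x) \<le>
      ennreal C * L2sq (\<lambda>y. complex_of_real (lamy i y powr (- s / 2)) * f y)"
    by (rule op_bddE[OF Top_op_bdd_real[OF q order_trans[OF s]]], rule that)
  show ?thesis
  proof (intro exI[of _ C] conjI allI impI C(1))
    fix t :: real and n and f :: "'a \<Rightarrow> complex" assume t: "0 \<le> t" and f: "rapid f"
    let ?f = "\<lambda>y. complex_of_real (jb y powr \<delta>) * f y"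
    have "L2sq (\<lambda>x. complex_of_real (jb x powr (- s)) * Reg (\<lambda>z. p (L z)) t n ?f x) =
        L2sq (\<lambda>x. complex_of_real (jb x powr (- s)) * Top q (t, n) ?f x)"
      unfolding Reg_def Top_def q_def rg_eq ..
    also have "\<dots> \<le> ennreal C * L2sq (\<lambda>y. complex_of_real (lamy (t, n) y powr (- s / 2)) * ?f y)"
      by (rule C(2)[OF rapid_jb_powr[OF f]])
    also have "\<dots> \<le> ennreal C * (ennreal ((jb t powr (\<delta> - s))\<^sup>2) * L2sq f)"
    proof (rule mult_left_mono)
      have le: "lamy (t, n) y powr (- s / 2) * jb y powr \<delta> \<le> jb t powr (\<delta> - s)" for y :: 'a
      proof -
        have 1: "(jb y)\<^sup>2 \<le> lamy (t, n) y" "(jb t)\<^sup>2 \<le> lamy (t, n) y"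
          using t by (auto simp: jb_sq lamy_def tm_def)
        have sq: "(r\<^sup>2) powr (a / 2) = r powr a" if "0 < r" for r a :: real
        proof -
          have "r\<^sup>2 = r powr 2" using that by simp
          then show ?thesis by (simp only: powr_powr) simp
        qed
        \<comment> \<open>Both new exponents are nonpositive because 0 <= \<open>\<delta>\<close> <=
          s, so one factor can be compared with the bracket of t and the other with that of
          y.\<close>
        have "lamy (t, n) y powr (- s / 2) = lamy (t, n) y powr ((\<delta> - s) / 2) * lamy (t, n) y powr (- \<delta> / 2)"
          by (simp only: powr_add[symmetric]) (simp add: field_simps)
        also have "\<dots> \<le> ((jb t)\<^sup>2) powr ((\<delta> - s) / 2) * ((jb y)\<^sup>2) powr (- \<delta> / 2)"
          using 1 jb_pos[of t] jb_pos[of y] s by (intro mult_mono powr_mono2') auto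
        also have "\<dots> = jb t powr (\<delta> - s) * jb y powr (- \<delta>)"
          by (simp only: sq jb_pos)
        finally have "lamy (t, n) y powr (- s / 2) * jb y powr \<delta> \<le> jb t powr (\<delta> - s) * jb y powr (- \<delta>) * jb y powr \<delta>"
          by (rule mult_right_mono) simp
        also have "\<dots> = jb t powr (\<delta> - s)"
          using jb_pos[of y] by (simp add: mult.assoc powr_add[symmetric])
        finally show ?thesis .
      qed
      have "L2sq (\<lambda>y. complex_of_real (lamy (t, n) y powr (- s / 2)) * ?f y) \<le> L2sq (\<lambda>y. complex_of_real (jb t powr (\<delta> - s)) * f y)"
      proof (rule L2sq_mono)
        fix y
        show "cmod (complex_of_real (lamy (t, n) y powr (- s / 2)) * ?f y) \<le> cmod (complex_of_real (jb t powr (\<delta> - s)) * f y)"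
          unfolding mult.assoc[symmetric] of_real_mult[symmetric] norm_mult norm_of_real
          using le[of y] by (intro mult_right_mono) auto
      qed
      also have "\<dots> = ennreal ((jb t powr (\<delta> - s))\<^sup>2) * L2sq f"
        unfolding L2sq_def norm_mult power_mult_distrib using rapid_measurable[OF f]
        by (subst nn_integral_cmult[symmetric]) (auto simp: ennreal_mult)
      finally show "L2sq (\<lambda>y. complex_of_real (lamy (t, n) y powr (- s / 2)) * ?f y) \<le> ennreal ((jb t powr (\<delta> - s))\<^sup>2) * L2sq f" .
    qed simp
    also have "\<dots> = ennreal (C * (jb t powr (\<delta> - s))\<^sup>2) * L2sq f"
      using C(1) by (simp add: ennreal_mult mult.assoc)
    finally show "L2sq (\<lambda>x. complex_of_real (jb x powr (- s)) * Reg (\<lambda>z. p (L z)) t n ?f x) \<le>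
       ennreal (C * (jb t powr (\<delta> - s))\<^sup>2) * L2sq f" .
  qed
qed

subsection \<open>Decay of partial Fourier transforms\<close>

text \<open>Rapid decay in y, uniformly in \<open>\<xi>\<close>, for the function and all its
  derivatives. A constant family indexed by \<open>par\<close> is used so that the symbol calculus
  applies to a single function.\<close>

definition schwartz_y :: "('a::euclidean_space \<times> 'a \<Rightarrow> complex) \<Rightarrow> bool" where
  "schwartz_y b \<longleftrightarrow> (\<forall>l. symb UNIV (\<lambda>i z. jsq i z powr (- l / 2)) (\<lambda>i::par. b))"

lemma schwartz_y_sym0: "schwartz_y b \<Longrightarrow> sym0 UNIV (\<lambda>i z. jsq i z powr (- l / 2)) (\<lambda>i::par. b)"
  unfolding schwartz_y_def symb_def by (metis sym_imp_sym0)

lemma schwartz_y_continuous: "schwartz_y b \<Longrightarrow> continuous_on UNIV b"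
  using schwartz_y_sym0[of b 0] by (simp add: sym0_def)

lemma schwartz_y_bound:
  assumes "schwartz_y (b :: 'a::euclidean_space \<times> 'a \<Rightarrow> complex)"
  obtains C where "0 \<le> C" "\<And>\<xi> y. cmod (b (\<xi>, y)) \<le> C * (1 / jb y ^ (2 * DIM('a)))"
proof -
  obtain C where C: "0 \<le> C" "\<And>(i::par) z. cmod (b z) \<le> C * jsq i z powr (- real (2 * DIM('a)) / 2)"
    using schwartz_y_sym0[OF assms, of "real (2 * DIM('a))"] unfolding sym0_def by blast
  have "cmod (b (\<xi>, y)) \<le> C * (1 / jb y ^ (2 * DIM('a)))" for \<xi> y
    using C(2)[of "(\<xi>, y)" undefined] jb_pos[of y] unfolding jsq_powr powr_minus
    by (simp add: powr_realpow divide_inverse del: of_nat_mult)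
  then show thesis using that C(1) by blast
qed

lemma schwartz_y_deriv:
  assumes "schwartz_y b" "v \<in> Basis"
  obtains b' where "\<And>z. ((\<lambda>s. b (z + s *\<^sub>R v)) has_vector_derivative b' z) (at 0)" "schwartz_y b'"
proof -
  obtain a where a: "\<And>(i::par) z. z \<in> UNIV \<Longrightarrow> ((\<lambda>s. b (z + s *\<^sub>R v)) has_vector_derivative a i z) (at 0)"
    using assms(1) unfolding schwartz_y_def
    by (metis symb_deriv[of UNIV _ "\<lambda>i. b" v, OF _ open_UNIV assms(2)])
  have "symb UNIV (\<lambda>i z. jsq i z powr (- l / 2)) (\<lambda>i::par. a undefined)" for l
  proof -
    obtain c where c: "\<And>(i::par) z. z \<in> UNIV \<Longrightarrow> ((\<lambda>s. b (z + s *\<^sub>R v)) has_vector_derivative c i z) (at 0)"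
      "symb UNIV (\<lambda>i z. jsq i z powr (- l / 2)) c"
      by (rule symb_deriv[OF assms(1)[unfolded schwartz_y_def, rule_format, of l] open_UNIV assms(2)], rule that)
    have "c = (\<lambda>i. a undefined)"
      by (intro ext) (rule vector_derivative_unique_at[OF c(1)[OF UNIV_I] a[OF UNIV_I]])
    with c(2) show ?thesis by simp
  qed
  then have "schwartz_y (a undefined)" by (simp add: schwartz_y_def)
  with a[OF UNIV_I] show thesis by (rule that)
qed

text \<open>The Fourier transform in y on the diagonal: \<open>\<xi>\<close> is at once the
  frequency and the parameter of b. Up to a unimodular factor in x, this is the
  \<open>\<xi>\<close>-integrand of the oscillatory integral without its cutoff.\<close>

definition FTy :: "('a::euclidean_space \<times> 'a \<Rightarrow> complex) \<Rightarrow> 'a \<Rightarrow> complex" where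
  "FTy b \<xi> = (LINT y|lborel. cis (- (y \<bullet> \<xi>)) * b (\<xi>, y))"

lemma schwartz_y_integrable:
  assumes b: "schwartz_y b"
  shows "integrable lborel (\<lambda>y. cis (- (y \<bullet> \<xi>)) * b (\<xi>, y))"
proof -
  obtain C where C: "0 \<le> C" "\<And>\<xi> y. cmod (b (\<xi>, y)) \<le> C * (1 / jb y ^ (2 * DIM('a)))"
    by (rule schwartz_y_bound[OF b], rule that)
  have [measurable]: "b \<in> borel_measurable borel"
    by (rule borel_measurable_continuous_onI[OF schwartz_y_continuous[OF b]])
  show ?thesis
    by (rule Bochner_Integration.integrable_bound[OF integrable_mult_right[OF integrable_inv_jb, of C]])
      (use C in \<open>auto simp: norm_mult intro: order_trans[OF _ abs_ge_self]\<close>)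
qed

lemma FTy_bounded:
  assumes b: "schwartz_y b"
  obtains C where "\<And>\<xi>. cmod (FTy b \<xi>) \<le> C"
proof -
  obtain C where C: "0 \<le> C" "\<And>\<xi> y. cmod (b (\<xi>, y)) \<le> C * (1 / jb y ^ (2 * DIM('a)))"
    by (rule schwartz_y_bound[OF b], rule that)
  have "cmod (FTy b \<xi>) \<le> (LINT y|lborel. C * (1 / jb (y::'a) ^ (2 * DIM('a))))" for \<xi>
    unfolding FTy_def
    by (rule Bochner_Integration.integral_norm_bound_integral[OF schwartz_y_integrable[OF b] integrable_mult_right[OF integrable_inv_jb]])
      (use C in \<open>auto simp: norm_mult\<close>)
  then show thesis using that by blast
qed

lemma FTy_continuous:
  assumes b: "schwartz_y b"
  shows "continuous_on UNIV (FTy b)"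
proof (intro continuous_at_imp_continuous_on ballI)
  fix x :: 'a
  obtain C where C: "0 \<le> C" "\<And>\<xi> y. cmod (b (\<xi>, y)) \<le> C * (1 / jb y ^ (2 * DIM('a)))"
    by (rule schwartz_y_bound[OF b], rule that)
  have [measurable]: "b \<in> borel_measurable borel"
    by (rule borel_measurable_continuous_onI[OF schwartz_y_continuous[OF b]])
  show "isCont (FTy b) x"
    unfolding continuous_at_sequentially comp_def FTy_def
  proof (intro allI impI)
    fix u assume u: "u \<longlonglongrightarrow> x"
    show "(\<lambda>n. LINT y|lborel. cis (- (y \<bullet> u n)) * b (u n, y)) \<longlonglongrightarrow> (LINT y|lborel. cis (- (y \<bullet> x)) * b (x, y))"
    proof (rule integral_dominated_convergence[where w = "\<lambda>y. C * (1 / jb y ^ (2 * DIM('a)))"])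
      show "integrable lborel (\<lambda>y::'a. C * (1 / jb y ^ (2 * DIM('a))))"
        by (rule integrable_mult_right[OF integrable_inv_jb])
      show "AE y in lborel. (\<lambda>n. cis (- (y \<bullet> u n)) * b (u n, y)) \<longlonglongrightarrow> cis (- (y \<bullet> x)) * b (x, y)"
        by (intro AE_I2 tendsto_intros continuous_on_tendsto_compose[OF schwartz_y_continuous[OF b]] u) auto
    qed (use C in \<open>auto simp: norm_mult\<close>)
  qed
qed

text \<open>Integration by parts in y at fixed \<open>\<xi>\<close>; as only y varies, the
  dependence of b on its parameter \<open>\<xi>\<close> produces no term.\<close>

lemma FTy_deriv:
  assumes b: "schwartz_y b" and v: "v \<in> Basis"
    and b': "\<And>z. ((\<lambda>s. b (z + s *\<^sub>R (0, v))) has_vector_derivative b' z) (at 0)" "schwartz_y b'"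
  shows "FTy b' \<xi> = \<i> * complex_of_real (\<xi> \<bullet> v) * FTy b \<xi>"
proof -
  let ?h = "\<lambda>y. cis (- (y \<bullet> \<xi>)) * b (\<xi>, y)"
  let ?h' = "\<lambda>y. (- \<i> * complex_of_real (\<xi> \<bullet> v)) * (cis (- (y \<bullet> \<xi>)) * b (\<xi>, y)) + cis (- (y \<bullet> \<xi>)) * b' (\<xi>, y)"
  note I = schwartz_y_integrable[OF b, of \<xi>] schwartz_y_integrable[OF b'(2), of \<xi>]
  have "integral\<^sup>L lborel ?h' = 0"
  proof (rule integral_directional_derivative[where v = v, OF I(1)])
    show "integrable lborel ?h'"
      by (intro Bochner_Integration.integrable_add integrable_mult_right I)
    have cp: "continuous_on UNIV (\<lambda>y::'a. (\<xi>, y))" by (intro continuous_intros)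
    show "continuous_on UNIV ?h'"
      by (intro continuous_intros continuous_on_compose2[OF schwartz_y_continuous[OF b] cp]
          continuous_on_compose2[OF schwartz_y_continuous[OF b'(2)] cp]) auto
    fix y
    have db: "((\<lambda>s. b (\<xi>, y + s *\<^sub>R v)) has_vector_derivative b' (\<xi>, y)) (at 0)"
      using b'(1)[of "(\<xi>, y)"] by simp
    have dc: "((\<lambda>s. cis (- ((y + s *\<^sub>R v) \<bullet> \<xi>))) has_vector_derivative (- (v \<bullet> \<xi>)) *\<^sub>R (\<i> * cis (- (y \<bullet> \<xi>)))) (at 0)"
      unfolding has_vector_derivative_def by (auto intro!: derivative_eq_intros simp: inner_add_left)
    show "((\<lambda>s. ?h (y + s *\<^sub>R v)) has_vector_derivative ?h' y) (at 0)"
      by (rule has_vector_derivative_eq_rhs[OF has_vector_derivative_mult[OF dc db]])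
        (simp add: scaleR_conv_of_real inner_commute algebra_simps)
  qed
  moreover have "integral\<^sup>L lborel ?h' = (- \<i> * complex_of_real (\<xi> \<bullet> v)) * FTy b \<xi> + FTy b' \<xi>"
    unfolding FTy_def using I by simp
  ultimately show ?thesis by (simp add: add_eq_0_iff)
qed

text \<open>A derivative in y supplies a factor \<open>\<xi>\<close> . v and stays in the class. The
  weight is a sum of coordinates, so that one more power of it splits linearly into terms covered by
  the induction hypothesis. This decay makes the oscillatory integral absolutely convergent in
  \<open>\<xi>\<close>.\<close>

lemma FTy_decay:
  fixes b :: "'a::euclidean_space \<times> 'a \<Rightarrow> complex"
  assumes "schwartz_y b"
  shows "\<exists>C. \<forall>\<xi>. (1 + (\<Sum>v\<in>Basis. \<bar>\<xi> \<bullet> v\<bar>)) ^ N * cmod (FTy b \<xi>) \<le> C"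
  using assms
proof (induction N arbitrary: b)
  case 0
  obtain C where "\<And>\<xi>. cmod (FTy b \<xi>) \<le> C" by (rule FTy_bounded[OF 0], rule that)
  then show ?case by auto
next
  case (Suc N)
  let ?w = "\<lambda>\<xi>::'a. 1 + (\<Sum>v\<in>Basis. \<bar>\<xi> \<bullet> v\<bar>)"
  obtain C0 where C0: "\<And>\<xi>. ?w \<xi> ^ N * cmod (FTy b \<xi>) \<le> C0"
    using Suc by blast
  have "\<exists>C. \<forall>\<xi>. ?w \<xi> ^ N * (\<bar>\<xi> \<bullet> v\<bar> * cmod (FTy b \<xi>)) \<le> C" if v: "v \<in> Basis" for v
  proof -
    have v0: "(0, v) \<in> Basis" using v by (simp add: Basis_prod_def)
    obtain b' where b': "\<And>z. ((\<lambda>s. b (z + s *\<^sub>R (0, v))) has_vector_derivative b' z) (at 0)" "schwartz_y b'"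
      by (rule schwartz_y_deriv[OF Suc.prems v0], rule that)
    have "cmod (FTy b' \<xi>) = \<bar>\<xi> \<bullet> v\<bar> * cmod (FTy b \<xi>)" for \<xi>
      unfolding FTy_deriv[OF Suc.prems v b'] by (simp add: norm_mult)
    then show ?thesis using Suc.IH[OF b'(2)] by simp
  qed
  then have "\<forall>v\<in>Basis. \<exists>C. \<forall>\<xi>. ?w \<xi> ^ N * (\<bar>\<xi> \<bullet> v\<bar> * cmod (FTy b \<xi>)) \<le> C" by blast
  from bchoice[OF this] obtain C where C: "\<forall>v\<in>Basis. \<forall>\<xi>. ?w \<xi> ^ N * (\<bar>\<xi> \<bullet> v\<bar> * cmod (FTy b \<xi>)) \<le> C v" ..
  have "?w \<xi> ^ Suc N * cmod (FTy b \<xi>) \<le> C0 + (\<Sum>v\<in>Basis. C v)" for \<xi>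
  proof -
    have "?w \<xi> ^ Suc N * cmod (FTy b \<xi>) = ?w \<xi> ^ N * cmod (FTy b \<xi>) + (\<Sum>v\<in>Basis. ?w \<xi> ^ N * (\<bar>\<xi> \<bullet> v\<bar> * cmod (FTy b \<xi>)))"
      by (simp add: sum_distrib_left[symmetric] sum_distrib_right[symmetric] algebra_simps)
    also have "\<dots> \<le> C0 + (\<Sum>v\<in>Basis. C v)"
      using C by (intro add_mono C0 sum_mono) blast
    finally show ?thesis .
  qed
  then show ?case by blast
qed

lemma FTy_integrable:
  fixes b :: "'a::euclidean_space \<times> 'a \<Rightarrow> complex"
  assumes b: "schwartz_y b"
  shows "integrable lborel (FTy b)"
proof -
  obtain C where C: "\<And>\<xi>::'a. (1 + (\<Sum>v\<in>Basis. \<bar>\<xi> \<bullet> v\<bar>)) ^ (2 * DIM('a)) * cmod (FTy b \<xi>) \<le> C"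
    using FTy_decay[OF b] by blast
  have le: "cmod (FTy b \<xi>) \<le> C * (1 / jb \<xi> ^ (2 * DIM('a)))" for \<xi>
  proof -
    have "jb \<xi> \<le> 1 + norm \<xi>"
      unfolding jb_def by (rule real_le_lsqrt) (auto simp: power2_sum)
    also have "\<dots> \<le> 1 + (\<Sum>v\<in>Basis. \<bar>\<xi> \<bullet> v\<bar>)" using norm_le_l1[of \<xi>] by simp
    finally have "jb \<xi> ^ (2 * DIM('a)) * cmod (FTy b \<xi>) \<le> (1 + (\<Sum>v\<in>Basis. \<bar>\<xi> \<bullet> v\<bar>)) ^ (2 * DIM('a)) * cmod (FTy b \<xi>)"
      using jb_pos[of \<xi>] by (intro mult_right_mono power_mono) auto
    from order_trans[OF this C] show ?thesis
      using jb_pos[of \<xi>] by (simp add: field_simps)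
  qed
  have "norm (FTy b \<xi>) \<le> norm (C * (1 / jb \<xi> ^ (2 * DIM('a))))" for \<xi>
    using order_trans[OF le abs_ge_self] by (simp only: real_norm_def)
  then show ?thesis
    using borel_measurable_continuous_onI[OF FTy_continuous[OF b]]
    by (intro Bochner_Integration.integrable_bound[OF integrable_mult_right[OF integrable_inv_jb, of C]] AE_I2) simp_all
qed

subsection \<open>Schwartz functions\<close>

lemma schwartz_bound:
  assumes f: "schwartz f" and vs: "set vs \<subseteq> Basis"
  shows "\<exists>C. \<forall>y. cmod (iter_pd vs f y) \<le> C * jb y powr (- l)"
proof -
  obtain n :: nat where n: "\<And>y :: 'a. jb y powr l \<le> jb y ^ n"
    using jb_powr_le_power by blast
  obtain C where C: "\<And>y. jb y ^ n * norm (iter_pd vs f y) \<le> C"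
    using f vs unfolding schwartz_def by blast
  have "cmod (iter_pd vs f y) \<le> C * jb y powr (- l)" for y
  proof -
    have "jb y powr l * cmod (iter_pd vs f y) \<le> C"
      by (rule order_trans[OF mult_right_mono[OF n norm_ge_zero] C])
    then show ?thesis
      using jb_pos[of y] by (simp add: powr_minus field_simps)
  qed
  then show ?thesis by blast
qed

lemma schwartz_rapid:
  assumes f: "schwartz f"
  shows "rapid f"
  unfolding rapid_def
proof (intro conjI allI)
  have "smooth_fn f" using f by (simp add: schwartz_def)
  from smooth_fn_continuous[OF this, of "[]"] show "f \<in> borel_measurable borel"
    by (intro borel_measurable_continuous_onI) simp
  show "\<exists>C. \<forall>y. jb y ^ k * cmod (f y) \<le> C" for k
    using f unfolding schwartz_def by (metis empty_subsetI iter_pd.simps(1) list.set(1))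
qed

lemma schwartz_y_mult:
  fixes p :: "'a::euclidean_space \<times> 'a \<Rightarrow> complex"
  assumes p: "\<And>n. symn n UNIV (\<lambda>_ _. 1) (\<lambda>i::par. p)" and f: "schwartz f"
  shows "schwartz_y (\<lambda>z. p z * (complex_of_real (jb (snd z) powr \<delta>) * f (snd z)))"
  unfolding schwartz_y_def symb_def
proof (intro allI)
  fix l :: real and n
  have sm: "smooth_fn f" using f by (simp add: schwartz_def)
  have "symn n UNIV (\<lambda>i z. jsq i z powr (- (l + \<delta>) / 2)) (\<lambda>(i::par) (z :: 'a \<times> 'a). iter_pd [] f (snd z))"
  proof (rule sym_iter_pd[OF sm bounded_linear_snd])
    fix vs :: "'a list" assume "set vs \<subseteq> Basis"
    then obtain C where C: "\<forall>y. cmod (iter_pd vs f y) \<le> C * jb y powr (- (l + \<delta>))"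
      using schwartz_bound[OF f, of vs "l + \<delta>"] by blast
    show "\<exists>C. \<forall>i. \<forall>z\<in>UNIV. cmod (iter_pd vs f (snd z)) \<le> C * jsq i (z :: 'a \<times> 'a) powr (- (l + \<delta>) / 2)"
      unfolding jsq_powr by (intro exI[of _ C] allI ballI) (rule C[rule_format])
  qed (auto simp: Basis_prod_def)
  then have fs: "symn n UNIV (\<lambda>i z. jsq i z powr (- (l + \<delta>) / 2)) (\<lambda>(i::par) (z :: 'a \<times> 'a). f (snd z))"
    by simp
  have js: "symn n UNIV (\<lambda>i z. jsq i z powr (\<delta> / 2)) (\<lambda>i (z :: 'a \<times> 'a). complex_of_real (jb (snd z) powr \<delta>))"
    using sym_bounded_linear[OF bounded_linear_of_real sym_jsq_powr[of n "\<delta> / 2"]] unfolding jsq_powr .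
  show "symn n UNIV (\<lambda>i z. jsq i z powr (- l / 2)) (\<lambda>i::par. \<lambda>z. p z * (complex_of_real (jb (snd z) powr \<delta>) * f (snd z)))"
  proof (rule sym_weaken[OF sym_mult[OF p sym_mult[OF js fs]], where c = 1])
    show "1 * (jsq i z powr (\<delta> / 2) * jsq i z powr (- (l + \<delta>) / 2)) \<le> 1 * jsq i z powr (- l / 2)" for i and z :: "'a \<times> 'a"
      unfolding powr_add[symmetric] by (simp add: field_simps)
  qed auto
qed

lemma smooth_bdd_derivs_symn:
  fixes p :: "'c::euclidean_space \<Rightarrow> complex"
  assumes p: "smooth_bdd_derivs p"
  shows "symn n UNIV (\<lambda>_ _. 1) (\<lambda>i::par. p)"
proof -
  have "symn n UNIV (\<lambda>_ _. 1) (\<lambda>(i::par) z. iter_pd [] p (id z))"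
  proof (rule sym_iter_pd)
    show "smooth_fn p" using p by (simp add: smooth_bdd_derivs_def)
    fix vs :: "'c list" assume "set vs \<subseteq> Basis"
    then have "bounded (range (iter_pd vs p))" using p by (simp add: smooth_bdd_derivs_def)
    then show "\<exists>C. \<forall>i::par. \<forall>z\<in>UNIV. cmod (iter_pd vs p (id z)) \<le> C * 1"
      unfolding bounded_iff by auto
  qed (auto simp: id_def bounded_linear_ident)
  then show ?thesis by simp
qed

lemma smooth_bdd_derivs_bounded:
  assumes p: "smooth_bdd_derivs (p :: 'c::euclidean_space \<Rightarrow> complex)"
  obtains B where "0 \<le> B" "\<And>z. cmod (p z) \<le> B"
proof -
  have "bounded (range (iter_pd [] p))"
    using p unfolding smooth_bdd_derivs_def by (metis empty_subsetI list.set(1))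
  then obtain B where B: "\<And>z. cmod (p z) \<le> B" unfolding bounded_iff by auto
  then show thesis using that order_trans[OF norm_ge_zero B] by blast
qed

lemma smooth_bdd_derivs_continuous:
  assumes p: "smooth_bdd_derivs (p :: 'c::euclidean_space \<Rightarrow> complex)"
  shows "continuous_on UNIV p"
  using smooth_fn_continuous[of p "[]"] p by (simp add: smooth_bdd_derivs_def)

subsection \<open>The operators in terms of absolutely convergent integrals\<close>

definition fconst :: "'a::euclidean_space itself \<Rightarrow> real" where
  "fconst _ = (2 * pi) powr (- real DIM('a))"

lemma fconst_eq: "(2 * pi) powr (- real DIM('a::euclidean_space)) = fconst TYPE('a)"
  by (simp add: fconst_def)

lemma fconst_bounds: "0 \<le> fconst TYPE('a::euclidean_space)" "fconst TYPE('a) \<le> 1"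
proof -
  have "1 \<le> 2 * pi" using pi_gt3 by simp
  then show "fconst TYPE('a) \<le> 1"
    unfolding fconst_def by (rule powr_minus_le_one) simp
qed (simp add: fconst_def)

lemma fconst_inverse: "complex_of_real (fconst TYPE('a::euclidean_space)) * (2 * complex_of_real pi) ^ DIM('a) = 1"
proof -
  have "fconst TYPE('a) = inverse ((2 * pi) ^ DIM('a))"
    unfolding fconst_def powr_minus by (subst powr_realpow) auto
  then have "fconst TYPE('a) * (2 * pi) ^ DIM('a) = 1"
    using left_inverse[of "(2 * pi) ^ DIM('a)"] by (simp del: power_mult_distrib)
  then have "complex_of_real (fconst TYPE('a) * (2 * pi) ^ DIM('a)) = 1" by simp
  then show ?thesis by simp
qed

text \<open>The cutoff is bounded by 1 and tends to 1 pointwise, so dominated convergence along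
  sequences removes it. This evaluates the limits in the definitions of both oscillatory
  integrals.\<close>

lemma Lim_cutoff:
  fixes g :: "'a::euclidean_space \<Rightarrow> complex"
  assumes g: "integrable lborel g"
  shows "Lim (at_right (0::real)) (\<lambda>\<epsilon>. K * (LINT \<xi>|lborel. complex_of_real (cutoff (\<epsilon> *\<^sub>R \<xi>)) * g \<xi>)) = K * integral\<^sup>L lborel g"
proof (rule tendsto_Lim[OF trivial_limit_at_right_real])
  have [measurable]: "g \<in> borel_measurable borel" using g by (simp add: borel_measurable_integrable)
  have [measurable]: "(\<lambda>\<xi>. cutoff (e *\<^sub>R \<xi>)) \<in> borel_measurable (borel :: 'a measure)" for e
    unfolding cutoff_def by measurable
  show "((\<lambda>\<epsilon>. K * (LINT \<xi>|lborel. complex_of_real (cutoff (\<epsilon> *\<^sub>R \<xi>)) * g \<xi>)) \<longlongrightarrow> K * integral\<^sup>L lborel g) (at_right 0)"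
    unfolding tendsto_at_iff_sequentially comp_def
  proof (intro allI impI tendsto_mult tendsto_const)
    fix e :: "nat \<Rightarrow> real" assume e: "e \<longlonglongrightarrow> 0"
    show "(\<lambda>n. LINT \<xi>|lborel. complex_of_real (cutoff (e n *\<^sub>R \<xi>)) * g \<xi>) \<longlonglongrightarrow> integral\<^sup>L lborel g"
    proof (rule integral_dominated_convergence[OF _ _ integrable_norm[OF g]])
      show "AE \<xi> in lborel. (\<lambda>n. complex_of_real (cutoff (e n *\<^sub>R \<xi>)) * g \<xi>) \<longlonglongrightarrow> g \<xi>"
      proof (rule AE_I2)
        fix \<xi> :: 'a
        have "isCont (\<lambda>r. cutoff (r *\<^sub>R \<xi>)) 0"
          unfolding cutoff_def by (intro continuous_intros)
        from isCont_tendsto_compose[OF this e] have "(\<lambda>n. cutoff (e n *\<^sub>R \<xi>)) \<longlonglongrightarrow> 1"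
          by (simp add: cutoff_def)
        then have "(\<lambda>n. complex_of_real (cutoff (e n *\<^sub>R \<xi>)) * g \<xi>) \<longlonglongrightarrow> complex_of_real 1 * g \<xi>"
          by (intro tendsto_intros)
        then show "(\<lambda>n. complex_of_real (cutoff (e n *\<^sub>R \<xi>)) * g \<xi>) \<longlonglongrightarrow> g \<xi>" by simp
      qed
      show "AE \<xi> in lborel. norm (complex_of_real (cutoff (e n *\<^sub>R \<xi>)) * g \<xi>) \<le> norm (g \<xi>)" for n
        by (auto simp: norm_mult cutoff_def intro!: mult_left_le_one_le)
    qed measurable
  qed
qed

text \<open>The cutoff does not depend on y and leaves the inner integral, where \<open>FTy\<close>
  remains; that is integrable in \<open>\<xi>\<close>, so \<open>Lim_cutoff\<close> applies.\<close>

lemma osc_right_eq: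
  assumes b: "schwartz_y (\<lambda>z. p z * F (snd z))"
  shows "osc_right p F x = complex_of_real (fconst TYPE('a::euclidean_space)) *
     (LINT \<xi>|lborel. cis (x \<bullet> \<xi>) * FTy (\<lambda>z. p z * F (snd z)) (\<xi>::'a))"
proof -
  have "(LINT y|lborel. cis ((x - y) \<bullet> \<xi>) * p (\<xi>, y) * complex_of_real (cutoff (\<epsilon> *\<^sub>R \<xi>)) * F y) =
      complex_of_real (cutoff (\<epsilon> *\<^sub>R \<xi>)) * (cis (x \<bullet> \<xi>) * FTy (\<lambda>z. p z * F (snd z)) \<xi>)" for \<epsilon> \<xi>
  proof -
    have "cis ((x - y) \<bullet> \<xi>) = cis (x \<bullet> \<xi>) * cis (- (y \<bullet> \<xi>))" for y
      by (simp add: cis_mult inner_diff_left)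
    then have "(\<lambda>y. cis ((x - y) \<bullet> \<xi>) * p (\<xi>, y) * complex_of_real (cutoff (\<epsilon> *\<^sub>R \<xi>)) * F y) =
       (\<lambda>y. complex_of_real (cutoff (\<epsilon> *\<^sub>R \<xi>)) * cis (x \<bullet> \<xi>) * (cis (- (y \<bullet> \<xi>)) * (p (\<xi>, y) * F y)))"
      by (auto simp: fun_eq_iff)
    then show ?thesis by (simp add: FTy_def mult.assoc)
  qed
  moreover have "integrable lborel (\<lambda>\<xi>. cis (x \<bullet> \<xi>) * FTy (\<lambda>z. p z * F (snd z)) \<xi>)"
    by (intro integrable_cis_mult FTy_integrable b) simp
  ultimately show ?thesis
    unfolding osc_right_def fconst_eq by (simp add: Lim_cutoff)
qed

text \<open>If the function is not integrable, the inner Bochner integral in \<open>free_prop\<close> is zero by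
  convention, so both alternatives have to be treated.\<close>
lemma free_prop_inverse_Fourier:
  fixes A :: "'a::euclidean_space \<Rightarrow> complex"
  assumes A: "integrable lborel A" "continuous_on UNIV A" "\<And>\<xi>. cmod (A \<xi>) \<le> B"
    and v: "\<And>x. v x = complex_of_real (fconst TYPE('a)) * (LINT \<xi>|lborel. cis (x \<bullet> \<xi>) * A \<xi>)"
  shows "integrable lborel v \<Longrightarrow> (LINT y|lborel. cis (- (y \<bullet> \<xi>)) * v y) = A \<xi>"
    and "\<not> integrable lborel v \<Longrightarrow> (LINT y|lborel. cis (- (y \<bullet> \<xi>)) * v y) = 0"
proof -
  let ?c = "complex_of_real (fconst TYPE('a))"
  have [measurable]: "A \<in> borel_measurable borel" using A(1) by (simp add: borel_measurable_integrable)
  have vm: "v \<in> borel_measurable borel" unfolding v[abs_def] by measurable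
  show "(LINT y|lborel. cis (- (y \<bullet> \<xi>)) * v y) = A \<xi>" if vi: "integrable lborel v"
  proof -
    have c0: "?c \<noteq> 0" using fconst_inverse[where 'a='a] by auto
    have "integrable lborel (\<lambda>x. inverse ?c * v x)" using vi by simp
    then have "integrable lborel (\<lambda>x. LINT \<xi>|lborel. cis (x \<bullet> \<xi>) * A \<xi>)"
      using c0 by (simp add: v mult.assoc[symmetric])
    from Fourier_inversion[OF A this, of \<xi>]
    have "(LINT x|lborel. cis (- (x \<bullet> \<xi>)) * (LINT \<xi>|lborel. cis (x \<bullet> \<xi>) * A \<xi>)) = (2 * pi) ^ DIM('a) * A \<xi>" .
    moreover have "(LINT y|lborel. cis (- (y \<bullet> \<xi>)) * v y) = ?c * (LINT x|lborel. cis (- (x \<bullet> \<xi>)) * (LINT \<xi>|lborel. cis (x \<bullet> \<xi>) * A \<xi>))"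
      unfolding v by (subst integral_mult_right_zero[symmetric]) (simp only: mult_ac)
    ultimately show ?thesis
      using fconst_inverse[where 'a='a] by (simp add: mult.assoc[symmetric])
  qed
  show "(LINT y|lborel. cis (- (y \<bullet> \<xi>)) * v y) = 0" if vi: "\<not> integrable lborel v"
  \<comment> \<open>A unimodular factor changes nothing about integrability.\<close>
  proof (rule not_integrable_integral_eq, rule notI)
    assume "integrable lborel (\<lambda>y. cis (- (y \<bullet> \<xi>)) * v y)"
    then have "integrable lborel (\<lambda>y. cis (y \<bullet> \<xi>) * (cis (- (y \<bullet> \<xi>)) * v y))"
      by (rule integrable_cis_mult) simp
    then show False using vi by (simp add: mult.assoc[symmetric] cis_mult)
  qed
qed

lemma rg_tendsto: "(\<lambda>n. rg (t, n) \<xi>) \<longlonglongrightarrow> 1"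
proof -
  have "(\<lambda>n. 1 / real (Suc n)) \<longlonglongrightarrow> 0" by (intro LIMSEQ_Suc lim_1_over_n)
  then have "(\<lambda>n. ep (t, n)) \<longlonglongrightarrow> 0" by (simp add: ep_def)
  then have "(\<lambda>n. (1 + (ep (t, n))\<^sup>2 * (norm \<xi>)\<^sup>2) powr (- real DIM('a))) \<longlonglongrightarrow> (1 + 0\<^sup>2 * (norm \<xi>)\<^sup>2) powr (- real DIM('a))"
    by (intro tendsto_intros) auto
  then show ?thesis by (simp add: rg_def)
qed

lemma integral_rg_tendsto:
  fixes g :: "'a::euclidean_space \<Rightarrow> complex"
  assumes g: "integrable lborel g"
  shows "(\<lambda>n. LINT \<xi>|lborel. complex_of_real (rg (t, n) \<xi>) * g \<xi>) \<longlonglongrightarrow> integral\<^sup>L lborel g"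
proof (rule integral_dominated_convergence[OF _ _ integrable_norm[OF g]])
  have [measurable]: "g \<in> borel_measurable borel" using g by (simp add: borel_measurable_integrable)
  show "g \<in> borel_measurable lborel" "\<And>n. (\<lambda>\<xi>. complex_of_real (rg (t, n) \<xi>) * g \<xi>) \<in> borel_measurable lborel"
    by measurable
  show "AE \<xi> in lborel. (\<lambda>n. complex_of_real (rg (t, n) \<xi>) * g \<xi>) \<longlonglongrightarrow> g \<xi>"
  proof (rule AE_I2)
    fix \<xi> :: 'a
    have "(\<lambda>n. complex_of_real (rg (t, n) \<xi>) * g \<xi>) \<longlonglongrightarrow> complex_of_real 1 * g \<xi>"
      by (intro tendsto_intros rg_tendsto)
    then show "(\<lambda>n. complex_of_real (rg (t, n) \<xi>) * g \<xi>) \<longlonglongrightarrow> g \<xi>" by simp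
  qed
  show "AE \<xi> in lborel. norm (complex_of_real (rg (t, n) \<xi>) * g \<xi>) \<le> norm (g \<xi>)" for n
    by (auto simp: norm_mult rg_nonneg rg_le_1 intro!: mult_left_le_one_le)
qed

lemma L2sq_Fatou:
  assumes "\<And>n. v n \<in> borel_measurable borel" "\<And>x. (\<lambda>n. v n x) \<longlonglongrightarrow> w x" "\<And>n. L2sq (v n) \<le> K"
  shows "L2sq w \<le> K"
  unfolding L2sq_def
proof (rule nn_integral_Fatou_le[where F = "\<lambda>n x. ennreal ((cmod (v n x))\<^sup>2)"])
  show "(\<lambda>x. ennreal ((cmod (v n x))\<^sup>2)) \<in> borel_measurable lborel" for n
    using assms(1)[of n] by measurable
  show "(\<lambda>n. ennreal ((cmod (v n x))\<^sup>2)) \<longlonglongrightarrow> ennreal ((cmod (w x))\<^sup>2)" for x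
    by (intro tendsto_ennrealI tendsto_intros assms)
qed (use assms(3) in \<open>simp add: L2sq_def\<close>)

lemma Reg_integrable:
  fixes q :: "'a::euclidean_space \<times> 'a \<Rightarrow> complex"
  assumes [measurable]: "q \<in> borel_measurable borel" and B: "\<And>z. cmod (q z) \<le> B" and f: "rapid f"
  shows "integrable lborel (\<lambda>z. osc (t, n) x z * (q z * complex_of_real (rg (t, n) (fst z))) * f (snd z))"
  by (rule integrable_bound_rg[OF _ _ f, of _ B])
    (use B in \<open>auto simp: norm_mult rg_nonneg intro!: mult_right_mono\<close>)

lemma Reg_measurable:
  fixes q :: "'a::euclidean_space \<times> 'a \<Rightarrow> complex"
  assumes [measurable]: "q \<in> borel_measurable borel" and f: "rapid f"
  shows "Reg q t n f \<in> borel_measurable borel"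
proof -
  note [measurable] = rapid_measurable[OF f]
  show ?thesis unfolding Reg_def[abs_def] by measurable
qed

lemma Reg_eq_FTy:
  fixes q :: "'a::euclidean_space \<times> 'a \<Rightarrow> complex"
  assumes t: "0 \<le> t" and q: "q \<in> borel_measurable borel" "\<And>z. cmod (q z) \<le> B" and f: "rapid f"
  shows "Reg q t n f x = (LINT \<xi>|lborel. complex_of_real (rg (t, n) \<xi>) *
    (cis (x \<bullet> \<xi>) * (cis (- t * (norm \<xi>)\<^sup>2 / 2) * FTy (\<lambda>z. q z * f (snd z)) \<xi>)))"
proof -
  have o: "osc (t, n) x (\<xi>, y) = cis (x \<bullet> \<xi>) * (cis (- t * (norm \<xi>)\<^sup>2 / 2) * cis (- (y \<bullet> \<xi>)))" for \<xi> y
    using t by (simp add: osc_def tm_def cis_mult inner_diff_left algebra_simps)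
  have "(LINT y|lborel. osc (t, n) x (\<xi>, y) * (q (\<xi>, y) * complex_of_real (rg (t, n) \<xi>)) * f y) =
     complex_of_real (rg (t, n) \<xi>) * (cis (x \<bullet> \<xi>) * (cis (- t * (norm \<xi>)\<^sup>2 / 2) * FTy (\<lambda>z. q z * f (snd z)) \<xi>))" for \<xi>
  proof -
    have "(\<lambda>y. osc (t, n) x (\<xi>, y) * (q (\<xi>, y) * complex_of_real (rg (t, n) \<xi>)) * f y) =
      (\<lambda>y. complex_of_real (rg (t, n) \<xi>) * cis (x \<bullet> \<xi>) * cis (- t * (norm \<xi>)\<^sup>2 / 2) * (cis (- (y \<bullet> \<xi>)) * (q (\<xi>, y) * f y)))"
      unfolding o by (simp only: mult_ac)
    then show ?thesis by (simp add: FTy_def mult.assoc)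
  qed
  then show ?thesis
    unfolding Reg_def lborel_Fubini(1)[OF Reg_integrable[OF q f], symmetric] by simp
qed

lemma fconst_mult_le: "cmod (a * (complex_of_real (fconst TYPE('a::euclidean_space)) * u)) \<le> cmod (a * u)"
  using fconst_bounds[where 'a='a] by (simp add: norm_mult mult_left_mono mult_left_le_one_le)

text \<open>If the function fed to the propagator is integrable, Fourier inversion recovers A and
  the result is a pointwise limit of regularised operators, so the uniform bound passes on by Fatou;
  otherwise the result is zero. The normalisation (2 pi)^(-m) is at most 1 and is estimated
  away.\<close>

lemma outgoing_part:
  fixes p :: "'a::euclidean_space \<times> 'a \<Rightarrow> complex"
  assumes p: "smooth_bdd_derivs p" and t: "0 \<le> t" and f: "schwartz f"
    and est: "\<And>n. L2sq (\<lambda>x. complex_of_real (jb x powr (- s)) * Reg p t n (\<lambda>y. complex_of_real (jb y powr \<delta>) * f y) x) \<le> K * L2sq f"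
  defines "g \<equiv> \<lambda>x. complex_of_real (jb x powr (- s)) * free_prop t (osc_right p (\<lambda>y. complex_of_real (jb y powr \<delta>) * f y)) x"
  shows "g \<in> borel_measurable lborel" "L2sq g \<le> K * L2sq f"
proof -
  let ?F = "\<lambda>y. complex_of_real (jb y powr \<delta>) * f y"
  let ?c = "complex_of_real (fconst TYPE('a))"
  define A where "A = FTy (\<lambda>z. p z * ?F (snd z))"
  have b: "schwartz_y (\<lambda>z. p z * ?F (snd z))"
    by (rule schwartz_y_mult[OF smooth_bdd_derivs_symn[OF p] f])
  have F: "rapid ?F" by (rule rapid_jb_powr[OF schwartz_rapid[OF f]])
  have pm [measurable]: "p \<in> borel_measurable borel"
    by (rule borel_measurable_continuous_onI[OF smooth_bdd_derivs_continuous[OF p]])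
  obtain Bp where Bp: "\<And>z. cmod (p z) \<le> Bp" by (rule smooth_bdd_derivs_bounded[OF p], rule that)
  have Ai: "integrable lborel A" unfolding A_def by (rule FTy_integrable[OF b])
  have Ac: "continuous_on UNIV A" unfolding A_def by (rule FTy_continuous[OF b])
  have [measurable]: "A \<in> borel_measurable borel" using Ai by (simp add: borel_measurable_integrable)
  obtain B where "\<And>\<xi>. cmod (FTy (\<lambda>z. p z * ?F (snd z)) \<xi>) \<le> B" by (rule FTy_bounded[OF b], rule that)
  then have B: "cmod (A \<xi>) \<le> B" for \<xi> by (simp only: A_def)
  define v where "v = osc_right p ?F"
  have v: "v x = ?c * (LINT \<xi>|lborel. cis (x \<bullet> \<xi>) * A \<xi>)" for x
    unfolding v_def A_def by (rule osc_right_eq[OF b])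
  define u where "u x = ?c * (LINT \<xi>|lborel. cis (x \<bullet> \<xi>) * (cis (- t * (norm \<xi>)\<^sup>2 / 2) * A \<xi>))" for x
  have um [measurable]: "u \<in> borel_measurable borel" unfolding u_def by measurable
  have ui: "integrable lborel (\<lambda>\<xi>. cis (x \<bullet> \<xi>) * (cis (- t * (norm \<xi>)\<^sup>2 / 2) * A \<xi>))" for x
    by (intro integrable_cis_mult Ai) measurable
  have fp: "free_prop t v x = (if integrable lborel v then u x else 0)" for x
    unfolding free_prop_def u_def fconst_eq
    using free_prop_inverse_Fourier[OF Ai Ac B v] by (simp add: mult.assoc)
  have ub: "L2sq (\<lambda>x. complex_of_real (jb x powr (- s)) * u x) \<le> K * L2sq f"
  proof (rule L2sq_Fatou[where v = "\<lambda>n x. complex_of_real (jb x powr (- s)) * (?c * Reg p t n ?F x)"])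
    note [measurable] = Reg_measurable[OF pm F]
    show "(\<lambda>x. complex_of_real (jb x powr (- s)) * (?c * Reg p t n ?F x)) \<in> borel_measurable borel" for n
      by measurable
    show "(\<lambda>n. complex_of_real (jb x powr (- s)) * (?c * Reg p t n ?F x)) \<longlonglongrightarrow> complex_of_real (jb x powr (- s)) * u x" for x
      unfolding Reg_eq_FTy[OF t pm Bp F] u_def A_def[symmetric]
      by (intro tendsto_mult tendsto_const integral_rg_tendsto ui)
    show "L2sq (\<lambda>x. complex_of_real (jb x powr (- s)) * (?c * Reg p t n ?F x)) \<le> K * L2sq f" for n
      by (rule order_trans[OF L2sq_mono[OF fconst_mult_le] est])
  qed
  have g: "g = (\<lambda>x. complex_of_real (jb x powr (- s)) * (if integrable lborel v then u x else 0))"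
    unfolding g_def v_def[symmetric] fp ..
  show "g \<in> borel_measurable lborel" unfolding g by (cases "integrable lborel v") auto
  show "L2sq g \<le> K * L2sq f"
    unfolding g using ub by (cases "integrable lborel v") (auto simp: L2sq_def)
qed

section \<open>Transposition and the incoming operator\<close>

lemma Cauchy_Schwarz_L2sq:
  fixes a b :: "'a::euclidean_space \<Rightarrow> complex"
  assumes [measurable]: "a \<in> borel_measurable borel" "b \<in> borel_measurable borel"
  shows "ennreal ((cmod (LINT x|lborel. a x * b x))\<^sup>2) \<le> L2sq a * L2sq b"
proof -
  have "ennreal (cmod (LINT x|lborel. a x * b x)) \<le> (\<integral>\<^sup>+x. ennreal (cmod (a x)) * ennreal (cmod (b x)) \<partial>lborel)"
  proof (cases "integrable lborel (\<lambda>x. a x * b x)")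
    case True
    from integral_norm_bound_ennreal[OF this] show ?thesis by (simp add: norm_mult ennreal_mult)
  qed (simp add: not_integrable_integral_eq)
  then have "(ennreal (cmod (LINT x|lborel. a x * b x)))\<^sup>2 \<le> (\<integral>\<^sup>+x. ennreal (cmod (a x)) * ennreal (cmod (b x)) \<partial>lborel)\<^sup>2"
    by (rule power_mono) simp
  also have "\<dots> \<le> (\<integral>\<^sup>+x. (ennreal (cmod (a x)))\<^sup>2 \<partial>lborel) * (\<integral>\<^sup>+x. (ennreal (cmod (b x)))\<^sup>2 \<partial>lborel)"
    by (rule Cauchy_Schwarz_nn_integral) measurable
  finally show ?thesis by (simp add: L2sq_def ennreal_power)
qed

text \<open>The regularised \<open>P\<^sub>- exp(-itH\<^sub>0)\<close> is the transpose of an operator of the first kind, whose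
  symbol is obtained by the reflection \<open>\<xi> \<rightarrow> -\<xi>\<close>.\<close>
lemma transposition:
  fixes p :: "'a::euclidean_space \<times> 'a \<Rightarrow> complex" and n :: nat
  assumes t: "0 \<le> t" and pm [measurable]: "p \<in> borel_measurable borel" and B: "\<And>z. cmod (p z) \<le> B"
    and G: "rapid G" and g: "rapid g0"
  defines "W \<equiv> \<lambda>x. LINT \<xi>|lborel. complex_of_real (rg (t, n) \<xi>) * (cis (x \<bullet> \<xi>) * p (x, \<xi>) *
      (cis (- t * (norm \<xi>)\<^sup>2 / 2) * (LINT y|lborel. cis (- (y \<bullet> \<xi>)) * g0 y)))"
  shows "(LINT x|lborel. W x * G x) = (LINT y|lborel. g0 y * Reg (\<lambda>z. p (snd z, - fst z)) t n G y)"
    and "\<exists>C. \<forall>x. cmod (W x) \<le> C" and "W \<in> borel_measurable borel"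
proof -
  note [measurable] = rapid_measurable[OF G] rapid_measurable[OF g]
  define ph where "ph \<xi> = complex_of_real (rg (t, n) \<xi>) * cis (- t * (norm \<xi>)\<^sup>2 / 2)" for \<xi> :: 'a
  have phm [measurable]: "ph \<in> borel_measurable borel" unfolding ph_def[abs_def] by measurable
  have ph: "cmod (ph \<xi>) = rg (t, n) \<xi>" for \<xi> by (simp add: ph_def norm_mult rg_nonneg)
  \<comment> \<open>The kernel of the regularised operator in (x, y), bounded because
    \<open>rg\<close> is integrable. Both sides of the duality are integrals against it, in opposite
    orders.\<close>
  define k where "k x y = (LINT \<xi>|lborel. cis ((x - y) \<bullet> \<xi>) * p (x, \<xi>) * ph \<xi>)" for x y :: 'a
  have B0: "0 \<le> B" by (rule order_trans[OF norm_ge_zero B])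
  have ki: "integrable lborel (\<lambda>\<xi>. cis ((x - y) \<bullet> \<xi>) * p (x, \<xi>) * ph \<xi>)" for x y
    by (rule Bochner_Integration.integrable_bound[OF integrable_mult_right[OF rg_integrable, of B "(t, n)"]])
      (use B B0 in \<open>auto simp: norm_mult ph rg_nonneg intro!: mult_right_mono\<close>)
  define R where "R = (LINT \<xi>|lborel. B * rg (t, n) (\<xi> :: 'a))"
  have kb: "cmod (k x y) \<le> R" for x y
    unfolding k_def R_def
    by (rule Bochner_Integration.integral_norm_bound_integral[OF ki integrable_mult_right[OF rg_integrable]])
      (use B in \<open>auto simp: norm_mult ph rg_nonneg intro!: mult_right_mono\<close>)
  have km [measurable]: "(\<lambda>z. k (fst z) (snd z)) \<in> borel_measurable borel"
    unfolding k_def by measurable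
  have W: "W x = (LINT y|lborel. k x y * g0 y)" for x
  proof -
    define F where "F = (\<lambda>(\<xi>, y). cis ((x - y) \<bullet> \<xi>) * p (x, \<xi>) * ph \<xi> * g0 y)"
    have Fi: "integrable lborel F"
    proof (rule lborel_integrable_prod_bound)
      show "integrable lborel (\<lambda>\<xi>::'a. B * rg (t, n) \<xi>)" by (intro integrable_mult_right rg_integrable)
      show "integrable lborel (\<lambda>y. cmod (g0 y))" using rapid_integrable[OF g] by simp
      show "norm (F (\<xi>, y)) \<le> B * rg (t, n) \<xi> * cmod (g0 y)" for \<xi> y
        using B by (auto simp: F_def norm_mult ph rg_nonneg intro!: mult_right_mono)
    qed (simp add: F_def split_beta')
    have "(LINT y|lborel. F (\<xi>, y)) = complex_of_real (rg (t, n) \<xi>) * (cis (x \<bullet> \<xi>) * p (x, \<xi>) *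
      (cis (- t * (norm \<xi>)\<^sup>2 / 2) * (LINT y|lborel. cis (- (y \<bullet> \<xi>)) * g0 y)))" for \<xi>
    proof -
      have "cis ((x - y) \<bullet> \<xi>) = cis (x \<bullet> \<xi>) * cis (- (y \<bullet> \<xi>))" for y
        by (simp add: cis_mult inner_diff_left)
      then have "(\<lambda>y. F (\<xi>, y)) = (\<lambda>y. (complex_of_real (rg (t, n) \<xi>) * (cis (x \<bullet> \<xi>) * p (x, \<xi>) *
         cis (- t * (norm \<xi>)\<^sup>2 / 2))) * (cis (- (y \<bullet> \<xi>)) * g0 y))"
        by (simp add: F_def ph_def mult_ac)
      then show ?thesis by (simp only: integral_mult_right_zero mult.assoc)
    qed
    moreover have "(LINT \<xi>|lborel. F (\<xi>, y)) = k x y * g0 y" for y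
      unfolding F_def k_def by simp
    ultimately show ?thesis
      unfolding W_def using lborel_Fubini[OF Fi] by simp
  qed
  have Rg: "Reg (\<lambda>z. p (snd z, - fst z)) t n G y = (LINT x|lborel. k x y * G x)" for y
  proof -
    have qm: "(\<lambda>z. p (snd z, - fst z)) \<in> borel_measurable borel" by measurable
    note I = Reg_integrable[OF qm B G, of t n y]
    have "(LINT \<xi>|lborel. osc (t, n) y (\<xi>, x) * (p (x, - \<xi>) * complex_of_real (rg (t, n) \<xi>)) * G x) = k x y * G x" for x
    proof -
      \<comment> \<open>Exchanging x and y in the phase amounts to the reflection of
        \<open>\<xi>\<close>, under which \<open>ph\<close> is even. Negation is written
        \<open>0 - \<xi>\<close> to fit \<open>integral_lborel_shift\<close>.\<close>
      have "osc (t, n) y (\<xi>, x) * (p (x, - \<xi>) * complex_of_real (rg (t, n) \<xi>)) = cis ((x - y) \<bullet> (0 - \<xi>)) * p (x, 0 - \<xi>) * ph (0 - \<xi>)" for \<xi>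
      proof -
        have "osc (t, n) y (\<xi>, x) = cis ((x - y) \<bullet> (0 - \<xi>)) * cis (- t * (norm \<xi>)\<^sup>2 / 2)"
          using t by (simp add: osc_def tm_def cis_mult inner_diff_left algebra_simps)
        then show ?thesis by (simp add: ph_def rg_def mult_ac)
      qed
      then show ?thesis
        using integral_lborel_shift(3)[OF ki[of x y], of 0] by (simp only: k_def integral_mult_left_zero)
    qed
    then show ?thesis
      unfolding Reg_def lborel_Fubini(2)[OF I, symmetric] by (simp only: fst_conv snd_conv)
  qed
  define H where "H = (\<lambda>(x, y). k x y * (G x * g0 y))"
  have Hi: "integrable lborel H"
  proof (rule lborel_integrable_prod_bound)
    show "integrable lborel (\<lambda>x. R * cmod (G x))" using rapid_integrable[OF G] by simp
    show "integrable lborel (\<lambda>y. cmod (g0 y))" using rapid_integrable[OF g] by simp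
    show "norm (H (x, y)) \<le> R * cmod (G x) * cmod (g0 y)" for x y
      using mult_right_mono[OF kb[of x y], of "cmod (G x) * cmod (g0 y)"] by (simp add: H_def norm_mult mult.assoc)
  qed (simp add: H_def split_beta')
  have "(LINT y|lborel. H (x, y)) = W x * G x" for x
    unfolding W H_def by (subst integral_mult_left_zero[symmetric]) (simp add: mult_ac)
  moreover have "(LINT x|lborel. H (x, y)) = g0 y * Reg (\<lambda>z. p (snd z, - fst z)) t n G y" for y
    unfolding Rg H_def by (subst integral_mult_right_zero[symmetric]) (simp add: mult_ac)
  ultimately show "(LINT x|lborel. W x * G x) = (LINT y|lborel. g0 y * Reg (\<lambda>z. p (snd z, - fst z)) t n G y)"
    using lborel_Fubini[OF Hi] by simp
  show "W \<in> borel_measurable borel"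
    unfolding W[abs_def] by measurable
  have "cmod (W x) \<le> (LINT y|lborel. R * cmod (g0 y))" for x
  proof -
    have i: "integrable lborel (\<lambda>y. R * cmod (g0 y))" using rapid_integrable[OF g] by simp
    have le: "norm (k x y * g0 y) \<le> R * cmod (g0 y)" for y
      by (simp add: norm_mult mult_right_mono kb)
    have "(\<lambda>y. k x y) \<in> borel_measurable borel"
      using measurable_compose[of "\<lambda>y. (x, y)" borel borel "\<lambda>z. k (fst z) (snd z)" borel] by simp
    then have "integrable lborel (\<lambda>y. k x y * g0 y)"
      by (intro Bochner_Integration.integrable_bound[OF i] AE_I2) (auto intro: order_trans[OF le])
    then show ?thesis
      unfolding W by (rule Bochner_Integration.integral_norm_bound_integral[OF _ i le])
  qed
  then show "\<exists>C. \<forall>x. cmod (W x) \<le> C" by blast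
qed

text \<open>The propagator acts first, so \<open>\<psi>\<close> is an inverse Fourier transform, and
  applying the operator inserts p(x, \<open>\<xi>\<close>) under that integral, or gives zero if
  \<open>\<psi>\<close> is not integrable. The regularised versions are bounded by duality:
  \<open>transposition\<close> moves the operator onto the test function, where the outgoing
  estimate for the reflected symbol applies.\<close>

lemma incoming_part:
  fixes p :: "'a::euclidean_space \<times> 'a \<Rightarrow> complex"
  assumes p: "smooth_bdd_derivs p" and t: "0 \<le> t" and f: "schwartz f" and K: "0 \<le> K" and \<delta>: "0 \<le> \<delta>"
    and est: "\<And>n h. rapid h \<Longrightarrow> L2sq (\<lambda>x. complex_of_real (jb x powr (- s)) *
        Reg (\<lambda>z. p (snd z, - fst z)) t n (\<lambda>y. complex_of_real (jb y powr \<delta>) * h y) x) \<le> ennreal K * L2sq h"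
  defines "g \<equiv> \<lambda>x. complex_of_real (jb x powr \<delta>) * osc_left p (free_prop t (\<lambda>y. complex_of_real (jb y powr (- s)) * f y)) x"
  shows "g \<in> borel_measurable lborel" "L2sq g \<le> ennreal K * L2sq f"
proof -
  let ?f = "\<lambda>y. complex_of_real (jb y powr (- s)) * f y"
  let ?c = "complex_of_real (fconst TYPE('a))"
  let ?q = "\<lambda>z. p (snd z, - fst z)"
  have pm [measurable]: "p \<in> borel_measurable borel"
    by (rule borel_measurable_continuous_onI[OF smooth_bdd_derivs_continuous[OF p]])
  obtain Bp where Bp: "\<And>z. cmod (p z) \<le> Bp" by (rule smooth_bdd_derivs_bounded[OF p], rule that)
  have fr: "rapid f" by (rule schwartz_rapid[OF f])
  note [measurable] = rapid_measurable[OF fr]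
  have b: "schwartz_y (\<lambda>z::'a \<times> 'a. 1 * ?f (snd z))"
    by (rule schwartz_y_mult[OF sym_const[where C = 1] f]) auto
  define A where "A \<xi> = cis (- t * (norm \<xi>)\<^sup>2 / 2) * FTy (\<lambda>z::'a \<times> 'a. 1 * ?f (snd z)) \<xi>" for \<xi>
  have A_eq: "A \<xi> = cis (- t * (norm \<xi>)\<^sup>2 / 2) * (LINT y|lborel. cis (- (y \<bullet> \<xi>)) * ?f y)" for \<xi>
    unfolding A_def FTy_def by (simp only: fst_conv snd_conv mult_1)
  have Ai: "integrable lborel A" unfolding A_def by (intro integrable_cis_mult FTy_integrable[OF b]) measurable
  have Ac: "continuous_on UNIV A" unfolding A_def by (intro continuous_intros FTy_continuous[OF b]) auto
  have [measurable]: "A \<in> borel_measurable borel" using Ai by (simp add: borel_measurable_integrable)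
  obtain B where "\<And>\<xi>. cmod (FTy (\<lambda>z::'a \<times> 'a. 1 * ?f (snd z)) \<xi>) \<le> B" by (rule FTy_bounded[OF b], rule that)
  then have B: "cmod (A \<xi>) \<le> B" for \<xi> by (simp only: A_def norm_mult norm_cis mult_1)
  define \<psi> where "\<psi> = free_prop t ?f"
  have \<psi>: "\<psi> x = ?c * (LINT \<xi>|lborel. cis (x \<bullet> \<xi>) * A \<xi>)" for x
    unfolding \<psi>_def free_prop_def fconst_eq A_eq by (simp only: mult.assoc)
  define w where "w x = ?c * (LINT \<xi>|lborel. cis (x \<bullet> \<xi>) * p (x, \<xi>) * A \<xi>)" for x
  have wm [measurable]: "w \<in> borel_measurable borel" unfolding w_def by measurable
  have pAi: "integrable lborel (\<lambda>\<xi>. cis (x \<bullet> \<xi>) * p (x, \<xi>) * A \<xi>)" for x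
    by (rule Bochner_Integration.integrable_bound[OF integrable_mult_right[OF integrable_norm[OF Ai], of Bp]])
      (use order_trans[OF norm_ge_zero Bp] in \<open>auto simp: norm_mult intro!: mult_right_mono Bp\<close>)
  have ol: "osc_left p \<psi> x = (if integrable lborel \<psi> then w x else 0)" for x
  proof -
    have "(LINT y|lborel. cis ((x - y) \<bullet> \<xi>) * p (x, \<xi>) * complex_of_real (cutoff (\<epsilon> *\<^sub>R \<xi>)) * \<psi> y) =
        complex_of_real (cutoff (\<epsilon> *\<^sub>R \<xi>)) * (cis (x \<bullet> \<xi>) * p (x, \<xi>) * (LINT y|lborel. cis (- (y \<bullet> \<xi>)) * \<psi> y))" for \<epsilon> \<xi>
    proof -
      have "cis ((x - y) \<bullet> \<xi>) = cis (x \<bullet> \<xi>) * cis (- (y \<bullet> \<xi>))" for y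
        by (simp add: cis_mult inner_diff_left)
      then have "(\<lambda>y. cis ((x - y) \<bullet> \<xi>) * p (x, \<xi>) * complex_of_real (cutoff (\<epsilon> *\<^sub>R \<xi>)) * \<psi> y) =
         (\<lambda>y. complex_of_real (cutoff (\<epsilon> *\<^sub>R \<xi>)) * (cis (x \<bullet> \<xi>) * p (x, \<xi>)) * (cis (- (y \<bullet> \<xi>)) * \<psi> y))"
        by (simp only: mult_ac)
      then show ?thesis by (simp only: integral_mult_right_zero mult.assoc)
    qed
    then have eq: "osc_left p \<psi> x = Lim (at_right (0::real)) (\<lambda>\<epsilon>. ?c * (LINT \<xi>|lborel. complex_of_real (cutoff (\<epsilon> *\<^sub>R \<xi>)) *
        (cis (x \<bullet> \<xi>) * p (x, \<xi>) * (LINT y|lborel. cis (- (y \<bullet> \<xi>)) * \<psi> y))))"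
      unfolding osc_left_def fconst_eq by (simp only:)
    show ?thesis
    proof (cases "integrable lborel \<psi>")
      case True
      then show ?thesis
        unfolding eq free_prop_inverse_Fourier(1)[OF Ai Ac B \<psi> True]
        by (simp only: Lim_cutoff[OF pAi] w_def if_True)
    next
      case False
      have "integrable lborel (\<lambda>\<xi>::'a. 0 :: complex)" by simp
      from Lim_cutoff[OF this] show ?thesis
        unfolding eq free_prop_inverse_Fourier(2)[OF Ai Ac B \<psi> False] using False by simp
    qed
  qed
  have g: "g = (\<lambda>x. complex_of_real (jb x powr \<delta>) * (if integrable lborel \<psi> then w x else 0))"
    unfolding g_def \<psi>_def[symmetric] ol ..
  define W where "W n x = (LINT \<xi>|lborel. complex_of_real (rg (t, n) \<xi>) * (cis (x \<bullet> \<xi>) * p (x, \<xi>) *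
      (cis (- t * (norm \<xi>)\<^sup>2 / 2) * (LINT y|lborel. cis (- (y \<bullet> \<xi>)) * ?f y))))" for n and x :: 'a
  have f0: "rapid ?f" by (rule rapid_jb_powr[OF fr])
  have Wm [measurable]: "W n \<in> borel_measurable borel" and Wb: "\<exists>C. \<forall>x. cmod (W n x) \<le> C" for n
    unfolding W_def using transposition(2,3)[OF t pm Bp fr f0, of n] by blast+
  have Wdual: "(LINT x|lborel. W n x * G x) = (LINT y|lborel. ?f y * Reg ?q t n G y)" if "rapid G" for n G
    unfolding W_def by (rule transposition(1)[OF t pm Bp that f0])
  have F2: "L2sq f = ennreal ((L2norm f)\<^sup>2)"
    by (rule L2sq_eq_L2norm[OF rapid_integrable(2)[OF fr]])
  have WL: "L2sq (\<lambda>x. complex_of_real (jb x powr \<delta>) * W n x) \<le> ennreal (K * (L2norm f)\<^sup>2)" for n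
  proof (rule L2sq_le_by_duality)
    show "(\<lambda>x. complex_of_real (jb x powr \<delta>) * W n x) \<in> borel_measurable borel" by measurable
    show "0 \<le> K * (L2norm f)\<^sup>2" using K by simp
    have jb_le: "jb x \<le> 1 + \<bar>R\<bar>" if "norm x \<le> R" for x :: 'a and R
    proof -
      have "jb x \<le> 1 + norm x"
        unfolding jb_def by (rule real_le_lsqrt) (auto simp: power2_sum)
      then show ?thesis using that by linarith
    qed
    show "\<exists>B. \<forall>x. norm x \<le> R \<longrightarrow> cmod (complex_of_real (jb x powr \<delta>) * W n x) \<le> B" for R
    proof -
      obtain C where C: "\<And>x. cmod (W n x) \<le> C" using Wb[of n] by blast
      have "cmod (complex_of_real (jb x powr \<delta>) * W n x) \<le> (1 + \<bar>R\<bar>) powr \<delta> * C" if "norm x \<le> R" for x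
        unfolding norm_mult using jb_le[OF that] jb_pos[of x] \<delta>
        by (auto intro!: mult_mono C powr_mono2)
      then show ?thesis by blast
    qed
    fix h :: "'a \<Rightarrow> complex" and R Bh :: real
    assume hm [measurable]: "h \<in> borel_measurable borel" and h0: "\<And>x. R < norm x \<Longrightarrow> h x = 0"
      and hB: "\<And>x. cmod (h x) \<le> Bh"
    have B0: "0 \<le> Bh" by (rule order_trans[OF norm_ge_zero hB])
    \<comment> \<open>The test function comes from a truncation and has no smoothness; this is why
      the estimates are stated for \<open>rapid\<close> functions.\<close>
    have h: "rapid h"
      unfolding rapid_def
    proof (intro conjI hm allI)
      fix k
      have "jb x ^ k * cmod (h x) \<le> (1 + \<bar>R\<bar>) ^ k * Bh" for x
      proof (cases "norm x \<le> R")
        case True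
        then show ?thesis
          using jb_le[OF True] jb_pos[of x] by (intro mult_mono power_mono hB) auto
      next
        case False
        then show ?thesis using h0[of x] B0 by simp
      qed
      then show "\<exists>C. \<forall>x. jb x ^ k * cmod (h x) \<le> C" by blast
    qed
    let ?G = "\<lambda>y. complex_of_real (jb y powr \<delta>) * h y"
    let ?r = "\<lambda>x. complex_of_real (jb x powr (- s)) * Reg ?q t n ?G x"
    have G: "rapid ?G" by (rule rapid_jb_powr[OF h])
    have qm: "?q \<in> borel_measurable borel" by measurable
    note [measurable] = Reg_measurable[OF qm G]
    have rm: "?r \<in> borel_measurable borel" by measurable
    have "(LINT x|lborel. complex_of_real (jb x powr \<delta>) * W n x * h x) = (LINT x|lborel. W n x * ?G x)"
      by (simp only: mult_ac)
    also have "\<dots> = (LINT x|lborel. f x * ?r x)"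
      unfolding Wdual[OF G] by (simp only: mult_ac)
    finally have eq: "(LINT x|lborel. complex_of_real (jb x powr \<delta>) * W n x * h x) = (LINT x|lborel. f x * ?r x)" .
    have "ennreal ((cmod (LINT x|lborel. f x * ?r x))\<^sup>2) \<le> L2sq f * L2sq ?r"
      by (rule Cauchy_Schwarz_L2sq[OF rapid_measurable[OF fr] rm])
    also have "\<dots> \<le> L2sq f * (ennreal K * L2sq h)"
      by (rule mult_left_mono[OF est[OF h]]) simp
    also have "L2sq h = ennreal (LINT x|lborel. (cmod (h x))\<^sup>2)"
      unfolding L2sq_def by (rule nn_integral_eq_integral[OF rapid_integrable(2)[OF h]]) simp
    also have "L2sq f * (ennreal K * ennreal (LINT x|lborel. (cmod (h x))\<^sup>2)) =
        ennreal (K * (L2norm f)\<^sup>2 * (LINT x|lborel. (cmod (h x))\<^sup>2))"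
      unfolding F2 using K by (simp add: ennreal_mult[symmetric] mult_ac)
    finally show "(cmod (LINT x|lborel. complex_of_real (jb x powr \<delta>) * W n x * h x))\<^sup>2 \<le>
        K * (L2norm f)\<^sup>2 * (LINT x|lborel. (cmod (h x))\<^sup>2)"
      unfolding eq using K by (simp add: ennreal_le_iff)
  qed
  have KF: "ennreal K * L2sq f = ennreal (K * (L2norm f)\<^sup>2)"
    unfolding F2 using K by (simp add: ennreal_mult)
  have wL: "L2sq (\<lambda>x. complex_of_real (jb x powr \<delta>) * w x) \<le> ennreal K * L2sq f"
    unfolding KF
  proof (rule L2sq_Fatou[where v = "\<lambda>n x. complex_of_real (jb x powr \<delta>) * (?c * W n x)"])
    show "(\<lambda>x. complex_of_real (jb x powr \<delta>) * (?c * W n x)) \<in> borel_measurable borel" for n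
      by measurable
    show "(\<lambda>n. complex_of_real (jb x powr \<delta>) * (?c * W n x)) \<longlonglongrightarrow> complex_of_real (jb x powr \<delta>) * w x" for x
      unfolding W_def w_def A_eq[symmetric]
      by (intro tendsto_mult tendsto_const integral_rg_tendsto pAi)
    show "L2sq (\<lambda>x. complex_of_real (jb x powr \<delta>) * (?c * W n x)) \<le> ennreal (K * (L2norm f)\<^sup>2)" for n
      by (rule order_trans[OF L2sq_mono[OF fconst_mult_le] WL])
  qed
  show "g \<in> borel_measurable lborel" unfolding g by (cases "integrable lborel \<psi>") auto
  show "L2sq g \<le> ennreal K * L2sq f"
    unfolding g using wL by (cases "integrable lborel \<psi>") (auto simp: L2sq_def)
qed

theorem theorem5p6:
  fixes p_plus p_minus :: "'a::euclidean_space \<times> 'a \<Rightarrow> complex"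
    and \<theta> \<rho> \<sigma> :: real
  assumes "-1 < \<theta>" and "\<theta> < 1" and "\<rho> > 0"
    and "\<theta> + \<rho> < 1" and "\<theta> - \<rho> > -1" and "\<sigma> > 0"
    and "smooth_bdd_derivs p_plus" and "smooth_bdd_derivs p_minus"
    and "\<forall>vs (l::real). set vs \<subseteq> Basis \<longrightarrow> 0 \<le> l \<longrightarrow>
           (\<exists>C. \<forall>\<xi> x. x \<noteq> 0 \<longrightarrow> \<xi> \<noteq> 0 \<longrightarrow> cosang x \<xi> < \<theta> + \<rho> \<longrightarrow>
              norm (iter_pd vs p_plus (\<xi>, x)) \<le> C * jb x powr (- l))"
    and "\<forall>vs (l::real). set vs \<subseteq> Basis \<longrightarrow> 0 \<le> l \<longrightarrow>
           (\<exists>C. \<forall>x \<xi>. x \<noteq> 0 \<longrightarrow> \<xi> \<noteq> 0 \<longrightarrow> cosang x \<xi> > \<theta> - \<rho> \<longrightarrow>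
              norm (iter_pd vs p_minus (x, \<xi>)) \<le> C * jb x powr (- l))"
    and "\<forall>\<xi> x. norm x < \<sigma> \<or> norm \<xi> < \<sigma> \<longrightarrow> p_plus (\<xi>, x) = 0"
    and "\<forall>x \<xi>. norm x < \<sigma> \<or> norm \<xi> < \<sigma> \<longrightarrow> p_minus (x, \<xi>) = 0"
  shows "\<forall>s \<delta>. 0 \<le> s \<longrightarrow> 0 \<le> \<delta> \<longrightarrow> \<delta> \<le> s \<longrightarrow>
     (\<exists>C>0. \<forall>t\<ge>0. \<forall>f. schwartz f \<longrightarrow>
        L2_bounded_by
          (\<lambda>x. complex_of_real (jb x powr (- s)) *
                free_prop t (osc_right p_plus (\<lambda>y. complex_of_real (jb y powr \<delta>) * f y)) x)
          (C * jb t powr (\<delta> - s)) f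
      \<and> L2_bounded_by
          (\<lambda>x. complex_of_real (jb x powr \<delta>) *
                osc_left p_minus (free_prop t (\<lambda>y. complex_of_real (jb y powr (- s)) * f y)) x)
          (C * jb t powr (\<delta> - s)) f)"
proof (intro allI impI)
  fix s \<delta> :: real
  assume s: "0 \<le> s" "0 \<le> \<delta>" "\<delta> \<le> s"
  have "\<exists>C\<ge>0. \<forall>t n f. 0 \<le> t \<longrightarrow> rapid f \<longrightarrow>
      L2sq (\<lambda>x. complex_of_real (jb x powr (- s)) * Reg (\<lambda>z. p_plus (id z)) t n (\<lambda>y. complex_of_real (jb y powr \<delta>) * f y) x)
        \<le> ennreal (C * (jb t powr (\<delta> - s))\<^sup>2) * L2sq f"
  proof (rule outgoing_estimate[where \<kappa> = "\<theta> + \<rho>" and \<sigma> = \<sigma>])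
    show "bounded_linear (id :: 'a \<times> 'a \<Rightarrow> 'a \<times> 'a)" unfolding id_def by (rule bounded_linear_ident)
    fix vs :: "('a \<times> 'a) list" and l :: real assume "set vs \<subseteq> Basis" "0 \<le> l"
    with assms(9) obtain C where "\<forall>\<xi> x. x \<noteq> 0 \<longrightarrow> \<xi> \<noteq> 0 \<longrightarrow> cosang x \<xi> < \<theta> + \<rho> \<longrightarrow>
        norm (iter_pd vs p_plus (\<xi>, x)) \<le> C * jb x powr (- l)" by blast
    then show "\<exists>C. \<forall>z. fst z \<noteq> 0 \<longrightarrow> snd z \<noteq> 0 \<longrightarrow> cosang (snd z) (fst z) < \<theta> + \<rho> \<longrightarrow>
        cmod (iter_pd vs p_plus (id z)) \<le> C * jb (snd z) powr (- l)"
      by (intro exI[of _ C]) simp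
  next
    show "p_plus (id z) = 0" if "norm (fst z) < \<sigma> \<or> norm (snd z) < \<sigma>" for z
      using assms(11) that by (cases z) auto
  qed (use assms s in auto)
  then obtain C1 where C1: "0 \<le> C1" "\<And>t n f. 0 \<le> t \<Longrightarrow> rapid f \<Longrightarrow>
      L2sq (\<lambda>x. complex_of_real (jb x powr (- s)) * Reg p_plus t n (\<lambda>y. complex_of_real (jb y powr \<delta>) * f y) x)
        \<le> ennreal (C1 * (jb t powr (\<delta> - s))\<^sup>2) * L2sq f"
    unfolding id_apply by blast
  \<comment> \<open>Transposition exchanges x and y and reflects \<open>\<xi>\<close>: in the
    coordinates (\<open>\<xi>\<close>, y) the symbol of P_- is read at (y,
    -\<open>\<xi>\<close>).\<close>
  define L where "L z = (snd z, - fst z)" for z :: "'a \<times> 'a"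
  have "\<exists>C\<ge>0. \<forall>t n f. 0 \<le> t \<longrightarrow> rapid f \<longrightarrow>
      L2sq (\<lambda>x. complex_of_real (jb x powr (- s)) * Reg (\<lambda>z. p_minus (L z)) t n (\<lambda>y. complex_of_real (jb y powr \<delta>) * f y) x)
        \<le> ennreal (C * (jb t powr (\<delta> - s))\<^sup>2) * L2sq f"
  \<comment> \<open>The reflection changes the sign of the cosine, so the region above
    \<open>\<theta> - \<rho>\<close> becomes the one below \<open>\<rho> - \<theta>\<close>. This
    number is less than 1 since \<open>\<theta> - \<rho> > -1\<close>, and greater than -1 since
    \<open>\<theta> < 1\<close> and \<open>\<rho> > 0\<close>.\<close>
  proof (rule outgoing_estimate[where \<kappa> = "\<rho> - \<theta>" and \<sigma> = \<sigma>])
    show "bounded_linear L"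
      unfolding L_def by (intro bounded_linear_Pair bounded_linear_minus bounded_linear_fst bounded_linear_snd)
    show "L v = 0 \<or> L v \<in> Basis \<or> - L v \<in> Basis" if "v \<in> Basis" for v
      using that by (auto simp: L_def Basis_prod_def)
    fix vs :: "('a \<times> 'a) list" and l :: real assume "set vs \<subseteq> Basis" "0 \<le> l"
    with assms(10) obtain C where C: "\<And>x \<xi>. x \<noteq> 0 \<Longrightarrow> \<xi> \<noteq> 0 \<Longrightarrow> cosang x \<xi> > \<theta> - \<rho> \<Longrightarrow>
        norm (iter_pd vs p_minus (x, \<xi>)) \<le> C * jb x powr (- l)" by blast
    have "cmod (iter_pd vs p_minus (L z)) \<le> C * jb (snd z) powr (- l)"
      if "fst z \<noteq> 0" "snd z \<noteq> 0" "cosang (snd z) (fst z) < \<rho> - \<theta>" for z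
    proof -
      have "cosang (snd z) (- fst z) = - cosang (snd z) (fst z)" by (simp add: cosang_def)
      then show ?thesis unfolding L_def using that by (intro C) auto
    qed
    then show "\<exists>C. \<forall>z. fst z \<noteq> 0 \<longrightarrow> snd z \<noteq> 0 \<longrightarrow> cosang (snd z) (fst z) < \<rho> - \<theta> \<longrightarrow>
        cmod (iter_pd vs p_minus (L z)) \<le> C * jb (snd z) powr (- l)"
      by blast
  next
    show "p_minus (L z) = 0" if "norm (fst z) < \<sigma> \<or> norm (snd z) < \<sigma>" for z
      unfolding L_def using assms(12) that by auto
  qed (use assms s in auto)
  then obtain C2 where C2: "0 \<le> C2" "\<And>t n f. 0 \<le> t \<Longrightarrow> rapid f \<Longrightarrow>
      L2sq (\<lambda>x. complex_of_real (jb x powr (- s)) * Reg (\<lambda>z. p_minus (snd z, - fst z)) t n (\<lambda>y. complex_of_real (jb y powr \<delta>) * f y) x)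
        \<le> ennreal (C2 * (jb t powr (\<delta> - s))\<^sup>2) * L2sq f"
    unfolding L_def by blast
  \<comment> \<open>C1 and C2 bound squared norms, hence the root; the summand 1 makes C
    positive.\<close>
  define C where "C = sqrt (C1 + C2 + 1)"
  have le: "ennreal (c * (jb t powr (\<delta> - s))\<^sup>2) * u \<le> ennreal ((C * jb t powr (\<delta> - s))\<^sup>2) * u"
    if "c \<le> C1 + C2 + 1" for c t u
  proof -
    have "(C * jb t powr (\<delta> - s))\<^sup>2 = (C1 + C2 + 1) * (jb t powr (\<delta> - s))\<^sup>2"
      using C1(1) C2(1) by (simp add: C_def power_mult_distrib)
    then show ?thesis
      using that by (intro mult_right_mono ennreal_leI) (auto intro: mult_right_mono)
  qed
  show "\<exists>C>0. \<forall>t\<ge>0. \<forall>f. schwartz f \<longrightarrow>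
        L2_bounded_by
          (\<lambda>x. complex_of_real (jb x powr (- s)) *
                free_prop t (osc_right p_plus (\<lambda>y. complex_of_real (jb y powr \<delta>) * f y)) x)
          (C * jb t powr (\<delta> - s)) f
      \<and> L2_bounded_by
          (\<lambda>x. complex_of_real (jb x powr \<delta>) *
                osc_left p_minus (free_prop t (\<lambda>y. complex_of_real (jb y powr (- s)) * f y)) x)
          (C * jb t powr (\<delta> - s)) f"
  proof (intro exI[of _ C] conjI allI impI)
    have c: "C1 \<le> C1 + C2 + 1" "C2 \<le> C1 + C2 + 1" using C1(1) C2(1) by linarith+
    show "0 < C" using C1(1) C2(1) by (simp add: C_def)
    fix t :: real and f :: "'a \<Rightarrow> complex" assume t: "0 \<le> t" and f: "schwartz f"
    have Ct: "0 \<le> C * jb t powr (\<delta> - s)" using C1(1) C2(1) by (simp add: C_def)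
    note E1 = outgoing_part[OF assms(7) t f C1(2)[OF t schwartz_rapid[OF f]]]
    show "L2_bounded_by (\<lambda>x. complex_of_real (jb x powr (- s)) *
        free_prop t (osc_right p_plus (\<lambda>y. complex_of_real (jb y powr \<delta>) * f y)) x) (C * jb t powr (\<delta> - s)) f"
      unfolding L2_bounded_by_def
      by (intro conjI Ct E1(1) order_trans[OF E1(2) le[OF c(1)]])
    have K2: "0 \<le> C2 * (jb t powr (\<delta> - s))\<^sup>2" using C2(1) by simp
    note E2 = incoming_part[OF assms(8) t f K2 s(2) C2(2)[OF t]]
    show "L2_bounded_by (\<lambda>x. complex_of_real (jb x powr \<delta>) *
        osc_left p_minus (free_prop t (\<lambda>y. complex_of_real (jb y powr (- s)) * f y)) x) (C * jb t powr (\<delta> - s)) f"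
      unfolding L2_bounded_by_def
      by (intro conjI Ct E2(1) order_trans[OF E2(2) le[OF c(2)]])
  qed
qed

end
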